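(* Let $L$ and $\tilde L$ be two $L_\infty$ algebras equipped with descending, bounded above and complete filtrations $$L=\mathfrak F_0L\supset \mathfrak F_1L\supset \mathfrak F_2L\supset\cdots,\qquad \tilde L=\mathfrak F_1\tilde L\supset \mathfrak F_2\tilde L\supset \mathfrak F_3\tilde L\supset\cdots$$ compatible with the $L_\infty$ structures. In addition, let $L$ be Abelian. Let $U:L\to\tilde L$ be an $\infty$-morphism of $L_\infty$ algebras compatible with the filtrations, and let $r\ge1$ be an arbitrary fixed integer such that the linear part $\psi$ of $U$ is a quasi-isomorphism on the $(r-1)$-st page of the spectral sequences induced by the filtered complexes $(L,d_L)$ and $(\tilde L,d_{\tilde L})$ (that is, $E_r(\mathrm{cone}(\psi))=0$). Assume moreover that $U$ raises the degree of filtration by $r-1$, and that $U_\star$ is a finite sum, i.e. for every $a\in L$ there exists $N\in\mathbb N$ such that $U'(a,\dots,a)=0$ ($n$ arguments) for all $n\ge N$. Assume also that $H^1\big((\mathfrak F_{2^q}\tilde L)/(\mathfrak F_{\min(2^{q+1},r)}\tilde L)\big)=0$ for every integer $q\ge0$ with $2^q<r$. Then $\mathfrak{MC}_\bullet(U)$ induces a bijection between the sets of connected components $$\pi_0(\mathfrak{MC}_\bullet(L))\xrightarrow{\ \cong\ }\pi_0(\mathfrak{MC}_\bullet(\tilde L)).$$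
   Context: Fix a field $\mathbb K$ of characteristic $0$. Vector spaces are $\mathbb Z$-graded, differentials raise degree by one, and $H^k$ is the $k$-th cohomology. Shifted $L_\infty$ algebras: a shifted $L_\infty$ algebra is a graded vector space $V$ with graded symmetric multilinear brackets $\{\ ,\dots,\ \}_k:V^{\otimes k}\to V$ ($k\ge1$) of degree $1$ such that the coderivation $Q$ they determine on the coalgebra $S^+(V)=\bigoplus_{k\ge1}S^k(V)$ satisfies $Q^2=0$; $d_V=\{\cdot\}_1$ is a differential. It is Abelian if all brackets with $k\ge2$ vanish. An $L_\infty$ structure on $L$ is a shifted $L_\infty$ structure on $L[1]$, where $L[1]^i=L^{i+1}$; hence $H^i(L)=H^{i-1}(L[1])$. All notions below are given for shifted $L_\infty$ algebras $V$ and are applied to an $L_\infty$ algebra $L$ through $V=L[1]$; thus Maurer-Cartan elements have degree $0$ in $V$, i.e. degree $1$ in $L$. The filtrations on $L$ and on $L[1]$ are the same. Filtrations: the $\mathfrak F_iV$ are graded subspaces; compatibility means $\{\mathfrak F_{i_1}V,\dots,\mathfrak F_{i_k}V\}_k\subset\mathfrak F_{i_1+\dots+i_k}V$ for all $k\ge1$; completeness means $V=\varprojlim_p V/\mathfrak F_pV$; "bounded above" means that the filtration starts at the indicated first term, and $\mathfrak F_iV=V$ for smaller indices $i$. The quotients $\mathfrak F_aV/\mathfrak F_bV$ ($a\le b$) are complexes with the induced differential. $\infty$-morphisms: an $\infty$-morphism $U:V\to\tilde V$ is a degree $0$ coalgebra morphism $S^+(V)\to S^+(\tilde V)$ commuting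 with the codifferentials. It is determined by $U'=\pi_{\tilde V}\circ U:S^+(V)\to\tilde V$, where $\pi_{\tilde V}$ is the projection onto $\tilde V$. It is compatible with the filtrations if $U'(\mathfrak F_{i_1}V\otimes\dots\otimes\mathfrak F_{i_p}V)\subset\mathfrak F_{i_1+\dots+i_p}\tilde V$, and it raises the degree of filtration by $r-1$ if $U'(\mathfrak F_{i_1}V\otimes\dots\otimes\mathfrak F_{i_p}V)\subset\mathfrak F_{i_1+\dots+i_p+(r-1)}\tilde V$. Its linear part is the chain map $\psi=U'|_V:V\to\tilde V$. For $\alpha\in V^0$, $U_\star(\alpha)=\sum_{m\ge1}\frac1{m!}U'(\alpha,\dots,\alpha)$ ($m$ arguments). Maurer-Cartan simplicial set: $\mathrm{MC}(V)=\{\alpha\in V^0:\mathrm{curv}(\alpha)=0\}$ with $\mathrm{curv}(\alpha)=\sum_{k\ge1}\frac1{k!}\{\alpha,\dots,\alpha\}_k$. Let $\Omega_n$ be the dg commutative algebra of polynomial differential forms on the $n$-simplex over $\mathbb K$, and $V\hat\otimes\Omega_n=\varprojlim_p(V\otimes\Omega_n)/(\mathfrak F_pV\otimes\Omega_n)$, with differential $d_V+d_{\Omega_n}$ and higher brackets extended $\Omega_n$-multilinearly with Koszul signs. Set $\mathfrak{MC}_n(V)=\mathrm{MC}(V\hat\otimes\Omega_n)$; these form a simplicial set $\mathfrak{MC}_\bullet(V)$, which is a Kan complex. Its set of connected components $\pi_0$ is the quotient of $\mathrm{MC}(V)$ by the relation identifying the two endpoints of each element of $\mathfrak{MC}_1(V)$.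 The $\infty$-morphism $U$ extends by $U^{(n)\prime}(v_1\otimes\omega_1,\dots,v_q\otimes\omega_q)=\pm U'(v_1,\dots,v_q)\otimes\omega_1\cdots\omega_q$ (Koszul sign), and $\mathfrak{MC}_n(U)=U^{(n)}_\star$ defines the simplicial map $\mathfrak{MC}_\bullet(U)$. Page condition: $\mathrm{cone}(\psi)=L\oplus\tilde L[-1]$ (with $\tilde L[-1]^i=\tilde L^{i-1}$), with differential $d(\alpha,\beta)=(d_L\alpha,\ \psi(\alpha)-d_{\tilde L}\beta)$ and filtration $\mathfrak F_pL\oplus\mathfrak F_p\tilde L$. "$\psi$ is a quasi-isomorphism on the $(r-1)$-st page" means that the $r$-th page of the associated spectral sequence vanishes, $E_r(\mathrm{cone}(\psi))=0$. Equivalently, for all $p$: if $a\in\mathfrak F_pL$ and $b\in\mathfrak F_p\tilde L$ satisfy $d_La\in\mathfrak F_{p+r}L$ and $\psi(a)-d_{\tilde L}b\in\mathfrak F_{p+r}\tilde L$, then there exist $x\in\mathfrak F_{p-r+1}L$ and $y\in\mathfrak F_{p-r+1}\tilde L$ with $d_Lx\in\mathfrak F_pL$, $\psi(x)-d_{\tilde L}y\in\mathfrak F_p\tilde L$, $a-d_Lx\in\mathfrak F_{p+1}L$ and $b-\psi(x)+d_{\tilde L}y\in\mathfrak F_{p+1}\tilde L$. *)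

theory Defs
  imports
    Complex_Main
    "HOL-Library.Poly_Mapping"
    "HOL-Library.Function_Algebras"
    "HOL-Library.Product_Plus"
    "HOL-Library.Disjoint_Sets"
begin

section \<open>Filtered graded vector spaces with brackets\<close>

text \<open>
  The total space is the type \<^typ>\<open>'v\<close> (except for the completed tensor product with forms
  below, where it is spanned by the homogeneous parts). The bracket with \<open>k\<close> arguments is the
  restriction of \<open>brk\<close> to lists of length \<open>k\<close>; its value on the empty list is never used.
\<close>

record ('k, 'v) bracket_space =
  scl :: "'k \<Rightarrow> 'v \<Rightarrow> 'v"
  grd :: "int \<Rightarrow> 'v set"
  fil :: "int \<Rightarrow> 'v set"
  brk :: "'v list \<Rightarrow> 'v"

definition shift1 :: "('k, 'v) bracket_space \<Rightarrow> ('k, 'v) bracket_space" where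
  "shift1 L = L\<lparr>grd := (\<lambda>i. grd L (i + 1))\<rparr>"

definition diffl :: "('k, 'v) bracket_space \<Rightarrow> 'v \<Rightarrow> 'v" where
  "diffl V v = brk V [v]"

definition is_decomposition ::
  "('k, 'v::ab_group_add) bracket_space \<Rightarrow> 'v \<Rightarrow> (int \<Rightarrow> 'v) \<Rightarrow> bool" where
  "is_decomposition V v c \<longleftrightarrow>
     (\<forall>i. c i \<in> grd V i) \<and> finite {i. c i \<noteq> 0} \<and> v = (\<Sum>i | c i \<noteq> 0. c i)"

definition graded_space :: "('k::field, 'v::ab_group_add) bracket_space \<Rightarrow> bool" where
  "graded_space V \<longleftrightarrow>
     vector_space (scl V) \<and>
     (\<forall>i. module.subspace (scl V) (grd V i)) \<and>
     (\<forall>v. \<exists>!c. is_decomposition V v c)"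

definition component :: "('k, 'v::ab_group_add) bracket_space \<Rightarrow> 'v \<Rightarrow> int \<Rightarrow> 'v" where
  "component V v = (THE c. is_decomposition V v c)"

text \<open>Degree of a nonzero homogeneous vector.\<close>
definition hdeg :: "('k, 'v) bracket_space \<Rightarrow> 'v \<Rightarrow> int" where
  "hdeg V v = (SOME i. v \<in> grd V i)"

definition parity_sign :: "int \<Rightarrow> 'k::field" where
  "parity_sign i = (if odd i then -1 else 1)"

definition multilinear_on_lists ::
  "('k \<Rightarrow> 'v::ab_group_add \<Rightarrow> 'v) \<Rightarrow> ('k \<Rightarrow> 'w::ab_group_add \<Rightarrow> 'w) \<Rightarrow> ('v list \<Rightarrow> 'w) \<Rightarrow> bool" where
  "multilinear_on_lists s s' f \<longleftrightarrow>
     (\<forall>xs a b ys. f (xs @ (a + b) # ys) = f (xs @ a # ys) + f (xs @ b # ys)) \<and>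
     (\<forall>xs c a ys. f (xs @ s c a # ys) = s' c (f (xs @ a # ys)))"

definition graded_symmetric ::
  "('k::field, 'v) bracket_space \<Rightarrow> ('k \<Rightarrow> 'w \<Rightarrow> 'w) \<Rightarrow> ('v list \<Rightarrow> 'w) \<Rightarrow> bool" where
  "graded_symmetric V s' f \<longleftrightarrow>
     (\<forall>xs ys i j. \<forall>a\<in>grd V i. \<forall>b\<in>grd V j.
        f (xs @ a # b # ys) = s' (parity_sign (i * j)) (f (xs @ b # a # ys)))"

definition has_degree ::
  "('k, 'v) bracket_space \<Rightarrow> ('k, 'w) bracket_space \<Rightarrow> ('v list \<Rightarrow> 'w) \<Rightarrow> int \<Rightarrow> bool" where
  "has_degree V W f k \<longleftrightarrow>
     (\<forall>vs is. vs \<noteq> [] \<longrightarrow> list_all2 (\<lambda>v i. v \<in> grd V i) vs is \<longrightarrow>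
        f vs \<in> grd W (sum_list is + k))"

section \<open>The symmetric coalgebra\<close>

text \<open>
  \<open>S\<^sup>+(V)\<close> is presented as the free vector space on the nonempty words over \<open>V\<close> modulo the subspace
  \<open>sym_relations V\<close>: the first two families of relations give the tensor powers of \<open>V\<close>,
  the third one the graded symmetric quotient.
\<close>

definition smul :: "'k::field \<Rightarrow> ('a \<Rightarrow>\<^sub>0 'k) \<Rightarrow> ('a \<Rightarrow>\<^sub>0 'k)" where
  "smul c x = Poly_Mapping.map (\<lambda>a. c * a) x"

definition word :: "'v list \<Rightarrow> ('v list \<Rightarrow>\<^sub>0 'k::field)" where
  "word w = Poly_Mapping.single w 1"

definition linear_extension ::
  "('v list \<Rightarrow> ('w list \<Rightarrow>\<^sub>0 'k::field)) \<Rightarrow> ('v list \<Rightarrow>\<^sub>0 'k) \<Rightarrow> ('w list \<Rightarrow>\<^sub>0 'k)" where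
  "linear_extension f x = (\<Sum>w\<in>Poly_Mapping.keys x. smul (Poly_Mapping.lookup x w) (f w))"

definition sym_relations ::
  "('k::field, 'v::ab_group_add) bracket_space \<Rightarrow> ('v list \<Rightarrow>\<^sub>0 'k) set" where
  "sym_relations V = module.span smul
     ({word (xs @ (a + b) # ys) - word (xs @ a # ys) - word (xs @ b # ys) | xs a b ys. True} \<union>
      {word (xs @ scl V c a # ys) - smul c (word (xs @ a # ys)) | xs c a ys. True} \<union>
      {word (xs @ a # b # ys) - smul (parity_sign (i * j)) (word (xs @ b # a # ys))
         | xs a b ys i j. a \<in> grd V i \<and> b \<in> grd V j})"

definition homogeneous_word :: "('k, 'v) bracket_space \<Rightarrow> 'v list \<Rightarrow> bool" where
  "homogeneous_word V vs \<longleftrightarrow> vs \<noteq> [] \<and> (\<forall>v\<in>set vs. \<exists>i. v \<in> grd V i)"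

text \<open>
  The sign in \<open>vs ! 0 \<cdots> vs ! (n - 1) = \<plusminus> vs ! (js ! 0) \<cdots> vs ! (js ! (n - 1))\<close>
  for a permutation \<open>js\<close> of the indices. Words containing \<open>0\<close>, for which degrees are ambiguous,
  vanish in \<open>S\<^sup>+(V)\<close>.
\<close>
definition koszul :: "('k::field, 'v) bracket_space \<Rightarrow> 'v list \<Rightarrow> nat list \<Rightarrow> 'k" where
  "koszul V vs js =
     (\<Prod>(a, b)\<in>{(a, b). a < b \<and> b < length js \<and> js ! b < js ! a}.
        parity_sign (hdeg V (vs ! (js ! a)) * hdeg V (vs ! (js ! b))))"

text \<open>
  The coderivation of \<open>S\<^sup>+(V)\<close> determined by the brackets: the sum over all nonempty sets \<open>I\<close> of
  positions (equivalently, over unshuffles) of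
  \<open>\<plusminus> {v\<^sub>I} v\<^sub>J\<close>, where \<open>J\<close> is the complement of \<open>I\<close>.
\<close>
definition coderivation ::
  "('k::field, 'v) bracket_space \<Rightarrow> 'v list \<Rightarrow> ('v list \<Rightarrow>\<^sub>0 'k)" where
  "coderivation V vs =
     (\<Sum>I | I \<subseteq> {..<length vs} \<and> I \<noteq> {}.
        smul (koszul V vs (sorted_list_of_set I @ sorted_list_of_set ({..<length vs} - I)))
          (word (brk V (nths vs I) # nths vs ({..<length vs} - I))))"

text \<open>
  The coalgebra morphism with corestriction \<open>U'\<close>: the sum over all partitions of the positions into
  nonempty blocks of \<open>\<plusminus> U'(v\<^bsub>I 1\<^esub>) \<cdots> U'(v\<^bsub>I p\<^esub>)\<close>. The sum below runs over ordered partitions,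
  and \<open>1 / p!\<close> compensates for the orderings of the blocks.
\<close>
definition coalgebra_morphism ::
  "('k::field_char_0, 'v) bracket_space \<Rightarrow> ('v list \<Rightarrow> 'w) \<Rightarrow> 'v list \<Rightarrow> ('w list \<Rightarrow>\<^sub>0 'k)" where
  "coalgebra_morphism V U' vs =
     (\<Sum>Is | distinct Is \<and> partition_on {..<length vs} (set Is).
        smul (koszul V vs (concat (map sorted_list_of_set Is)) / fact (length Is))
          (word (map (\<lambda>I. U' (nths vs I)) Is)))"

section \<open>L-infinity algebras and their morphisms\<close>

definition shifted_Linf_algebra ::
  "('k::field_char_0, 'v::ab_group_add) bracket_space \<Rightarrow> bool" where
  "shifted_Linf_algebra V \<longleftrightarrow>
     graded_space V \<and>
     multilinear_on_lists (scl V) (scl V) (brk V) \<and>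
     graded_symmetric V (scl V) (brk V) \<and>
     has_degree V V (brk V) 1 \<and>
     (\<forall>vs. homogeneous_word V vs \<longrightarrow>
        linear_extension (coderivation V) (coderivation V vs) \<in> sym_relations V)"

definition Linf_algebra ::
  "('k::field_char_0, 'v::ab_group_add) bracket_space \<Rightarrow> bool" where
  "Linf_algebra L \<longleftrightarrow> shifted_Linf_algebra (shift1 L)"

definition abelian :: "('k, 'v::zero) bracket_space \<Rightarrow> bool" where
  "abelian V \<longleftrightarrow> (\<forall>vs. length vs \<ge> 2 \<longrightarrow> brk V vs = 0)"

text \<open>An \<open>\<infinity>\<close>-morphism \<open>U\<close> of shifted algebras is given by its corestriction \<open>U'\<close>.\<close>
definition infinity_morphism ::
  "('k::field_char_0, 'v::ab_group_add) bracket_space \<Rightarrow> ('k, 'w::ab_group_add) bracket_space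
     \<Rightarrow> ('v list \<Rightarrow> 'w) \<Rightarrow> bool" where
  "infinity_morphism V W U' \<longleftrightarrow>
     multilinear_on_lists (scl V) (scl W) U' \<and>
     graded_symmetric V (scl W) U' \<and>
     has_degree V W U' 0 \<and>
     (\<forall>vs. homogeneous_word V vs \<longrightarrow>
        linear_extension (coalgebra_morphism V U') (coderivation V vs)
        - linear_extension (coderivation W) (coalgebra_morphism V U' vs) \<in> sym_relations W)"

definition linear_part :: "('v list \<Rightarrow> 'w) \<Rightarrow> 'v \<Rightarrow> 'w" where
  "linear_part U' v = U' [v]"

section \<open>Filtrations\<close>

text \<open>
  Completeness is understood in graded vector spaces: in each degree \<open>k\<close>, every compatible family of
  classes modulo the \<open>fil V p\<close> comes from exactly one vector.
\<close>
definition complete_filtration ::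
  "int \<Rightarrow> ('k::field, 'v::ab_group_add) bracket_space \<Rightarrow> bool" where
  "complete_filtration start V \<longleftrightarrow>
     (\<forall>p. module.subspace (scl V) (fil V p)) \<and>
     (\<forall>p. \<forall>v\<in>fil V p. \<forall>i. component V v i \<in> fil V p) \<and>
     (\<forall>p. fil V (p + 1) \<subseteq> fil V p) \<and>
     (\<forall>p\<le>start. fil V p = UNIV) \<and>
     (\<forall>k x. (\<forall>p::int. x p \<in> grd V k \<and> x (p + 1) - x p \<in> fil V p) \<longrightarrow>
        (\<exists>!v. v \<in> grd V k \<and> (\<forall>p. v - x p \<in> fil V p)))"

definition raises_filtration ::
  "('k, 'v) bracket_space \<Rightarrow> ('k, 'w) bracket_space \<Rightarrow> ('v list \<Rightarrow> 'w) \<Rightarrow> int \<Rightarrow> bool" where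
  "raises_filtration V W f s \<longleftrightarrow>
     (\<forall>vs is. vs \<noteq> [] \<longrightarrow> list_all2 (\<lambda>v i. v \<in> fil V i) vs is \<longrightarrow>
        f vs \<in> fil W (sum_list is + s))"

abbreviation filtration_compatible ::
  "('k, 'v) bracket_space \<Rightarrow> ('k, 'w) bracket_space \<Rightarrow> ('v list \<Rightarrow> 'w) \<Rightarrow> bool" where
  "filtration_compatible V W f \<equiv> raises_filtration V W f 0"

text \<open>Convergence of a series in the filtration topology.\<close>
definition filt_sums ::
  "(int \<Rightarrow> 'v set) \<Rightarrow> (nat \<Rightarrow> 'v::ab_group_add) \<Rightarrow> 'v \<Rightarrow> bool" where
  "filt_sums F f s \<longleftrightarrow> (\<forall>p. \<exists>N. \<forall>n\<ge>N. (\<Sum>k<n. f k) - s \<in> F p)"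

text \<open>\<open>H\<^sup>k(F\<^sub>a/F\<^sub>b) = 0\<close>, in the grading of \<open>L\<close>\<close>
definition quotient_cohomology_vanishes ::
  "('k, 'v::ab_group_add) bracket_space \<Rightarrow> int \<Rightarrow> int \<Rightarrow> int \<Rightarrow> bool" where
  "quotient_cohomology_vanishes L a b k \<longleftrightarrow>
     (\<forall>x \<in> fil L a \<inter> grd L k. diffl L x \<in> fil L b \<longrightarrow>
        (\<exists>y \<in> fil L a \<inter> grd L (k - 1). x - diffl L y \<in> fil L b))"

text \<open>
  The \<open>r\<close>-th page of the spectral sequence of a filtered complex is
  \<open>Z\<^sub>r\<^sup>p / (Z\<^sub>r\<^sub>-\<^sub>1\<^sup>p\<^sup>+\<^sup>1 + d Z\<^sub>r\<^sub>-\<^sub>1\<^sup>p\<^sup>-\<^sup>r\<^sup>+\<^sup>1)\<close>.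
\<close>
definition page_cycles :: "('c \<Rightarrow> 'c) \<Rightarrow> (int \<Rightarrow> 'c set) \<Rightarrow> int \<Rightarrow> int \<Rightarrow> 'c set" where
  "page_cycles d F r p = {x \<in> F p. d x \<in> F (p + r)}"

definition page_vanishes ::
  "('c::ab_group_add \<Rightarrow> 'c) \<Rightarrow> (int \<Rightarrow> 'c set) \<Rightarrow> int \<Rightarrow> bool" where
  "page_vanishes d F r \<longleftrightarrow>
     (\<forall>p. page_cycles d F r p \<subseteq>
        {y + d z | y z. y \<in> page_cycles d F (r - 1) (p + 1) \<and>
                        z \<in> page_cycles d F (r - 1) (p - r + 1)})"

definition cone_diffl ::
  "('k, 'v) bracket_space \<Rightarrow> ('k, 'w::ab_group_add) bracket_space \<Rightarrow> ('v \<Rightarrow> 'w)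
     \<Rightarrow> 'v \<times> 'w \<Rightarrow> 'v \<times> 'w" where
  "cone_diffl L M \<psi> = (\<lambda>(a, b). (diffl L a, \<psi> a - diffl M b))"

definition cone_fil ::
  "('k, 'v) bracket_space \<Rightarrow> ('k, 'w) bracket_space \<Rightarrow> int \<Rightarrow> ('v \<times> 'w) set" where
  "cone_fil L M p = fil L p \<times> fil M p"

section \<open>Maurer-Cartan elements and connected components\<close>

definition MC :: "('k::field_char_0, 'v::ab_group_add) bracket_space \<Rightarrow> 'v set" where
  "MC V = {\<alpha> \<in> grd V 0.
     filt_sums (fil V) (\<lambda>k. scl V (1 / fact (k + 1)) (brk V (replicate (k + 1) \<alpha>))) 0}"

text \<open>The grading involution, which is \<open>v \<mapsto> (-1)\<^bsup>|v|\<^esup> v\<close> on homogeneous vectors.\<close>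
definition grading_involution ::
  "('k::field, 'v::ab_group_add) bracket_space \<Rightarrow> 'v \<Rightarrow> 'v" where
  "grading_involution V v =
     (\<Sum>i | component V v i \<noteq> 0. scl V (parity_sign i) (component V v i))"

text \<open>
  Polynomial forms on the 1-simplex have the basis \<open>t\<^sup>i\<close>, encoded as \<open>(i, False)\<close>,
  and \<open>t\<^sup>i dt\<close>, encoded as \<open>(i, True)\<close>. For complete \<open>V\<close>, an element of the completed tensor product of
  \<open>V\<close> with these forms is a family \<open>h\<close> of coefficients in \<open>V\<close> that tends to \<open>0\<close>; it stands for the
  sum of the \<open>h b \<otimes> b\<close> over the basis.
\<close>
definition null_family :: "(int \<Rightarrow> 'v set) \<Rightarrow> ('b \<Rightarrow> 'v) \<Rightarrow> bool" where
  "null_family F h \<longleftrightarrow> (\<forall>p. finite {b. h b \<notin> F p})"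

text \<open>\<open>d(v \<otimes> \<omega>) = (-1)\<^bsup>|v|\<^esup> v \<otimes> d\<omega>\<close>\<close>
definition form_diffl ::
  "('k::field, 'v::ab_group_add) bracket_space \<Rightarrow> (nat \<times> bool \<Rightarrow> 'v) \<Rightarrow> nat \<times> bool \<Rightarrow> 'v" where
  "form_diffl V h = (\<lambda>(m, dt).
     if dt then scl V (of_nat (m + 1)) (grading_involution V (h (m + 1, False))) else 0)"

text \<open>
  The coefficient of the extended bracket at a basis form is a finite sum over the families of basis
  forms with that product. In
  \<open>{v\<^sub>1 \<otimes> \<omega>\<^sub>1, \<dots>, v\<^sub>k \<otimes> \<omega>\<^sub>k} = \<plusminus> {v\<^sub>1, \<dots>, v\<^sub>k} \<otimes> \<omega>\<^sub>1 \<cdots> \<omega>\<^sub>k\<close> the Koszul sign arises from moving each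
  \<open>v\<^sub>j\<close> past the forms preceding it, that is, from applying the grading involution to \<open>v\<^sub>j\<close> once
  for every \<open>i < j\<close> such that \<open>\<omega>\<^sub>i\<close> is a 1-form.
\<close>
definition form_bracket ::
  "('k::field, 'v::ab_group_add) bracket_space \<Rightarrow> (nat \<times> bool \<Rightarrow> 'v) list \<Rightarrow> nat \<times> bool \<Rightarrow> 'v" where
  "form_bracket V hs = (\<lambda>(m, dt).
     \<Sum>bs | length bs = length hs \<and> sum_list (map fst bs) = m
             \<and> length (filter snd bs) = (if dt then 1 else 0).
       brk V (map (\<lambda>j. (grading_involution V ^^ length (filter snd (take j bs))) ((hs ! j) (bs ! j)))
                [0..<length hs]))"

definition tensor_forms ::
  "('k::field, 'v::ab_group_add) bracket_space \<Rightarrow> ('k, nat \<times> bool \<Rightarrow> 'v) bracket_space" where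
  "tensor_forms V =
     \<lparr>scl = (\<lambda>c h b. scl V c (h b)),
      grd = (\<lambda>k. {h. null_family (fil V) h \<and>
                      (\<forall>i. h (i, False) \<in> grd V k \<and> h (i, True) \<in> grd V (k - 1))}),
      fil = (\<lambda>p. {h. null_family (fil V) h \<and> (\<forall>b. h b \<in> fil V p)}),
      brk = (\<lambda>hs. form_bracket V hs + (if length hs = 1 then form_diffl V (hd hs) else 0))\<rparr>"

text \<open>\<open>MC\<^sub>1(V)\<close>; the endpoints of a 1-simplex are its values at \<open>t = 0\<close> and \<open>t = 1\<close>.\<close>
definition MC1 ::
  "('k::field_char_0, 'v::ab_group_add) bracket_space \<Rightarrow> (nat \<times> bool \<Rightarrow> 'v) set" where
  "MC1 V = MC (tensor_forms V)"

definition MC_endpoints ::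
  "('k::field_char_0, 'v::ab_group_add) bracket_space \<Rightarrow> ('v \<times> 'v) set" where
  "MC_endpoints V =
     {(h (0, False), x) | h x. h \<in> MC1 V \<and> filt_sums (fil V) (\<lambda>i. h (i, False)) x}"

definition MC_connected ::
  "('k::field_char_0, 'v::ab_group_add) bracket_space \<Rightarrow> ('v \<times> 'v) set" where
  "MC_connected V = (MC_endpoints V \<union> (MC_endpoints V)\<inverse>)\<^sup>* \<inter> (MC V \<times> MC V)"

definition pi0_MC :: "('k::field_char_0, 'v::ab_group_add) bracket_space \<Rightarrow> 'v set set" where
  "pi0_MC V = MC V // MC_connected V"

definition U_star ::
  "('k::field_char_0, 'w::ab_group_add) bracket_space \<Rightarrow> ('v list \<Rightarrow> 'w) \<Rightarrow> 'v \<Rightarrow> 'w" where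
  "U_star W U' \<alpha> =
     (THE s. filt_sums (fil W) (\<lambda>m. scl W (1 / fact (m + 1)) (U' (replicate (m + 1) \<alpha>))) s)"

end

theory Submission
  imports Defs
begin

text \<open>
  Write \<open>V\<close> and \<open>W\<close> for the shifts of \<open>L\<close> and \<open>M\<close>, so that Maurer-Cartan elements have degree \<open>0\<close>,
  let \<open>d\<close> be the differential of \<open>V\<close> and \<open>\<psi>\<close> the linear part of \<open>U\<close>. As \<open>V\<close> is Abelian, the
  Maurer-Cartan elements of \<open>V\<close> are the closed vectors of degree \<open>0\<close>, and two of them are connected iff
  they differ by a boundary. The theorem therefore says that \<open>\<alpha> \<mapsto> U\<^sub>\<star>(\<alpha>)\<close> identifies the cohomology of
  \<open>V\<close> in degree \<open>0\<close> with the components of the Maurer-Cartan set of \<open>W\<close>. The proof is a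
  Goldman-Millson argument by successive approximation, done twice: for elements and for paths.

  \<^bold>\<open>Paths and flows.\<close> For \<open>a\<close> in \<open>W\<close> of degree \<open>0\<close> put \<open>D\<^sub>a x = \<Sum>\<^sub>k {x, a\<^sup>k} / k!\<close>. A 1-simplex of Maurer-Cartan
  elements is a pair of power series \<open>a(t)\<close>, \<open>\<beta>(t)\<close> with coefficients tending to \<open>0\<close> such that every
  \<open>a(t)\<close> is a Maurer-Cartan element and \<open>a'(t) = - D\<^bsub>a(t)\<^esub> \<beta>(t)\<close> (\<open>MC1_iff_path\<close>). Such series are treated as
  functions of \<open>t\<close>. They form a complete filtered graded space again, and multilinear operations act on
  them pointwise, so that every result about elements also holds for families. Since \<open>W = F\<^sub>1 W\<close>, all
  exponential series in \<open>W\<close> converge, and the equation \<open>A' = - D\<^sub>A y\<close> has a unique solution \<open>A\<close> with given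
  \<open>A(0)\<close> for each \<open>y\<close> of degree \<open>-1\<close>. This gauge flow preserves the Maurer-Cartan equation (\<open>flow_mc\<close>), and it
  transports a relation \<open>\<delta> a = - D\<^sub>a \<beta>\<close>, for a derivation \<open>\<delta>\<close>, to its end (\<open>flow_transport\<close>); with
  \<open>\<delta> = d/dt\<close> this means that the flow of a family in \<open>t\<close> moves paths to paths.

  \<^bold>\<open>Surjectivity.\<close> The quadratic part of the curvature doubles filtration degrees, so that the
  cohomological hypothesis on the quotients \<open>F\<^bsub>2^q\<^esub> / F\<^bsub>min(2^(q+1), r)\<^esub>\<close> moves a Maurer-Cartan element of \<open>W\<close> into \<open>F\<^sub>r W\<close> by finitely
  many flows (\<open>raise_to_r\<close>). Then let \<open>\<beta>\<close> be a Maurer-Cartan element and \<open>\<alpha> \<in> F\<^sub>1 V\<close>, both \<open>d \<alpha>\<close> and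
  \<open>e = \<beta> - U\<^sub>\<star>(\<alpha>)\<close> being of filtration \<open>r + n\<close>. As the curvature of \<open>U\<^sub>\<star>(\<alpha>)\<close> is \<open>\<psi>(d \<alpha>)\<close> up to higher
  terms, \<open>(- d \<alpha>, e)\<close> is a cycle of the \<open>r\<close>-th page of the cone. Vanishing of that page provides
  corrections of filtration \<open>n + 1\<close> which improve \<open>\<alpha>\<close> and \<open>\<beta>\<close> by one filtration degree
  (\<open>approximation_step\<close>), and the limit yields \<open>\<beta> = U\<^sub>\<star>(\<alpha>)\<close> after one flow (\<open>surjectivity_in_Fr\<close>).

  \<^bold>\<open>Injectivity.\<close> Given a path from \<open>U\<^sub>\<star>(\<gamma>\<^sub>0)\<close> to \<open>U\<^sub>\<star>(\<gamma>\<^sub>1)\<close> with closed \<open>\<gamma>\<^sub>i \<in> F\<^sub>1 V\<close>, apply the surjectivity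
  argument to the whole path, with corrections vanishing at the ends. The path becomes \<open>U\<^sub>\<star>(\<alpha>(t))\<close>
  for a family of closed vectors from \<open>\<gamma>\<^sub>0\<close> to \<open>\<gamma>\<^sub>1\<close>. Its derivative \<open>\<alpha>'\<close> is mapped to a boundary of the
  twisted complex of \<open>W\<close>, and the twisted linear part of \<open>U\<close> is injective on cohomology by the
  page condition again (\<open>twisted_injectivity\<close>). So \<open>\<alpha>' = d X\<close>, and integration exhibits \<open>\<gamma>\<^sub>1 - \<gamma>\<^sub>0\<close> as a
  boundary (\<open>path_between_images\<close>).

  \<^bold>\<open>Arguments outside \<open>F\<^sub>1 V\<close>.\<close> Every closed \<open>\<alpha>\<close> has the form \<open>\<alpha>\<^sub>1 + d z\<close> with \<open>\<alpha>\<^sub>1 \<in> F\<^sub>1 V\<close>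
  (\<open>closed_decomposition\<close>), and \<open>U\<^sub>\<star>(\<alpha>\<^sub>1 + t d z)\<close> is a path (\<open>exact_deformation_joined\<close>). The point is
  that its coefficients tend to \<open>0\<close> although \<open>d z\<close> need not lie in \<open>F\<^sub>1\<close>. It is here that \<open>U\<^sub>\<star>\<close> has
  to be a finite sum: modulo \<open>F\<^sub>p\<close> only finitely many powers of \<open>\<alpha>\<^sub>1\<close> matter, and the terms
  \<open>U'(\<alpha>\<^sub>1\<^sup>i, (d z)\<^sup>j)\<close> for large \<open>i + j\<close> are combinations of the values \<open>U'((2\<^sup>s \<alpha>\<^sub>1 + d z)\<^bsup>i+j\<^esup>) = 0\<close>, by a
  Vandermonde argument (\<open>finite_powers_null\<close>).

  \<^bold>\<open>The coalgebra.\<close> The relations of the structures are given in symmetric coalgebras. Applying to them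
  the linear functional that projects a word to its one-letter part turns them into sums over subsets and
  ordered partitions of positions; on words with at most two letters of odd degree these collapse to
  the binomial identities that express \<open>D\<^sub>a D\<^sub>a = 0\<close>, its Leibniz rule, and the chain map property of \<open>U\<close>
  twisted by \<open>a\<close>.
\<close>

section \<open>Summation in filtered graded vector spaces\<close>

abbreviation (input) lies_in :: "(int \<Rightarrow> 'v set) \<Rightarrow> 'v list \<Rightarrow> int list \<Rightarrow> bool" where
  "lies_in G \<equiv> list_all2 (\<lambda>v i. v \<in> G i)"

text \<open>
  Convergence of unordered sums in the filtration topology. Since the filtration is by subspaces,
  a family is summable as soon as it tends to zero, and rearrangement or grouping of terms is harmless.
\<close>

definition has_nsum :: "(int \<Rightarrow> 'v set) \<Rightarrow> ('i \<Rightarrow> 'v::ab_group_add) \<Rightarrow> 'i set \<Rightarrow> 'v \<Rightarrow> bool" where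
  "has_nsum F h A s \<longleftrightarrow>
     (\<forall>p. \<exists>X. finite X \<and> X \<subseteq> A \<and> (\<forall>i\<in>A - X. h i \<in> F p) \<and> sum h X - s \<in> F p)"

definition nsum :: "(int \<Rightarrow> 'v set) \<Rightarrow> ('i \<Rightarrow> 'v::ab_group_add) \<Rightarrow> 'i set \<Rightarrow> 'v" where
  "nsum F h A = (THE s. has_nsum F h A s)"

text \<open>
  For \<open>A = UNIV\<close> this is \<^const>\<open>null_family\<close>; a separate index set is needed for sums over lists of
  given length.
\<close>

definition nullf :: "(int \<Rightarrow> 'v set) \<Rightarrow> ('i \<Rightarrow> 'v) \<Rightarrow> 'i set \<Rightarrow> bool" where
  "nullf F h A \<longleftrightarrow> (\<forall>p. finite {i\<in>A. h i \<notin> F p})"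

text \<open>
  A complete filtered graded vector space: completeness is required in each degree only, as a
  filtration of a graded space need not be complete in the sum of the degrees. Homogeneity
  is therefore a hypothesis of every existence statement below.
\<close>

locale filtered_space = vector_space S
  for S :: "'k::field_char_0 \<Rightarrow> 'v::ab_group_add \<Rightarrow> 'v" +
  fixes G F :: "int \<Rightarrow> 'v set"
  assumes G_sub: "subspace (G k)"
    and F_sub: "subspace (F p)"
    and F_Suc: "F (p + 1) \<subseteq> F p"
    and F_top: "p \<le> 0 \<Longrightarrow> F p = UNIV"
    and hausdorff: "(\<And>p. v \<in> F p) \<Longrightarrow> v = 0"
    and complete: "(\<And>p. x p \<in> G k) \<Longrightarrow> (\<And>p. x (p + 1) - x p \<in> F p) \<Longrightarrow>
                     \<exists>v\<in>G k. \<forall>p. v - x p \<in> F p"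
begin

lemmas F_add = subspace_add[OF F_sub] and F_diff = subspace_diff[OF F_sub]
  and F_neg = subspace_neg[OF F_sub] and F_zero[simp] = subspace_0[OF F_sub]
  and F_scale = subspace_scale[OF F_sub] and F_sum = subspace_sum[OF F_sub]

lemmas G_add = subspace_add[OF G_sub] and G_diff = subspace_diff[OF G_sub]
  and G_neg = subspace_neg[OF G_sub] and G_zero[simp] = subspace_0[OF G_sub]
  and G_scale = subspace_scale[OF G_sub] and G_sum = subspace_sum[OF G_sub]

lemma F_anti: assumes "p \<le> q" shows "F q \<subseteq> F p"
  using assms
proof (induction q rule: int_ge_induct)
  case (step i)
  then show ?case using F_Suc[of i] by blast
qed simp

lemma F_antiD: "v \<in> F q \<Longrightarrow> p \<le> q \<Longrightarrow> v \<in> F p"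
  using F_anti by blast

lemma F_swap: "a - b \<in> F p \<longleftrightarrow> b - a \<in> F p"
  using F_neg[of "a - b" p] F_neg[of "b - a" p] by auto

lemma F_eq: "a - b \<in> F p \<Longrightarrow> a \<in> F p \<longleftrightarrow> b \<in> F p"
  using F_diff[of a p "a - b"] F_add[of "a - b" p b] by auto

lemma F_trans: "a - b \<in> F p \<Longrightarrow> b - c \<in> F p \<Longrightarrow> a - c \<in> F p"
  using F_add[of "a - b" p "b - c"] by simp

lemma F_scale_iff: "c \<noteq> 0 \<Longrightarrow> S c v \<in> F p \<longleftrightarrow> v \<in> F p"
  using F_scale[of v p c] F_scale[of "S c v" p "inverse c"] by auto

lemma eq_by_F: "(\<And>p. a - b \<in> F p) \<Longrightarrow> a = b"
  using hausdorff[of "a - b"] by simp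

lemma has_nsum_null: "has_nsum F h A s \<Longrightarrow> finite {i\<in>A. h i \<notin> F p}"
proof -
  assume "has_nsum F h A s"
  then obtain X where "finite X" "\<forall>i\<in>A - X. h i \<in> F p" unfolding has_nsum_def by blast
  then show ?thesis by (blast intro: finite_subset[of _ X])
qed

lemma has_nsum_nullf: "has_nsum F h A s \<Longrightarrow> nullf F h A"
  unfolding nullf_def using has_nsum_null by blast

lemma has_nsum_approx:
  assumes "has_nsum F h A s" "finite Y" "Y \<subseteq> A" "\<And>i. i \<in> A - Y \<Longrightarrow> h i \<in> F p"
  shows "sum h Y - s \<in> F p"
proof -
  obtain X where X: "finite X" "X \<subseteq> A" "\<forall>i\<in>A - X. h i \<in> F p" "sum h X - s \<in> F p"
    using assms(1) unfolding has_nsum_def by blast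
  have "sum h Y = sum h (Y - X) + sum h (Y \<inter> X)"
    using assms(2) by (metis add.commute sum.Int_Diff)
  moreover have "sum h X = sum h (X - Y) + sum h (Y \<inter> X)"
    using X(1) by (metis add.commute inf_commute sum.Int_Diff)
  ultimately have "sum h Y - s = sum h (Y - X) - sum h (X - Y) + (sum h X - s)" by simp
  moreover have "sum h (Y - X) \<in> F p" "sum h (X - Y) \<in> F p"
    using assms X by (auto intro!: F_sum)
  ultimately show ?thesis using X(4) F_add F_diff by metis
qed

lemma has_nsum_unique: "has_nsum F h A s \<Longrightarrow> has_nsum F h A s' \<Longrightarrow> s = s'"
proof (rule eq_by_F)
  fix p assume a: "has_nsum F h A s" "has_nsum F h A s'"
  let ?Y = "{i\<in>A. h i \<notin> F p}"
  have "sum h ?Y - s \<in> F p" "sum h ?Y - s' \<in> F p"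
    by (rule has_nsum_approx[OF a(1) has_nsum_null[OF a(1)]], auto)
       (rule has_nsum_approx[OF a(2) has_nsum_null[OF a(1)]], auto)
  then show "s - s' \<in> F p" using F_swap F_trans by blast
qed

lemma nsum_eq: "has_nsum F h A s \<Longrightarrow> nsum F h A = s"
  unfolding nsum_def using has_nsum_unique by blast

text \<open>
  The partial sums over the terms outside \<open>F p\<close> form a compatible sequence modulo the filtration.
\<close>

lemma has_nsum_exists:
  assumes n: "nullf F h A" and G: "\<And>i. i \<in> A \<Longrightarrow> h i \<in> G k"
  shows "\<exists>s\<in>G k. has_nsum F h A s"
proof -
  \<comment> \<open>the terms that are not negligible modulo \<open>F p\<close>\<close>
  define Y where "Y p = {i\<in>A. h i \<notin> F p}" for p
  have fin: "finite (Y p)" for p using n unfolding nullf_def Y_def by blast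
  have "\<exists>v\<in>G k. \<forall>p. v - sum h (Y p) \<in> F p"
  proof (rule complete)
    show "sum h (Y p) \<in> G k" for p by (rule G_sum) (auto simp: Y_def G)
    show "sum h (Y (p + 1)) - sum h (Y p) \<in> F p" for p
    proof -
      have "Y p \<subseteq> Y (p + 1)" using F_Suc[of p] by (auto simp: Y_def)
      then have "sum h (Y (p + 1)) - sum h (Y p) = sum h (Y (p + 1) - Y p)"
        using fin by (simp add: sum_diff)
      also have "\<dots> \<in> F p" by (rule F_sum) (auto simp: Y_def)
      finally show ?thesis .
    qed
  qed
  then obtain v where v: "v \<in> G k" "\<And>p. v - sum h (Y p) \<in> F p" by blast
  have "has_nsum F h A v" unfolding has_nsum_def
  proof
    fix p
    show "\<exists>X. finite X \<and> X \<subseteq> A \<and> (\<forall>i\<in>A - X. h i \<in> F p) \<and> sum h X - v \<in> F p"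
      using fin[of p] v(2)[of p] F_swap by (intro exI[of _ "Y p"]) (auto simp: Y_def)
  qed
  then show ?thesis using v(1) by blast
qed

lemma has_nsum_nsum:
  "nullf F h A \<Longrightarrow> (\<And>i. i \<in> A \<Longrightarrow> h i \<in> G k) \<Longrightarrow> has_nsum F h A (nsum F h A)"
  using has_nsum_exists nsum_eq by metis

lemma has_nsum_G: "has_nsum F h A s \<Longrightarrow> (\<And>i. i \<in> A \<Longrightarrow> h i \<in> G k) \<Longrightarrow> s \<in> G k"
  using has_nsum_exists[OF has_nsum_nullf] has_nsum_unique by metis

lemma has_nsum_F: "has_nsum F h A s \<Longrightarrow> (\<And>i. i \<in> A \<Longrightarrow> h i \<in> F p) \<Longrightarrow> s \<in> F p"
  using has_nsum_approx[of h A s "{}" p] F_neg[of "- s" p] by simp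

lemma has_nsum_finite: "finite A \<Longrightarrow> has_nsum F h A (sum h A)"
  unfolding has_nsum_def by (intro allI exI[of _ A]) auto

lemma has_nsum_0: "has_nsum F (\<lambda>_. 0) A 0"
  unfolding has_nsum_def by (intro allI exI[of _ "{}"]) auto

lemma has_nsum_cong: "(\<And>i. i \<in> A \<Longrightarrow> h i = h' i) \<Longrightarrow> has_nsum F h A s \<longleftrightarrow> has_nsum F h' A s"
proof -
  have *: "has_nsum F h' A s" if e: "\<And>i. i \<in> A \<Longrightarrow> h i = h' i" and n: "has_nsum F h A s" for h h'
    unfolding has_nsum_def
  proof
    fix p
    obtain X where X: "finite X" "X \<subseteq> A" "\<forall>i\<in>A - X. h i \<in> F p" "sum h X - s \<in> F p"
      using n unfolding has_nsum_def by blast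
    moreover have "sum h X = sum h' X" using X(2) e by (intro sum.cong) auto
    ultimately show "\<exists>X. finite X \<and> X \<subseteq> A \<and> (\<forall>i\<in>A - X. h' i \<in> F p) \<and> sum h' X - s \<in> F p"
      using e by (intro exI[of _ X]) auto
  qed
  assume "\<And>i. i \<in> A \<Longrightarrow> h i = h' i"
  then show ?thesis using *[of h h'] *[of h' h] by auto
qed

lemma has_nsum_add:
  assumes "has_nsum F h A s" "has_nsum F h' A s'"
  shows "has_nsum F (\<lambda>i. h i + h' i) A (s + s')"
  unfolding has_nsum_def
proof
  fix p
  let ?Y = "{i\<in>A. h i \<notin> F p} \<union> {i\<in>A. h' i \<notin> F p}"
  have fin: "finite ?Y" using assms has_nsum_null by blast
  have "sum h ?Y - s \<in> F p" "sum h' ?Y - s' \<in> F p"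
    by (rule has_nsum_approx[OF assms(1) fin], auto) (rule has_nsum_approx[OF assms(2) fin], auto)
  then have "(sum h ?Y - s) + (sum h' ?Y - s') \<in> F p" by (rule F_add)
  then show "\<exists>X. finite X \<and> X \<subseteq> A \<and> (\<forall>i\<in>A - X. h i + h' i \<in> F p) \<and>
      (\<Sum>i\<in>X. h i + h' i) - (s + s') \<in> F p"
    using fin by (intro exI[of _ ?Y]) (auto simp: sum.distrib algebra_simps intro: F_add)
qed

lemma has_nsum_scale:
  assumes "has_nsum F h A s" shows "has_nsum F (\<lambda>i. S c (h i)) A (S c s)"
  unfolding has_nsum_def
proof
  fix p
  obtain X where X: "finite X" "X \<subseteq> A" "\<forall>i\<in>A - X. h i \<in> F p" "sum h X - s \<in> F p"
    using assms unfolding has_nsum_def by blast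
  have "(\<Sum>i\<in>X. S c (h i)) - S c s = S c (sum h X - s)"
    by (simp add: scale_sum_right scale_right_diff_distrib)
  then show "\<exists>X. finite X \<and> X \<subseteq> A \<and> (\<forall>i\<in>A - X. S c (h i) \<in> F p) \<and> (\<Sum>i\<in>X. S c (h i)) - S c s \<in> F p"
    using X F_scale by (intro exI[of _ X]) auto
qed

lemma has_nsum_neg: "has_nsum F h A s \<Longrightarrow> has_nsum F (\<lambda>i. - h i) A (- s)"
  using has_nsum_scale[of h A s "-1"] by simp

lemma has_nsum_diff:
  "has_nsum F h A s \<Longrightarrow> has_nsum F h' A s' \<Longrightarrow> has_nsum F (\<lambda>i. h i - h' i) A (s - s')"
  using has_nsum_add[OF _ has_nsum_neg, of h A s h' s'] by simp

lemma has_nsum_sum: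
  assumes "finite B" "\<And>j. j \<in> B \<Longrightarrow> has_nsum F (h j) A (s j)"
  shows "has_nsum F (\<lambda>i. \<Sum>j\<in>B. h j i) A (\<Sum>j\<in>B. s j)"
  using assms
  by (induction B rule: finite_induct) (auto intro: has_nsum_0 has_nsum_add)

lemma has_nsum_reindex:
  assumes "bij_betw g B A"
  shows "has_nsum F (\<lambda>j. h (g j)) B s \<longleftrightarrow> has_nsum F h A s"
proof
  assume l: "has_nsum F (\<lambda>j. h (g j)) B s"
  show "has_nsum F h A s" unfolding has_nsum_def
  proof
    fix p
    obtain X where X: "finite X" "X \<subseteq> B" "\<forall>i\<in>B - X. h (g i) \<in> F p" "(\<Sum>j\<in>X. h (g j)) - s \<in> F p"
      using l unfolding has_nsum_def by blast
    have "sum h (g ` X) = (\<Sum>j\<in>X. h (g j))"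
      using assms X(2) by (subst sum.reindex) (auto simp: bij_betw_def intro: inj_on_subset)
    then show "\<exists>X. finite X \<and> X \<subseteq> A \<and> (\<forall>i\<in>A - X. h i \<in> F p) \<and> sum h X - s \<in> F p"
      using X assms by (intro exI[of _ "g ` X"]) (auto simp: bij_betw_def)
  qed
next
  assume r: "has_nsum F h A s"
  show "has_nsum F (\<lambda>j. h (g j)) B s" unfolding has_nsum_def
  proof
    fix p
    obtain X where X: "finite X" "X \<subseteq> A" "\<forall>i\<in>A - X. h i \<in> F p" "sum h X - s \<in> F p"
      using r unfolding has_nsum_def by blast
    let ?Y = "{j\<in>B. g j \<in> X}"
    have im: "g ` ?Y = X" and inj: "inj_on g ?Y"
      using assms X(2) by (auto simp: bij_betw_def intro: inj_on_subset)
    have "finite ?Y" using im inj X(1) by (metis finite_imageD)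
    moreover have "(\<Sum>j\<in>?Y. h (g j)) = sum h X" using im inj by (metis (no_types, lifting) sum.reindex_cong)
    ultimately show "\<exists>X. finite X \<and> X \<subseteq> B \<and> (\<forall>i\<in>B - X. h (g i) \<in> F p) \<and> (\<Sum>j\<in>X. h (g j)) - s \<in> F p"
      using X assms by (intro exI[of _ ?Y]) (auto simp: bij_betw_def)
  qed
qed

text \<open>
  Joint nullity is what allows a double sum to be computed by an iterated one: outside a finite set
  all terms are negligible, and only finitely many rows are affected.
\<close>

lemma has_nsum_Sigma:
  assumes null: "nullf F h (Sigma A B)"
    and inner: "\<And>i. i \<in> A \<Longrightarrow> has_nsum F (\<lambda>j. h (i, j)) (B i) (g i)"
    and outer: "has_nsum F g A s"
  shows "has_nsum F h (Sigma A B) s"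
  unfolding has_nsum_def
proof
  fix p
  let ?X = "{x\<in>Sigma A B. h x \<notin> F p}"
  let ?Y = "fst ` ?X"
  let ?Z = "\<lambda>i. {j\<in>B i. h (i, j) \<notin> F p}"
  have fin: "finite ?X" using null unfolding nullf_def by blast
  have finZ: "finite (?Z i)" if "i \<in> A" for i using has_nsum_null[OF inner[OF that]] .
  have g: "sum (\<lambda>j. h (i, j)) (?Z i) - g i \<in> F p" if "i \<in> A" for i
    by (rule has_nsum_approx[OF inner[OF that] finZ[OF that]]) auto
  have "sum g ?Y - s \<in> F p"
  proof (rule has_nsum_approx[OF outer])
    fix i assume i: "i \<in> A - ?Y"
    then have "?Z i = {}" by force
    then have "sum (\<lambda>j. h (i, j)) (?Z i) = 0" by (metis sum.empty)
    then show "g i \<in> F p" using g[of i] i F_neg[of "- g i" p] by simp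
  qed (use fin in auto)
  moreover have "sum h ?X = (\<Sum>i\<in>?Y. \<Sum>j\<in>?Z i. h (i, j))"
  proof -
    have eq: "?X = Sigma ?Y ?Z" by force
    have "(\<Sum>i\<in>?Y. \<Sum>j\<in>?Z i. h (i, j)) = (\<Sum>(i, j)\<in>Sigma ?Y ?Z. h (i, j))"
      by (rule sum.Sigma) (use fin finZ in auto)
    also have "\<dots> = sum h ?X" unfolding eq[symmetric] by simp
    finally show ?thesis by simp
  qed
  moreover have "(\<Sum>i\<in>?Y. \<Sum>j\<in>?Z i. h (i, j)) - sum g ?Y \<in> F p"
    unfolding sum_subtractf[symmetric] by (rule F_sum) (use g in auto)
  ultimately have "sum h ?X - s \<in> F p" by (auto intro: F_trans)
  then show "\<exists>X. finite X \<and> X \<subseteq> Sigma A B \<and> (\<forall>i\<in>Sigma A B - X. h i \<in> F p) \<and> sum h X - s \<in> F p"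
    using fin by (intro exI[of _ ?X]) auto
qed

text \<open>
  Regrouping by the fibres of a map, mostly by total degree. In contrast to \<open>has_nsum_Sigma\<close>, the
  convergence of the whole sum is known here and that of the sum of the groups is the conclusion.
\<close>

lemma has_nsum_group:
  assumes s: "has_nsum F h A s" and q: "\<And>i. i \<in> A \<Longrightarrow> q i \<in> B"
    and inner: "\<And>m. m \<in> B \<Longrightarrow> has_nsum F h {i\<in>A. q i = m} (g m)"
  shows "has_nsum F g B s"
  unfolding has_nsum_def
proof
  fix p
  let ?X = "{i\<in>A. h i \<notin> F p}"
  have fin: "finite ?X" using has_nsum_null[OF s] .
  have gm: "sum h {i\<in>?X. q i = m} - g m \<in> F p" if "m \<in> B" for m
    by (rule has_nsum_approx[OF inner[OF that]]) (use fin in \<open>auto intro: finite_subset[OF _ fin]\<close>)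
  have "sum h ?X = (\<Sum>m\<in>q ` ?X. sum h {i\<in>?X. q i = m})"
    by (rule sum.image_gen[OF fin])
  moreover have "(\<Sum>m\<in>q ` ?X. sum h {i\<in>?X. q i = m}) - sum g (q ` ?X) \<in> F p"
    unfolding sum_subtractf[symmetric] by (rule F_sum) (use gm q in auto)
  moreover have "sum h ?X - s \<in> F p" by (rule has_nsum_approx[OF s fin]) auto
  ultimately have "sum g (q ` ?X) - s \<in> F p" by (auto intro: F_trans simp: F_swap[of _ "sum g (q ` ?X)"])
  moreover have "g m \<in> F p" if "m \<in> B - q ` ?X" for m
  proof -
    have "{i\<in>?X. q i = m} = {}" using that by auto
    then have "sum h {i\<in>?X. q i = m} = 0" by (metis sum.empty)
    then show ?thesis using gm[of m] that F_neg[of "- g m" p] by simp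
  qed
  ultimately show "\<exists>X. finite X \<and> X \<subseteq> B \<and> (\<forall>i\<in>B - X. g i \<in> F p) \<and> sum g X - s \<in> F p"
    using fin q by (intro exI[of _ "q ` ?X"]) auto
qed

text \<open>
  Used to isolate the first terms of an exponential series.
\<close>

lemma has_nsum_tail:
  fixes h :: "nat \<Rightarrow> 'v"
  assumes "has_nsum F h UNIV s" "\<And>k. k \<ge> N \<Longrightarrow> h k \<in> F p"
  shows "s - (\<Sum>k<N. h k) \<in> F p"
  using has_nsum_approx[OF assms(1), of "{..<N}" p] assms(2) F_swap by auto

lemma nullf_nat: "(\<And>i::nat. h i \<in> F (int i)) \<Longrightarrow> nullf F h A"
  unfolding nullf_def
proof
  fix p assume h: "\<And>i. h i \<in> F (int i)"
  have "{i\<in>A. h i \<notin> F p} \<subseteq> {..<nat p}"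
    using F_antiD[OF h] by (auto simp: not_less[symmetric]) (metis nat_le_iff not_le)
  then show "finite {i\<in>A. h i \<notin> F p}" using finite_subset by blast
qed

lemma nullf_subset: "nullf F h B \<Longrightarrow> A \<subseteq> B \<Longrightarrow> nullf F h A"
  unfolding nullf_def
proof
  fix p assume "\<forall>p. finite {i\<in>B. h i \<notin> F p}" "A \<subseteq> B"
  then show "finite {i\<in>A. h i \<notin> F p}" by (auto intro: rev_finite_subset[of "{i\<in>B. h i \<notin> F p}"])
qed

lemma nullf_le:
  assumes "nullf F h A" and "\<And>i p. i \<in> A \<Longrightarrow> h i \<in> F p \<Longrightarrow> h' i \<in> F p"
  shows "nullf F h' A"
  unfolding nullf_def
proof
  fix p
  have "{i\<in>A. h' i \<notin> F p} \<subseteq> {i\<in>A. h i \<notin> F p}" using assms(2) by blast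
  then show "finite {i\<in>A. h' i \<notin> F p}" using assms(1) finite_subset unfolding nullf_def by blast
qed

lemma has_nsum_imp_filt_sums: "has_nsum F h UNIV s \<Longrightarrow> filt_sums F h s"
  unfolding filt_sums_def
proof
  fix p assume s: "has_nsum F h UNIV s"
  obtain N where N: "\<forall>i\<in>{i\<in>UNIV. h i \<notin> F p}. i < N"
    using has_nsum_null[OF s, of p] finite_nat_set_iff_bounded by blast
  then have "\<And>i. i \<ge> N \<Longrightarrow> h i \<in> F p" by force
  then have "(\<Sum>k<n. h k) - s \<in> F p" if "n \<ge> N" for n
    using that has_nsum_approx[OF s, of "{..<n}" p] by auto
  then show "\<exists>N. \<forall>n\<ge>N. (\<Sum>k<n. h k) - s \<in> F p" by blast
qed

lemma filt_sums_unique: "filt_sums F h s \<Longrightarrow> filt_sums F h s' \<Longrightarrow> s = s'"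
proof (rule eq_by_F)
  fix p assume "filt_sums F h s" "filt_sums F h s'"
  then obtain N N' where "\<forall>n\<ge>N. (\<Sum>k<n. h k) - s \<in> F p" "\<forall>n\<ge>N'. (\<Sum>k<n. h k) - s' \<in> F p"
    unfolding filt_sums_def by meson
  then have "(\<Sum>k<max N N'. h k) - s \<in> F p" "(\<Sum>k<max N N'. h k) - s' \<in> F p" by auto
  then show "s - s' \<in> F p" using F_swap F_trans by blast
qed

lemma complete_nat:
  assumes x: "\<And>n. x n \<in> G k" and d: "\<And>n. x (Suc n) - x n \<in> F (int n + c)"
  shows "\<exists>v\<in>G k. \<forall>n. v - x n \<in> F (int n + c)"
proof -
  have mono: "x n' - x n \<in> F (int n + c)" if "n \<le> n'" for n n'
    using that
  proof (induction rule: dec_induct)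
    case (step m)
    have "x (Suc m) - x m \<in> F (int n + c)" using F_antiD[OF d[of m]] step by simp
    then show ?case using step F_trans by blast
  qed simp
  have "\<exists>v\<in>G k. \<forall>p. v - x (nat (p - c)) \<in> F p"
  proof (rule complete)
    fix p
    show "x (nat (p + 1 - c)) - x (nat (p - c)) \<in> F p"
      using mono[of "nat (p - c)" "nat (p + 1 - c)"] F_antiD by (cases "p - c \<ge> 0") auto
  qed (rule x)
  then obtain v where v: "v \<in> G k" "\<And>p. v - x (nat (p - c)) \<in> F p" by blast
  have "v - x n \<in> F (int n + c)" for n using v(2)[of "int n + c"] by simp
  then show ?thesis using v(1) by blast
qed

text \<open>
  The Banach fixed point principle: a map that gains one filtration degree on differences contracts.
\<close>

lemma fixed_point:
  assumes T: "\<And>x. x \<in> G k \<Longrightarrow> T x \<in> G k"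
    and contr: "\<And>x y n. x \<in> G k \<Longrightarrow> y \<in> G k \<Longrightarrow> n \<ge> 0 \<Longrightarrow> x - y \<in> F n \<Longrightarrow> T x - T y \<in> F (n + 1)"
  shows "\<exists>x\<in>G k. T x = x"
proof -
  define x where "x n = (T ^^ n) 0" for n
  have x: "x n \<in> G k" for n by (induction n) (auto simp: x_def T)
  have d: "x (Suc n) - x n \<in> F (int n + 0)" for n
  proof (induction n)
    case 0 then show ?case using F_top by simp
  next
    case (Suc n)
    then show ?case using contr[OF x x, of "int n" "Suc n" n] by (simp add: x_def add.commute)
  qed
  from complete_nat[OF x d] obtain v where v: "v \<in> G k" "\<And>n. v - x n \<in> F (int n)" by auto
  have "T v - v \<in> F p" for p
  proof -
    have "T v - T (x (nat p)) \<in> F (int (nat p) + 1)" by (rule contr[OF v(1) x _ v(2)]) simp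
    moreover have "T (x (nat p)) = x (Suc (nat p))" by (simp add: x_def)
    ultimately have "T v - v \<in> F (int (nat p) + 1)"
      using v(2)[of "Suc (nat p)"] F_swap[of v] F_trans[of "T v" "x (Suc (nat p))" _ v]
      by (simp add: add.commute)
    then show ?thesis by (rule F_antiD) linarith
  qed
  then show ?thesis using v(1) eq_by_F by blast
qed

end

text \<open>
  The subspace \<open>B\<close> allows maps that are additive on vectors of one degree only.
\<close>

lemma has_nsum_image:
  assumes V: "filtered_space S G F" and W: "filtered_space S' G' F'"
    and add: "\<And>x y. x \<in> B \<Longrightarrow> y \<in> B \<Longrightarrow> T (x - y) = T x - T y"
    and B: "module.subspace S B" "\<And>i. i \<in> A \<Longrightarrow> h i \<in> B" "s \<in> B"
    and T: "\<And>x p. x \<in> B \<Longrightarrow> x \<in> F p \<Longrightarrow> T x \<in> F' p"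
    and s: "has_nsum F h A s"
  shows "has_nsum F' (\<lambda>i. T (h i)) A (T s)"
proof -
  interpret V: filtered_space S G F by fact
  interpret W: filtered_space S' G' F' by fact
  have T0: "T 0 = 0" using add[of 0 0] V.subspace_0[OF B(1)] by simp
  have Tadd: "T (x + y) = T x + T y" if "x \<in> B" "y \<in> B" for x y
  proof -
    have y: "- y \<in> B" using that V.subspace_neg[OF B(1)] by blast
    have "T (- y) = - T y" using add[of 0 y] that(2) V.subspace_0[OF B(1)] T0 by simp
    then show ?thesis using add[OF that(1) y] by simp
  qed
  have sumB: "sum h X \<in> B" if "X \<subseteq> A" for X
    by (rule V.subspace_sum[OF B(1)]) (use B(2) that in auto)
  have Tsum: "T (sum h X) = (\<Sum>i\<in>X. T (h i))" if "finite X" "X \<subseteq> A" for X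
    using that
  proof (induction X rule: finite_induct)
    case (insert a X)
    have "T (sum h (insert a X)) = T (h a + sum h X)" using insert.hyps by simp
    also have "\<dots> = T (h a) + T (sum h X)" using insert.prems by (intro Tadd B(2) sumB) auto
    also have "\<dots> = (\<Sum>i\<in>insert a X. T (h i))" using insert by simp
    finally show ?case .
  qed (simp add: T0)
  show ?thesis unfolding has_nsum_def
  proof
    fix p
    obtain X where X: "finite X" "X \<subseteq> A" "\<forall>i\<in>A - X. h i \<in> F p" "sum h X - s \<in> F p"
      using s unfolding has_nsum_def by blast
    have "(\<Sum>i\<in>X. T (h i)) - T s = T (sum h X - s)"
      using add[OF sumB[OF X(2)] B(3)] Tsum[OF X(1,2)] by simp
    also have "\<dots> \<in> F' p"
      by (rule T[OF _ X(4)]) (intro V.subspace_diff[OF B(1)] sumB[OF X(2)] B(3))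
    finally have "(\<Sum>i\<in>X. T (h i)) - T s \<in> F' p" .
    moreover have "\<forall>i\<in>A - X. T (h i) \<in> F' p" using X(3) T[OF B(2)] by blast
    ultimately show "\<exists>X. finite X \<and> X \<subseteq> A \<and> (\<forall>i\<in>A - X. T (h i) \<in> F' p) \<and> (\<Sum>i\<in>X. T (h i)) - T s \<in> F' p"
      using X(1,2) by blast
  qed
qed

lemma (in filtered_space) has_nsum_Suc:
  assumes "h (0::nat) = 0"
  shows "has_nsum F h UNIV s \<longleftrightarrow> has_nsum F (\<lambda>k. h (Suc k)) UNIV s"
proof -
  have "has_nsum F (\<lambda>k. h (Suc k)) UNIV s \<longleftrightarrow> has_nsum F h (UNIV - {0}) s"
  proof (rule has_nsum_reindex)
    show "bij_betw Suc UNIV (UNIV - {0})"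
      by (rule bij_betwI[where g = "\<lambda>n. n - 1"]) auto
  qed
  also have "\<dots> \<longleftrightarrow> has_nsum F h UNIV s"
  proof
    assume l: "has_nsum F h (UNIV - {0}) s"
    show "has_nsum F h UNIV s" unfolding has_nsum_def
    proof
      fix p
      obtain X where "finite X" "X \<subseteq> UNIV - {0}" "\<forall>i\<in>UNIV - {0} - X. h i \<in> F p" "sum h X - s \<in> F p"
        using spec[OF l[unfolded has_nsum_def], of p] by blast
      moreover have "h i \<in> F p" if "\<forall>i\<in>UNIV - {0} - X. h i \<in> F p" "i \<notin> X" for i
        using that assms by (cases "i = 0") auto
      ultimately show "\<exists>X. finite X \<and> X \<subseteq> UNIV \<and> (\<forall>i\<in>UNIV - X. h i \<in> F p) \<and> sum h X - s \<in> F p"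
        by (intro exI[of _ X]) auto
    qed
  next
    assume r: "has_nsum F h UNIV s"
    show "has_nsum F h (UNIV - {0}) s" unfolding has_nsum_def
    proof
      fix p
      obtain X where X: "finite X" "\<forall>i\<in>UNIV - X. h i \<in> F p" "sum h X - s \<in> F p"
        using spec[OF r[unfolded has_nsum_def], of p] by blast
      moreover have "sum h (X - {0}) = sum h X" using X(1) assms by (intro sum.mono_neutral_left) auto
      ultimately show "\<exists>X. finite X \<and> X \<subseteq> UNIV - {0} \<and> (\<forall>i\<in>UNIV - {0} - X. h i \<in> F p) \<and> sum h X - s \<in> F p"
        by (intro exI[of _ "X - {0}"]) auto
    qed
  qed
  finally show ?thesis by simp
qed

lemma (in filtered_space) has_nsum_congD:
  "has_nsum F h A s \<Longrightarrow> (\<And>i. i \<in> A \<Longrightarrow> h i = h' i) \<Longrightarrow> has_nsum F h' A s"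
  using has_nsum_cong by blast

lemma (in filtered_space) has_nsum_support_on:
  assumes "finite X" "X \<subseteq> A" "\<And>i. i \<in> A - X \<Longrightarrow> h i = 0" shows "has_nsum F h A (sum h X)"
  unfolding has_nsum_def using assms by (intro allI exI[of _ X]) auto

lemma (in filtered_space) has_nsum_extend:
  assumes "has_nsum F h B s" "B \<subseteq> A" "\<And>i. i \<in> A - B \<Longrightarrow> h i = 0" shows "has_nsum F h A s"
  unfolding has_nsum_def
proof
  fix p
  obtain X where "finite X" "X \<subseteq> B" "\<forall>i\<in>B - X. h i \<in> F p" "sum h X - s \<in> F p"
    using assms(1) unfolding has_nsum_def by blast
  then show "\<exists>X. finite X \<and> X \<subseteq> A \<and> (\<forall>i\<in>A - X. h i \<in> F p) \<and> sum h X - s \<in> F p"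
    using assms(2,3) by (intro exI[of _ X]) (metis DiffD1 DiffD2 DiffI F_zero subset_trans)
qed

section \<open>Power series with coefficients tending to zero\<close>

text \<open>
  \<open>f\<close> is the sum of the power series with coefficients \<open>c\<close>, which tend to zero. Working with the
  function instead of its coefficients makes products, and hence all multilinear operations, pointwise;
  the coefficients are recovered by \<open>expands_unique\<close>, as the field is infinite.
\<close>

definition expands :: "('k::field \<Rightarrow> 'v \<Rightarrow> 'v) \<Rightarrow> (int \<Rightarrow> 'v set) \<Rightarrow> ('k \<Rightarrow> 'v::ab_group_add) \<Rightarrow> (nat \<Rightarrow> 'v) \<Rightarrow> bool" where
  "expands S F f c \<longleftrightarrow> nullf F c UNIV \<and> (\<forall>t. has_nsum F (\<lambda>i. S (t ^ i) (c i)) UNIV (f t))"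

text \<open>
  These three definitions make the power series with coefficients in \<open>G k\<close> into the part of degree \<open>k\<close> of a
  filtered space; \<open>pS\<close> is the pointwise scalar multiplication.
\<close>

definition pG :: "('k::field \<Rightarrow> 'v \<Rightarrow> 'v) \<Rightarrow> (int \<Rightarrow> 'v set) \<Rightarrow> (int \<Rightarrow> 'v set) \<Rightarrow> int \<Rightarrow> ('k \<Rightarrow> 'v::ab_group_add) set" where
  "pG S G F k = {f. \<exists>c. expands S F f c \<and> (\<forall>i. c i \<in> G k)}"

definition pF :: "(int \<Rightarrow> 'v set) \<Rightarrow> int \<Rightarrow> ('k \<Rightarrow> 'v) set" where
  "pF F p = {f. \<forall>t. f t \<in> F p}"

definition pS :: "('k \<Rightarrow> 'v \<Rightarrow> 'v) \<Rightarrow> 'k \<Rightarrow> ('a \<Rightarrow> 'v) \<Rightarrow> 'a \<Rightarrow> 'v" where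
  "pS S c f = (\<lambda>t. S c (f t))"

definition coef :: "('k::field \<Rightarrow> 'v \<Rightarrow> 'v) \<Rightarrow> (int \<Rightarrow> 'v set) \<Rightarrow> ('k \<Rightarrow> 'v::ab_group_add) \<Rightarrow> nat \<Rightarrow> 'v" where
  "coef S F f = (THE c. expands S F f c)"

definition pD :: "('k::field \<Rightarrow> 'v \<Rightarrow> 'v) \<Rightarrow> (int \<Rightarrow> 'v set) \<Rightarrow> ('k \<Rightarrow> 'v::ab_group_add) \<Rightarrow> 'k \<Rightarrow> 'v" where
  "pD S F f t = nsum F (\<lambda>i. S (of_nat i * t ^ (i - 1)) (coef S F f i)) UNIV"

definition pI :: "('k::field \<Rightarrow> 'v \<Rightarrow> 'v) \<Rightarrow> (int \<Rightarrow> 'v set) \<Rightarrow> ('k \<Rightarrow> 'v::ab_group_add) \<Rightarrow> 'k \<Rightarrow> 'v" where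
  "pI S F f t = nsum F (\<lambda>i. S (t ^ (i + 1)) (S (1 / of_nat (i + 1)) (coef S F f i))) UNIV"

lemma pF_iff: "f \<in> pF F p \<longleftrightarrow> (\<forall>t. f t \<in> F p)"
  by (simp add: pF_def)

lemma pS_apply [simp]: "pS S c f t = S c (f t)"
  by (simp add: pS_def)

lemma fun_sum_apply: "sum h X t = (\<Sum>i\<in>X. h i t)"
  by (induction X rule: infinite_finite_induct) auto

context filtered_space
begin

text \<open>
  A polynomial whose values at the points \<open>2\<^sup>j\<close> lie in a subspace has its coefficients there. The
  points are chosen for the induction: \<open>f(2 t) - 2\<^sup>N f(t)\<close> has no term of degree \<open>N\<close>, and its
  values at \<open>2\<^sup>j\<close> for \<open>j < N\<close> only need those of \<open>f\<close> at \<open>2\<^sup>j\<close> for \<open>j \<le> N\<close>.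
\<close>

lemma vandermonde:
  assumes "\<And>j. j < N \<Longrightarrow> (\<Sum>i<N. S ((2 ^ j) ^ i) (c i)) \<in> F p" and "i < N"
  shows "c i \<in> F p"
  using assms
proof (induction N arbitrary: c i)
  case (Suc N)
  \<comment> \<open>the factors of the coefficients of \<open>f(2 t) - 2\<^sup>N f(t)\<close>\<close>
  define e :: "nat \<Rightarrow> 'k" where "e i = 2 ^ i - 2 ^ N" for i
  have e: "e i \<noteq> 0" if "i < N" for i
  proof -
    have "(2::nat) ^ i \<noteq> 2 ^ N" using that by simp
    then have "of_nat (2 ^ i) \<noteq> (of_nat (2 ^ N) :: 'k)" using of_nat_eq_iff by blast
    then show ?thesis by (simp add: e_def)
  qed
  have "S (e i) (c i) \<in> F p" if "i < N" for i
  proof (rule Suc.IH[OF _ that])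
    fix j assume j: "j < N"
    have "(\<Sum>i<Suc N. S ((2 ^ Suc j) ^ i) (c i)) - S (2 ^ N) (\<Sum>i<Suc N. S ((2 ^ j) ^ i) (c i)) \<in> F p"
      by (intro F_diff F_scale Suc.prems(1)) (use j in auto)
    also have "(\<Sum>i<Suc N. S ((2 ^ Suc j) ^ i) (c i)) - S (2 ^ N) (\<Sum>i<Suc N. S ((2 ^ j) ^ i) (c i))
        = (\<Sum>i<Suc N. S ((2 ^ j) ^ i) (S (e i) (c i)))"
      unfolding scale_sum_right sum_subtractf[symmetric]
    proof (intro sum.cong refl)
      fix i
      have "((2::'k) ^ Suc j) ^ i = 2 ^ i * (2 ^ j) ^ i" by (simp add: power_mult_distrib)
      then show "S ((2 ^ Suc j) ^ i) (c i) - S (2 ^ N) (S ((2 ^ j) ^ i) (c i)) = S ((2 ^ j) ^ i) (S (e i) (c i))"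
        by (simp add: e_def scale_left_diff_distrib scale_right_diff_distrib mult.commute)
    qed
    also have "\<dots> = (\<Sum>i<N. S ((2 ^ j) ^ i) (S (e i) (c i)))" by (simp add: e_def)
    finally show "(\<Sum>i<N. S ((2 ^ j) ^ i) (S (e i) (c i))) \<in> F p" .
  qed
  then have c: "c i \<in> F p" if "i < N" for i using that e F_scale_iff by blast
  have "(\<Sum>i<Suc N. S ((2 ^ 0) ^ i) (c i)) \<in> F p" by (rule Suc.prems(1)) simp
  then have "(\<Sum>i<N. c i) + c N \<in> F p" by simp
  moreover have "(\<Sum>i<N. c i) \<in> F p" by (rule F_sum) (use c in auto)
  ultimately have "c N \<in> F p" using F_diff[of "(\<Sum>i<N. c i) + c N" p "\<Sum>i<N. c i"] by simp
  then show ?case using c Suc.prems(2) less_Suc_eq by blast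
qed simp

lemma nullf_bound: 
  fixes c :: "nat \<Rightarrow> 'v"
  assumes "nullf F c UNIV" shows "\<exists>N. \<forall>i\<ge>N. c i \<in> F p"
proof -
  have "finite {i. c i \<notin> F p}" using assms unfolding nullf_def by simp
  then obtain N where "\<forall>i\<in>{i. c i \<notin> F p}. i < N" using finite_nat_set_iff_bounded by blast
  then have "\<forall>i\<ge>N. c i \<in> F p" by force
  then show ?thesis ..
qed

lemma expands_sum: "expands S F f c \<Longrightarrow> has_nsum F (\<lambda>i. S (t ^ i) (c i)) UNIV (f t)"
  unfolding expands_def by blast

text \<open>
  This equivalence is the reason why functions can replace families of coefficients: the
  filtration by values and the filtration by coefficients agree.
\<close>

lemma expands_F:
  assumes "expands S F f c" shows "f \<in> pF F p \<longleftrightarrow> (\<forall>i. c i \<in> F p)"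
proof
  assume f: "f \<in> pF F p"
  obtain N where N: "\<forall>i\<ge>N. c i \<in> F p" using assms nullf_bound unfolding expands_def by blast
  have "(\<Sum>i<N. S (t ^ i) (c i)) \<in> F p" for t
  proof -
    have "f t - (\<Sum>i<N. S (t ^ i) (c i)) \<in> F p"
      by (rule has_nsum_tail[OF expands_sum[OF assms]]) (use N F_scale in blast)
    then show ?thesis using F_eq f by (auto simp: pF_iff)
  qed
  then have "i < N \<Longrightarrow> c i \<in> F p" for i using vandermonde[of N c p i] by blast
  then show "\<forall>i. c i \<in> F p" using N not_le by blast
next
  assume c: "\<forall>i. c i \<in> F p"
  show "f \<in> pF F p" unfolding pF_iff
    using has_nsum_F[OF expands_sum[OF assms]] c F_scale by blast
qed

lemma nullf_combine:
  assumes "nullf F c A" "nullf F c' A"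
    and "\<And>i p. i \<in> A \<Longrightarrow> c i \<in> F p \<Longrightarrow> c' i \<in> F p \<Longrightarrow> d i \<in> F p"
  shows "nullf F d A"
  unfolding nullf_def
proof
  fix p
  have "{i\<in>A. d i \<notin> F p} \<subseteq> {i\<in>A. c i \<notin> F p} \<union> {i\<in>A. c' i \<notin> F p}" using assms(3) by blast
  then show "finite {i\<in>A. d i \<notin> F p}"
    using assms(1,2) unfolding nullf_def by (meson finite_Un finite_subset)
qed

lemma expands_add:
  assumes "expands S F f c" "expands S F g d"
  shows "expands S F (f + g) (\<lambda>i. c i + d i)"
  unfolding expands_def
proof (intro conjI allI)
  show "nullf F (\<lambda>i. c i + d i) UNIV"
    by (rule nullf_combine[of c UNIV d, OF _ _ F_add]) (use assms in \<open>auto simp: expands_def\<close>)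
  show "has_nsum F (\<lambda>i. S (t ^ i) (c i + d i)) UNIV ((f + g) t)" for t
    using has_nsum_add[OF expands_sum[OF assms(1)] expands_sum[OF assms(2)], of t]
    by (simp add: scale_right_distrib)
qed

lemma expands_scale:
  assumes "expands S F f c"
  shows "expands S F (pS S a f) (\<lambda>i. S a (c i))"
  unfolding expands_def
proof (intro conjI allI)
  show "nullf F (\<lambda>i. S a (c i)) UNIV"
    by (rule nullf_le[OF _ F_scale]) (use assms in \<open>auto simp: expands_def\<close>)
  show "has_nsum F (\<lambda>i. S (t ^ i) (S a (c i))) UNIV (pS S a f t)" for t
    using has_nsum_scale[OF expands_sum[OF assms], of a t] by (simp add: mult.commute)
qed

lemma expands_diff:
  assumes "expands S F f c" "expands S F g d"
  shows "expands S F (f - g) (\<lambda>i. c i - d i)"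
proof -
  have "pS S (-1) g = - g" by (auto simp: pS_def)
  then show ?thesis using expands_add[OF assms(1) expands_scale[OF assms(2), of "-1"]] by simp
qed

lemma expands_unique:
  assumes "expands S F f c" "expands S F f d" shows "c = d"
proof
  fix i
  have e: "expands S F 0 (\<lambda>i. c i - d i)" using expands_diff[OF assms] by simp
  have "c i - d i \<in> F p" for p using expands_F[OF e, of p] by (simp add: pF_iff)
  then show "c i = d i" by (rule eq_by_F)
qed

lemma coef_eq: "expands S F f c \<Longrightarrow> coef S F f = c"
  unfolding coef_def using expands_unique by blast

lemma pG_expands: "f \<in> pG S G F k \<Longrightarrow> expands S F f (coef S F f)"
  unfolding pG_def using coef_eq by fastforce

lemma pG_coef: "f \<in> pG S G F k \<Longrightarrow> coef S F f i \<in> G k"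
  unfolding pG_def using coef_eq by fastforce

lemma pG_I: "expands S F f c \<Longrightarrow> (\<And>i. c i \<in> G k) \<Longrightarrow> f \<in> pG S G F k"
  unfolding pG_def by blast

lemma pG_null: "f \<in> pG S G F k \<Longrightarrow> nullf F (coef S F f) UNIV"
  by (drule pG_expands) (simp add: expands_def)

lemma coef_0: assumes "expands S F f c" shows "f 0 = c 0"
proof -
  have "has_nsum F (\<lambda>i. S (0 ^ i) (c i)) UNIV (c 0)"
    unfolding has_nsum_def by (intro allI exI[of _ "{0}"]) (auto simp: power_0_left)
  then show ?thesis using expands_sum[OF assms] has_nsum_unique by blast
qed

lemma pG_value: "f \<in> pG S G F k \<Longrightarrow> f t \<in> G k"
  using has_nsum_G[OF expands_sum[OF pG_expands]] pG_coef G_scale by blast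

text \<open>
  Families indexed by any set, with several terms of the same degree \<open>n i\<close>, arise from products
  of series; collecting the terms of equal degree gives an expansion.
\<close>

lemma expands_group:
  assumes null: "nullf F w A" and w: "\<And>i. i \<in> A \<Longrightarrow> w i \<in> G k"
    and f: "\<And>t. has_nsum F (\<lambda>i. S (t ^ n i) (w i)) A (f t)"
  shows "expands S F f (\<lambda>m. nsum F w {i\<in>A. n i = m}) \<and> (\<forall>m. nsum F w {i\<in>A. n i = m} \<in> G k)"
proof -
  define c where "c m = nsum F w {i\<in>A. n i = m}" for m
  have c: "has_nsum F w {i\<in>A. n i = m} (c m)" for m
    unfolding c_def by (rule has_nsum_nsum[OF nullf_subset[OF null]]) (use w in auto)
  have cG: "c m \<in> G k" for m by (rule has_nsum_G[OF c]) (use w in auto)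
  have "nullf F c UNIV" unfolding nullf_def
  proof
    fix p
    have "{m. c m \<notin> F p} \<subseteq> n ` {i\<in>A. w i \<notin> F p}"
    proof
      fix m assume "m \<in> {m. c m \<notin> F p}"
      then show "m \<in> n ` {i\<in>A. w i \<notin> F p}" using has_nsum_F[OF c[of m], of p] by blast
    qed
    then show "finite {m \<in> UNIV. c m \<notin> F p}"
      using null finite_subset unfolding nullf_def by fastforce
  qed
  moreover have "has_nsum F (\<lambda>m. S (t ^ m) (c m)) UNIV (f t)" for t
  proof (rule has_nsum_group[OF f, where q = n])
    fix m
    show "has_nsum F (\<lambda>i. S (t ^ n i) (w i)) {i\<in>A. n i = m} (S (t ^ m) (c m))"
      by (rule iffD1[OF has_nsum_cong has_nsum_scale[OF c]]) auto
  qed simp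
  ultimately show ?thesis using cG unfolding expands_def c_def by blast
qed

lemma nullf_scale: "nullf F w A \<Longrightarrow> nullf F (\<lambda>i. S (a i) (w i)) A"
  by (erule nullf_le) (rule F_scale)

lemma pG_group:
  assumes "nullf F w A" and "\<And>i. i \<in> A \<Longrightarrow> w i \<in> G k"
    and "\<And>t. has_nsum F (\<lambda>i. S (t ^ n i) (w i)) A (f t)"
  shows "f \<in> pG S G F k"
  using expands_group[where n = n, OF assms] pG_I by blast

lemma pD_group:
  assumes null: "nullf F w A" and w: "\<And>i. i \<in> A \<Longrightarrow> w i \<in> G k"
    and f: "\<And>t. has_nsum F (\<lambda>i. S (t ^ n i) (w i)) A (f t)"
  shows "has_nsum F (\<lambda>i. S (of_nat (n i) * t ^ (n i - 1)) (w i)) A (pD S F f t)"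
proof -
  define c where "c m = nsum F w {i\<in>A. n i = m}" for m
  have c: "has_nsum F w {i\<in>A. n i = m} (c m)" for m
    unfolding c_def by (rule has_nsum_nsum[OF nullf_subset[OF null]]) (use w in auto)
  have coef: "coef S F f = c"
    using expands_group[where n = n, OF assms] coef_eq unfolding c_def by blast
  let ?h = "\<lambda>i. S (of_nat (n i) * t ^ (n i - 1)) (w i)"
  have s: "has_nsum F ?h A (nsum F ?h A)"
    by (rule has_nsum_nsum[where k = k, OF nullf_scale[OF null] G_scale[OF w]])
  have "has_nsum F (\<lambda>m. S (of_nat m * t ^ (m - 1)) (c m)) UNIV (nsum F ?h A)"
  proof (rule has_nsum_group[OF s, where q = n])
    fix m
    show "has_nsum F ?h {i\<in>A. n i = m} (S (of_nat m * t ^ (m - 1)) (c m))"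
      by (rule iffD1[OF has_nsum_cong has_nsum_scale[OF c]]) auto
  qed simp
  from nsum_eq[OF this] have "pD S F f t = nsum F ?h A" unfolding pD_def coef .
  then show ?thesis using s by simp
qed

lemma pD_sum:
  "f \<in> pG S G F k \<Longrightarrow> has_nsum F (\<lambda>i. S (of_nat i * t ^ (i - 1)) (coef S F f i)) UNIV (pD S F f t)"
proof (rule pD_group[where n = "\<lambda>i. i" and k = k])
  assume f: "f \<in> pG S G F k"
  show "nullf F (coef S F f) UNIV" using pG_expands[OF f] unfolding expands_def by (rule conjunct1)
  show "coef S F f i \<in> G k" for i by (rule pG_coef[OF f])
  show "has_nsum F (\<lambda>i. S (t ^ i) (coef S F f i)) UNIV (f t)" for t
    by (rule expands_sum[OF pG_expands[OF f]])
qed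

lemma pD_in_pG:
  assumes f: "f \<in> pG S G F k" shows "pD S F f \<in> pG S G F k"
proof (rule pG_group[where n = "\<lambda>i. i - 1"])
  show "nullf F (\<lambda>i. S (of_nat i) (coef S F f i)) UNIV"
    by (rule nullf_scale) (use pG_expands[OF f] in \<open>simp add: expands_def\<close>)
  show "has_nsum F (\<lambda>i. S (t ^ (i - 1)) (S (of_nat i) (coef S F f i))) UNIV (pD S F f t)" for t
    using pD_sum[OF f, of t] by (simp add: mult.commute)
qed (rule G_scale[OF pG_coef[OF f]])

lemma pI_sum:
  assumes f: "f \<in> pG S G F k"
  shows "has_nsum F (\<lambda>i. S (t ^ (i + 1)) (S (1 / of_nat (i + 1)) (coef S F f i))) UNIV (pI S F f t)"
  unfolding pI_def
proof (rule has_nsum_nsum[where k = k])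
  show "nullf F (\<lambda>i. S (t ^ (i + 1)) (S (1 / of_nat (i + 1)) (coef S F f i))) UNIV"
    by (rule nullf_scale, rule nullf_scale, rule pG_null[OF f])
qed (intro G_scale pG_coef[OF f])

lemma pI_in_pG:
  assumes f: "f \<in> pG S G F k" shows "pI S F f \<in> pG S G F k"
proof (rule pG_group[where n = "\<lambda>i. i + 1"])
  show "nullf F (\<lambda>i. S (1 / of_nat (i + 1)) (coef S F f i)) UNIV"
    by (rule nullf_scale) (use pG_expands[OF f] in \<open>simp add: expands_def\<close>)
qed (rule G_scale[OF pG_coef[OF f]], rule pI_sum[OF f])

lemma pD_pI:
  assumes f: "f \<in> pG S G F k" shows "pD S F (pI S F f) = f"
proof
  fix t
  have "has_nsum F (\<lambda>i. S (of_nat (i + 1) * t ^ (i + 1 - 1)) (S (1 / of_nat (i + 1)) (coef S F f i)))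
          UNIV (pD S F (pI S F f) t)"
  proof (rule pD_group)
    show "nullf F (\<lambda>i. S (1 / of_nat (i + 1)) (coef S F f i)) UNIV"
      by (rule nullf_scale) (use pG_expands[OF f] in \<open>simp add: expands_def\<close>)
  qed (rule G_scale[OF pG_coef[OF f]], rule pI_sum[OF f])
  moreover have "(\<lambda>i. S (of_nat (i + 1) * t ^ (i + 1 - 1)) (S (1 / of_nat (i + 1)) (coef S F f i)))
      = (\<lambda>i. S (t ^ i) (coef S F f i))"
  proof
    fix i
    have "of_nat (i + 1) \<noteq> (0::'k)" by (metis add_is_0 of_nat_eq_0_iff one_neq_zero)
    then show "S (of_nat (i + 1) * t ^ (i + 1 - 1)) (S (1 / of_nat (i + 1)) (coef S F f i)) = S (t ^ i) (coef S F f i)"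
      by (simp add: field_simps)
  qed
  ultimately have "has_nsum F (\<lambda>i. S (t ^ i) (coef S F f i)) UNIV (pD S F (pI S F f) t)"
    by (simp only:)
  then show "pD S F (pI S F f) t = f t"
    using has_nsum_unique expands_sum[OF pG_expands[OF f]] by blast
qed

lemma pI_0: assumes f: "f \<in> pG S G F k" shows "pI S F f 0 = 0"
proof -
  have "has_nsum F (\<lambda>i. 0) (UNIV :: nat set) (pI S F f 0)" using pI_sum[OF f, of 0] by simp
  then show ?thesis using has_nsum_0 by (rule has_nsum_unique)
qed

lemma pD_F: "f \<in> pG S G F k \<Longrightarrow> f \<in> pF F p \<Longrightarrow> pD S F f \<in> pF F p"
  unfolding pF_iff[of "pD S F f"]
  by (intro allI, rule has_nsum_F[OF pD_sum], assumption) (simp add: F_scale expands_F[OF pG_expands])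

lemma pI_F: "f \<in> pG S G F k \<Longrightarrow> f \<in> pF F p \<Longrightarrow> pI S F f \<in> pF F p"
  unfolding pF_iff[of "pI S F f"]
  by (intro allI, rule has_nsum_F[OF pI_sum], assumption) (simp add: F_scale expands_F[OF pG_expands])

lemma expands_zero: "expands S F 0 (\<lambda>_. 0)"
  by (auto simp: expands_def nullf_def has_nsum_0)

lemma pG_subspace_facts:
  shows pG_add: "f \<in> pG S G F k \<Longrightarrow> g \<in> pG S G F k \<Longrightarrow> f + g \<in> pG S G F k"
    and pG_diff: "f \<in> pG S G F k \<Longrightarrow> g \<in> pG S G F k \<Longrightarrow> f - g \<in> pG S G F k"
    and pG_scale: "f \<in> pG S G F k \<Longrightarrow> pS S a f \<in> pG S G F k"
    and pG_zero: "0 \<in> pG S G F k"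
proof -
  show "f + g \<in> pG S G F k" if "f \<in> pG S G F k" "g \<in> pG S G F k"
    by (rule pG_I[OF expands_add[OF that[THEN pG_expands]]]) (intro G_add that[THEN pG_coef])
  show "f - g \<in> pG S G F k" if "f \<in> pG S G F k" "g \<in> pG S G F k"
    by (rule pG_I[OF expands_diff[OF that[THEN pG_expands]]]) (intro G_diff that[THEN pG_coef])
  show "pS S a f \<in> pG S G F k" if "f \<in> pG S G F k"
    by (rule pG_I[OF expands_scale[OF pG_expands[OF that]]]) (intro G_scale pG_coef[OF that])
  show "0 \<in> pG S G F k"
    by (rule pG_I[OF expands_zero]) simp
qed

lemma pD_add:
  assumes "f \<in> pG S G F k" "g \<in> pG S G F k"
  shows "pD S F (f + g) = pD S F f + pD S F g"
proof
  fix t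
  have c: "coef S F (f + g) = (\<lambda>i. coef S F f i + coef S F g i)"
    by (rule coef_eq[OF expands_add[OF assms[THEN pG_expands]]])
  have "has_nsum F (\<lambda>i. S (of_nat i * t ^ (i - 1)) (coef S F (f + g) i)) UNIV (pD S F f t + pD S F g t)"
    unfolding c scale_right_distrib by (rule has_nsum_add[OF assms[THEN pD_sum]])
  then show "pD S F (f + g) t = (pD S F f + pD S F g) t"
    using has_nsum_unique[OF pD_sum[OF pG_add[OF assms]]] by simp
qed

lemma pD_scale:
  assumes "f \<in> pG S G F k"
  shows "pD S F (pS S a f) = pS S a (pD S F f)"
proof
  fix t
  have c: "coef S F (pS S a f) = (\<lambda>i. S a (coef S F f i))"
    by (rule coef_eq[OF expands_scale[OF pG_expands[OF assms]]])
  have "has_nsum F (\<lambda>i. S (of_nat i * t ^ (i - 1)) (coef S F (pS S a f) i)) UNIV (S a (pD S F f t))"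
    using has_nsum_scale[OF pD_sum[OF assms], of a] by (simp add: c mult.commute)
  then show "pD S F (pS S a f) t = pS S a (pD S F f) t"
    using has_nsum_unique[OF pD_sum[OF pG_scale[OF assms]]] by simp
qed

lemma pD_diff:
  assumes "f \<in> pG S G F k" "g \<in> pG S G F k"
  shows "pD S F (f - g) = pD S F f - pD S F g"
  using pD_add[OF pG_diff[OF assms] assms(2)] by (simp add: algebra_simps)

text \<open>
  In characteristic zero \<open>(m + 1) c\<^bsub>m+1\<^esub> = 0\<close> forces \<open>c\<^bsub>m+1\<^esub> = 0\<close>.
\<close>

lemma pD_zero_const:
  assumes f: "f \<in> pG S G F k" and "\<And>t. pD S F f t = 0" shows "f t = f 0"
proof -
  let ?c = "coef S F f"
  have d: "expands S F (pD S F f) (\<lambda>m. nsum F (\<lambda>i. S (of_nat i) (?c i)) {i\<in>UNIV. i - 1 = m})"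
  proof (rule conjunct1[OF expands_group[where k = k]])
    show "nullf F (\<lambda>i. S (of_nat i) (?c i)) UNIV"
      by (rule nullf_scale) (use pG_expands[OF f] in \<open>simp add: expands_def\<close>)
    show "has_nsum F (\<lambda>i. S (t ^ (i - 1)) (S (of_nat i) (?c i))) UNIV (pD S F f t)" for t
      using pD_sum[OF f, of t] by (simp add: mult.commute)
  qed (rule G_scale[OF pG_coef[OF f]])
  moreover have "pD S F f = 0" using assms(2) by auto
  ultimately have "expands S F 0 (\<lambda>m. nsum F (\<lambda>i. S (of_nat i) (?c i)) {i\<in>UNIV. i - 1 = m})"
    by (simp only:)
  from fun_cong[OF expands_unique[OF this expands_zero]]
  have z: "nsum F (\<lambda>i. S (of_nat i) (?c i)) {i\<in>UNIV. i - 1 = m} = 0" for m .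
  have "?c (Suc m) = 0" for m
  proof -
    have "{i. i - 1 = m} = (if m = 0 then {0, 1} else {Suc m})" by auto
    then have "(\<Sum>i\<in>{i\<in>UNIV. i - 1 = m}. S (of_nat i) (?c i)) = S (of_nat (Suc m)) (?c (Suc m))"
      by auto
    moreover have "finite {i. i - 1 = m}" by (rule finite_subset[of _ "{..Suc m}"]) auto
    ultimately have "S (of_nat (Suc m)) (?c (Suc m)) = 0"
      using z[of m] nsum_eq[OF has_nsum_finite[of "{i\<in>UNIV. i - 1 = m}" "\<lambda>i. S (of_nat i) (?c i)"]] by simp
    then show ?thesis by (simp del: of_nat_Suc)
  qed
  then have "has_nsum F (\<lambda>i. S (t ^ i) (?c i)) UNIV (?c 0)"
    unfolding has_nsum_def by (intro allI exI[of _ "{0}"]) (auto, metis F_zero not0_implies_Suc scale_zero_right)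
  then have "f t = ?c 0" using has_nsum_unique expands_sum[OF pG_expands[OF f]] by blast
  then show ?thesis using coef_0[OF pG_expands[OF f]] by simp
qed

lemma pG_monom: "v \<in> G k \<Longrightarrow> (\<lambda>t. S (t ^ n) v) \<in> pG S G F k"
proof (rule pG_group[of "\<lambda>_. v" "{()}" k "\<lambda>_. n"])
  show "has_nsum F (\<lambda>i. S (t ^ n) v) {()} (S (t ^ n) v)" for t
    using has_nsum_finite[of "{()}" "\<lambda>_. S (t ^ n) v"] by simp
qed (auto simp: nullf_def)

lemma pG_const: "v \<in> G k \<Longrightarrow> (\<lambda>_. v) \<in> pG S G F k"
  using pG_monom[of v k 0] by simp

lemma pD_const: assumes "v \<in> G k" shows "pD S F (\<lambda>_. v) = 0"
proof
  fix t
  have "has_nsum F (\<lambda>i::unit. S (of_nat 0 * t ^ (0 - 1)) v) {()} (pD S F (\<lambda>_. v) t)"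
    by (rule pD_group[where n = "\<lambda>_. 0" and k = k])
       (use assms has_nsum_finite[of "{()}" "\<lambda>_. v"] in \<open>auto simp: nullf_def\<close>)
  then have "has_nsum F (\<lambda>i. 0) {()} (pD S F (\<lambda>_. v) t)" by simp
  from has_nsum_unique[OF this has_nsum_0] show "pD S F (\<lambda>_. v) t = 0 t" by simp
qed

lemma pI_pD:
  assumes f: "f \<in> pG S G F k" shows "f t = f 0 + pI S F (pD S F f) t"
proof -
  let ?g = "f - pI S F (pD S F f)"
  note d = pD_in_pG[OF f]
  have g: "?g \<in> pG S G F k" by (intro pG_diff f pI_in_pG d)
  have "pD S F ?g t = 0" for t
    using pD_diff[OF f pI_in_pG[OF d]] pD_pI[OF d] by simp
  then have "?g t = ?g 0" by (rule pD_zero_const[OF g])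
  then show ?thesis using pI_0[OF d] by (simp add: algebra_simps)
qed

text \<open>
  Only completeness needs an argument: the coefficients of a compatible sequence are compatible by
  \<open>expands_F\<close>, so that the limit can be taken for each coefficient.
\<close>

lemma p_filtered_space: "filtered_space (pS S) (pG S G F) (pF F :: int \<Rightarrow> ('k \<Rightarrow> 'v) set)"
proof -
  interpret P: vector_space "pS S :: 'k \<Rightarrow> ('k \<Rightarrow> 'v) \<Rightarrow> ('k \<Rightarrow> 'v)"
    by unfold_locales (auto simp: pS_def scale_right_distrib scale_left_distrib)
  show ?thesis
  proof
    show "P.subspace (pG S G F k)" for k
      unfolding P.subspace_def using pG_add pG_scale pG_zero by blast
    show "P.subspace (pF F p)" for p
      by (auto simp: P.subspace_def pF_iff intro: F_add F_scale)
    show "pF F (p + 1) \<subseteq> pF F p" for p using subsetD[OF F_Suc[of p]] by (simp add: pF_iff subset_iff)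
    show "pF F p = UNIV" if "p \<le> 0" for p using F_top[OF that] by (auto simp: pF_iff)
    show "v = 0" if "\<And>p. v \<in> pF F p" for v :: "'k \<Rightarrow> 'v"
    proof
      fix t show "v t = 0 t" using hausdorff[of "v t"] that by (simp add: pF_iff)
    qed
    fix x :: "int \<Rightarrow> 'k \<Rightarrow> 'v" and k
    assume x: "\<And>p. x p \<in> pG S G F k" and d: "\<And>p. x (p + 1) - x p \<in> pF F p"
    define c where "c p = coef S F (x p)" for p
    have cx: "expands S F (x p) (c p)" for p unfolding c_def by (rule pG_expands[OF x])
    have cd: "c (p + 1) i - c p i \<in> F p" for p i
      using expands_F[OF expands_diff[OF cx[of "p + 1"] cx[of p]], of p] d[of p] by simp
    have "\<exists>v\<in>G k. \<forall>p. v - c p i \<in> F p" for i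
      by (rule complete) (use cd in \<open>auto simp: c_def pG_coef[OF x]\<close>)
    then obtain v where v: "\<And>i. v i \<in> G k" "\<And>i p. v i - c p i \<in> F p" by metis
    have null: "nullf F v UNIV" unfolding nullf_def
    proof
      fix p
      have "{i. v i \<notin> F p} \<subseteq> {i. c p i \<notin> F p}" using F_eq[OF v(2)] by blast
      then show "finite {i\<in>UNIV. v i \<notin> F p}"
        using cx[of p] finite_subset unfolding expands_def nullf_def by fastforce
    qed
    define f where "f t = nsum F (\<lambda>i. S (t ^ i) (v i)) UNIV" for t
    have f: "expands S F f v" unfolding expands_def f_def
      by (intro conjI null allI has_nsum_nsum[where k = k] nullf_scale[OF null] G_scale[OF v(1)])
    have "f - x p \<in> pF F p" for p
      using expands_F[OF expands_diff[OF f cx[of p]], of p] v(2) by simp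
    moreover have "f \<in> pG S G F k" by (rule pG_I[OF f v(1)])
    ultimately show "\<exists>v\<in>pG S G F k. \<forall>p. v - x p \<in> pF F p" by blast
  qed
qed

text \<open>
  Evaluation at \<open>t\<close> maps \<open>pF F p\<close> to \<open>F p\<close>.
\<close>

lemma has_nsum_pointwise: "has_nsum (pF F) h A s \<Longrightarrow> has_nsum F (\<lambda>i. h i t) A (s t)"
  unfolding has_nsum_def pF_iff
proof
  fix p assume "\<forall>p. \<exists>X. finite X \<and> X \<subseteq> A \<and> (\<forall>i\<in>A - X. \<forall>t. h i t \<in> F p) \<and> (\<forall>t. (sum h X - s) t \<in> F p)"
  then obtain X where "finite X" "X \<subseteq> A" "\<forall>i\<in>A - X. \<forall>t. h i t \<in> F p" "\<forall>t. (sum h X - s) t \<in> F p"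
    by meson
  then show "\<exists>X. finite X \<and> X \<subseteq> A \<and> (\<forall>i\<in>A - X. h i t \<in> F p) \<and> (\<Sum>i\<in>X. h i t) - s t \<in> F p"
    by (intro exI[of _ X]) (auto simp: fun_sum_apply)
qed

text \<open>
  The non-archimedean form of Gronwall's lemma: a solution of a homogeneous linear equation that
  vanishes at \<open>0\<close> gains a filtration degree with every integration.
\<close>

lemma ode_zero:
  assumes f: "f \<in> pG S G F k" and "f 0 = 0"
    and step: "\<And>n. n \<ge> 0 \<Longrightarrow> f \<in> pF F n \<Longrightarrow> pD S F f \<in> pF F (n + 1)"
  shows "f = 0"
proof -
  have "f \<in> pF F (int n)" for n
  proof (induction n)
    case 0 then show ?case using F_top by (simp add: pF_iff)
  next
    case (Suc n)
    have "pI S F (pD S F f) \<in> pF F (int n + 1)"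
      by (rule pI_F[OF pD_in_pG[OF f] step[OF _ Suc]]) simp
    moreover have "f = pI S F (pD S F f)" using pI_pD[OF f] assms(2) by auto
    ultimately show ?case by (simp add: add.commute)
  qed
  then have "f t \<in> F (int (nat p))" for t p unfolding pF_iff by blast
  then have "f t \<in> F p" for t p by (rule F_antiD[of _ "int (nat p)"]) simp
  then have "f t = 0" for t by (rule hausdorff)
  then show ?thesis by auto
qed

end

context filtered_space
begin

lemma pD_line: assumes "v \<in> G k" shows "pD S F (\<lambda>t. S t v) = (\<lambda>_. v)"
proof
  fix t
  have "has_nsum F (\<lambda>i::unit. S (of_nat 1 * t ^ (1 - 1)) v) {()} (pD S F (\<lambda>t. S t v) t)"
    by (rule pD_group[where n = "\<lambda>_. 1" and k = k])
       (use assms has_nsum_finite[of "{()}" "\<lambda>_. S _ v"] in \<open>auto simp: nullf_def\<close>)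
  then have "has_nsum F (\<lambda>i::unit. v) {()} (pD S F (\<lambda>t. S t v) t)" by simp
  from has_nsum_unique[OF this has_nsum_finite] show "pD S F (\<lambda>t. S t v) t = v" by simp
qed

lemma increment_F:
  assumes f: "f \<in> pG S G F k" and w: "w \<in> G k" and d: "pD S F f - (\<lambda>_. w) \<in> pF F p"
  shows "f 1 - f 0 - w \<in> F p"
proof -
  define g where "g = f - (\<lambda>t. S t w)"
  have l: "(\<lambda>t. S t w) \<in> pG S G F k" using pG_monom[OF w, of 1] by simp
  have g: "g \<in> pG S G F k" unfolding g_def by (rule pG_diff[OF f l])
  have "pD S F g \<in> pF F p" unfolding g_def pD_diff[OF f l] pD_line[OF w] by (rule d)
  from pI_F[OF pD_in_pG[OF g] this] have "pI S F (pD S F g) 1 \<in> F p" by (simp add: pF_iff)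
  moreover have "g 1 - g 0 = pI S F (pD S F g) 1" using pI_pD[OF g, of 1] by simp
  ultimately show ?thesis by (simp add: g_def algebra_simps)
qed

lemma increment_pF:
  assumes f: "f \<in> pG S G F k" and d: "pD S F f \<in> pF F p" and "f 0 \<in> F p"
  shows "f \<in> pF F p"
  using pI_F[OF pD_in_pG[OF f] d] pI_pD[OF f] assms(3) F_add by (metis pF_iff)

lemma pI_diff:
  assumes "f \<in> pG S G F k" "g \<in> pG S G F k"
  shows "pI S F (f - g) = pI S F f - pI S F g"
proof
  fix t
  let ?h = "pI S F (f - g) - (pI S F f - pI S F g)"
  note d = pG_diff[OF assms]
  have h: "?h \<in> pG S G F k" by (intro pG_diff pI_in_pG assms d)
  have "pD S F ?h = 0"
    by (simp add: pD_diff[OF pI_in_pG[OF d] pG_diff[OF pI_in_pG[OF assms(1)] pI_in_pG[OF assms(2)]]]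
        pD_diff[OF pI_in_pG[OF assms(1)] pI_in_pG[OF assms(2)]] pD_pI[OF d] pD_pI[OF assms(1)] pD_pI[OF assms(2)])
  then have "?h t = ?h 0" by (intro pD_zero_const[OF h]) simp
  then show "pI S F (f - g) t = (pI S F f - pI S F g) t"
    using pI_0[OF d] pI_0[OF assms(1)] pI_0[OF assms(2)] by simp
qed

lemma nullf_nat2:
  assumes "\<And>i j. h (j, i) \<in> F (int i)" "\<And>i j. h (j, i) \<in> F (int j)"
  shows "nullf F (h :: nat \<times> nat \<Rightarrow> 'v) A"
  unfolding nullf_def
proof
  fix p
  have "{x\<in>A. h x \<notin> F p} \<subseteq> {..nat p} \<times> {..nat p}"
  proof
    fix x assume "x \<in> {x\<in>A. h x \<notin> F p}"
    then obtain j i where x: "x = (j, i)" "h (j, i) \<notin> F p" by (cases x) auto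
    have "\<not> p \<le> int i" "\<not> p \<le> int j" using x(2) assms F_antiD by blast+
    then show "x \<in> {..nat p} \<times> {..nat p}" using x by auto
  qed
  then show "finite {x\<in>A. h x \<notin> F p}" using finite_subset by blast
qed

text \<open>
  A double series vanishes if its terms of each total degree cancel. The structure equations
  are of that form.
\<close>

lemma antidiagonal_zero:
  fixes h :: "nat \<times> nat \<Rightarrow> 'v"
  assumes h: "has_nsum F h UNIV s" and z: "\<And>n. (\<Sum>i\<le>n. h (n - i, i)) = (0::'v)"
  shows "s = 0"
proof -
  have "has_nsum F (\<lambda>_::nat. 0) UNIV s"
  proof (rule has_nsum_group[OF h, where q = "\<lambda>(j, i). i + j"])
    fix n :: nat
    let ?A = "{x \<in> UNIV. (case x of (j, i) \<Rightarrow> i + j) = n}"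
    have A: "?A = (\<lambda>i. (n - i, i)) ` {..n}" by (auto simp: image_iff)
    have inj: "inj_on (\<lambda>i. (n - i, i)) {..n}" by (auto simp: inj_on_def)
    have "sum h ?A = 0" unfolding A sum.reindex[OF inj] using z[of n] by simp
    moreover have "finite ?A" unfolding A by simp
    ultimately show "has_nsum F h ?A 0" using has_nsum_finite by metis
  qed simp
  then show ?thesis using has_nsum_0 by (rule has_nsum_unique)
qed

end

text \<open>
  Linear maps that preserve the filtration act on coefficients. They are only required to be
  additive in one degree, which covers evaluations as well as differentials.
\<close>

lemma pG_map:
  assumes V: "filtered_space S G F" and W: "filtered_space S' G' F'"
    and TG: "\<And>x. x \<in> G k \<Longrightarrow> T x \<in> G' k'"
    and Td: "\<And>x y. x \<in> G k \<Longrightarrow> y \<in> G k \<Longrightarrow> T (x - y) = T x - T y"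
    and TS: "\<And>x c. x \<in> G k \<Longrightarrow> T (S c x) = S' c (T x)"
    and TF: "\<And>x p. x \<in> G k \<Longrightarrow> x \<in> F p \<Longrightarrow> T x \<in> F' p"
    and f: "f \<in> pG S G F k"
  shows "(\<lambda>s. T (f s)) \<in> pG S' G' F' k'" and "pD S' F' (\<lambda>s. T (f s)) = (\<lambda>s. T (pD S F f s))"
    and "coef S' F' (\<lambda>s. T (f s)) = (\<lambda>i. T (coef S F f i))"
proof -
  interpret V: filtered_space S G F by fact
  interpret W: filtered_space S' G' F' by fact
  let ?c = "coef S F f"
  note c = V.pG_coef[OF f]
  have im: "has_nsum F' (\<lambda>i. T (h i)) UNIV (T s)"
    if "has_nsum F h UNIV s" "\<And>i. h i \<in> G k" for h :: "nat \<Rightarrow> 'b" and s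
    by (rule has_nsum_image[OF V W, where B = "G k" and T = T])
       (use that V.has_nsum_G[OF that(1)] V.G_sub Td TF in auto)
  have e: "expands S' F' (\<lambda>s. T (f s)) (\<lambda>i. T (?c i))" unfolding expands_def
  proof (intro conjI allI)
    show "nullf F' (\<lambda>i. T (?c i)) UNIV" unfolding nullf_def
    proof
      fix p
      have "{i. T (?c i) \<notin> F' p} \<subseteq> {i\<in>UNIV. ?c i \<notin> F p}" using TF[OF c] by blast
      then show "finite {i\<in>UNIV. T (?c i) \<notin> F' p}"
        using V.pG_null[OF f] finite_subset unfolding nullf_def by fastforce
    qed
    show "has_nsum F' (\<lambda>i. S' (t ^ i) (T (?c i))) UNIV (T (f t))" for t
      using im[OF V.expands_sum[OF V.pG_expands[OF f]] V.G_scale[OF c], of t] TS[OF c] by simp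
  qed
  show "coef S' F' (\<lambda>s. T (f s)) = (\<lambda>i. T (coef S F f i))" by (rule W.coef_eq[OF e])
  show g: "(\<lambda>s. T (f s)) \<in> pG S' G' F' k'" by (rule W.pG_I[OF e]) (rule TG[OF c])
  show "pD S' F' (\<lambda>s. T (f s)) = (\<lambda>s. T (pD S F f s))"
  proof
    fix t
    have "has_nsum F' (\<lambda>i. S' (of_nat i * t ^ (i - 1)) (T (?c i))) UNIV (T (pD S F f t))"
      using im[OF V.pD_sum[OF f] V.G_scale[OF c], of t] TS[OF c] by simp
    then show "pD S' F' (\<lambda>s. T (f s)) t = T (pD S F f t)"
      using W.pD_sum[OF g, of t] W.has_nsum_unique unfolding W.coef_eq[OF e] by blast
  qed
qed

context filtered_space
begin

lemma expands_sum_list: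
  assumes "finite X" "\<And>k. k \<in> X \<Longrightarrow> expands S F (f k) (c k)"
  shows "expands S F (sum f X) (\<lambda>m. \<Sum>k\<in>X. c k m)"
  using assms by (induction X rule: finite_induct) (auto intro: expands_zero expands_add simp del: plus_fun_apply)

lemma expands_pD:
  assumes f: "f \<in> pG S G F k"
  shows "expands S F (pD S F f) (\<lambda>m. S (of_nat (m + 1)) (coef S F f (m + 1)))"
  unfolding expands_def
proof (intro conjI allI)
  have "inj Suc" by simp
  have "finite {m \<in> UNIV. coef S F f (m + 1) \<notin> F p}" for p
    using finite_vimageI[OF _ \<open>inj Suc\<close>, of "{i \<in> UNIV. coef S F f i \<notin> F p}"] pG_null[OF f]
    unfolding nullf_def by (simp add: vimage_def)
  then show "nullf F (\<lambda>m. S (of_nat (m + 1)) (coef S F f (m + 1))) UNIV"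
    by (intro nullf_scale) (simp add: nullf_def)
  fix t
  have "has_nsum F (\<lambda>i. S (of_nat (Suc i) * t ^ (Suc i - 1)) (coef S F f (Suc i))) UNIV (pD S F f t)"
    using pD_sum[OF f, of t] has_nsum_Suc[of "\<lambda>i. S (of_nat i * t ^ (i - 1)) (coef S F f i)"] by simp
  then show "has_nsum F (\<lambda>m. S (t ^ m) (S (of_nat (m + 1)) (coef S F f (m + 1)))) UNIV (pD S F f t)"
    by (simp add: mult.commute)
qed

end

section \<open>Multilinear operations and their exponential insertions\<close>

definition plift :: "('v list \<Rightarrow> 'w) \<Rightarrow> ('k \<Rightarrow> 'v) list \<Rightarrow> 'k \<Rightarrow> 'w" where
  "plift f fs = (\<lambda>t. f (map (\<lambda>g. g t) fs))"

text \<open>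
  \<open>\<Sum>\<^sub>k f(xs, a\<^sup>k) / k!\<close>. For the brackets of an algebra, \<open>xs = []\<close> gives the curvature of \<open>a\<close> and nonempty
  \<open>xs\<close> the brackets twisted by \<open>a\<close>; for a morphism, \<open>xs = []\<close> gives its value on \<open>a\<close> and \<open>xs = [x]\<close> its
  derivative at \<open>a\<close> in direction \<open>x\<close>.
\<close>

definition ins :: "('k::field_char_0 \<Rightarrow> 'w \<Rightarrow> 'w) \<Rightarrow> (int \<Rightarrow> 'w set) \<Rightarrow> ('v list \<Rightarrow> 'w::ab_group_add) \<Rightarrow> 'v list \<Rightarrow> 'v \<Rightarrow> 'w" where
  "ins S F f xs a = nsum F (\<lambda>k. S (1 / fact k) (f (xs @ replicate k a))) UNIV"

text \<open>
  Graded symmetric multilinear operations of degree \<open>e\<close> which raise the filtration by \<open>\<sigma>\<close>, in all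
  arities at once. Brackets have \<open>e = 1\<close> and \<open>\<sigma> = 0\<close>, the components of a morphism \<open>e = 0\<close> and \<open>\<sigma> = r - 1\<close>.
  The normalisation on the empty list removes the constant term of the exponential series.
\<close>

locale multimap = V: filtered_space SV GV FV + W: filtered_space SW GW FW
  for SV :: "'k::field_char_0 \<Rightarrow> 'v::ab_group_add \<Rightarrow> 'v" and GV FV
    and SW :: "'k \<Rightarrow> 'w::ab_group_add \<Rightarrow> 'w" and GW FW +
  fixes f :: "'v list \<Rightarrow> 'w" and e \<sigma> :: int
  assumes f_nil [simp]: "f [] = 0"
    and f_add: "f (xs @ (a + b) # ys) = f (xs @ a # ys) + f (xs @ b # ys)"
    and f_scale: "f (xs @ SV c a # ys) = SW c (f (xs @ a # ys))"
    and f_sym: "a \<in> GV i \<Longrightarrow> b \<in> GV j \<Longrightarrow>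
                  f (xs @ a # b # ys) = SW (parity_sign (i * j)) (f (xs @ b # a # ys))"
    and f_deg: "vs \<noteq> [] \<Longrightarrow> lies_in GV vs is \<Longrightarrow> f vs \<in> GW (sum_list is + e)"
    and f_fil: "vs \<noteq> [] \<Longrightarrow> lies_in FV vs is \<Longrightarrow> f vs \<in> FW (sum_list is + \<sigma>)"
    and shift_nonneg: "0 \<le> \<sigma>"
begin

lemma f_diff: "f (xs @ (a - b) # ys) = f (xs @ a # ys) - f (xs @ b # ys)"
  using f_add[of xs "a - b" b ys] by simp

lemma f_zero: "f (xs @ 0 # ys) = 0"
  using f_diff[of xs 0 0 ys] by simp

lemma f_even: "a \<in> GV 0 \<Longrightarrow> b \<in> GV j \<Longrightarrow> f (xs @ a # b # ys) = f (xs @ b # a # ys)"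
  using f_sym[of a 0 b j xs ys] by (simp add: parity_sign_def)

lemma f_even_replicate:
  "a \<in> GV 0 \<Longrightarrow> b \<in> GV j \<Longrightarrow> f (xs @ replicate k a @ b # ys) = f (xs @ b # replicate k a @ ys)"
proof (induction k arbitrary: ys)
  case (Suc k)
  have "f (xs @ replicate (Suc k) a @ b # ys) = f ((xs @ replicate k a) @ a # b # ys)"
    by (simp add: replicate_app_Cons_same)
  also have "\<dots> = f (xs @ replicate k a @ b # (a # ys))" using f_even[OF Suc.prems, of "xs @ replicate k a" ys] by simp
  also have "\<dots> = f (xs @ b # replicate k a @ a # ys)" by (rule Suc.IH[OF Suc.prems])
  also have "replicate k a @ a # ys = replicate (Suc k) a @ ys" by (simp add: replicate_app_Cons_same)
  finally show ?case by simp
qed simp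

lemma f_fil_slot: assumes "x \<in> FV p" shows "f (xs @ x # ys) \<in> FW p"
proof -
  have 0: "lies_in FV zs (map (\<lambda>_. 0) zs)" for zs
    using V.F_top by (simp add: list.rel_map list.rel_refl)
  have z: "sum_list (map (\<lambda>_. 0::int) zs) = 0" for zs :: "'v list" by (induction zs) auto
  have "f (xs @ x # ys) \<in> FW (sum_list (map (\<lambda>_. 0) xs @ p # map (\<lambda>_. 0) ys) + \<sigma>)"
    by (rule f_fil) (auto intro!: list_all2_appendI 0 assms)
  then show ?thesis using z W.F_antiD[of _ "p + \<sigma>" p] shift_nonneg by simp
qed

lemma f_nsum:
  assumes "has_nsum FV h A s"
  shows "has_nsum FW (\<lambda>i. f (xs @ h i # ys)) A (f (xs @ s # ys))"
proof (rule has_nsum_image[where T = "\<lambda>x. f (xs @ x # ys)" and B = UNIV and S = SV and S' = SW and F = FV])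
  show "filtered_space SV GV FV" "filtered_space SW GW FW" by unfold_locales
qed (use assms f_diff f_fil_slot in \<open>auto simp: V.subspace_UNIV\<close>)

lemma f_expand_null:
  assumes "\<And>h. h \<in> set hs \<Longrightarrow> nullf FV h UNIV"
  shows "nullf FW (\<lambda>is. f (xs @ map2 (\<lambda>h i. h i) hs is)) {is. length is = length hs}"
  unfolding nullf_def
proof
  fix p
  have fin: "finite {is. list_all2 (\<lambda>h i. h i \<notin> FV p) hs is}"
    using assms
  proof (induction hs)
    case (Cons h hs)
    have "{is. list_all2 (\<lambda>h i. h i \<notin> FV p) (h # hs) is}
        \<subseteq> (\<lambda>(i, is). i # is) ` ({i\<in>UNIV. h i \<notin> FV p} \<times> {is. list_all2 (\<lambda>h i. h i \<notin> FV p) hs is})"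
      by (auto simp: list_all2_Cons1 image_iff)
    moreover have "finite {i\<in>UNIV. h i \<notin> FV p}" using Cons.prems[of h] unfolding nullf_def by simp
    ultimately show ?case using Cons by (meson finite_SigmaI finite_imageI finite_subset list.set_intros(2))
  qed (rule finite_subset[of _ "{[]}"], auto)
  have out: "f (xs @ map2 (\<lambda>h i. h i) hs is) \<in> FW p"
    if "length is = length hs" "\<not> list_all2 (\<lambda>h i. h i \<notin> FV p) hs is" for xs "is"
    using that
  proof (induction hs arbitrary: "is" xs)
    case (Cons h hs)
    then obtain i js where "is": "is = i # js" "length js = length hs" by (auto simp: length_Suc_conv)
    show ?case
    proof (cases "h i \<in> FV p")
      case True
      then show ?thesis using f_fil_slot "is" by simp
    next
      case False
      then have "f ((xs @ [h i]) @ map2 (\<lambda>h i. h i) hs js) \<in> FW p"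
        using Cons.prems(2) "is" by (intro Cons.IH) auto
      then show ?thesis using "is" by simp
    qed
  qed simp
  have "{is \<in> {is. length is = length hs}. f (xs @ map2 (\<lambda>h i. h i) hs is) \<notin> FW p}
      \<subseteq> {is. list_all2 (\<lambda>h i. h i \<notin> FV p) hs is}" using out by blast
  then show "finite {is \<in> {is. length is = length hs}. f (xs @ map2 (\<lambda>h i. h i) hs is) \<notin> FW p}"
    using fin finite_subset by blast
qed

text \<open>
  A multilinear operation commutes with convergent sums in all its arguments simultaneously; the
  resulting sum over lists of indices is null because a term with one small argument is small.
\<close>

lemma f_expand:
  assumes "list_all2 (\<lambda>h s. has_nsum FV h UNIV s) hs ss"
  shows "has_nsum FW (\<lambda>is. f (xs @ map2 (\<lambda>h i. h i) hs is)) {is. length is = length hs} (f (xs @ ss))"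
  using assms
proof (induction hs arbitrary: xs ss)
  case Nil
  then show ?case using W.has_nsum_finite[of "{[]}" "\<lambda>is. f xs"] by simp
next
  case (Cons h hs)
  then obtain s ss' where ss: "ss = s # ss'" and s: "has_nsum FV h UNIV s"
    and ss': "list_all2 (\<lambda>h s. has_nsum FV h UNIV s) hs ss'" by (auto simp: list_all2_Cons1)
  have b: "bij_betw (\<lambda>(i, is). i # is) (UNIV \<times> {is. length is = length hs}) {is. length is = length (h # hs)}"
    by (rule bij_betwI[where g = "\<lambda>is. (hd is, tl is)"]) (auto simp: length_Suc_conv)
  have null: "nullf FW (\<lambda>is. f (xs @ map2 (\<lambda>h i. h i) (h # hs) is)) {is. length is = length (h # hs)}"
  proof (rule f_expand_null)
    fix g assume "g \<in> set (h # hs)"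
    then show "nullf FV g UNIV" using Cons.prems V.has_nsum_nullf
      by (metis in_set_conv_nth list_all2_conv_all_nth)
  qed
  have "has_nsum FW (\<lambda>x. f (xs @ h (fst x) # map2 (\<lambda>h i. h i) hs (snd x))) (UNIV \<times> {is. length is = length hs})
      (f (xs @ s # ss'))"
  proof (rule W.has_nsum_Sigma)
    show "nullf FW (\<lambda>x. f (xs @ h (fst x) # map2 (\<lambda>h i. h i) hs (snd x))) (UNIV \<times> {is. length is = length hs})"
      unfolding nullf_def
    proof
      fix p
      have "{x \<in> UNIV \<times> {is. length is = length hs}. f (xs @ h (fst x) # map2 (\<lambda>h i. h i) hs (snd x)) \<notin> FW p}
         \<subseteq> (\<lambda>is. (hd is, tl is)) ` {is \<in> {is. length is = length (h # hs)}. f (xs @ map2 (\<lambda>h i. h i) (h # hs) is) \<notin> FW p}"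
        by (auto simp: image_iff intro!: exI[of _ "_ # _"])
      then show "finite {x \<in> UNIV \<times> {is. length is = length hs}. f (xs @ h (fst x) # map2 (\<lambda>h i. h i) hs (snd x)) \<notin> FW p}"
        using null unfolding nullf_def by (meson finite_imageI finite_subset)
    qed
    show "has_nsum FW (\<lambda>i. f (xs @ h i # ss')) UNIV (f (xs @ s # ss'))" by (rule f_nsum[OF s])
    show "has_nsum FW (\<lambda>j. f (xs @ h (fst (i, j)) # map2 (\<lambda>h i. h i) hs (snd (i, j)))) {is. length is = length hs} (f (xs @ h i # ss'))" for i
      using Cons.IH[OF ss', of "xs @ [h i]"] by simp
  qed
  then have "has_nsum FW (\<lambda>x. f (xs @ map2 (\<lambda>h i. h i) (h # hs) (case x of (i, is) \<Rightarrow> i # is)))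
      (UNIV \<times> {is. length is = length hs}) (f (xs @ ss))"
    unfolding ss by (rule W.has_nsum_congD) auto
  then show ?case
    using W.has_nsum_reindex[OF b, of "\<lambda>is. f (xs @ map2 (\<lambda>h i. h i) (h # hs) is)"] by blast
qed

lemma f_scale_list:
  "length cs = length vs \<Longrightarrow> f (xs @ map2 SV cs vs) = SW (prod_list cs) (f (xs @ vs))"
proof (induction cs vs arbitrary: xs rule: list_induct2)
  case (Cons c cs v vs)
  have "f (xs @ map2 SV (c # cs) (v # vs)) = SW c (f ((xs @ [v]) @ map2 SV cs vs))"
    by (simp add: f_scale)
  then show ?case using Cons.IH[of "xs @ [v]"] by simp
qed simp

subsection \<open>Pointwise extension to power series\<close>

abbreviation coef_bracket where "coef_bracket fs is \<equiv> f (map2 (\<lambda>g. coef SV FV g) fs is)"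

lemma prod_list_power: "prod_list (map (\<lambda>i. t ^ i) is) = (t::'k) ^ sum_list is"
  by (induction "is") (auto simp: power_add)

lemma map2_scale: "length fs = length is \<Longrightarrow>
   map2 (\<lambda>h i. h i) (map (\<lambda>g i. SV (c i) (coef SV FV g i)) fs) is = map2 SV (map c is) (map2 (\<lambda>g. coef SV FV g) fs is)"
  by (induction fs "is" rule: list_induct2) auto

text \<open>
  The coefficient of \<open>t\<^sup>m\<close> in \<open>f(g\<^sub>1(t), \<dots>, g\<^sub>n(t))\<close> is a sum over the lists of exponents with sum \<open>m\<close>. It is kept
  as a sum over all lists of length \<open>n\<close>, which also serves for the derivative.
\<close>

lemma plift_expand:
  assumes "\<And>g. g \<in> set fs \<Longrightarrow> \<exists>k. g \<in> pG SV GV FV k"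
  shows "has_nsum FW (\<lambda>is. SW (t ^ sum_list is) (coef_bracket fs is)) {is. length is = length fs} (plift f fs t)"
proof -
  have "list_all2 (\<lambda>h s. has_nsum FV h UNIV s) (map (\<lambda>g i. SV (t ^ i) (coef SV FV g i)) fs) (map (\<lambda>g. g t) fs)"
    using V.expands_sum[OF V.pG_expands] assms by (fastforce simp: list.rel_map list_all2_same)
  from f_expand[OF this, of "[]"]
  have "has_nsum FW (\<lambda>is. f (map2 (\<lambda>h i. h i) (map (\<lambda>g i. SV (t ^ i) (coef SV FV g i)) fs) is))
      {is. length is = length fs} (plift f fs t)" by (simp add: plift_def)
  then show ?thesis
  proof (rule W.has_nsum_congD)
    fix "is" :: "nat list" assume "is \<in> {is. length is = length fs}"
    then have l: "length fs = length is" by simp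
    show "f (map2 (\<lambda>h i. h i) (map (\<lambda>g i. SV (t ^ i) (coef SV FV g i)) fs) is) = SW (t ^ sum_list is) (coef_bracket fs is)"
      using f_scale_list[of "map (\<lambda>i. t ^ i) is" "map2 (\<lambda>g. coef SV FV g) fs is" "[]"] l
      by (simp add: map2_scale prod_list_power)
  qed
qed

lemma plift_null:
  assumes "\<And>g. g \<in> set fs \<Longrightarrow> \<exists>k. g \<in> pG SV GV FV k"
  shows "nullf FW (coef_bracket fs) {is. length is = length fs}"
proof -
  have "nullf FW (\<lambda>is. f ([] @ map2 (\<lambda>h i. h i) (map (coef SV FV) fs) is)) {is. length is = length (map (coef SV FV) fs)}"
    by (rule f_expand_null) (use assms V.pG_null in auto)
  moreover have "map2 (\<lambda>h i. h i) (map (coef SV FV) fs) is = map2 (coef SV FV) fs is" for "is" :: "nat list"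
    by (simp add: zip_map1 case_prod_unfold comp_def)
  ultimately show ?thesis by simp
qed

lemma coefs_degree:
  assumes "lies_in (pG SV GV FV) fs ks" "length is = length fs"
  shows "lies_in GV (map2 (\<lambda>g. coef SV FV g) fs is) ks"
  using assms(1) assms(2)[symmetric]
proof (induction fs ks arbitrary: "is" rule: list_all2_induct)
  case (Cons g fs k ks)
  then show ?case by (cases "is") (auto simp: V.pG_coef)
qed simp

lemma list_all2_pG: "lies_in (pG SV GV FV) fs ks \<Longrightarrow> g \<in> set fs \<Longrightarrow> \<exists>k. g \<in> pG SV GV FV k"
  by (auto simp: list_all2_conv_all_nth in_set_conv_nth)

lemma fV_degree:
  assumes "lies_in (pG SV GV FV) fs ks" "length is = length fs"
  shows "coef_bracket fs is \<in> GW (sum_list ks + e)"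
proof (cases "fs = []")
  case False
  then have "map2 (\<lambda>g. coef SV FV g) fs is \<noteq> []" using assms(2) by (cases fs; cases "is") auto
  then show ?thesis using f_deg coefs_degree[OF assms] by blast
qed simp

lemma plift_degree:
  assumes "lies_in (pG SV GV FV) fs ks"
  shows "plift f fs \<in> pG SW GW FW (sum_list ks + e)"
proof (rule W.pG_group)
  show "nullf FW (coef_bracket fs) {is. length is = length fs}" by (rule plift_null[OF list_all2_pG[OF assms]])
  show "has_nsum FW (\<lambda>is. SW (t ^ sum_list is) (coef_bracket fs is)) {is. length is = length fs} (plift f fs t)" for t
    by (rule plift_expand[OF list_all2_pG[OF assms]])
qed (use fV_degree[OF assms] in auto)

lemma plift_pD_expand:
  assumes l: "\<And>x. x \<in> set (us @ g # vs) \<Longrightarrow> \<exists>k. x \<in> pG SV GV FV k"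
  shows "has_nsum FW (\<lambda>is. SW (of_nat (is ! length us) * t ^ (sum_list is - 1)) (coef_bracket (us @ g # vs) is))
           {is. length is = length (us @ g # vs)} (plift f (us @ pD SV FV g # vs) t)"
proof -
  let ?h = "\<lambda>g i. SV (t ^ i) (coef SV FV g i)"
  let ?d = "\<lambda>i. SV (of_nat i * t ^ (i - 1)) (coef SV FV g i)"
  have h: "list_all2 (\<lambda>h s. has_nsum FV h UNIV s) (map ?h ws) (map (\<lambda>g. g t) ws)" if "set ws \<subseteq> set (us @ g # vs)" for ws
    unfolding list.rel_map list_all2_same
  proof
    fix x assume "x \<in> set ws"
    then obtain k where "x \<in> pG SV GV FV k" using l \<open>set ws \<subseteq> _\<close> by blast
    then show "has_nsum FV (?h x) UNIV (x t)" by (rule V.expands_sum[OF V.pG_expands])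
  qed
  obtain k where k: "g \<in> pG SV GV FV k" using l by auto
  have "list_all2 (\<lambda>h s. has_nsum FV h UNIV s) (map ?h us @ ?d # map ?h vs)
      (map (\<lambda>g. g t) us @ pD SV FV g t # map (\<lambda>g. g t) vs)"
    using h[of us] h[of vs] V.pD_sum[OF k] by (auto intro!: list_all2_appendI)
  from f_expand[OF this, of "[]"]
  have "has_nsum FW (\<lambda>is. f (map2 (\<lambda>h i. h i) (map ?h us @ ?d # map ?h vs) is))
      {is. length is = length (us @ g # vs)} (plift f (us @ pD SV FV g # vs) t)" by (simp add: plift_def)
  then show ?thesis
  proof (rule W.has_nsum_congD)
    fix "is" :: "nat list" assume "is \<in> {is. length is = length (us @ g # vs)}"
    then have len: "length is = length us + Suc (length vs)" by simp
    define is1 where "is1 = take (length us) is"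
    define m where "m = is ! length us"
    define is2 where "is2 = drop (Suc (length us)) is"
    have "is": "is = is1 @ m # is2" unfolding is1_def is2_def m_def
      using len by (simp add: id_take_nth_drop)
    have l1: "length us = length is1" and l2: "length vs = length is2" using len by (auto simp: is1_def is2_def)
    \<comment> \<open>the differentiated factor contributes \<open>m t\<^bsup>m-1\<^esup>\<close>, the others their powers of \<open>t\<close>\<close>
    let ?cs = "map (\<lambda>i. t ^ i) is1 @ (of_nat m * t ^ (m - 1)) # map (\<lambda>i. t ^ i) is2"
    have "map2 (\<lambda>h i. h i) (map ?h us @ ?d # map ?h vs) is = map2 SV ?cs (map2 (\<lambda>g. coef SV FV g) (us @ g # vs) is)"
      using l1 l2 unfolding "is" by (simp add: map2_scale)
    then have "f (map2 (\<lambda>h i. h i) (map ?h us @ ?d # map ?h vs) is) = SW (prod_list ?cs) (coef_bracket (us @ g # vs) is)"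
      using f_scale_list[of ?cs "map2 (\<lambda>g. coef SV FV g) (us @ g # vs) is" "[]"] len l1 l2 by simp
    moreover have "prod_list ?cs = of_nat m * t ^ (sum_list is - 1)"
    proof (cases m)
      case (Suc m')
      then show ?thesis by (simp add: "is" prod_list_power power_add)
    qed simp
    ultimately show "f (map2 (\<lambda>h i. h i) (map ?h us @ ?d # map ?h vs) is)
        = SW (of_nat (is ! length us) * t ^ (sum_list is - 1)) (coef_bracket (us @ g # vs) is)" by (simp add: m_def)
  qed
qed

text \<open>
  In terms of exponents, this is \<open>i\<^sub>1 + \<dots> + i\<^sub>n\<close> distributed over the summands.
\<close>

lemma leibniz:
  assumes "lies_in (pG SV GV FV) fs ks"
  shows "pD SW FW (plift f fs) t = (\<Sum>j<length fs. plift f (take j fs @ pD SV FV (fs ! j) # drop (Suc j) fs) t)"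
proof -
  note ex = list_all2_pG[OF assms]
  let ?A = "{is. length is = length fs}"
  have "has_nsum FW (\<lambda>is. SW (of_nat (sum_list is) * t ^ (sum_list is - 1)) (coef_bracket fs is)) ?A (pD SW FW (plift f fs) t)"
  proof (rule W.pD_group)
    show "nullf FW (coef_bracket fs) ?A" by (rule plift_null[OF ex])
    show "has_nsum FW (\<lambda>is. SW (t ^ sum_list is) (coef_bracket fs is)) ?A (plift f fs t)" for t
      by (rule plift_expand[OF ex])
  qed (use fV_degree[OF assms] in auto)
  moreover have "has_nsum FW (\<lambda>is. \<Sum>j<length fs. SW (of_nat (is ! j) * t ^ (sum_list is - 1)) (coef_bracket fs is)) ?A
      (\<Sum>j<length fs. plift f (take j fs @ pD SV FV (fs ! j) # drop (Suc j) fs) t)"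
  proof (rule W.has_nsum_sum)
    fix j assume "j \<in> {..<length fs}"
    then have j: "j < length fs" by simp
    then have fs: "take j fs @ fs ! j # drop (Suc j) fs = fs" by (simp add: id_take_nth_drop[symmetric])
    show "has_nsum FW (\<lambda>is. SW (of_nat (is ! j) * t ^ (sum_list is - 1)) (coef_bracket fs is)) ?A
       (plift f (take j fs @ pD SV FV (fs ! j) # drop (Suc j) fs) t)"
      using plift_pD_expand[of "take j fs" "fs ! j" "drop (Suc j) fs" t] ex j unfolding fs by simp
  qed simp
  moreover have "(\<Sum>j<length fs. SW (of_nat (is ! j) * t ^ (sum_list is - 1)) (coef_bracket fs is))
      = SW (of_nat (sum_list is) * t ^ (sum_list is - 1)) (coef_bracket fs is)" if "is \<in> ?A" for "is" :: "nat list"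
    using that by (simp add: W.scale_sum_left[symmetric] sum_list_sum_nth atLeast0LessThan sum_distrib_right)
  ultimately show ?thesis using W.has_nsum_unique[OF _ W.has_nsum_congD] by blast
qed

text \<open>
  Families inherit the structure pointwise. All later statements about elements can therefore be
  applied to families, and to families of families.
\<close>

lemma p_multimap:
  "multimap (pS SV) (pG SV GV FV) (pF FV) (pS SW) (pG SW GW FW) (pF FW) (plift f) e \<sigma>"
proof -
  interpret PV: filtered_space "pS SV :: 'k \<Rightarrow> ('k \<Rightarrow> 'v) \<Rightarrow> _" "pG SV GV FV" "pF FV" by (rule V.p_filtered_space)
  interpret PW: filtered_space "pS SW :: 'k \<Rightarrow> ('k \<Rightarrow> 'w) \<Rightarrow> _" "pG SW GW FW" "pF FW" by (rule W.p_filtered_space)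
  show ?thesis
  proof
    show "plift f [] = 0" by (auto simp: plift_def)
    show "plift f (xs @ (a + b) # ys) = plift f (xs @ a # ys) + plift f (xs @ b # ys)" for xs a b ys
      by (auto simp: plift_def f_add)
    show "plift f (xs @ pS SV c a # ys) = pS SW c (plift f (xs @ a # ys))" for xs c a ys
      by (auto simp: plift_def f_scale)
    show "plift f (xs @ a # b # ys) = pS SW (parity_sign (i * j)) (plift f (xs @ b # a # ys))"
      if "a \<in> pG SV GV FV i" "b \<in> pG SV GV FV j" for a b i j xs ys
      using f_sym[OF V.pG_value[OF that(1)] V.pG_value[OF that(2)]] by (auto simp: plift_def)
    show "plift f vs \<in> pG SW GW FW (sum_list is + e)" if "lies_in (pG SV GV FV) vs is" for vs "is"
      by (rule plift_degree[OF that])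
    show "plift f vs \<in> pF FW (sum_list is + \<sigma>)" if "vs \<noteq> []" "lies_in (pF FV) vs is" for vs "is"
      unfolding pF_iff plift_def
    proof
      fix t
      have "lies_in FV (map (\<lambda>g. g t) vs) is"
        unfolding list.rel_map by (rule list_all2_mono[OF that(2)]) (simp add: pF_iff)
      then show "f (map (\<lambda>g. g t) vs) \<in> FW (sum_list is + \<sigma>)" using f_fil that(1) by simp
    qed
  qed (rule shift_nonneg)
qed

end

lemma list_all2_replicate2: "P a b \<Longrightarrow> list_all2 P (replicate k a) (replicate k b)"
  by (simp add: list_all2_conv_all_nth)

context multimap
begin

subsection \<open>Exponential insertions\<close>

abbreviation I where "I \<equiv> ins SW FW f"

lemma deg_replicate:
  assumes "lies_in GV xs ds" "a \<in> GV 0"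
  shows "f (xs @ replicate k a) \<in> GW (sum_list ds + e)"
proof (cases "xs @ replicate k a = []")
  case False
  have "lies_in GV (xs @ replicate k a) (ds @ replicate k 0)"
    using assms by (intro list_all2_appendI) (auto simp: list_all2_conv_all_nth)
  from f_deg[OF False this] show ?thesis by (simp add: sum_list_replicate)
qed (simp only: f_nil W.G_zero)

lemma fil_replicate:
  assumes "lies_in FV xs is" "a \<in> FV m" "xs @ replicate k a \<noteq> []"
  shows "f (xs @ replicate k a) \<in> FW (sum_list is + int k * m + \<sigma>)"
proof -
  have "lies_in FV (xs @ replicate k a) (is @ replicate k m)"
    using assms by (intro list_all2_appendI) (auto simp: list_all2_conv_all_nth)
  from f_fil[OF assms(3) this] show ?thesis by (simp add: sum_list_replicate)
qed

lemma ins_fil: assumes "a \<in> FV 1" shows "f (xs @ replicate k a) \<in> FW (int k)"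
proof (cases "xs @ replicate k a = []")
  case False
  have "lies_in FV xs (map (\<lambda>_. 0) xs)"
    using V.F_top by (simp add: list.rel_map list.rel_refl)
  moreover have "sum_list (map (\<lambda>_. 0::int) xs) = 0" by (induction xs) auto
  ultimately have "f (xs @ replicate k a) \<in> FW (int k + \<sigma>)"
    using fil_replicate[of xs _ a 1 k] assms False by fastforce
  then show ?thesis by (rule W.F_antiD) (use shift_nonneg in simp)
qed (simp only: f_nil W.F_zero)

lemma ins_null: "a \<in> FV 1 \<Longrightarrow> nullf FW (\<lambda>k. f (xs @ replicate k a)) UNIV"
  by (rule W.nullf_nat) (rule ins_fil)

text \<open>
  The nullity of the powers is a hypothesis, and not deduced from \<open>a \<in> FV 1\<close>, since \<open>U\<^sub>\<star>\<close> is also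
  evaluated outside \<open>FV 1\<close>.
\<close>

lemma ins_sum_null:
  assumes "lies_in GV xs ds" "a \<in> GV 0" "nullf FW (\<lambda>k. f (xs @ replicate k a)) UNIV"
  shows "has_nsum FW (\<lambda>k. SW (1 / fact k) (f (xs @ replicate k a))) UNIV (I xs a)"
  unfolding ins_def
  by (rule W.has_nsum_nsum[OF W.nullf_scale[OF assms(3)] W.G_scale[OF deg_replicate[OF assms(1,2)]]])

lemma ins_sum:
  assumes "lies_in GV xs ds" "a \<in> GV 0" "a \<in> FV 1"
  shows "has_nsum FW (\<lambda>k. SW (1 / fact k) (f (xs @ replicate k a))) UNIV (I xs a)"
  by (rule ins_sum_null[OF assms(1,2) ins_null[OF assms(3)]])

lemma ins_G:
  assumes "lies_in GV xs ds" "a \<in> GV 0" "a \<in> FV 1"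
  shows "I xs a \<in> GW (sum_list ds + e)"
  by (rule W.has_nsum_G[OF ins_sum[OF assms] W.G_scale[OF deg_replicate[OF assms(1,2)]]])

lemma ins_diff:
  assumes "lies_in GV us ds" "x \<in> GV i" "y \<in> GV i" "lies_in GV vs ds'"
    and a: "a \<in> GV 0" "a \<in> FV 1"
  shows "I (us @ (x - y) # vs) a = I (us @ x # vs) a - I (us @ y # vs) a"
proof (rule W.has_nsum_unique)
  have l: "lies_in GV (us @ z # vs) (ds @ i # ds')" if "z \<in> GV i" for z
    using assms that by (auto intro!: list_all2_appendI)
  show "has_nsum FW (\<lambda>k. SW (1 / fact k) (f ((us @ (x - y) # vs) @ replicate k a))) UNIV (I (us @ (x - y) # vs) a)"
    by (rule ins_sum[OF l a]) (rule V.G_diff[OF assms(2,3)])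
  show "has_nsum FW (\<lambda>k. SW (1 / fact k) (f ((us @ (x - y) # vs) @ replicate k a))) UNIV
     (I (us @ x # vs) a - I (us @ y # vs) a)"
    using W.has_nsum_diff[OF ins_sum[OF l[OF assms(2)] a] ins_sum[OF l[OF assms(3)] a]]
    by (simp add: f_diff W.scale_right_diff_distrib)
qed

lemma ins_zero: "I (us @ 0 # vs) a = 0"
  unfolding ins_def using W.nsum_eq[OF W.has_nsum_0] by (simp add: f_zero)

lemma ins_neg:
  assumes "lies_in GV us ds" "y \<in> GV i" "lies_in GV vs ds'"
    and a: "a \<in> GV 0" "a \<in> FV 1"
  shows "I (us @ (- y) # vs) a = - I (us @ y # vs) a"
  using ins_diff[OF assms(1) V.G_zero assms(2,3) a] by (simp add: ins_zero)

lemma ins_add: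
  assumes "lies_in GV us ds" "x \<in> GV i" "y \<in> GV i" "lies_in GV vs ds'"
    and a: "a \<in> GV 0" "a \<in> FV 1"
  shows "I (us @ (x + y) # vs) a = I (us @ x # vs) a + I (us @ y # vs) a"
  using ins_diff[OF assms(1,2) V.G_neg[OF assms(3)] assms(4) a] ins_neg[OF assms(1,3,4) a] by simp

lemma ins_swap:
  assumes "x \<in> GV i" "y \<in> GV j" "lies_in GV zs ds" and a: "a \<in> GV 0" "a \<in> FV 1"
  shows "I (x # y # zs) a = SW (parity_sign (i * j)) (I (y # x # zs) a)"
proof (rule W.has_nsum_unique)
  show "has_nsum FW (\<lambda>k. SW (1 / fact k) (f ((x # y # zs) @ replicate k a))) UNIV (I (x # y # zs) a)"
    by (rule ins_sum[where ds = "i # j # ds"]) (use assms in auto)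
  have "has_nsum FW (\<lambda>k. SW (1 / fact k) (f ((y # x # zs) @ replicate k a))) UNIV (I (y # x # zs) a)"
    by (rule ins_sum[where ds = "j # i # ds"]) (use assms in auto)
  from W.has_nsum_scale[OF this, of "parity_sign (i * j)"]
  show "has_nsum FW (\<lambda>k. SW (1 / fact k) (f ((x # y # zs) @ replicate k a))) UNIV (SW (parity_sign (i * j)) (I (y # x # zs) a))"
    using f_sym[OF assms(1,2), of "[]"] by (simp add: mult.commute)
qed

text \<open>
  The difference of two powers is the sum of the words with one argument \<open>a' - a\<close>, preceded by a
  power of \<open>a\<close> and followed by a power of \<open>a'\<close>.
\<close>

lemma telescope:
  assumes T: "W.subspace T"
    and c: "\<And>i. i < k \<Longrightarrow> f (xs @ replicate i a @ (a' - a) # replicate (k - 1 - i) a') \<in> T"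
  shows "f (xs @ replicate k a') - f (xs @ replicate k a) \<in> T"
  using c
proof (induction k arbitrary: xs)
  case 0 then show ?case using W.subspace_0[OF T] by simp
next
  case (Suc k)
  have "f (xs @ replicate (Suc k) a') - f (xs @ replicate (Suc k) a)
     = f (xs @ (a' - a) # replicate k a') + (f ((xs @ [a]) @ replicate k a') - f ((xs @ [a]) @ replicate k a))"
    by (simp add: f_diff)
  moreover have "f (xs @ (a' - a) # replicate k a') \<in> T" using Suc.prems[of 0] by simp
  moreover have "f ((xs @ [a]) @ replicate k a') - f ((xs @ [a]) @ replicate k a) \<in> T"
  proof (rule Suc.IH)
    fix i assume "i < k"
    then show "f ((xs @ [a]) @ replicate i a @ (a' - a) # replicate (k - 1 - i) a') \<in> T"
      using Suc.prems[of "Suc i"] by simp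
  qed
  ultimately show ?case using W.subspace_add[OF T] by metis
qed

lemma ins_lipschitz_term:
  assumes xs: "lies_in FV xs is" and a: "a \<in> FV m" "a' \<in> FV m" "a' - a \<in> FV n" and "k \<ge> 1"
  shows "f (xs @ replicate k a') - f (xs @ replicate k a) \<in> FW (sum_list is + n + (int k - 1) * m + \<sigma>)"
proof (rule telescope[OF W.F_sub])
  fix i assume i: "i < k"
  have "lies_in FV (xs @ replicate i a @ (a' - a) # replicate (k - 1 - i) a')
     (is @ replicate i m @ n # replicate (k - 1 - i) m)"
    using xs a by (auto intro!: list_all2_appendI list_all2_replicate2)
  from f_fil[OF _ this] have "f (xs @ replicate i a @ (a' - a) # replicate (k - 1 - i) a')
     \<in> FW (sum_list is + (int i * m + (n + int (k - 1 - i) * m)) + \<sigma>)"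
    by (simp add: sum_list_replicate)
  moreover have "int i * m + (n + int (k - 1 - i) * m) = n + (int k - 1) * m"
    using i by (simp add: algebra_simps of_nat_diff)
  then have "sum_list is + (int i * m + (n + int (k - 1 - i) * m)) + \<sigma> = sum_list is + n + (int k - 1) * m + \<sigma>"
    by linarith
  ultimately show "f (xs @ replicate i a @ (a' - a) # replicate (k - 1 - i) a') \<in> FW (sum_list is + n + (int k - 1) * m + \<sigma>)"
    by (simp only:)
qed

lemma in_F_one_mono: "a \<in> FV m \<Longrightarrow> m \<ge> 1 \<Longrightarrow> a \<in> FV 1" using V.F_antiD by blast

lemma ins_lipschitz:
  assumes xs: "lies_in FV xs is" "lies_in GV xs ds"
    and a: "a \<in> GV 0" "a' \<in> GV 0" "a \<in> FV 1" "a' \<in> FV 1" "a' - a \<in> FV n"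
  shows "I xs a' - I xs a \<in> FW (sum_list is + n + \<sigma>)"
proof (rule W.has_nsum_F[OF W.has_nsum_diff[OF ins_sum[OF xs(2) a(2,4)] ins_sum[OF xs(2) a(1,3)]]])
  fix k :: nat
  have "f (xs @ replicate k a') - f (xs @ replicate k a) \<in> FW (sum_list is + n + \<sigma>)"
  proof (cases "k \<ge> 1")
    case True
    show ?thesis
      by (rule W.F_antiD[OF ins_lipschitz_term[OF xs(1) a(3,4,5) True]]) (use True in simp)
  qed (cases k; simp)
  then show "SW (1 / fact k) (f (xs @ replicate k a')) - SW (1 / fact k) (f (xs @ replicate k a)) \<in> FW (sum_list is + n + \<sigma>)"
    unfolding W.scale_right_diff_distrib[symmetric] by (rule W.F_scale)
qed

text \<open>
  The linear term of the difference is split off; all others contain at least one more argument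
  from \<open>FV m\<close>. This second order estimate is what makes the approximation procedure converge.
\<close>

lemma ins_lipschitz2:
  assumes a: "a \<in> GV 0" "a' \<in> GV 0" "a \<in> FV m" "a' \<in> FV m" "m \<ge> 1" "a' - a \<in> FV n"
  shows "I [] a' - I [] a - f [a' - a] \<in> FW (n + m + \<sigma>)"
proof -
  let ?h = "\<lambda>k. SW (1 / fact k) (f ([] @ replicate k a')) - SW (1 / fact k) (f ([] @ replicate k a))"
  have "has_nsum FW ?h UNIV (I [] a' - I [] a)"
    using a in_F_one_mono by (intro W.has_nsum_diff ins_sum[where ds = "[]"]) auto
  then have "I [] a' - I [] a - (\<Sum>k<2. ?h k) \<in> FW (n + m + \<sigma>)"
  proof (rule W.has_nsum_tail)
    fix k :: nat assume k: "2 \<le> k"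
    have "f ([] @ replicate k a') - f ([] @ replicate k a) \<in> FW (sum_list [] + n + (int k - 1) * m + \<sigma>)"
      by (rule ins_lipschitz_term) (use a k in auto)
    then have "f ([] @ replicate k a') - f ([] @ replicate k a) \<in> FW (n + m + \<sigma>)"
    proof (rule W.F_antiD)
      have "1 * m \<le> (int k - 1) * m" using k a(5) by (intro mult_right_mono) auto
      then show "n + m + \<sigma> \<le> sum_list [] + n + (int k - 1) * m + \<sigma>" by simp
    qed
    then show "?h k \<in> FW (n + m + \<sigma>)"
      unfolding W.scale_right_diff_distrib[symmetric] by (rule W.F_scale)
  qed
  moreover have "(\<Sum>k<2. ?h k) = f [a' - a]" using f_diff[of "[]" a' a "[]"] by (simp add: numeral_2_eq_2)
  ultimately show ?thesis by simp
qed

text \<open>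
  Twisting by \<open>a \<in> FV m\<close> changes an operation only by terms with at least one argument \<open>a\<close>.
\<close>

lemma ins_first:
  assumes xs: "lies_in FV xs is" "lies_in GV xs ds" "xs \<noteq> []"
    and a: "a \<in> GV 0" "a \<in> FV m" "m \<ge> 1"
  shows "I xs a - f xs \<in> FW (sum_list is + m + \<sigma>)"
proof -
  let ?h = "\<lambda>k. SW (1 / fact k) (f (xs @ replicate k a))"
  have "I xs a - (\<Sum>k<1. ?h k) \<in> FW (sum_list is + m + \<sigma>)"
  proof (rule W.has_nsum_tail[OF ins_sum[OF xs(2) a(1) in_F_one_mono[OF a(2,3)]]])
    fix k :: nat assume k: "1 \<le> k"
    have "f (xs @ replicate k a) \<in> FW (sum_list is + int k * m + \<sigma>)"
      by (rule fil_replicate) (use xs a in auto)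
    then have "f (xs @ replicate k a) \<in> FW (sum_list is + m + \<sigma>)"
    proof (rule W.F_antiD)
      have "1 * m \<le> int k * m" using k a(3) by (intro mult_right_mono) auto
      then show "sum_list is + m + \<sigma> \<le> sum_list is + int k * m + \<sigma>" by simp
    qed
    then show "?h k \<in> FW (sum_list is + m + \<sigma>)" by (rule W.F_scale)
  qed
  then show ?thesis by simp
qed

lemma ins_F:
  assumes xs: "lies_in FV xs is" "lies_in GV xs ds" "xs \<noteq> []"
    and a: "a \<in> GV 0" "a \<in> FV 1"
  shows "I xs a \<in> FW (sum_list is + \<sigma>)"
proof -
  have "I xs a - f xs \<in> FW (sum_list is + \<sigma>)"
    by (rule W.F_antiD[OF ins_first[OF xs a]]) auto
  then show ?thesis using f_fil[OF xs(3,1)] W.F_eq by blast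
qed

lemma ins_first0:
  assumes a: "a \<in> GV 0" "a \<in> FV m" "m \<ge> 1"
  shows "I [] a - f [a] \<in> FW (2 * m + \<sigma>)" and "I [] a \<in> FW (m + \<sigma>)"
proof -
  have 0: "I [] 0 = 0" unfolding ins_def
  proof (rule W.nsum_eq, rule W.has_nsum_congD[OF W.has_nsum_0])
    show "0 = SW (1 / fact k) (f ([] @ replicate k 0))" for k
      using f_zero[of "[]"] by (cases k) auto
  qed
  show l: "I [] a - f [a] \<in> FW (2 * m + \<sigma>)"
    using ins_lipschitz2[of 0 a m m] a by (simp add: 0)
  have "f [a] \<in> FW (m + \<sigma>)" using f_fil[of "[a]" "[m]"] a by simp
  moreover have "I [] a - f [a] \<in> FW (m + \<sigma>)" by (rule W.F_antiD[OF l]) (use a in simp)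
  ultimately show "I [] a \<in> FW (m + \<sigma>)" using W.F_eq by blast
qed

lemma ins_pointwise:
  assumes "lies_in (pG SV GV FV) xs ds" "A \<in> pG SV GV FV 0" "A \<in> pF FV 1"
  shows "ins (pS SW) (pF FW) (plift f) xs A t = I (map (\<lambda>g. g t) xs) (A t)"
proof -
  interpret P: multimap "pS SV" "pG SV GV FV" "pF FV" "pS SW" "pG SW GW FW" "pF FW" "plift f" e \<sigma>
    by (rule p_multimap)
  have "has_nsum FW (\<lambda>k. (pS SW (1 / fact k) (plift f (xs @ replicate k A))) t) UNIV
          (ins (pS SW) (pF FW) (plift f) xs A t)"
    by (rule W.has_nsum_pointwise[OF P.ins_sum[OF assms]])
  moreover have "(\<lambda>k. (pS SW (1 / fact k) (plift f (xs @ replicate k A))) t)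
     = (\<lambda>k. SW (1 / fact k) (f (map (\<lambda>g. g t) xs @ replicate k (A t))))"
    by (simp add: plift_def)
  moreover have "lies_in GV (map (\<lambda>g. g t) xs) ds"
    unfolding list.rel_map by (rule list_all2_mono[OF assms(1)]) (rule V.pG_value)
  then have "has_nsum FW (\<lambda>k. SW (1 / fact k) (f (map (\<lambda>g. g t) xs @ replicate k (A t)))) UNIV (I (map (\<lambda>g. g t) xs) (A t))"
    by (rule ins_sum) (use assms V.pG_value in \<open>auto simp: pF_iff[of A]\<close>)
  ultimately show ?thesis using W.has_nsum_unique by (simp only:)
qed

subsection \<open>The derivative of an exponential insertion\<close>

lemma pD_ins_aux:
  assumes xs: "lies_in (pG SV GV FV) xs ds" and A: "A \<in> pG SV GV FV 0" "A \<in> pF FV 1"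
  shows "has_nsum (pF FW) (\<lambda>k. pS SW (1 / fact k) (pD SW FW (plift f (xs @ replicate k A)))) UNIV
           (pD SW FW (ins (pS SW) (pF FW) (plift f) xs A))"
proof -
  interpret P: multimap "pS SV" "pG SV GV FV" "pF FV" "pS SW" "pG SW GW FW" "pF FW" "plift f" e \<sigma>
    by (rule p_multimap)
  let ?G = "pG SW GW FW (sum_list ds + e)"
  have "has_nsum (pF FW) (\<lambda>k. pD SW FW (pS SW (1 / fact k) (plift f (xs @ replicate k A)))) UNIV
           (pD SW FW (ins (pS SW) (pF FW) (plift f) xs A))"
  proof (rule has_nsum_image[OF P.W.filtered_space_axioms P.W.filtered_space_axioms, where B = ?G and T = "pD SW FW"])
    show "P.W.subspace ?G" by (rule P.W.G_sub)
    show "pS SW (1 / fact k) (plift f (xs @ replicate k A)) \<in> ?G" for k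
      by (rule P.W.G_scale[OF P.deg_replicate[OF xs A(1)]])
    show "ins (pS SW) (pF FW) (plift f) xs A \<in> ?G" by (rule P.ins_G[OF xs A])
    show "has_nsum (pF FW) (\<lambda>k. pS SW (1 / fact k) (plift f (xs @ replicate k A))) UNIV (ins (pS SW) (pF FW) (plift f) xs A)"
      by (rule P.ins_sum[OF xs A])
  qed (rule W.pD_diff, assumption+, rule W.pD_F, assumption+)
  then show ?thesis
    by (simp only: W.pD_scale[OF P.deg_replicate[OF xs A(1)]])
qed

lemma leibniz_replicate:
  assumes xs: "lies_in (pG SV GV FV) xs ds" and A: "A \<in> pG SV GV FV 0"
  shows "pD SW FW (plift f (xs @ replicate k A))
    = (\<lambda>t. \<Sum>j<length xs. plift f (take j xs @ pD SV FV (xs ! j) # drop (Suc j) xs @ replicate k A) t)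
      + pS SW (of_nat k) (plift f (xs @ pD SV FV A # replicate (k - 1) A))"
proof
  fix t
  interpret P: multimap "pS SV" "pG SV GV FV" "pF FV" "pS SW" "pG SW GW FW" "pF FW" "plift f" e \<sigma>
    by (rule p_multimap)
  let ?n = "length xs" and ?fs = "xs @ replicate k A"
  let ?T = "\<lambda>j. plift f (take j ?fs @ pD SV FV (?fs ! j) # drop (Suc j) ?fs) t"
  have "lies_in (pG SV GV FV) ?fs (ds @ replicate k 0)"
    using assms by (intro list_all2_appendI) (auto simp: list_all2_conv_all_nth)
  from leibniz[OF this] have "pD SW FW (plift f ?fs) t = (\<Sum>j<?n + k. ?T j)" by simp
  also have "{..<?n + k} = {..<?n} \<union> (\<lambda>j. ?n + j) ` {..<k}"
    by (auto simp: image_iff) (metis le_Suc_ex lessThan_iff nat_add_left_cancel_less not_less)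
  also have "(\<Sum>j\<in>\<dots>. ?T j) = (\<Sum>j<?n. ?T j) + (\<Sum>j\<in>(\<lambda>j. ?n + j) ` {..<k}. ?T j)"
    by (rule sum.union_disjoint) auto
  also have "(\<Sum>j\<in>(\<lambda>j. ?n + j) ` {..<k}. ?T j) = (\<Sum>j<k. ?T (?n + j))"
    by (subst sum.reindex) auto
  also have "(\<Sum>j<k. ?T (?n + j)) = (\<Sum>j<k. plift f (xs @ pD SV FV A # replicate (k - 1) A) t)"
  proof (rule sum.cong[OF refl])
    fix j assume "j \<in> {..<k}"
    then have j: "j < k" by simp
    have "?T (?n + j) = plift f (xs @ replicate j A @ pD SV FV A # replicate (k - Suc j) A) t"
      using j by (simp add: nth_append)
    also have "\<dots> = plift f (xs @ pD SV FV A # replicate j A @ replicate (k - Suc j) A) t"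
      using P.f_even_replicate[OF A V.pD_in_pG[OF A]] by simp
    also have "replicate j A @ replicate (k - Suc j) A = replicate (k - 1) A"
      using j by (simp add: replicate_add[symmetric])
    finally show "?T (?n + j) = plift f (xs @ pD SV FV A # replicate (k - 1) A) t" .
  qed
  also have "\<dots> = SW (of_nat k) (plift f (xs @ pD SV FV A # replicate (k - 1) A) t)"
    by (simp add: W.sum_constant_scale)
  finally have "pD SW FW (plift f ?fs) t = (\<Sum>j<?n. ?T j) + SW (of_nat k) (plift f (xs @ pD SV FV A # replicate (k - 1) A) t)" .
  moreover have "(\<Sum>j<?n. ?T j) = (\<Sum>j<?n. plift f (take j xs @ pD SV FV (xs ! j) # drop (Suc j) xs @ replicate k A) t)"
    by (rule sum.cong) (auto simp: nth_append)
  ultimately show "pD SW FW (plift f ?fs) t = ((\<lambda>t. \<Sum>j<length xs. plift f (take j xs @ pD SV FV (xs ! j) # drop (Suc j) xs @ replicate k A) t)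
      + pS SW (of_nat k) (plift f (xs @ pD SV FV A # replicate (k - 1) A))) t" by simp
qed

lemma ins_shift_sum:
  assumes xs: "lies_in GV (xs @ [x]) ds" and a: "a \<in> GV 0" "a \<in> FV 1"
  shows "has_nsum FW (\<lambda>k. SW (1 / fact k) (SW (of_nat k) (f (xs @ x # replicate (k - 1) a)))) UNIV (I (xs @ [x]) a)"
proof -
  have "has_nsum FW (\<lambda>k. SW (1 / fact (Suc k)) (SW (of_nat (Suc k)) (f (xs @ x # replicate (Suc k - 1) a)))) UNIV (I (xs @ [x]) a)"
  proof (rule W.has_nsum_congD[OF ins_sum[OF xs a]])
    fix k :: nat
    have "of_nat (Suc k) \<noteq> (0::'k)" by (rule of_nat_neq_0)
    then have "1 / fact (Suc k) * of_nat (Suc k) = (1 / fact k :: 'k)"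
      unfolding fact_Suc by (simp del: of_nat_Suc)
    then show "SW (1 / fact k) (f ((xs @ [x]) @ replicate k a))
       = SW (1 / fact (Suc k)) (SW (of_nat (Suc k)) (f (xs @ x # replicate (Suc k - 1) a)))"
      unfolding W.scale_scale by simp
  qed
  then show ?thesis
    using W.has_nsum_Suc[of "\<lambda>k. SW (1 / fact k) (SW (of_nat k) (f (xs @ x # replicate (k - 1) a)))"] by simp
qed

text \<open>
  Differentiating \<open>f(A\<^sup>k) / k!\<close> gives \<open>f(A', A\<^bsup>k-1\<^esup>) / (k-1)!\<close>, by symmetry: \<open>A\<close> has even degree.
\<close>

lemma pD_ins0:
  assumes A: "A \<in> pG SV GV FV 0" "A \<in> pF FV 1"
  shows "pD SW FW (ins (pS SW) (pF FW) (plift f) [] A) = ins (pS SW) (pF FW) (plift f) [pD SV FV A] A"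
proof -
  interpret P: multimap "pS SV" "pG SV GV FV" "pF FV" "pS SW" "pG SW GW FW" "pF FW" "plift f" e \<sigma>
    by (rule p_multimap)
  have "has_nsum (pF FW) (\<lambda>k. pS SW (1 / fact k) (pS SW (of_nat k) (plift f ([] @ pD SV FV A # replicate (k - 1) A)))) UNIV
           (ins (pS SW) (pF FW) (plift f) ([] @ [pD SV FV A]) A)"
    by (rule P.ins_shift_sum[where ds = "[0]"]) (use A V.pD_in_pG in auto)
  moreover have "has_nsum (pF FW) (\<lambda>k. pS SW (1 / fact k) (pD SW FW (plift f ([] @ replicate k A)))) UNIV
           (pD SW FW (ins (pS SW) (pF FW) (plift f) [] A))"
    by (rule pD_ins_aux[OF _ A, of "[]" "[]"]) simp
  moreover have "pD SW FW (plift f ([] @ replicate k A)) = pS SW (of_nat k) (plift f ([] @ pD SV FV A # replicate (k - 1) A))" for k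
    unfolding leibniz_replicate[of "[]" "[]" A k, OF list_all2_Nil2[THEN iffD2, OF refl] A(1)] by auto
  ultimately show ?thesis using P.W.has_nsum_unique by simp
qed

lemma pD_ins1:
  assumes Y: "Y \<in> pG SV GV FV d" and A: "A \<in> pG SV GV FV 0" "A \<in> pF FV 1"
  shows "pD SW FW (ins (pS SW) (pF FW) (plift f) [Y] A)
     = ins (pS SW) (pF FW) (plift f) [pD SV FV Y] A + ins (pS SW) (pF FW) (plift f) [Y, pD SV FV A] A"
proof -
  interpret P: multimap "pS SV" "pG SV GV FV" "pF FV" "pS SW" "pG SW GW FW" "pF FW" "plift f" e \<sigma>
    by (rule p_multimap)
  have 1: "has_nsum (pF FW) (\<lambda>k. pS SW (1 / fact k) (pS SW (of_nat k) (plift f ([Y] @ pD SV FV A # replicate (k - 1) A)))) UNIV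
           (ins (pS SW) (pF FW) (plift f) ([Y] @ [pD SV FV A]) A)"
    by (rule P.ins_shift_sum[where ds = "[d, 0]"]) (use A Y V.pD_in_pG in auto)
  have 2: "has_nsum (pF FW) (\<lambda>k. pS SW (1 / fact k) (plift f ([pD SV FV Y] @ replicate k A))) UNIV
           (ins (pS SW) (pF FW) (plift f) [pD SV FV Y] A)"
    by (rule P.ins_sum[where ds = "[d]"]) (use A Y V.pD_in_pG in auto)
  have "has_nsum (pF FW) (\<lambda>k. pS SW (1 / fact k) (pD SW FW (plift f ([Y] @ replicate k A)))) UNIV
           (pD SW FW (ins (pS SW) (pF FW) (plift f) [Y] A))"
    by (rule pD_ins_aux[OF _ A, of "[Y]" "[d]"]) (use Y in simp)
  moreover have "pD SW FW (plift f ([Y] @ replicate k A)) = plift f ([pD SV FV Y] @ replicate k A)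
      + pS SW (of_nat k) (plift f ([Y] @ pD SV FV A # replicate (k - 1) A))" for k
  proof -
    have "lies_in (pG SV GV FV) [Y] [d]" using Y by simp
    from leibniz_replicate[OF this A(1), of k] show ?thesis by auto
  qed
  ultimately show ?thesis
    using P.W.has_nsum_unique P.W.has_nsum_add[OF 2 1]
    by (simp add: P.W.scale_right_distrib)
qed

end

section \<open>Maurer-Cartan elements and the gauge flow\<close>

text \<open>
  The coefficients of \<open>D\<^sub>a D\<^sub>a x\<close> and of the Leibniz rule for \<open>D\<^sub>a\<close>, together with the terms that contain the
  curvature of \<open>a\<close>; there are \<open>i\<close> arguments \<open>a\<close> in the inner bracket and \<open>j\<close> in the outer one.
\<close>

abbreviation (input) square_terms :: "('w list \<Rightarrow> 'w::ab_group_add) \<Rightarrow> 'w \<Rightarrow> 'w \<Rightarrow> nat \<Rightarrow> nat \<Rightarrow> 'w" where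
  "square_terms b x a i j \<equiv> b (b (x # replicate i a) # replicate j a) + b (b (replicate i a) # x # replicate j a)"

abbreviation (input) leibniz_terms :: "('w list \<Rightarrow> 'w::ab_group_add) \<Rightarrow> 'w \<Rightarrow> 'w \<Rightarrow> 'w \<Rightarrow> nat \<Rightarrow> nat \<Rightarrow> 'w" where
  "leibniz_terms b x y a i j \<equiv> b (b (x # y # replicate i a) # replicate j a) + b (b (x # replicate i a) # y # replicate j a)
     - b (b (y # replicate i a) # x # replicate j a) + b (b (replicate i a) # x # y # replicate j a)"

text \<open>
  \<open>J2\<close> and \<open>J3\<close> are the structure equations evaluated on the words \<open>x a\<^sup>n\<close> and \<open>x y a\<^sup>n\<close>, for \<open>a\<close> of
  degree \<open>0\<close>, in terms of iterated brackets. The condition \<open>F 1 = UNIV\<close> ensures that every exponential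
  series converges.
\<close>

locale mc_algebra = multimap S G F S G F b 1 0
  for S :: "'k::field_char_0 \<Rightarrow> 'w::ab_group_add \<Rightarrow> 'w" and G F b +
  assumes F_one: "F 1 = UNIV"
    and J2: "x \<in> G k \<Longrightarrow> a \<in> G 0 \<Longrightarrow>
      (\<Sum>i\<le>n. S (of_nat (n choose i))
         (square_terms b x a i (n - i))) = 0"
    and J3: "x \<in> G (-1) \<Longrightarrow> y \<in> G (-1) \<Longrightarrow> a \<in> G 0 \<Longrightarrow>
      (\<Sum>i\<le>n. S (of_nat (n choose i))
         (leibniz_terms b x y a i (n - i))) = 0"
begin

lemma in_F_one [simp]: "a \<in> F 1"
  by (simp add: F_one)

lemma p_mc_algebra: "mc_algebra (pS S) (pG S G F) (pF F :: int \<Rightarrow> ('k \<Rightarrow> 'w) set) (plift b)"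
proof -
  interpret P: multimap "pS S" "pG S G F" "pF F" "pS S" "pG S G F" "pF F :: int \<Rightarrow> ('k \<Rightarrow> 'w) set" "plift b" 1 0
    by (rule p_multimap)
  show ?thesis
  proof
    show "pF F 1 = (UNIV :: ('k \<Rightarrow> 'w) set)" by (auto simp: pF_iff)
  next
    fix x a :: "'k \<Rightarrow> 'w" and k n assume "x \<in> pG S G F k" "a \<in> pG S G F 0"
    then show "(\<Sum>i\<le>n. pS S (of_nat (n choose i))
         (square_terms (plift b) x a i (n - i))) = 0"
      using J2[OF V.pG_value V.pG_value] by (auto simp: plift_def fun_sum_apply)
  next
    fix x y a :: "'k \<Rightarrow> 'w" and n assume "x \<in> pG S G F (-1)" "y \<in> pG S G F (-1)" "a \<in> pG S G F 0"
    then show "(\<Sum>i\<le>n. pS S (of_nat (n choose i))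
         (leibniz_terms (plift b) x y a i (n - i))) = 0"
      using J3[OF V.pG_value V.pG_value V.pG_value] by (auto simp: plift_def fun_sum_apply)
  qed
qed

subsection \<open>The identities for the twisted brackets\<close>

text \<open>
  Both sums of a nested insertion are expanded into one double series, in which \<open>i\<close> arguments \<open>a\<close>
  are in the inner and \<open>j\<close> in the outer bracket.
\<close>

lemma ins_ins:
  assumes xs: "lies_in G xs ds" and zs: "lies_in G zs ds'" and a: "a \<in> G 0"
  shows "has_nsum F (\<lambda>(j, i). S (1 / (fact i * fact j)) (b (b (xs @ replicate i a) # zs @ replicate j a))) UNIV
           (I (I xs a # zs) a)"
proof -
  let ?h = "\<lambda>(j, i). S (1 / (fact i * fact j)) (b (b (xs @ replicate i a) # zs @ replicate j a))"
  have "has_nsum F ?h (UNIV \<times> UNIV) (I (I xs a # zs) a)"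
  proof (rule V.has_nsum_Sigma)
    show "nullf F ?h (UNIV \<times> UNIV)"
    proof (rule V.nullf_nat2)
      fix i j
      show "?h (j, i) \<in> F (int i)"
        using f_fil_slot[OF ins_fil[OF in_F_one, of xs i a], of "[]" "zs @ replicate j a"] V.F_scale by simp
      show "?h (j, i) \<in> F (int j)"
        using ins_fil[OF in_F_one, of "b (xs @ replicate i a) # zs" j a] V.F_scale by simp
    qed
    show "has_nsum F (\<lambda>i. ?h (j, i)) UNIV (S (1 / fact j) (b ((I xs a # zs) @ replicate j a)))" for j
    proof (rule V.has_nsum_congD)
      show "has_nsum F (\<lambda>i. S (1 / fact j) (b ([] @ S (1 / fact i) (b (xs @ replicate i a)) # zs @ replicate j a))) UNIV
         (S (1 / fact j) (b ((I xs a # zs) @ replicate j a)))"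
        using V.has_nsum_scale[OF f_nsum[OF ins_sum[OF xs a in_F_one], of "[]" "zs @ replicate j a"], of "1 / fact j"]
        by simp
      show "S (1 / fact j) (b ([] @ S (1 / fact i) (b (xs @ replicate i a)) # zs @ replicate j a)) = ?h (j, i)" for i
        unfolding f_scale by (simp add: mult.commute)
    qed
    show "has_nsum F (\<lambda>j. S (1 / fact j) (b ((I xs a # zs) @ replicate j a))) UNIV (I (I xs a # zs) a)"
      by (rule ins_sum[where ds = "(sum_list ds + 1) # ds'"]) (use ins_G[OF xs a in_F_one] zs a in auto)
  qed
  then show ?thesis by simp
qed

lemma antidiagonal_fact:
  "(\<Sum>i\<le>n. S (1 / (fact i * fact (n - i))) (v i)) = S (1 / fact n) (\<Sum>i\<le>n. S (of_nat (n choose i)) (v i))"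
  unfolding V.scale_sum_right
proof (rule sum.cong)
  fix i assume "i \<in> {..n}"
  then have "(of_nat (n choose i) :: 'k) = fact n / (fact i * fact (n - i))" by (simp add: binomial_fact)
  then show "S (1 / (fact i * fact (n - i))) (v i) = S (1 / fact n) (S (of_nat (n choose i)) (v i))" by simp
qed simp

text \<open>
  \<open>J2\<close> is the cancellation of the terms of total degree \<open>n\<close> in the double series of the
  left hand side.
\<close>

lemma twisted_square:
  assumes x: "x \<in> G k" and a: "a \<in> G 0"
  shows "I [I [x] a] a + I [I [] a, x] a = 0"
proof (rule V.antidiagonal_zero)
  let ?g = "\<lambda>i j. square_terms b x a i j"
  let ?h = "\<lambda>(j, i). S (1 / (fact i * fact j)) (?g i j)"
  show "has_nsum F ?h UNIV (I [I [x] a] a + I [I [] a, x] a)"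
    using V.has_nsum_add[OF ins_ins[where xs = "[x]" and ds = "[k]" and zs = "[]" and ds' = "[]"]
        ins_ins[where xs = "[]" and ds = "[]" and zs = "[x]" and ds' = "[k]"], OF _ _ a _ _ a] x
    by (simp add: case_prod_unfold V.scale_right_distrib)
  show "(\<Sum>i\<le>n. ?h (n - i, i)) = 0" for n
    using J2[OF x a, of n] antidiagonal_fact[of n "\<lambda>i. ?g i (n - i)"] by simp
qed

text \<open>
  For a Maurer-Cartan element \<open>a\<close>, the twisted differential is a derivation of the twisted binary bracket;
  the sign is that of two arguments of odd degree.
\<close>

lemma twisted_leibniz:
  assumes x: "x \<in> G (-1)" and y: "y \<in> G (-1)" and a: "a \<in> G 0" and mc: "I [] a = 0"
  shows "I [I [x, y] a] a + I [I [x] a, y] a - I [I [y] a, x] a = 0"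
proof -
  let ?g = "\<lambda>i j. leibniz_terms b x y a i j"
  let ?h = "\<lambda>(j, i). S (1 / (fact i * fact j)) (?g i j)"
  let ?s = "\<lambda>(j, i). S (1 / (fact i * fact j)) (b (b (x # y # replicate i a) # replicate j a))"
  let ?t = "\<lambda>(j, i). S (1 / (fact i * fact j)) (b (b (x # replicate i a) # y # replicate j a))"
  let ?u = "\<lambda>(j, i). S (1 / (fact i * fact j)) (b (b (y # replicate i a) # x # replicate j a))"
  let ?v = "\<lambda>(j, i). S (1 / (fact i * fact j)) (b (b (replicate i a) # x # y # replicate j a))"
  have "has_nsum F ?s UNIV (I [I [x, y] a] a)"
    using ins_ins[of "[x, y]" "[-1, -1]" "[]" "[]" a] x y a by simp
  moreover have "has_nsum F ?t UNIV (I [I [x] a, y] a)"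
    using ins_ins[of "[x]" "[-1]" "[y]" "[-1]" a] x y a by simp
  moreover have "has_nsum F ?u UNIV (I [I [y] a, x] a)"
    using ins_ins[of "[y]" "[-1]" "[x]" "[-1]" a] x y a by simp
  moreover have "has_nsum F ?v UNIV (I [I [] a, x, y] a)"
    using ins_ins[of "[]" "[]" "[x, y]" "[-1, -1]" a] x y a by simp
  ultimately have "has_nsum F (\<lambda>p. ?s p + ?t p - ?u p + ?v p) UNIV
      (I [I [x, y] a] a + I [I [x] a, y] a - I [I [y] a, x] a + I [I [] a, x, y] a)"
    by (intro V.has_nsum_add V.has_nsum_diff)
  then have "has_nsum F ?h UNIV (I [I [x, y] a] a + I [I [x] a, y] a - I [I [y] a, x] a + I [I [] a, x, y] a)"
    by (rule V.has_nsum_congD) (auto simp: V.scale_right_distrib V.scale_right_diff_distrib)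
  then have "I [I [x, y] a] a + I [I [x] a, y] a - I [I [y] a, x] a + I [I [] a, x, y] a = 0"
  proof (rule V.antidiagonal_zero)
    show "(\<Sum>i\<le>n. ?h (n - i, i)) = 0" for n
      using J3[OF x y a, of n] antidiagonal_fact[of n "\<lambda>i. ?g i (n - i)"] by simp
  qed
  moreover have "I [I [] a, x, y] a = 0" unfolding mc using ins_zero[of "[]" "[x, y]" a] by simp
  ultimately show ?thesis by simp
qed

subsection \<open>The flow\<close>

abbreviation IP where "IP \<equiv> ins (pS S) (pF F) (plift b)"

text \<open>
  The gauge action of \<open>y\<close>, as the solution of its differential equation in place of the explicit
  series over trees that higher brackets require.
\<close>

definition is_flow :: "'w \<Rightarrow> 'w \<Rightarrow> ('k \<Rightarrow> 'w) \<Rightarrow> bool" where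
  "is_flow a y A \<longleftrightarrow> A \<in> pG S G F 0 \<and> A 0 = a \<and> pD S F A = - IP [\<lambda>_. y] A"

interpretation P: mc_algebra "pS S" "pG S G F" "pF F :: int \<Rightarrow> ('k \<Rightarrow> 'w) set" "plift b"
  by (rule p_mc_algebra)

lemma IP_pG: "lies_in (pG S G F) xs ds \<Longrightarrow> A \<in> pG S G F 0 \<Longrightarrow> IP xs A \<in> pG S G F (sum_list ds + 1)"
  by (rule P.ins_G) auto

text \<open>
  Picard iteration contracts: \<open>y\<close> lies in \<open>F 1\<close>, so that \<open>A \<mapsto> D\<^sub>A y\<close> gains one filtration degree on
  differences.
\<close>

lemma flow_exists:
  assumes a: "a \<in> G 0" and y: "y \<in> G (-1)"
  shows "\<exists>A. is_flow a y A"
proof -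
  let ?Y = "\<lambda>_. y"
  have Y: "?Y \<in> pG S G F (-1)" by (rule V.pG_const[OF y])
  have IY: "IP [?Y] A \<in> pG S G F 0" if "A \<in> pG S G F 0" for A
    using IP_pG[of "[?Y]" "[-1]" A] Y that by simp
  \<comment> \<open>the integral form of the equation\<close>
  let ?T = "\<lambda>A. (\<lambda>_. a) - pI S F (IP [?Y] A)"
  have "\<exists>A\<in>pG S G F 0. ?T A = A"
  proof (rule P.V.fixed_point)
    show "?T A \<in> pG S G F 0" if "A \<in> pG S G F 0" for A
      by (intro V.pG_diff V.pG_const[OF a] V.pI_in_pG IY that)
    show "?T A - ?T A' \<in> pF F (n + 1)"
      if "A \<in> pG S G F 0" "A' \<in> pG S G F 0" "A - A' \<in> pF F n" for A A' n
    proof -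
      have "IP [?Y] A' - IP [?Y] A \<in> pF F (sum_list [1] + n + 0)"
        using that(3) P.V.F_swap by (intro P.ins_lipschitz[where ds = "[-1]"]) (use Y that in auto)
      then have "pI S F (IP [?Y] A' - IP [?Y] A) \<in> pF F (n + 1)"
        by (intro V.pI_F[OF V.pG_diff[OF IY IY]]) (use that in \<open>auto simp: add.commute\<close>)
      moreover have "pI S F (IP [?Y] A' - IP [?Y] A) = pI S F (IP [?Y] A') - pI S F (IP [?Y] A)"
        by (rule V.pI_diff[OF IY IY]) (use that in auto)
      ultimately show ?thesis by simp
    qed
  qed
  then obtain A where A: "A \<in> pG S G F 0" "A = ?T A" by metis
  have "A 0 = a" by (subst A(2)) (simp add: V.pI_0[OF IY[OF A(1)]])
  moreover have "pD S F A = - IP [?Y] A"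
    by (subst A(2)) (simp add: V.pD_diff[OF V.pG_const[OF a] V.pI_in_pG[OF IY[OF A(1)]]]
        V.pD_const[OF a] V.pD_pI[OF IY[OF A(1)]])
  ultimately show ?thesis using A(1) unfolding is_flow_def by blast
qed

lemma flow_pG: "is_flow a y A \<Longrightarrow> A \<in> pG S G F 0"
  and flow_0: "is_flow a y A \<Longrightarrow> A 0 = a"
  and flow_pD: "is_flow a y A \<Longrightarrow> pD S F A = - IP [\<lambda>_. y] A"
  unfolding is_flow_def by auto

lemma flow_G: "is_flow a y A \<Longrightarrow> A s \<in> G 0"
  using flow_pG V.pG_value by blast

text \<open>
  By the Bianchi identity \<open>twisted_square\<close>, the curvature \<open>K\<close> satisfies the linear equation
  \<open>K' = {K, y}\<^sub>A\<close> along the flow, hence it stays zero.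
\<close>

lemma flow_mc:
  assumes fl: "is_flow a y A" and y: "y \<in> G (-1)" and mc: "I [] a = 0"
  shows "IP [] A = 0"
proof -
  let ?Y = "\<lambda>_. y"
  note A = flow_pG[OF fl]
  have Y: "?Y \<in> pG S G F (-1)" by (rule V.pG_const[OF y])
  have IY: "IP [?Y] A \<in> pG S G F 0" using IP_pG[of "[?Y]" "[-1]" A] Y A by simp
  have K: "IP [] A \<in> pG S G F 1" using IP_pG[of "[]" "[]" A] A by simp
  show ?thesis
  proof (rule V.ode_zero[OF K])
    show "IP [] A 0 = 0" using ins_pointwise[of "[]" "[]" A 0] A flow_0[OF fl] mc by simp
    have "pD S F (IP [] A) = IP [pD S F A] A" by (rule pD_ins0[OF A]) simp
    also have "\<dots> = - IP [IP [?Y] A] A"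
      unfolding flow_pD[OF fl] using P.ins_neg[of "[]" "[]" "IP [?Y] A" 0 "[]" "[]" A] IY A by simp
    also have "\<dots> = IP [IP [] A, ?Y] A"
      using P.twisted_square[OF Y A] by (simp add: neg_eq_iff_add_eq_0)
    finally have d: "pD S F (IP [] A) = IP [IP [] A, ?Y] A" .
    show "pD S F (IP [] A) \<in> pF F (n + 1)" if "IP [] A \<in> pF F n" for n
      unfolding d using P.ins_F[of "[IP [] A, ?Y]" "[n, 1]" "[1, -1]" A] that K Y A by simp
  qed
qed

lemma flow_mc_end: "is_flow a y A \<Longrightarrow> y \<in> G (-1) \<Longrightarrow> I [] a = 0 \<Longrightarrow> I [] (A s) = 0"
  using flow_mc ins_pointwise[of "[]" "[]" A s] flow_pG by fastforce

text \<open>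
  Only \<open>{y}\<close> has to lie in \<open>F m\<close>, not \<open>y\<close> itself: as long as \<open>A\<close> is close to \<open>F m\<close>, all other terms of
  \<open>D\<^sub>A y\<close> contain \<open>A\<close> and the vector \<open>y \<in> F 1\<close>, and gain a degree.
\<close>

lemma flow_F:
  assumes fl: "is_flow a y A" and y: "y \<in> G (-1)" and a: "a \<in> F m" and d: "b [y] \<in> F m"
  shows "A \<in> pF F m"
proof -
  let ?Y = "\<lambda>_. y"
  note A = flow_pG[OF fl]
  have Y: "?Y \<in> pG S G F (-1)" by (rule V.pG_const[OF y])
  have "A \<in> pF F (min m (int n + 1))" for n
  proof (induction n)
    case 0 then show ?case using P.V.F_antiD[OF P.in_F_one, of "min m (int 0 + 1)" A] by simp
  next
    case (Suc n)
    let ?m = "min m (int n + 1)"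
    have "IP [?Y] A \<in> pF F (min m (int (Suc n) + 1))"
    proof (cases "?m \<ge> 1")
      case True
      have "IP [?Y] A - plift b [?Y] \<in> pF F (sum_list [1] + ?m + 0)"
        by (rule P.ins_first[where ds = "[-1]"]) (use Suc True A Y in auto)
      then have "IP [?Y] A - plift b [?Y] \<in> pF F (min m (int (Suc n) + 1))"
        by (rule P.V.F_antiD) auto
      moreover have "plift b [?Y] \<in> pF F (min m (int (Suc n) + 1))"
        using V.F_antiD[OF d] by (simp add: pF_iff plift_def)
      ultimately show ?thesis using P.V.F_eq by blast
    next
      case False
      then have "min m (int (Suc n) + 1) \<le> 0" by auto
      then show ?thesis by (simp add: P.V.F_top)
    qed
    then have "pD S F A \<in> pF F (min m (int (Suc n) + 1))" unfolding flow_pD[OF fl] by (rule P.V.F_neg)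
    then show ?case
      by (rule V.increment_pF[OF A]) (use V.F_antiD[OF a] flow_0[OF fl] in simp)
  qed
  from this[of "nat m"] show ?thesis by (rule P.V.F_antiD) simp
qed

text \<open>
  The error consists of the terms \<open>{y, A\<^sup>k}\<close> with \<open>k > 0\<close>.
\<close>

lemma flow_first_order:
  assumes fl: "is_flow a y A" and y: "y \<in> G (-1)" "y \<in> F m" and a: "a \<in> F m" and "m \<ge> 1"
  shows "A 1 - a + b [y] \<in> F (2 * m)"
proof -
  let ?Y = "\<lambda>_. y"
  note A = flow_pG[OF fl]
  have Y: "?Y \<in> pG S G F (-1)" by (rule V.pG_const[OF y(1)])
  have bG: "b [y] \<in> G 0" using f_deg[of "[y]" "[-1]"] y by simp
  have "b [y] \<in> F m" using f_fil[of "[y]" "[m]"] y by simp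
  then have "A \<in> pF F m" by (rule flow_F[OF fl y(1) a])
  then have "IP [?Y] A - plift b [?Y] \<in> pF F (sum_list [m] + m + 0)"
    by (intro P.ins_first[where ds = "[-1]"]) (use assms A Y in \<open>auto simp: pF_iff\<close>)
  then have "pD S F A - (\<lambda>_. - b [y]) \<in> pF F (2 * m)"
    using P.V.F_neg by (fastforce simp: flow_pD[OF fl] plift_def fun_eq_iff pF_iff fun_Compl_def fun_diff_def)
  from V.increment_F[OF A V.G_neg[OF bG] this] show ?thesis using flow_0[OF fl] by simp
qed

text \<open>
  Changing the direction of the flow by \<open>\<eta>\<close> changes its end by \<open>- {\<eta>}\<close> up to terms of higher filtration.
  Here \<open>\<eta>\<close> itself may be of lower filtration than \<open>{\<eta>}\<close>, as is typical of corrections on the \<open>r\<close>-th page.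
\<close>

lemma flow_compare:
  assumes fl: "is_flow a y A" "is_flow a y' A'" and y: "y \<in> G (-1)" "y' \<in> G (-1)"
    and \<eta>: "y' - y \<in> F k" "b [y' - y] \<in> F q" and A': "A' \<in> pF F m" "m \<ge> 1" and q: "q + 1 \<le> k + m"
  shows "A' - A \<in> pF F q" and "A' 1 - A 1 + b [y' - y] \<in> F (q + 1)"
proof -
  let ?Y = "\<lambda>_. y" and ?Y' = "\<lambda>_. y'" and ?H = "\<lambda>_. y' - y"
  note A = flow_pG[OF fl(1)] and A'G = flow_pG[OF fl(2)]
  have yy: "y' - y \<in> G (-1)" by (rule V.G_diff[OF y(2,1)])
  have Y: "?Y \<in> pG S G F (-1)" "?Y' \<in> pG S G F (-1)" "?H \<in> pG S G F (-1)"
    using V.pG_const y yy by blast+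
  have C: "A' - A \<in> pG S G F 0" by (rule V.pG_diff[OF A'G A])
  have C0: "(A' - A) 0 = 0" using fl by (simp add: flow_0)
  have eq: "?Y + ?H = ?Y'" by auto
  have Y': "IP [?Y'] A' = IP [?Y] A' + IP [?H] A'"
    using P.ins_add[of "[]" "[]" ?Y "-1" ?H "[]" "[]" A', unfolded eq] Y A'G by simp
  have dC: "pD S F (A' - A) = - IP [?H] A' - (IP [?Y] A' - IP [?Y] A)"
    unfolding V.pD_diff[OF A'G A] flow_pD[OF fl(1)] flow_pD[OF fl(2)] Y' by simp
  have H1: "IP [?H] A' - plift b [?H] \<in> pF F (q + 1)"
  proof -
    have "IP [?H] A' - plift b [?H] \<in> pF F (sum_list [k] + m + 0)"
      by (rule P.ins_first[where ds = "[-1]"]) (use \<eta> A' A'G Y in \<open>auto simp: pF_iff\<close>)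
    then show ?thesis by (rule P.V.F_antiD) (use q in simp)
  qed
  have "plift b [?H] \<in> pF F q" using \<eta> by (simp add: pF_iff plift_def)
  then have H: "IP [?H] A' \<in> pF F q" using P.V.F_antiD[OF H1, of q] P.V.F_eq by auto
  have L: "IP [?Y] A' - IP [?Y] A \<in> pF F (n + 1)" if "A' - A \<in> pF F n" for n
    using P.ins_lipschitz[of "[?Y]" "[1]" "[-1]" A A' n] that A A'G Y by (simp add: add.commute)
  have "A' - A \<in> pF F (min q (int n))" for n
  proof (induction n)
    case 0 then show ?case using P.V.F_top by simp
  next
    case (Suc n)
    have "IP [?Y] A' - IP [?Y] A \<in> pF F (min q (int (Suc n)))"
      by (rule P.V.F_antiD[OF L[OF Suc]]) auto
    moreover have "IP [?H] A' \<in> pF F (min q (int (Suc n)))" by (rule P.V.F_antiD[OF H]) simp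
    ultimately have "pD S F (A' - A) \<in> pF F (min q (int (Suc n)))"
      unfolding dC by (rule P.V.F_diff[OF P.V.F_neg, rotated])
    then show ?case by (rule V.increment_pF[OF C]) (simp only: C0 V.F_zero)
  qed
  from this[of "nat q"] show c: "A' - A \<in> pF F q" by (rule P.V.F_antiD) simp
  have bG: "b [y' - y] \<in> G 0" using f_deg[of "[y' - y]" "[-1]"] yy by simp
  have "- (IP [?H] A' - plift b [?H]) - (IP [?Y] A' - IP [?Y] A) \<in> pF F (q + 1)"
    by (rule P.V.F_diff[OF P.V.F_neg[OF H1] L[OF c]])
  moreover have "pD S F (A' - A) - (\<lambda>_. - b [y' - y]) = - (IP [?H] A' - plift b [?H]) - (IP [?Y] A' - IP [?Y] A)"
    unfolding dC by (auto simp: plift_def)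
  ultimately have "pD S F (A' - A) - (\<lambda>_. - b [y' - y]) \<in> pF F (q + 1)" by simp
  from V.increment_F[OF C V.G_neg[OF bG] this] C0 show "A' 1 - A 1 + b [y' - y] \<in> F (q + 1)" by simp
qed

lemma flow_unique:
  assumes fl: "is_flow a y A" "is_flow a y A'" and y: "y \<in> G (-1)"
  shows "A' = A"
proof -
  have "A' - A \<in> pF F q" for q
    by (rule flow_compare(1)[OF fl y y, of q q 1]) (use f_zero[of "[]" "[]"] in auto)
  then have "A' - A = 0" by (rule P.V.hausdorff)
  then show ?thesis by simp
qed

lemma flow_trivial: assumes "a \<in> G 0" shows "is_flow a 0 (\<lambda>_. a)"
proof -
  have z: "(\<lambda>_. 0) = (0 :: 'k \<Rightarrow> 'w)" by auto
  show ?thesis unfolding is_flow_def z using P.ins_zero[of "[]" "[]"] V.pG_const[OF assms] V.pD_const[OF assms] by simp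
qed

subsection \<open>Transport of flat connections along the flow\<close>

text \<open>
  A relation \<open>\<delta> a = - D\<^sub>a \<beta>\<close> says that the pair \<open>(a, \<beta>)\<close> is flat in the direction of the derivation \<open>\<delta>\<close>. To
  keep it along the flow, \<open>\<beta>\<close> has to develop according to \<open>B' = \<delta> y - {y, B}\<^sub>A\<close>; this linear equation is
  solved by iteration. The defect \<open>\<delta> A + D\<^sub>A B\<close> then satisfies the homogeneous equation
  \<open>c' = - {y, c}\<^sub>A\<close>, by \<open>twisted_leibniz\<close>.
\<close>

theorem flow_transport:
  assumes \<delta>G: "\<And>k x. x \<in> G k \<Longrightarrow> \<delta> x \<in> G k"
    and \<delta>d: "\<And>k x y. x \<in> G k \<Longrightarrow> y \<in> G k \<Longrightarrow> \<delta> (x - y) = \<delta> x - \<delta> y"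
    and \<delta>S: "\<And>k x c. x \<in> G k \<Longrightarrow> \<delta> (S c x) = S c (\<delta> x)"
    and \<delta>F: "\<And>k x p. x \<in> G k \<Longrightarrow> x \<in> F p \<Longrightarrow> \<delta> x \<in> F p"
    and \<delta>I: "\<And>x a. x \<in> G (-1) \<Longrightarrow> a \<in> G 0 \<Longrightarrow> \<delta> (I [x] a) = I [\<delta> x] a + I [x, \<delta> a] a"
    and fl: "is_flow a y A" and y: "y \<in> G (-1)" and mc: "I [] a = 0"
    and \<beta>: "\<beta> \<in> G (-1)" "\<delta> a = - I [\<beta>] a"
  shows "\<exists>\<beta>'\<in>G (-1). \<delta> (A 1) = - I [\<beta>'] (A 1)"
proof -
  note A = flow_pG[OF fl]
  have mcA: "IP [] A = 0" by (rule flow_mc[OF fl y mc])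
  let ?Y = "\<lambda>_. y" and ?dY = "\<lambda>_. \<delta> y" and ?dA = "\<lambda>s. \<delta> (A s)"
  have Y: "?Y \<in> pG S G F (-1)" by (rule V.pG_const[OF y])
  have dY: "?dY \<in> pG S G F (-1)" by (rule V.pG_const[OF \<delta>G[OF y]])
  have dA: "?dA \<in> pG S G F 0"
    by (rule pG_map(1)[OF V.filtered_space_axioms V.filtered_space_axioms, where T = \<delta> and f = A]) (assumption | rule \<delta>G \<delta>d \<delta>S \<delta>F A)+
  have pdA: "pD S F ?dA = (\<lambda>s. \<delta> (pD S F A s))"
    by (rule pG_map(2)[OF V.filtered_space_axioms V.filtered_space_axioms, where T = \<delta> and f = A]) (assumption | rule \<delta>G \<delta>d \<delta>S \<delta>F A)+
  have IY: "IP [X] A \<in> pG S G F 0" if "X \<in> pG S G F (-1)" for X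
    using IP_pG[of "[X]" "[-1]" A] that A by simp
  have IYB: "IP [?Y, B] A \<in> pG S G F (-1)" if "B \<in> pG S G F (-1)" for B
    using IP_pG[of "[?Y, B]" "[-1, -1]" A] that A Y by simp
  \<comment> \<open>the integral form of \<open>B' = \<delta> y - {y, B}\<^sub>A\<close> with \<open>B(0) = \<beta>\<close>\<close>
  let ?T = "\<lambda>B. (\<lambda>_. \<beta>) + pI S F (?dY - IP [?Y, B] A)"
  have R: "?dY - IP [?Y, B] A \<in> pG S G F (-1)" if "B \<in> pG S G F (-1)" for B
    by (intro V.pG_diff dY IYB that)
  have "\<exists>B\<in>pG S G F (-1). ?T B = B"
  proof (rule P.V.fixed_point)
    show "?T B \<in> pG S G F (-1)" if "B \<in> pG S G F (-1)" for B
      by (intro V.pG_add V.pG_const[OF \<beta>(1)] V.pI_in_pG R that)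
    show "?T B - ?T B' \<in> pF F (n + 1)"
      if B: "B \<in> pG S G F (-1)" "B' \<in> pG S G F (-1)" and d: "B - B' \<in> pF F n" for B B' n
    proof -
      have "IP [?Y, B' - B] A = IP [?Y, B'] A - IP [?Y, B] A"
        using P.ins_diff[of "[?Y]" "[-1]" B' "-1" B "[]" "[]" A] Y B A by simp
      then have e: "(?dY - IP [?Y, B] A) - (?dY - IP [?Y, B'] A) = IP [?Y, B' - B] A" by simp
      have "?T B - ?T B' = pI S F (IP [?Y, B' - B] A)"
        unfolding e[symmetric] using V.pI_diff[OF R[OF B(1)] R[OF B(2)]] by simp
      moreover have "IP [?Y, B' - B] A \<in> pF F (sum_list [1, n] + 0)"
        by (rule P.ins_F[where ds = "[-1, -1]"]) (use Y B A d V.pG_diff P.V.F_swap in auto)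
      then have "pI S F (IP [?Y, B' - B] A) \<in> pF F (n + 1)"
        by (intro V.pI_F[OF IYB[OF V.pG_diff[OF B(2,1)]]]) (simp add: add.commute)
      ultimately show ?thesis by simp
    qed
  qed
  then obtain B where B: "B \<in> pG S G F (-1)" "B = ?T B" by metis
  have B0: "B 0 = \<beta>" by (subst B(2)) (simp add: V.pI_0[OF R[OF B(1)]])
  have dB: "pD S F B = ?dY - IP [?Y, B] A"
    by (subst B(2)) (simp add: V.pD_add[OF V.pG_const[OF \<beta>(1)] V.pI_in_pG[OF R[OF B(1)]]]
        V.pD_const[OF \<beta>(1)] V.pD_pI[OF R[OF B(1)]])
  \<comment> \<open>the defect of flatness along the flow\<close>
  define c where "c = ?dA + IP [B] A"
  have c: "c \<in> pG S G F 0" unfolding c_def by (intro V.pG_add dA IY B(1))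
  have "c = 0"
  proof (rule V.ode_zero[OF c])
    have "IP [B] A 0 = I [\<beta>] a"
      using ins_pointwise[of "[B]" "[-1]" A 0] B(1) A B0 flow_0[OF fl] by simp
    then show "c 0 = 0" using \<beta>(2) flow_0[OF fl] by (simp add: c_def)
    have nA: "pD S F A = - IP [?Y] A" by (rule flow_pD[OF fl])
    have "\<delta> (IP [?Y] A s) = IP [?dY] A s + IP [?Y, ?dA] A s" for s
    proof -
      have "IP [?Y] A s = I [y] (A s)" "IP [?dY] A s = I [\<delta> y] (A s)" "IP [?Y, ?dA] A s = I [y, \<delta> (A s)] (A s)"
        using ins_pointwise[of "[?Y]" "[-1]" A s] ins_pointwise[of "[?dY]" "[-1]" A s]
          ins_pointwise[of "[?Y, ?dA]" "[-1, 0]" A s] Y dY dA A by simp_all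
      then show ?thesis using \<delta>I[OF y flow_G[OF fl]] by simp
    qed
    moreover have "\<delta> (- x) = - \<delta> x" if "x \<in> G 0" for x using \<delta>S[OF that, of "-1"] by simp
    ultimately have 1: "pD S F ?dA = - IP [?dY] A - IP [?Y, ?dA] A"
      unfolding pdA nA using V.pG_value[OF IY[OF Y]] by (auto simp: fun_eq_iff)
    have "?dA = c - IP [B] A" by (simp add: c_def)
    then have 2: "IP [?Y, ?dA] A = IP [?Y, c] A - IP [?Y, IP [B] A] A"
      using P.ins_diff[of "[?Y]" "[-1]" c 0 "IP [B] A" "[]" "[]" A] Y c IY[OF B(1)] A by simp
    have 3: "pD S F (IP [B] A) = IP [pD S F B] A + IP [B, pD S F A] A"
      by (rule pD_ins1[OF B(1) A]) simp
    have 4: "IP [pD S F B] A = IP [?dY] A - IP [IP [?Y, B] A] A"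
      unfolding dB using P.ins_diff[of "[]" "[]" ?dY "-1" "IP [?Y, B] A" "[]" "[]" A] dY IYB[OF B(1)] A by simp
    have 5: "IP [B, pD S F A] A = - IP [B, IP [?Y] A] A"
      unfolding nA using P.ins_neg[of "[B]" "[-1]" "IP [?Y] A" 0 "[]" "[]" A] B IY[OF Y] A by simp
    have 6: "IP [?Y, IP [B] A] A = IP [IP [B] A, ?Y] A" "IP [B, IP [?Y] A] A = IP [IP [?Y] A, B] A"
      using P.ins_swap[of ?Y "-1" "IP [B] A" 0 "[]" "[]" A] P.ins_swap[of B "-1" "IP [?Y] A" 0 "[]" "[]" A]
        Y B(1) IY A by (simp_all add: parity_sign_def)
    have 7: "IP [IP [?Y, B] A] A + IP [IP [?Y] A, B] A - IP [IP [B] A, ?Y] A = 0"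
      by (rule P.twisted_leibniz[OF Y B(1) A mcA])
    have "pD S F c = pD S F ?dA + pD S F (IP [B] A)"
      unfolding c_def by (rule V.pD_add[OF dA IY[OF B(1)]])
    also have "\<dots> = - IP [?Y, c] A - (IP [IP [?Y, B] A] A + IP [IP [?Y] A, B] A - IP [IP [B] A, ?Y] A)"
      unfolding 1 2 3 4 5 6 by (simp add: algebra_simps)
    finally have d: "pD S F c = - IP [?Y, c] A" unfolding 7 by simp
    show "pD S F c \<in> pF F (n + 1)" if "c \<in> pF F n" for n
      unfolding d by (rule P.V.F_neg) (use P.ins_F[of "[?Y, c]" "[1, n]" "[-1, 0]" A] that Y c A in \<open>simp add: add.commute\<close>)
  qed
  then have "c 1 = 0" by simp
  then have "\<delta> (A 1) + I [B 1] (A 1) = 0"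
    using ins_pointwise[of "[B]" "[-1]" A 1] B(1) A by (simp add: c_def)
  then have "\<delta> (A 1) = - I [B 1] (A 1)" by (simp add: eq_neg_iff_add_eq_0)
  then show ?thesis using V.pG_value[OF B(1), of 1] by blast
qed

end

context mc_algebra
begin

interpretation P: mc_algebra "pS S" "pG S G F" "pF F :: int \<Rightarrow> ('k \<Rightarrow> 'w) set" "plift b"
  by (rule p_mc_algebra)

text \<open>
  Evaluation at \<open>t\<close> commutes with insertions and with the derivative in the flow parameter.
\<close>

lemma flow_eval:
  fixes a y :: "'k \<Rightarrow> 'w"
  assumes fl: "P.is_flow a y A" and y: "y \<in> pG S G F (-1)"
  shows "is_flow (a t) (y t) (\<lambda>s. A s t)"
proof -
  note A = P.flow_pG[OF fl]
  have ev: "(\<lambda>s. A s t) \<in> pG S G F 0" "pD S F (\<lambda>s. A s t) = (\<lambda>s. pD (pS S) (pF F) A s t)"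
    using pG_map[OF P.V.filtered_space_axioms V.filtered_space_axioms, where T = "\<lambda>x. x t" and f = A and k = 0 and k' = 0]
      V.pG_value A by (auto simp: pF_iff)
  have "pD (pS S) (pF F) A s t = - IP [\<lambda>_. y t] (\<lambda>s. A s t) s" for s
  proof -
    have "pD (pS S) (pF F) A s t = - (ins (pS (pS S)) (pF (pF F)) (plift (plift b)) [\<lambda>_. y] A s t)"
      unfolding P.flow_pD[OF fl] by simp
    also have "\<dots> = - (IP [y] (A s) t)"
      using P.ins_pointwise[of "[\<lambda>_. y]" "[-1]" A s] P.V.pG_const[OF y] A by (simp add: pF_iff)
    also have "IP [y] (A s) t = I [y t] (A s t)"
      using ins_pointwise[of "[y]" "[-1]" "A s" t] y P.V.pG_value[OF A] by simp
    also have "I [y t] (A s t) = IP [\<lambda>_. y t] (\<lambda>s. A s t) s"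
      using ins_pointwise[of "[\<lambda>_. y t]" "[-1]" "\<lambda>s. A s t" s] V.pG_const[OF V.pG_value[OF y]] ev by simp
    finally show ?thesis .
  qed
  then show ?thesis unfolding is_flow_def ev(2) using ev(1) P.flow_0[OF fl] by auto
qed

end

section \<open>Morphisms from an abelian algebra\<close>

text \<open>
  A morphism from an Abelian algebra with differential \<open>d\<close>, reduced to the two consequences of the
  morphism equations that are used: \<open>U\<^sub>\<star>\<close> carries the curvature \<open>d a\<close> of \<open>a\<close> to that of \<open>U\<^sub>\<star>(a)\<close>, and for closed
  \<open>a\<close> its derivative is a chain map into the complex twisted by \<open>U\<^sub>\<star>(a)\<close>. Both are stated for
  \<open>a \<in> FV 1\<close>, where \<open>U\<^sub>\<star>\<close> converges without further hypotheses.
\<close>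

locale abelian_morphism = U: multimap SV GV FV SW GW FW u 0 "r - 1" + W: mc_algebra SW GW FW b
  for SV :: "'k::field_char_0 \<Rightarrow> 'v::ab_group_add \<Rightarrow> 'v" and GV FV
    and SW :: "'k \<Rightarrow> 'w::ab_group_add \<Rightarrow> 'w" and GW FW u b and r :: int +
  fixes d :: "'v \<Rightarrow> 'v"
  assumes d_diff: "d (x - y) = d x - d y"
    and d_scale: "d (SV c x) = SV c (d x)"
    and d_G: "x \<in> GV k \<Longrightarrow> d x \<in> GV (k + 1)"
    and d_F: "x \<in> FV p \<Longrightarrow> d x \<in> FV p"
    and d_d: "x \<in> GV k \<Longrightarrow> d (d x) = 0"
    and curvature_image: "a \<in> GV 0 \<Longrightarrow> a \<in> FV 1 \<Longrightarrow> W.I [] (U.I [] a) = U.I [d a] a"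
    and twisted_chain_map: "a \<in> GV 0 \<Longrightarrow> a \<in> FV 1 \<Longrightarrow> d a = 0 \<Longrightarrow> x \<in> GV k \<Longrightarrow>
            W.I [U.I [x] a] (U.I [] a) = U.I [d x] a"
begin

lemma r_pos: "r \<ge> 1" using U.shift_nonneg by simp

lemma d_zero [simp]: "d 0 = 0" using d_diff[of 0 0] by simp

lemma d_neg: "d (- x) = - d x" using d_diff[of 0 x] by simp

lemma d_add: "d (x + y) = d x + d y" using d_diff[of x "- y"] by (simp add: d_neg)

text \<open>
  The vanishing of the \<open>r\<close>-th page of the cone, for homogeneous pairs and relative to subspaces \<open>JV\<close>,
  \<open>JW\<close>. The relative version serves for families that vanish at the ends of a path.
\<close>

definition page_condition :: "'v set \<Rightarrow> 'w set \<Rightarrow> bool" where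
  "page_condition JV JW \<longleftrightarrow> (\<forall>k p a c. a \<in> JV \<inter> GV (k + 1) \<inter> FV p \<longrightarrow> c \<in> JW \<inter> GW k \<inter> FW p \<longrightarrow>
      d a \<in> FV (p + r) \<longrightarrow> u [a] - b [c] \<in> FW (p + r) \<longrightarrow>
      (\<exists>x\<in>JV \<inter> GV k \<inter> FV (p - r + 1). \<exists>y\<in>JW \<inter> GW (k - 1) \<inter> FW (p - r + 1).
         d x \<in> FV p \<and> u [x] - b [y] \<in> FW p \<and> a - d x \<in> FV (p + 1) \<and> c - u [x] + b [y] \<in> FW (p + 1)))"

definition H1_condition :: "'w set \<Rightarrow> bool" where
  "H1_condition JW \<longleftrightarrow> (\<forall>q::nat. 2 ^ q < r \<longrightarrow> (\<forall>z\<in>JW \<inter> GW 0 \<inter> FW (2 ^ q). b [z] \<in> FW (min (2 ^ (q + 1)) r) \<longrightarrow>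
      (\<exists>y\<in>JW \<inter> GW (-1) \<inter> FW (2 ^ q). z - b [y] \<in> FW (min (2 ^ (q + 1)) r))))"

text \<open>
  The closure properties of \<open>JV\<close> and \<open>JW\<close> under which the approximation procedure, started at a pair that
  agrees modulo \<open>JW\<close>, never leaves the class modulo \<open>JV\<close> and \<open>JW\<close>.
\<close>

definition ideal_pair :: "'v set \<Rightarrow> 'w set \<Rightarrow> bool" where
  "ideal_pair JV JW \<longleftrightarrow> U.V.subspace JV \<and> U.W.subspace JW \<and>
     (\<forall>v. (\<forall>p. \<exists>j\<in>JV. v - j \<in> FV p) \<longrightarrow> v \<in> JV) \<and> (\<forall>v. (\<forall>p. \<exists>j\<in>JW. v - j \<in> FW p) \<longrightarrow> v \<in> JW) \<and>
     (\<forall>x\<in>JV. d x \<in> JV) \<and>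
     (\<forall>a\<in>GV 0 \<inter> FV 1. \<forall>a'\<in>GV 0 \<inter> FV 1. a' - a \<in> JV \<longrightarrow> U.I [] a' - U.I [] a \<in> JW) \<and>
     (\<forall>a\<in>GW 0. \<forall>y\<in>GW (-1) \<inter> JW. \<forall>A. W.is_flow a y A \<longrightarrow> A 1 - a \<in> JW)"

definition moves :: "'w set \<Rightarrow> 'w \<Rightarrow> 'w \<Rightarrow> bool" where
  "moves JW a a' \<longleftrightarrow> (\<exists>y\<in>GW (-1) \<inter> JW. \<exists>A. W.is_flow a y A \<and> A 1 = a')"

text \<open>
  The \<open>k\<close>-th term of \<open>U\<^sub>\<star>(\<alpha>)\<close> has filtration at least \<open>k + r - 1\<close>.
\<close>

lemma image_in_F: assumes "\<alpha> \<in> GV 0" "\<alpha> \<in> FV 1" shows "U.I [] \<alpha> \<in> FW r" "U.I [] \<alpha> \<in> GW 0"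
  using U.ins_first0(2)[OF assms] U.ins_G[of "[]" "[]" \<alpha>] assms by auto

lemma moves_mc:
  assumes "moves JW a a'" "a \<in> GW 0" "W.I [] a = 0" shows "a' \<in> GW 0" "W.I [] a' = 0"
  using assms W.flow_mc_end W.flow_G unfolding moves_def by blast+

end

locale goldman_millson = abelian_morphism SV GV FV SW GW FW u b r d
  for SV :: "'k::field_char_0 \<Rightarrow> 'v::ab_group_add \<Rightarrow> 'v" and GV FV
    and SW :: "'k \<Rightarrow> 'w::ab_group_add \<Rightarrow> 'w" and GW FW u b and r :: int and d +
  fixes JV JW
  assumes page: "page_condition JV JW" and H1: "H1_condition JW" and ideal: "ideal_pair JV JW"
begin

lemmas JV_sub = ideal[unfolded ideal_pair_def, THEN conjunct1]
lemmas JW_sub = ideal[unfolded ideal_pair_def, THEN conjunct2, THEN conjunct1]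

lemma JV_closed: "(\<And>p. \<exists>j\<in>JV. v - j \<in> FV p) \<Longrightarrow> v \<in> JV"
  using ideal unfolding ideal_pair_def by simp

lemma JW_closed: "(\<And>p. \<exists>j\<in>JW. v - j \<in> FW p) \<Longrightarrow> v \<in> JW"
  using ideal unfolding ideal_pair_def by simp

lemma J_d: "x \<in> JV \<Longrightarrow> d x \<in> JV"
  using ideal unfolding ideal_pair_def by simp

lemma J_star: "a \<in> GV 0 \<Longrightarrow> a \<in> FV 1 \<Longrightarrow> a' \<in> GV 0 \<Longrightarrow> a' \<in> FV 1 \<Longrightarrow> a' - a \<in> JV \<Longrightarrow> U.I [] a' - U.I [] a \<in> JW"
  using ideal unfolding ideal_pair_def by simp

lemma J_flow: "W.is_flow a y A \<Longrightarrow> a \<in> GW 0 \<Longrightarrow> y \<in> GW (-1) \<Longrightarrow> y \<in> JW \<Longrightarrow> A 1 - a \<in> JW"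
  using ideal unfolding ideal_pair_def by simp

lemma moves_J: "moves JW a a' \<Longrightarrow> a \<in> GW 0 \<Longrightarrow> a' - a \<in> JW"
  using J_flow unfolding moves_def by auto

text \<open>
  Modulo \<open>F (2 m)\<close> the curvature equation of \<open>a \<in> F m\<close> is linear, so that \<open>a\<close> is a cycle there. The
  image \<open>U\<^sub>\<star>(\<alpha>)\<close>, which lies in \<open>F r\<close>, is subtracted to obtain a cycle in \<open>JW\<close>.
\<close>

lemma raise_step:
  assumes a: "a \<in> GW 0" "W.I [] a = 0" "a \<in> FW (2 ^ q)" and q: "2 ^ q < r"
    and \<alpha>: "\<alpha> \<in> GV 0" "\<alpha> \<in> FV 1" and J: "a - U.I [] \<alpha> \<in> JW"
  shows "\<exists>a'. moves JW a a' \<and> a' \<in> FW (min (2 ^ (q + 1)) r)"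
proof -
  let ?m = "2 ^ q :: int" and ?M = "min (2 ^ (q + 1)) r"
  let ?z = "a - U.I [] \<alpha>"
  have M: "?M \<le> r" "?M \<le> 2 * ?m" "?m \<le> r" "1 \<le> ?m" using q by auto
  note s = image_in_F[OF \<alpha>]
  have "W.I [] a - b [a] \<in> FW (2 * ?m + 0)" by (rule W.ins_first0(1)[OF a(1,3) M(4)])
  then have "b [a] \<in> FW ?M" using U.W.F_neg U.W.F_antiD[OF _ M(2)] a(2) by fastforce
  moreover have "b [U.I [] \<alpha>] \<in> FW ?M"
    using W.f_fil_slot[OF s(1), of "[]" "[]"] U.W.F_antiD[OF _ M(1)] by simp
  moreover have "b [?z] = b [a] - b [U.I [] \<alpha>]" using W.f_diff[of "[]" a "U.I [] \<alpha>" "[]"] by simp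
  ultimately have "b [?z] \<in> FW ?M" by (simp only: U.W.F_diff)
  moreover have "?z \<in> JW \<inter> GW 0 \<inter> FW ?m"
    using J U.W.G_diff[OF a(1) s(2)] U.W.F_diff[OF a(3) U.W.F_antiD[OF s(1) M(3)]] by blast
  ultimately obtain y where y: "y \<in> JW" "y \<in> GW (-1)" "y \<in> FW ?m" "?z - b [y] \<in> FW ?M"
    using H1 q unfolding H1_condition_def by blast
  obtain A where A: "W.is_flow a y A" using W.flow_exists[OF a(1) y(2)] by blast
  have "A 1 - a + b [y] \<in> FW ?M"
    by (rule U.W.F_antiD[OF W.flow_first_order[OF A y(2,3) a(3) M(4)] M(2)])
  moreover have "U.I [] \<alpha> \<in> FW ?M" by (rule U.W.F_antiD[OF s(1) M(1)])
  ultimately have "(A 1 - a + b [y]) + (?z - b [y]) + U.I [] \<alpha> \<in> FW ?M"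
    by (rule U.W.F_add[OF U.W.F_add[OF _ y(4)]])
  then have "A 1 \<in> FW ?M" by simp
  then show ?thesis using A y(1,2) unfolding moves_def by blast
qed

lemma moves_star:
  assumes "(moves JW)\<^sup>*\<^sup>* a a'" "a \<in> GW 0" "W.I [] a = 0" "a - s \<in> JW"
  shows "a' \<in> GW 0 \<and> W.I [] a' = 0 \<and> a' - s \<in> JW"
  using assms
proof (induction rule: rtranclp_induct)
  case (step a' a'')
  then have h: "a' \<in> GW 0" "W.I [] a' = 0" "a' - s \<in> JW" by auto
  have "(a'' - a') + (a' - s) \<in> JW"
    by (rule U.W.subspace_add[OF JW_sub moves_J[OF step(2) h(1)] h(3)])
  then show ?case using moves_mc[OF step(2) h(1,2)] by simp
qed simp

lemma raise_to_r:
  assumes a: "a \<in> GW 0" "W.I [] a = 0" and \<alpha>: "\<alpha> \<in> GV 0" "\<alpha> \<in> FV 1" and J: "a - U.I [] \<alpha> \<in> JW"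
  shows "\<exists>a'. (moves JW)\<^sup>*\<^sup>* a a' \<and> a' \<in> FW r"
proof -
  have "\<exists>a'. (moves JW)\<^sup>*\<^sup>* a a' \<and> a' \<in> FW (min (2 ^ q) r)" for q
  proof (induction q)
    case 0
    have "a \<in> FW (min (2 ^ 0) r)" using r_pos by simp
    then show ?case by blast
  next
    case (Suc q)
    then obtain a' where a': "(moves JW)\<^sup>*\<^sup>* a a'" "a' \<in> FW (min (2 ^ q) r)" by blast
    note h = moves_star[OF a'(1) a J]
    show ?case
    proof (cases "2 ^ q < r")
      case True
      have "\<exists>a''. moves JW a' a'' \<and> a'' \<in> FW (min (2 ^ (q + 1)) r)"
        by (rule raise_step[OF _ _ _ True \<alpha>]) (use h a'(2) True in auto)
      then show ?thesis using a'(1) by (metis Suc_eq_plus1 rtranclp.rtrancl_into_rtrancl)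
    next
      case False
      moreover have "(2::int) ^ q \<le> 2 ^ Suc q" by simp
      ultimately have "min (2 ^ q) r = r" "min (2 ^ Suc q) r = r" by linarith+
      then show ?thesis using a' by metis
    qed
  qed
  from this[of "nat r"] obtain a' where a': "(moves JW)\<^sup>*\<^sup>* a a'" "a' \<in> FW (min (2 ^ nat r) r)" by blast
  have "int (nat r) < 2 ^ nat r" using of_nat_less_two_power by blast
  then have "min (2 ^ nat r) r = r" using r_pos by auto
  then show ?thesis using a' by metis
qed

text \<open>
  The quadratic estimate \<open>ins_lipschitz2\<close> compares the curvatures of \<open>\<beta>\<close> and \<open>U\<^sub>\<star>(\<alpha>)\<close> and shows that
  \<open>(- d \<alpha>, \<beta> - U\<^sub>\<star>(\<alpha>))\<close> is a cycle of the \<open>r\<close>-th page at filtration \<open>r + n\<close>. The page condition then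
  corrects both entries. The correction \<open>\<eta>\<close> is not applied to \<open>\<beta>\<close> here: it changes the direction of the flow.
\<close>

lemma approximation_step:
  assumes \<beta>: "\<beta> \<in> GW 0" "W.I [] \<beta> = 0" "\<beta> \<in> FW r"
    and \<alpha>: "\<alpha> \<in> GV 0" "\<alpha> \<in> FV 1" "d \<alpha> \<in> JV" "d \<alpha> \<in> FV (r + int n)"
    and J: "\<beta> - U.I [] \<alpha> \<in> JW" and def: "\<beta> - U.I [] \<alpha> \<in> FW (r + int n)"
  shows "\<exists>x\<in>JV \<inter> GV 0 \<inter> FV (int n + 1). \<exists>\<eta>\<in>JW \<inter> GW (-1) \<inter> FW (int n + 1).
     d (\<alpha> + x) \<in> FV (r + int n + 1) \<and> b [\<eta>] \<in> FW (r + int n) \<and>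
     \<beta> + b [\<eta>] - U.I [] (\<alpha> + x) \<in> FW (r + int n + 1)"
proof -
  let ?p = "r + int n"
  note s = image_in_F[OF \<alpha>(1,2)]
  have d\<alpha>: "d \<alpha> \<in> GV 1" using d_G[OF \<alpha>(1)] by simp
  let ?e = "\<beta> - U.I [] \<alpha>"
  \<comment> \<open>the two curvatures agree to first order, up to terms in which \<open>e\<close> meets an element of \<open>F r\<close>\<close>
  have "W.I [] \<beta> - W.I [] (U.I [] \<alpha>) - b [?e] \<in> FW (?p + r + 0)"
    by (rule W.ins_lipschitz2[OF s(2) \<beta>(1) s(1) \<beta>(3) r_pos def])
  then have "- U.I [d \<alpha>] \<alpha> - b [?e] \<in> FW (?p + r)"
    using \<beta>(2) curvature_image[OF \<alpha>(1,2)] by simp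
  moreover have "U.I [d \<alpha>] \<alpha> - u [d \<alpha>] \<in> FW (sum_list [?p] + 1 + (r - 1))"
    by (rule U.ins_first[where ds = "[1]"]) (use \<alpha> d\<alpha> in auto)
  ultimately have "(- U.I [d \<alpha>] \<alpha> - b [?e]) + (U.I [d \<alpha>] \<alpha> - u [d \<alpha>]) \<in> FW (?p + r)"
    by (intro U.W.F_add) auto
  moreover have "u [- d \<alpha>] = - u [d \<alpha>]" using U.f_diff[of "[]" 0 "d \<alpha>" "[]"] U.f_zero[of "[]" "[]"] by simp
  ultimately have "u [- d \<alpha>] - b [?e] \<in> FW (?p + r)" by (simp add: algebra_simps)
  moreover have "- d \<alpha> \<in> JV \<inter> GV (0 + 1) \<inter> FV ?p"
    using U.V.subspace_neg[OF JV_sub \<alpha>(3)] U.V.G_neg[OF d\<alpha>] U.V.F_neg[OF \<alpha>(4)] by simp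
  moreover have "?e \<in> JW \<inter> GW 0 \<inter> FW ?p" using J def U.W.G_diff[OF \<beta>(1) s(2)] by blast
  moreover have "d (- d \<alpha>) \<in> FV (?p + r)" using d_d[OF \<alpha>(1)] by (simp add: d_neg)
  ultimately obtain x y where x: "x \<in> JV" "x \<in> GV 0" "x \<in> FV (?p - r + 1)"
    and y: "y \<in> JW" "y \<in> GW (-1)" "y \<in> FW (?p - r + 1)"
    and xy: "u [x] - b [y] \<in> FW ?p" "- d \<alpha> - d x \<in> FV (?p + 1)" "?e - u [x] + b [y] \<in> FW (?p + 1)"
    using page[unfolded page_condition_def, rule_format, of "- d \<alpha>" 0 ?p ?e] by auto
  have n: "?p - r + 1 = int n + 1" by simp
  have "u [x] \<in> FW (sum_list [int n + 1] + (r - 1))"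
    by (rule U.f_fil) (use x n in auto)
  \<comment> \<open>\<open>b [y]\<close> gains over \<open>y\<close>: it differs from \<open>u [x]\<close> by an element of \<open>F p\<close>, and \<open>u\<close> raises the filtration\<close>
  then have "u [x] \<in> FW ?p" by (simp add: add.commute)
  from U.W.F_diff[OF this xy(1)] have by': "b [y] \<in> FW ?p" by simp
  have "- (- d \<alpha> - d x) \<in> FV (?p + 1)" by (rule U.V.F_neg[OF xy(2)])
  then have 1: "d (\<alpha> + x) \<in> FV (?p + 1)" by (simp add: d_add add.commute)
  have x1: "x \<in> FV 1" using x(3) by (rule U.V.F_antiD) simp
  have "U.I [] (\<alpha> + x) - U.I [] \<alpha> - u [\<alpha> + x - \<alpha>] \<in> FW (int n + 1 + 1 + (r - 1))"
    by (rule U.ins_lipschitz2) (use \<alpha> x x1 n in \<open>auto intro: U.V.G_add U.V.F_add\<close>)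
  then have "U.I [] (\<alpha> + x) - U.I [] \<alpha> - u [x] \<in> FW (?p + 1)" by (simp add: algebra_simps)
  from U.W.F_diff[OF xy(3) this] have "\<beta> + b [y] - U.I [] (\<alpha> + x) \<in> FW (?p + 1)"
    by (simp add: algebra_simps)
  then show ?thesis using x y 1 by' unfolding n by blast
qed

text \<open>
  A choice of solutions; by \<open>flow_unique\<close> there is only one.
\<close>

definition flow where "flow a y = (SOME A. W.is_flow a y A)"

lemma flow: "a \<in> GW 0 \<Longrightarrow> y \<in> GW (-1) \<Longrightarrow> W.is_flow a y (flow a y)"
  unfolding flow_def using W.flow_exists someI_ex by metis

text \<open>
  The iteration of \<open>approximation_step\<close>. All directions \<open>y\<^sub>n\<close> refer to the initial element \<open>a\<close>, so that the limit
  is a single flow and no infinite composition of flows is needed.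
\<close>

theorem surjectivity_in_Fr:
  assumes a: "a \<in> GW 0" "W.I [] a = 0" "a \<in> FW r"
    and \<alpha>0: "\<alpha>0 \<in> GV 0" "\<alpha>0 \<in> FV 1" "d \<alpha>0 = 0" and J: "a - U.I [] \<alpha>0 \<in> JW"
  shows "\<exists>\<alpha>\<in>GV 0 \<inter> FV 1. d \<alpha> = 0 \<and> \<alpha> - \<alpha>0 \<in> JV \<and> moves JW a (U.I [] \<alpha>)"
proof -
  let ?end = "\<lambda>y. flow a y 1"
  \<comment> \<open>the invariant: \<open>d \<alpha>\<close> and the distance between \<open>U\<^sub>\<star>(\<alpha>)\<close> and the end of the flow have filtration \<open>r + n\<close>\<close>
  define Q where "Q n s = (case s of (\<alpha>, y) \<Rightarrow>
      \<alpha> \<in> GV 0 \<and> \<alpha> \<in> FV 1 \<and> \<alpha> - \<alpha>0 \<in> JV \<and> d \<alpha> \<in> FV (r + int n) \<and>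
      y \<in> GW (-1) \<and> y \<in> JW \<and> b [y] \<in> FW r \<and> ?end y - U.I [] \<alpha> \<in> FW (r + int n))" for n s
  define R where "R n s s' = (case s of (\<alpha>, y) \<Rightarrow> case s' of (\<alpha>', y') \<Rightarrow>
      \<alpha>' - \<alpha> \<in> FV (int n + 1) \<and> y' - y \<in> FW (int n + 1))" for n s s'
  have fl: "W.is_flow a y (flow a y)" if "y \<in> GW (-1)" for y by (rule flow[OF a(1) that])
  have "\<exists>f. \<forall>n. Q n (f n) \<and> R n (f n) (f (Suc n))"
  proof (rule dependent_nat_choice)
    have "W.is_flow a 0 (\<lambda>_. a)" by (rule W.flow_trivial[OF a(1)])
    then have "?end 0 = a" using W.flow_unique[OF fl[OF U.W.G_zero] _ U.W.G_zero] by metis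
    moreover have "a - U.I [] \<alpha>0 \<in> FW (r + int 0)" using U.W.F_diff[OF a(3) image_in_F(1)[OF \<alpha>0(1,2)]] by simp
    ultimately have "Q 0 (\<alpha>0, 0)" unfolding Q_def
      using \<alpha>0 U.V.subspace_0[OF JV_sub] U.W.subspace_0[OF JW_sub] W.f_zero[of "[]" "[]"] by simp
    then show "\<exists>s. Q 0 s" by blast
  next
    fix s n assume "Q n s"
    then obtain \<alpha> y where s: "s = (\<alpha>, y)" and
      \<alpha>: "\<alpha> \<in> GV 0" "\<alpha> \<in> FV 1" "\<alpha> - \<alpha>0 \<in> JV" "d \<alpha> \<in> FV (r + int n)" and
      y: "y \<in> GW (-1)" "y \<in> JW" "b [y] \<in> FW r" and def: "?end y - U.I [] \<alpha> \<in> FW (r + int n)"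
      unfolding Q_def by (cases s) auto
    let ?\<beta> = "?end y"
    have \<beta>: "?\<beta> \<in> GW 0" "W.I [] ?\<beta> = 0" using W.flow_G[OF fl[OF y(1)]] W.flow_mc_end[OF fl[OF y(1)] y(1) a(2)] by auto
    have \<beta>r: "?\<beta> \<in> FW r" using W.flow_F[OF fl[OF y(1)] y(1) a(3) y(3)] by (simp add: pF_iff)
    have dJ: "d \<alpha> \<in> JV" using J_d[OF \<alpha>(3)] \<alpha>0(3) by (simp add: d_diff)
    have "(?\<beta> - a) + (a - U.I [] \<alpha>0) - (U.I [] \<alpha> - U.I [] \<alpha>0) \<in> JW"
      by (intro U.W.subspace_diff[OF JW_sub] U.W.subspace_add[OF JW_sub] J
          J_flow[OF fl[OF y(1)] a(1) y(1,2)] J_star \<alpha>0 \<alpha>)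
    then have \<beta>J: "?\<beta> - U.I [] \<alpha> \<in> JW" by simp
    obtain x \<eta> where x: "x \<in> JV" "x \<in> GV 0" "x \<in> FV (int n + 1)"
      and \<eta>: "\<eta> \<in> JW" "\<eta> \<in> GW (-1)" "\<eta> \<in> FW (int n + 1)" "b [\<eta>] \<in> FW (r + int n)"
      and new: "d (\<alpha> + x) \<in> FV (r + int n + 1)" "?\<beta> + b [\<eta>] - U.I [] (\<alpha> + x) \<in> FW (r + int n + 1)"
      using approximation_step[OF \<beta> \<beta>r \<alpha>(1,2) dJ \<alpha>(4) \<beta>J def] by blast
    \<comment> \<open>the end of the flow has to move by \<open>+ b [\<eta>]\<close>, hence the sign\<close>
    let ?y = "y - \<eta>"
    have yG: "?y \<in> GW (-1)" by (rule U.W.G_diff[OF y(1) \<eta>(2)])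
    have bd: "b [v - w] = b [v] - b [w]" for v w using W.f_diff[of "[]" v w "[]"] by simp
    have \<eta>r: "b [\<eta>] \<in> FW r" by (rule U.W.F_antiD[OF \<eta>(4)]) simp
    have by': "b [?y] \<in> FW r" unfolding bd by (rule U.W.F_diff[OF y(3) \<eta>r])
    have neg: "?y - y = - \<eta>" "b [?y - y] = - b [\<eta>]" using bd[of ?y y] bd[of y \<eta>] by auto
    have "?end ?y - ?end y + b [?y - y] \<in> FW (r + int n + 1)"
    proof (rule W.flow_compare(2)[OF fl[OF y(1)] fl[OF yG] y(1) yG])
      show "?y - y \<in> FW (int n + 1)" unfolding neg(1) by (rule U.W.F_neg[OF \<eta>(3)])
      show "b [?y - y] \<in> FW (r + int n)" unfolding neg(2) by (rule U.W.F_neg[OF \<eta>(4)])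
      show "flow a ?y \<in> pF FW r" by (rule W.flow_F[OF fl[OF yG] yG a(3) by'])
    qed (use r_pos in auto)
    then have "?end ?y - ?end y - b [\<eta>] \<in> FW (r + int n + 1)" unfolding neg(2) by simp
    from U.W.F_add[OF this new(2)] have "?end ?y - U.I [] (\<alpha> + x) \<in> FW (r + int (Suc n))"
      by (simp add: algebra_simps)
    moreover have "(\<alpha> - \<alpha>0) + x \<in> JV" by (rule U.V.subspace_add[OF JV_sub \<alpha>(3) x(1)])
    then have "\<alpha> + x - \<alpha>0 \<in> JV" by (simp add: algebra_simps)
    moreover have "\<alpha> + x \<in> FV 1" by (rule U.V.F_add[OF \<alpha>(2) U.V.F_antiD[OF x(3)]]) simp
    ultimately have "Q (Suc n) (\<alpha> + x, ?y)" unfolding Q_def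
      using U.V.G_add[OF \<alpha>(1) x(2)] yG U.W.subspace_diff[OF JW_sub y(2) \<eta>(1)] by' new(1)
      by (simp add: algebra_simps)
    moreover have "R n s (\<alpha> + x, ?y)" unfolding R_def s using x(3) U.W.F_neg[OF \<eta>(3)] by simp
    ultimately show "\<exists>s'. Q (Suc n) s' \<and> R n s s'" by blast
  qed
  then obtain f where f: "\<And>n. Q n (f n)" "\<And>n. R n (f n) (f (Suc n))" by blast
  define \<alpha> y where "\<alpha> n = fst (f n)" and "y n = snd (f n)" for n
  have \<alpha>: "\<alpha> n \<in> GV 0" "\<alpha> n \<in> FV 1" "\<alpha> n - \<alpha>0 \<in> JV" "d (\<alpha> n) \<in> FV (r + int n)"
    and y: "y n \<in> GW (-1)" "y n \<in> JW" "b [y n] \<in> FW r" "?end (y n) - U.I [] (\<alpha> n) \<in> FW (r + int n)" for n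
    using f(1)[of n] unfolding Q_def \<alpha>_def y_def by (auto split: prod.splits)
  have step: "\<alpha> (Suc n) - \<alpha> n \<in> FV (int n + 1)" "y (Suc n) - y n \<in> FW (int n + 1)" for n
    using f(2)[of n] unfolding R_def \<alpha>_def y_def by (auto split: prod.splits)
  obtain \<alpha>x where \<alpha>x: "\<alpha>x \<in> GV 0" "\<And>n. \<alpha>x - \<alpha> n \<in> FV (int n + 1)"
    using U.V.complete_nat[OF \<alpha>(1) step(1)] by blast
  obtain yx where yx: "yx \<in> GW (-1)" "\<And>n. yx - y n \<in> FW (int n + 1)"
    using U.W.complete_nat[OF y(1) step(2)] by blast
  have \<alpha>x1: "\<alpha>x \<in> FV 1" using \<alpha>x(2)[of 0] \<alpha>(2)[of 0] U.V.F_eq by auto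
  have d\<alpha>: "d \<alpha>x = 0"
  proof (rule U.V.hausdorff)
    fix p
    let ?n = "nat p"
    have "d \<alpha>x - d (\<alpha> ?n) \<in> FV (int ?n + 1)" using d_F[OF \<alpha>x(2)[of ?n]] by (simp add: d_diff)
    moreover have "d (\<alpha> ?n) \<in> FV (int ?n + 1)" by (rule U.V.F_antiD[OF \<alpha>(4)]) (use r_pos in simp)
    ultimately have "d \<alpha>x \<in> FV (int ?n + 1)" using U.V.F_eq by blast
    then show "d \<alpha>x \<in> FV p" by (rule U.V.F_antiD) simp
  qed
  have J\<alpha>: "\<alpha>x - \<alpha>0 \<in> JV"
  proof (rule JV_closed)
    fix p
    have "(\<alpha>x - \<alpha>0) - (\<alpha> (nat p) - \<alpha>0) \<in> FV p"
      using U.V.F_antiD[OF \<alpha>x(2)[of "nat p"], of p] by simp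
    then show "\<exists>j\<in>JV. (\<alpha>x - \<alpha>0) - j \<in> FV p" using \<alpha>(3) by blast
  qed
  have Jy: "yx \<in> JW"
  proof (rule JW_closed)
    fix p
    have "yx - y (nat p) \<in> FW p" using U.W.F_antiD[OF yx(2)[of "nat p"], of p] by simp
    then show "\<exists>j\<in>JW. yx - j \<in> FW p" using y(2) by blast
  qed
  have "?end yx = U.I [] \<alpha>x"
  proof (rule U.W.eq_by_F)
    fix p
    let ?n = "nat p"
    have "flow a yx - flow a (y ?n) \<in> pF FW (int ?n + 1)"
    proof (rule W.flow_compare(1)[OF fl[OF y(1)] fl[OF yx(1)] y(1) yx(1) yx(2)])
      show "b [yx - y ?n] \<in> FW (int ?n + 1)" using W.f_fil_slot[OF yx(2)[of ?n], of "[]" "[]"] by simp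
      show "flow a yx \<in> pF FW 1" by (simp add: pF_iff)
    qed auto
    then have "?end yx - ?end (y ?n) \<in> FW p" using U.W.F_antiD[of _ "int ?n + 1" p] by (simp add: pF_iff)
    moreover have "?end (y ?n) - U.I [] (\<alpha> ?n) \<in> FW p" by (rule U.W.F_antiD[OF y(4)]) (use r_pos in simp)
    moreover have "U.I [] \<alpha>x - U.I [] (\<alpha> ?n) \<in> FW (sum_list [] + (int ?n + 1) + (r - 1))"
      by (rule U.ins_lipschitz[OF _ _ \<alpha>(1) \<alpha>x(1) \<alpha>(2) \<alpha>x1 \<alpha>x(2), where ds = "[]"]) simp_all
    then have "U.I [] \<alpha>x - U.I [] (\<alpha> ?n) \<in> FW p" by (rule U.W.F_antiD) (use r_pos in simp)
    then have "U.I [] (\<alpha> ?n) - U.I [] \<alpha>x \<in> FW p" using U.W.F_swap by blast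
    ultimately show "?end yx - U.I [] \<alpha>x \<in> FW p" using U.W.F_trans by blast
  qed
  then have "moves JW a (U.I [] \<alpha>x)" unfolding moves_def using fl[OF yx(1)] yx(1) Jy by blast
  then show ?thesis using \<alpha>x(1) \<alpha>x1 d\<alpha> J\<alpha> by blast
qed

corollary surjectivity:
  assumes a: "a \<in> GW 0" "W.I [] a = 0"
    and \<alpha>0: "\<alpha>0 \<in> GV 0" "\<alpha>0 \<in> FV 1" "d \<alpha>0 = 0" and J: "a - U.I [] \<alpha>0 \<in> JW"
  shows "\<exists>\<alpha>\<in>GV 0 \<inter> FV 1. d \<alpha> = 0 \<and> \<alpha> - \<alpha>0 \<in> JV \<and> (moves JW)\<^sup>*\<^sup>* a (U.I [] \<alpha>)"
proof -
  obtain a' where a': "(moves JW)\<^sup>*\<^sup>* a a'" "a' \<in> FW r" using raise_to_r[OF a \<alpha>0(1,2) J] by blast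
  have "\<exists>\<alpha>\<in>GV 0 \<inter> FV 1. d \<alpha> = 0 \<and> \<alpha> - \<alpha>0 \<in> JV \<and> moves JW a' (U.I [] \<alpha>)"
    by (rule surjectivity_in_Fr) (use moves_star[OF a'(1) a J] a'(2) \<alpha>0 in auto)
  then show ?thesis using a'(1) by (meson rtranclp.rtrancl_into_rtrancl)
qed

text \<open>
  The linear analogue of the approximation: a closed \<open>\<gamma>\<close> whose image is a boundary of the twisted complex
  gives a cycle \<open>(\<gamma>, \<beta>)\<close> of the cone of the twisted morphism. Twisting changes the entries only in higher
  filtration, so that the page condition of the untwisted cone applies at each step.
\<close>

theorem twisted_injectivity:
  assumes JV: "JV = UNIV" and JW: "JW = UNIV"
    and \<alpha>: "\<alpha> \<in> GV 0" "\<alpha> \<in> FV 1" "d \<alpha> = 0"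
    and \<gamma>: "\<gamma> \<in> GV 0" "d \<gamma> = 0" and \<beta>: "\<beta> \<in> GW (-1)"
    and eq: "U.I [\<gamma>] \<alpha> = W.I [\<beta>] (U.I [] \<alpha>)"
  shows "\<exists>x\<in>GV (-1). d x = \<gamma>"
proof -
  let ?a = "U.I [] \<alpha>"
  note s = image_in_F[OF \<alpha>(1,2)]
  have mc: "W.I [] ?a = 0" using curvature_image[OF \<alpha>(1,2)] \<alpha>(3) U.ins_zero[of "[]" "[]"] by simp
  \<comment> \<open>\<open>(X, Y)\<close> is a primitive of \<open>(\<gamma>, \<beta>)\<close> in the twisted cone up to filtration \<open>n\<close>\<close>
  define Q where "Q n t = (case t of (X, Y) \<Rightarrow> X \<in> GV (-1) \<and> Y \<in> GW (-2) \<and> \<gamma> - d X \<in> FV (int n) \<and>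
      \<beta> - U.I [X] \<alpha> + W.I [Y] ?a \<in> FW (int n))" for n t
  define R where "R n t t' = (case t of (X, Y) \<Rightarrow> case t' of (X', Y') \<Rightarrow> X' - X \<in> FV (int n + (1 - r)))"
    for n :: nat and t t' :: "'v \<times> 'w"
  have "\<exists>f. \<forall>n. Q n (f n) \<and> R n (f n) (f (Suc n))"
  proof (rule dependent_nat_choice)
    have "Q 0 (0, 0)" unfolding Q_def using U.V.F_top U.W.F_top by simp
    then show "\<exists>t. Q 0 t" by blast
  next
    fix t n assume "Q n t"
    then obtain X Y where t: "t = (X, Y)" and X: "X \<in> GV (-1)" and Y: "Y \<in> GW (-2)"
      and \<gamma>n: "\<gamma> - d X \<in> FV (int n)" and \<beta>n: "\<beta> - U.I [X] \<alpha> + W.I [Y] ?a \<in> FW (int n)"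
      unfolding Q_def by (cases t) auto
    let ?\<gamma> = "\<gamma> - d X" and ?\<beta> = "\<beta> - U.I [X] \<alpha> + W.I [Y] ?a"
    have dX: "d X \<in> GV 0" using d_G[OF X] by simp
    have \<gamma>G: "?\<gamma> \<in> GV 0" by (rule U.V.G_diff[OF \<gamma>(1) dX])
    have IX: "U.I [X] \<alpha> \<in> GW (-1)" using U.ins_G[of "[X]" "[-1]" \<alpha>] X \<alpha> by simp
    have IY: "W.I [Y] ?a \<in> GW (-1)" using W.ins_G[of "[Y]" "[-2]" ?a] Y s by simp
    have \<beta>G: "?\<beta> \<in> GW (-1)" by (intro U.W.G_add U.W.G_diff \<beta> IX IY)
    have "U.I [?\<gamma>] \<alpha> = U.I [\<gamma>] \<alpha> - U.I [d X] \<alpha>"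
      using U.ins_diff[of "[]" "[]" \<gamma> 0 "d X" "[]" "[]" \<alpha>] \<gamma> dX \<alpha> by simp
    also have "\<dots> = W.I [\<beta>] ?a - W.I [U.I [X] \<alpha>] ?a"
      using eq twisted_chain_map[OF \<alpha> X] by simp
    also have "\<dots> = W.I [\<beta> - U.I [X] \<alpha>] ?a"
      using W.ins_diff[of "[]" "[]" \<beta> "-1" "U.I [X] \<alpha>" "[]" "[]" ?a] \<beta> IX s by simp
    also have "W.I [W.I [Y] ?a] ?a = 0"
      using W.twisted_square[OF Y s(2)] mc W.ins_zero[of "[]" "[Y]" ?a] by simp
    then have "W.I [\<beta> - U.I [X] \<alpha>] ?a = W.I [?\<beta>] ?a"
      using W.ins_add[of "[]" "[]" "\<beta> - U.I [X] \<alpha>" "-1" "W.I [Y] ?a" "[]" "[]" ?a]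
        U.W.G_diff[OF \<beta> IX] IY s by simp
    finally have e: "U.I [?\<gamma>] \<alpha> = W.I [?\<beta>] ?a" .
    have "U.I [?\<gamma>] \<alpha> - u [?\<gamma>] \<in> FW (sum_list [int n] + 1 + (r - 1))"
      by (rule U.ins_first[where ds = "[0]"]) (use \<gamma>n \<gamma>G \<alpha> in auto)
    moreover have "W.I [?\<beta>] ?a - b [?\<beta>] \<in> FW (sum_list [int n] + r + 0)"
      by (rule W.ins_first[where ds = "[-1]"]) (use \<beta>n \<beta>G s r_pos in auto)
    ultimately have "(W.I [?\<beta>] ?a - b [?\<beta>]) - (U.I [?\<gamma>] \<alpha> - u [?\<gamma>]) \<in> FW (int n + r)"
      by (intro U.W.F_diff[of "_ - _" _ "_ - _"]) auto
    then have "u [?\<gamma>] - b [?\<beta>] \<in> FW (int n + r)" unfolding e by simp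
    moreover have "d ?\<gamma> \<in> FV (int n + r)" using \<gamma>(2) d_d[OF X] by (simp add: d_diff)
    moreover have "?\<gamma> \<in> JV \<inter> GV (-1 + 1) \<inter> FV (int n)" "?\<beta> \<in> JW \<inter> GW (-1) \<inter> FW (int n)"
      using \<gamma>G \<gamma>n \<beta>G \<beta>n JV JW by auto
    ultimately obtain x y where x: "x \<in> GV (-1)" "x \<in> FV (int n - r + 1)"
      and y: "y \<in> GW (-1 - 1)" "y \<in> FW (int n - r + 1)"
      and xy: "?\<gamma> - d x \<in> FV (int n + 1)" "?\<beta> - u [x] + b [y] \<in> FW (int n + 1)"
      using page[unfolded page_condition_def, rule_format, of ?\<gamma> "-1" "int n" ?\<beta>] by blast
    have "U.I [x] \<alpha> - u [x] \<in> FW (sum_list [int n - r + 1] + 1 + (r - 1))"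
      by (rule U.ins_first[where ds = "[-1]"]) (use x \<alpha> in auto)
    moreover have "W.I [y] ?a - b [y] \<in> FW (sum_list [int n - r + 1] + r + 0)"
      by (rule W.ins_first[where ds = "[-2]"]) (use y s r_pos in auto)
    ultimately have "(W.I [y] ?a - b [y]) - (U.I [x] \<alpha> - u [x]) \<in> FW (int n + 1)"
      by (intro U.W.F_diff[of "_ - _" _ "_ - _"]) (auto simp: add.commute)
    from U.W.F_add[OF xy(2) this] have "?\<beta> - U.I [x] \<alpha> + W.I [y] ?a \<in> FW (int n + 1)"
      by (simp add: algebra_simps)
    moreover have "U.I [X + x] \<alpha> = U.I [X] \<alpha> + U.I [x] \<alpha>"
      using U.ins_add[of "[]" "[]" X "-1" x "[]" "[]" \<alpha>] X x \<alpha> by simp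
    moreover have "W.I [Y + y] ?a = W.I [Y] ?a + W.I [y] ?a"
      using W.ins_add[of "[]" "[]" Y "-2" y "[]" "[]" ?a] Y y s by simp
    ultimately have "\<beta> - U.I [X + x] \<alpha> + W.I [Y + y] ?a \<in> FW (int (Suc n))"
      by (simp add: algebra_simps)
    moreover have "\<gamma> - d (X + x) \<in> FV (int (Suc n))" using xy(1) by (simp add: d_add algebra_simps)
    ultimately have "Q (Suc n) (X + x, Y + y)"
      unfolding Q_def using U.V.G_add[OF X x(1)] U.W.G_add[OF Y] y(1) by simp
    moreover have "R n t (X + x, Y + y)" unfolding R_def t using x(2) by (simp add: algebra_simps)
    ultimately show "\<exists>t'. Q (Suc n) t' \<and> R n t t'" by blast
  qed
  then obtain f where f: "\<And>n. Q n (f n)" "\<And>n. R n (f n) (f (Suc n))" by blast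
  define X where "X n = fst (f n)" for n
  have X: "X n \<in> GV (-1)" "\<gamma> - d (X n) \<in> FV (int n)" "X (Suc n) - X n \<in> FV (int n + (1 - r))" for n
    using f(1)[of n] f(2)[of n] unfolding Q_def R_def X_def by (auto split: prod.splits)
  obtain x where x: "x \<in> GV (-1)" "\<And>n. x - X n \<in> FV (int n + (1 - r))"
    using U.V.complete_nat[OF X(1,3)] by blast
  have "d x = \<gamma>"
  proof (rule U.V.eq_by_F)
    fix p
    \<comment> \<open>the corrections only have filtration \<open>n + 1 - r\<close>, hence the shift by \<open>r\<close>\<close>
    let ?n = "nat (p + r)"
    have "d (x - X ?n) \<in> FV p" by (rule d_F[OF U.V.F_antiD[OF x(2)]]) simp
    moreover have "\<gamma> - d (X ?n) \<in> FV p" by (rule U.V.F_antiD[OF X(2)]) (use r_pos in simp)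
    ultimately have "d (x - X ?n) - (\<gamma> - d (X ?n)) \<in> FV p" by (rule U.V.F_diff)
    then show "d x - \<gamma> \<in> FV p" by (simp add: d_diff)
  qed
  then show ?thesis using x(1) by blast
qed

end

section \<open>Families over the affine line that vanish at given points\<close>

definition vanish :: "'k set \<Rightarrow> ('k \<Rightarrow> 'v::zero) set" where
  "vanish E = {f. \<forall>s\<in>E. f s = 0}"

text \<open>
  A basis of the polynomials that vanish on \<open>E\<close>, for \<open>E = {}\<close> or \<open>E = {0, 1}\<close>. With respect to it, a family
  vanishing on \<open>E\<close> has the same coefficients as in the basis of powers, apart from the first two.
\<close>

definition vbasis :: "'k set \<Rightarrow> nat \<Rightarrow> 'k::field \<Rightarrow> 'k" where
  "vbasis E i t = (if E = {} then t ^ i else if i = 0 then 0 else t ^ i - t)"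

abbreviation admissible :: "'k::field set \<Rightarrow> bool" where
  "admissible E \<equiv> E = {} \<or> E = {0, 1}"

lemma vbasis_zero: "admissible E \<Longrightarrow> s \<in> E \<Longrightarrow> vbasis E i s = 0"
  by (auto simp: vbasis_def)

context filtered_space
begin

lemma vbasis_pG: assumes "v \<in> G k" shows "(\<lambda>t. S (vbasis E i t) v) \<in> pG S G F k"
proof -
  have "(\<lambda>t. S (t ^ i) v) - (\<lambda>t. S (t ^ 1) v) \<in> pG S G F k"
    by (intro pG_diff pG_monom assms)
  then have "(\<lambda>t. S (t ^ i - t) v) \<in> pG S G F k" by (simp add: fun_diff_def scale_left_diff_distrib)
  moreover have "(\<lambda>t. 0) \<in> pG S G F k" using pG_zero by (simp add: zero_fun_def)
  ultimately show ?thesis using pG_monom[OF assms, of i] unfolding vbasis_def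
    by (cases "E = {}"; cases "i = 0") simp_all
qed

lemma vbasis_expand:
  assumes z: "z \<in> pG S G F k" "z \<in> vanish E" and E: "admissible E"
  shows "has_nsum F (\<lambda>i. S (vbasis E i t) (coef S F z i)) UNIV (z t)"
proof (cases "E = {}")
  case True
  then show ?thesis using expands_sum[OF pG_expands[OF z(1)]] by (simp add: vbasis_def)
next
  case False
  then have "E = {0, 1}" using E by simp
  then have z01: "z 0 = 0" "z 1 = 0" using z(2) by (auto simp: vanish_def)
  have c0: "coef S F z 0 = 0" using coef_0[OF pG_expands[OF z(1)]] z01 by simp
  have "has_nsum F (\<lambda>i. S (t ^ i) (coef S F z i) - S t (S (1 ^ i) (coef S F z i))) UNIV (z t - S t (z 1))"
    by (intro has_nsum_diff has_nsum_scale expands_sum[OF pG_expands[OF z(1)]])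
  then have "has_nsum F (\<lambda>i. S (t ^ i) (coef S F z i) - S t (S (1 ^ i) (coef S F z i))) UNIV (z t)"
    using z01 by simp
  then show ?thesis
    by (rule has_nsum_congD) (use False c0 in \<open>auto simp: vbasis_def scale_left_diff_distrib\<close>)
qed

lemma vbasis_sum:
  assumes "finite X" "\<And>i. i \<in> X \<Longrightarrow> v i \<in> G k" "admissible E"
  shows "(\<lambda>t. \<Sum>i\<in>X. S (vbasis E i t) (v i)) \<in> pG S G F k" "(\<lambda>t. \<Sum>i\<in>X. S (vbasis E i t) (v i)) \<in> vanish E"
proof -
  show "(\<lambda>t. \<Sum>i\<in>X. S (vbasis E i t) (v i)) \<in> pG S G F k"
    using assms(1,2)
  proof (induction X rule: finite_induct)
    case empty
    then show ?case using pG_zero by (simp add: zero_fun_def)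
  next
    case (insert a X)
    have "(\<lambda>t. S (vbasis E a t) (v a)) + (\<lambda>t. \<Sum>i\<in>X. S (vbasis E i t) (v i)) \<in> pG S G F k"
      using insert by (intro pG_add vbasis_pG) auto
    then show ?case using insert by (simp add: plus_fun_def)
  qed
  show "(\<lambda>t. \<Sum>i\<in>X. S (vbasis E i t) (v i)) \<in> vanish E"
    using vbasis_zero[OF assms(3)] by (simp add: vanish_def)
qed

lemma coef_F: "f \<in> pG S G F k \<Longrightarrow> f \<in> pF F p \<Longrightarrow> coef S F f i \<in> F p"
  using expands_F[OF pG_expands] by blast

text \<open>
  A family is approximated in \<open>F p\<close> by approximating finitely many coefficients.
\<close>

lemma vbasis_approx:
  assumes z: "z \<in> pG S G F k" "z \<in> vanish E" and E: "admissible E"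
    and X: "finite X" "\<And>i. i \<notin> X \<Longrightarrow> w i = 0" and d: "\<And>i. coef S F z i - w i \<in> F p"
  shows "z t - (\<Sum>i\<in>X. S (vbasis E i t) (w i)) \<in> F p"
proof (rule has_nsum_F)
  show "has_nsum F (\<lambda>i. S (vbasis E i t) (coef S F z i) - S (vbasis E i t) (w i)) UNIV
     (z t - (\<Sum>i\<in>X. S (vbasis E i t) (w i)))"
    by (intro has_nsum_diff vbasis_expand[OF z E] has_nsum_support_on X(1)) (simp_all add: X(2))
  show "S (vbasis E i t) (coef S F z i) - S (vbasis E i t) (w i) \<in> F p" for i
    unfolding scale_right_diff_distrib[symmetric] by (rule F_scale[OF d])
qed

end

context multimap
begin

lemma unary_sum: "finite X \<Longrightarrow> f [(\<Sum>i\<in>X. SV (c i) (x i))] = (\<Sum>i\<in>X. SW (c i) (f [x i]))"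
proof (induction X rule: finite_induct)
  case empty then show ?case using f_zero[of "[]" "[]"] by simp
next
  case (insert a X)
  then show ?case using f_add[of "[]" "SV (c a) (x a)" _ "[]"] f_scale[of "[]" "c a" "x a" "[]"] by simp
qed

lemma single_map:
  assumes "g \<in> pG SV GV FV k"
  shows "(\<lambda>s. f [g s]) \<in> pG SW GW FW (k + e)" "coef SW FW (\<lambda>s. f [g s]) = (\<lambda>i. f [coef SV FV g i])"
proof -
  have 1: "f [x] \<in> GW (k + e)" if "x \<in> GV k" for x using f_deg[of "[x]" "[k]"] that by simp
  have 2: "f [x - y] = f [x] - f [y]" for x y using f_diff[of "[]" x y "[]"] by simp
  have 3: "f [SV c x] = SW c (f [x])" for c x using f_scale[of "[]" c x "[]"] by simp
  have 4: "f [x] \<in> FW p" if "x \<in> FV p" for x p using f_fil_slot[OF that, of "[]" "[]"] by simp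
  note m = pG_map[OF V.filtered_space_axioms W.filtered_space_axioms, where T = "\<lambda>x. f [x]" and f = g, OF 1 2 3 4 assms]
  show "(\<lambda>s. f [g s]) \<in> pG SW GW FW (k + e)" "coef SW FW (\<lambda>s. f [g s]) = (\<lambda>i. f [coef SV FV g i])"
    by (rule m(1) m(3); assumption)+
qed

end

context abelian_morphism
begin

lemma d_map: "f \<in> pG SV GV FV k \<Longrightarrow> (\<lambda>s. d (f s)) \<in> pG SV GV FV (k + 1)"
  and d_pD: "f \<in> pG SV GV FV k \<Longrightarrow> pD SV FV (\<lambda>s. d (f s)) = (\<lambda>s. d (pD SV FV f s))"
  and d_coef: "f \<in> pG SV GV FV k \<Longrightarrow> coef SV FV (\<lambda>s. d (f s)) = (\<lambda>i. d (coef SV FV f i))"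
  using pG_map[OF U.V.filtered_space_axioms U.V.filtered_space_axioms, where T = d and k = k and k' = "k + 1" and f = f]
    d_G d_diff d_scale d_F by blast+

lemma d_sum: "finite X \<Longrightarrow> d (\<Sum>i\<in>X. SV (c i) (x i)) = (\<Sum>i\<in>X. SV (c i) (d (x i)))"
  by (induction X rule: finite_induct) (auto simp: d_add d_scale)

text \<open>
  Evaluation commutes with insertions, so that the hypotheses hold at each parameter \<open>t\<close>.
\<close>

lemma p_abelian_morphism:
  "abelian_morphism (pS SV) (pG SV GV FV) (pF FV :: int \<Rightarrow> ('k \<Rightarrow> 'v) set) (pS SW) (pG SW GW FW) (pF FW) (plift u) (plift b) r
     (\<lambda>f t. d (f t))"
proof -
  interpret PU: multimap "pS SV" "pG SV GV FV" "pF FV :: int \<Rightarrow> ('k \<Rightarrow> 'v) set" "pS SW" "pG SW GW FW" "pF FW" "plift u" 0 "r - 1"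
    by (rule U.p_multimap)
  interpret PW: mc_algebra "pS SW" "pG SW GW FW" "pF FW :: int \<Rightarrow> ('k \<Rightarrow> 'w) set" "plift b"
    by (rule W.p_mc_algebra)
  have UG: "PU.I xs A \<in> pG SW GW FW (sum_list ds)"
    if "lies_in (pG SV GV FV) xs ds" "A \<in> pG SV GV FV 0" "A \<in> pF FV 1" for xs ds A
    using PU.ins_G[OF that] by simp
  have Ap: "A t \<in> GV 0" "A t \<in> FV 1" if "A \<in> pG SV GV FV 0" "A \<in> pF FV 1" for A t
    using that U.V.pG_value by (auto simp: pF_iff[of A])
  show ?thesis
  proof
    show "(\<lambda>t. d ((x - y) t)) = (\<lambda>t. d (x t)) - (\<lambda>t. d (y t))" for x y by (auto simp: d_diff)
    show "(\<lambda>t. d (pS SV c x t)) = pS SV c (\<lambda>t. d (x t))" for c x by (auto simp: d_scale)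
    show "(\<lambda>t. d (x t)) \<in> pG SV GV FV (k + 1)" if "x \<in> pG SV GV FV k" for x k by (rule d_map[OF that])
    show "(\<lambda>t. d (x t)) \<in> pF FV p" if "x \<in> pF FV p" for x p using that d_F by (simp add: pF_iff)
    show "(\<lambda>t. d (d (x t))) = 0" if "x \<in> pG SV GV FV k" for x k
      using d_d[OF U.V.pG_value[OF that]] by auto
  next
    fix A assume A: "A \<in> pG SV GV FV 0" "A \<in> pF FV 1"
    show "PW.I [] (PU.I [] A) = PU.I [\<lambda>t. d (A t)] A"
    proof
      fix t
      have "PW.I [] (PU.I [] A) t = W.I [] (PU.I [] A t)"
        using W.ins_pointwise[of "[]" "[]" "PU.I [] A" t] UG[of "[]" "[]", OF _ A] by simp
      also have "PU.I [] A t = U.I [] (A t)" using U.ins_pointwise[of "[]" "[]" A t] A by simp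
      also have "W.I [] \<dots> = U.I [d (A t)] (A t)" by (rule curvature_image[OF Ap[OF A]])
      also have "\<dots> = PU.I [\<lambda>t. d (A t)] A t" using U.ins_pointwise[of "[\<lambda>t. d (A t)]" "[1]" A t] A d_map[OF A(1)] by simp
      finally show "PW.I [] (PU.I [] A) t = PU.I [\<lambda>t. d (A t)] A t" .
    qed
  next
    fix A x :: "'k \<Rightarrow> 'v" and k assume A: "A \<in> pG SV GV FV 0" "A \<in> pF FV 1" and dA: "(\<lambda>t. d (A t)) = 0"
      and x: "x \<in> pG SV GV FV k"
    show "PW.I [PU.I [x] A] (PU.I [] A) = PU.I [\<lambda>t. d (x t)] A"
    proof
      fix t
      have "PW.I [PU.I [x] A] (PU.I [] A) t = W.I [PU.I [x] A t] (PU.I [] A t)"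
        using W.ins_pointwise[of "[PU.I [x] A]" "[k]" "PU.I [] A" t] UG[of "[]" "[]", OF _ A] UG[of "[x]" "[k]", OF _ A] x by simp
      also have "PU.I [] A t = U.I [] (A t)" using U.ins_pointwise[of "[]" "[]" A t] A by simp
      also have "PU.I [x] A t = U.I [x t] (A t)" using U.ins_pointwise[of "[x]" "[k]" A t] A x by simp
      also have "W.I [U.I [x t] (A t)] (U.I [] (A t)) = U.I [d (x t)] (A t)"
        by (rule twisted_chain_map[OF Ap[OF A] _ U.V.pG_value[OF x]]) (use dA in \<open>auto simp: fun_eq_iff\<close>)
      also have "\<dots> = PU.I [\<lambda>t. d (x t)] A t"
        using U.ins_pointwise[of "[\<lambda>t. d (x t)]" "[k + 1]" A t] A d_map[OF x] by simp
      finally show "PW.I [PU.I [x] A] (PU.I [] A) t = PU.I [\<lambda>t. d (x t)] A t" .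
    qed
  qed
qed

interpretation P: abelian_morphism "pS SV" "pG SV GV FV" "pF FV :: int \<Rightarrow> ('k \<Rightarrow> 'v) set" "pS SW" "pG SW GW FW"
  "pF FW" "plift u" "plift b" r "\<lambda>f t. d (f t)"
  by (rule p_abelian_morphism)

lemma unary_map:
  "f \<in> pG SV GV FV k \<Longrightarrow> (\<lambda>s. u [f s]) \<in> pG SW GW FW k"
  "f \<in> pG SV GV FV k \<Longrightarrow> coef SW FW (\<lambda>s. u [f s]) = (\<lambda>i. u [coef SV FV f i])"
  using U.single_map[of f k] by simp_all

lemma bracket_map:
  "f \<in> pG SW GW FW k \<Longrightarrow> (\<lambda>s. b [f s]) \<in> pG SW GW FW (k + 1)"
  "f \<in> pG SW GW FW k \<Longrightarrow> coef SW FW (\<lambda>s. b [f s]) = (\<lambda>i. b [coef SW FW f i])"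
  using W.single_map[of f k] by simp_all

text \<open>
  The condition is applied to each coefficient. All but finitely many of them already lie in
  \<open>F (p + 1)\<close>, and the zero correction is chosen for those, which makes the corrections polynomials. The
  basis \<open>vbasis\<close> keeps them zero on \<open>E\<close>.
\<close>

lemma p_page_condition:
  assumes base: "page_condition UNIV UNIV" and E: "admissible E"
  shows "P.page_condition (vanish E) (vanish E)"
  unfolding P.page_condition_def
proof (intro allI impI)
  fix k p a c
  assume "a \<in> vanish E \<inter> pG SV GV FV (k + 1) \<inter> pF FV p" "c \<in> vanish E \<inter> pG SW GW FW k \<inter> pF FW p"
    and da: "(\<lambda>t. d (a t)) \<in> pF FV (p + r)" and uc: "plift u [a] - plift b [c] \<in> pF FW (p + r)"
  then have a: "a \<in> vanish E" "a \<in> pG SV GV FV (k + 1)" "a \<in> pF FV p"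
    and c: "c \<in> vanish E" "c \<in> pG SW GW FW k" "c \<in> pF FW p" by auto
  let ?a = "coef SV FV a" and ?c = "coef SW FW c"
  note aG = U.V.pG_coef[OF a(2)] and aF = U.V.coef_F[OF a(2,3)]
  note cG = U.W.pG_coef[OF c(2)] and cF = U.W.coef_F[OF c(2,3)]
  have da': "d (?a i) \<in> FV (p + r)" for i
    using U.V.coef_F[OF d_map[OF a(2)] da, of i] d_coef[OF a(2)] by simp
  have uc': "u [?a i] - b [?c i] \<in> FW (p + r)" for i
  proof -
    note ea = U.W.pG_expands[OF unary_map(1)[OF a(2)], unfolded unary_map(2)[OF a(2)]]
    note ec = U.W.pG_expands[OF bracket_map(1)[OF c(2)], unfolded bracket_map(2)[OF c(2)]]
    have "(\<lambda>t. u [a t]) - (\<lambda>t. b [c t]) \<in> pF FW (p + r)" using uc by (simp add: pF_iff plift_def)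
    then show ?thesis using U.W.expands_F[OF U.W.expands_diff[OF ea ec]] by blast
  qed
  \<comment> \<open>the coefficients that need a correction\<close>
  define X where "X = {i\<in>UNIV. ?a i \<notin> FV (p + 1)} \<union> {i\<in>UNIV. ?c i \<notin> FW (p + 1)}"
  have X: "finite X" unfolding X_def
    using U.V.pG_null[OF a(2)] U.W.pG_null[OF c(2)] unfolding nullf_def by simp
  have "\<exists>x y. (i \<notin> X \<longrightarrow> x = 0 \<and> y = 0) \<and> x \<in> GV k \<and> x \<in> FV (p - r + 1) \<and> y \<in> GW (k - 1) \<and> y \<in> FW (p - r + 1) \<and>
     d x \<in> FV p \<and> u [x] - b [y] \<in> FW p \<and> ?a i - d x \<in> FV (p + 1) \<and> ?c i - u [x] + b [y] \<in> FW (p + 1)" for i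
  proof (cases "i \<in> X")
    case True
    have "?a i \<in> UNIV \<inter> GV (k + 1) \<inter> FV p" "?c i \<in> UNIV \<inter> GW k \<inter> FW p" using aG aF cG cF by auto
    from base[unfolded page_condition_def, rule_format, OF this da' uc'] show ?thesis using True by blast
  next
    case False
    then have "?a i \<in> FV (p + 1)" "?c i \<in> FW (p + 1)" by (auto simp: X_def)
    then show ?thesis using U.f_zero[of "[]" "[]"] W.f_zero[of "[]" "[]"] by (intro exI[of _ 0]) simp
  qed
  then obtain x y where off: "\<And>i. i \<notin> X \<Longrightarrow> x i = 0" "\<And>i. i \<notin> X \<Longrightarrow> y i = 0"
    and x: "\<And>i. x i \<in> GV k" "\<And>i. x i \<in> FV (p - r + 1)" and y: "\<And>i. y i \<in> GW (k - 1)" "\<And>i. y i \<in> FW (p - r + 1)"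
    and xy: "\<And>i. d (x i) \<in> FV p" "\<And>i. u [x i] - b [y i] \<in> FW p"
      "\<And>i. ?a i - d (x i) \<in> FV (p + 1)" "\<And>i. ?c i - u [x i] + b [y i] \<in> FW (p + 1)"
    by metis
  define fx fy where "fx t = (\<Sum>i\<in>X. SV (vbasis E i t) (x i))" and "fy t = (\<Sum>i\<in>X. SW (vbasis E i t) (y i))" for t
  have dfx: "d (fx t) = (\<Sum>i\<in>X. SV (vbasis E i t) (d (x i)))" for t unfolding fx_def by (rule d_sum[OF X])
  have ub: "u [fx t] - b [fy t] = (\<Sum>i\<in>X. SW (vbasis E i t) (u [x i] - b [y i]))" for t
    unfolding fx_def fy_def U.unary_sum[OF X] W.unary_sum[OF X]
    by (simp add: U.W.scale_right_diff_distrib sum_subtractf)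
  have "fx \<in> vanish E \<inter> pG SV GV FV k \<inter> pF FV (p - r + 1)"
    using U.V.vbasis_sum[OF X x(1) E] x(2) unfolding fx_def[abs_def]
    by (auto simp: pF_iff intro!: U.V.F_sum U.V.F_scale)
  moreover have "fy \<in> vanish E \<inter> pG SW GW FW (k - 1) \<inter> pF FW (p - r + 1)"
    using U.W.vbasis_sum[OF X y(1) E] y(2) unfolding fy_def[abs_def]
    by (auto simp: pF_iff intro!: U.W.F_sum U.W.F_scale)
  moreover have "(\<lambda>t. d (fx t)) \<in> pF FV p"
    unfolding pF_iff dfx by (intro allI U.V.F_sum U.V.F_scale xy)
  moreover have "plift u [fx] - plift b [fy] \<in> pF FW p"
    unfolding pF_iff plift_def using ub by simp (intro allI U.W.F_sum U.W.F_scale xy)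
  moreover have "a - (\<lambda>t. d (fx t)) \<in> pF FV (p + 1)"
    unfolding pF_iff minus_apply dfx
    by (intro allI U.V.vbasis_approx[OF a(2,1) E X] xy) (simp add: off)
  moreover have "c - plift u [fx] + plift b [fy] \<in> pF FW (p + 1)"
    unfolding pF_iff
  proof
    fix t
    have "c t - (\<Sum>i\<in>X. SW (vbasis E i t) (u [x i] - b [y i])) \<in> FW (p + 1)"
      by (rule U.W.vbasis_approx[OF c(2,1) E X])
         (use off U.f_zero[of "[]" "[]"] W.f_zero[of "[]" "[]"] xy(4) in \<open>simp_all add: algebra_simps\<close>)
    then have "c t - (u [fx t] - b [fy t]) \<in> FW (p + 1)" unfolding ub .
    then show "(c - plift u [fx] + plift b [fy]) t \<in> FW (p + 1)" by (simp add: plift_def algebra_simps)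
  qed
  ultimately show "\<exists>x\<in>vanish E \<inter> pG SV GV FV k \<inter> pF FV (p - r + 1).
      \<exists>y\<in>vanish E \<inter> pG SW GW FW (k - 1) \<inter> pF FW (p - r + 1).
         (\<lambda>t. d (x t)) \<in> pF FV p \<and> plift u [x] - plift b [y] \<in> pF FW p \<and>
         a - (\<lambda>t. d (x t)) \<in> pF FV (p + 1) \<and> c - plift u [x] + plift b [y] \<in> pF FW (p + 1)" by blast
qed

lemma p_H1_condition:
  assumes base: "H1_condition UNIV" and E: "admissible E"
  shows "P.H1_condition (vanish E)"
  unfolding P.H1_condition_def
proof (intro allI impI ballI)
  fix q z assume q: "2 ^ q < r" and "z \<in> vanish E \<inter> pG SW GW FW 0 \<inter> pF FW (2 ^ q)"
    and bz: "plift b [z] \<in> pF FW (min (2 ^ (q + 1)) r)"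
  then have z: "z \<in> vanish E" "z \<in> pG SW GW FW 0" "z \<in> pF FW (2 ^ q)" by auto
  let ?M = "min (2 ^ (q + 1)) r" and ?c = "coef SW FW z"
  have bc: "b [?c i] \<in> FW ?M" for i
  proof -
    have "(\<lambda>t. b [z t]) \<in> pF FW ?M" using bz by (simp add: pF_iff plift_def)
    then show ?thesis using U.W.coef_F[OF bracket_map(1)[OF z(2)]] bracket_map(2)[OF z(2)] by metis
  qed
  define X where "X = {i\<in>UNIV. ?c i \<notin> FW ?M}"
  have X: "finite X" unfolding X_def using U.W.pG_null[OF z(2)] unfolding nullf_def by blast
  have "\<exists>y. (i \<notin> X \<longrightarrow> y = 0) \<and> y \<in> GW (-1) \<and> y \<in> FW (2 ^ q) \<and> ?c i - b [y] \<in> FW ?M" for i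
  proof (cases "i \<in> X")
    case True
    have "?c i \<in> UNIV \<inter> GW 0 \<inter> FW (2 ^ q)" using U.W.pG_coef[OF z(2)] U.W.coef_F[OF z(2,3)] by auto
    then show ?thesis using base bc q True unfolding H1_condition_def by blast
  next
    case False
    then show ?thesis using W.f_zero[of "[]" "[]"] by (intro exI[of _ 0]) (simp add: X_def)
  qed
  then obtain y where off: "\<And>i. i \<notin> X \<Longrightarrow> y i = 0"
    and y: "\<And>i. y i \<in> GW (-1)" "\<And>i. y i \<in> FW (2 ^ q)" "\<And>i. ?c i - b [y i] \<in> FW ?M" by metis
  define fy where "fy t = (\<Sum>i\<in>X. SW (vbasis E i t) (y i))" for t
  have bfy: "b [fy t] = (\<Sum>i\<in>X. SW (vbasis E i t) (b [y i]))" for t unfolding fy_def by (rule W.unary_sum[OF X])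
  have "fy \<in> vanish E \<inter> pG SW GW FW (-1) \<inter> pF FW (2 ^ q)"
    using U.W.vbasis_sum[OF X y(1) E] y(2) unfolding fy_def[abs_def]
    by (auto simp: pF_iff intro!: U.W.F_sum U.W.F_scale)
  moreover have "z - plift b [fy] \<in> pF FW ?M" unfolding pF_iff
  proof
    fix t
    have "z t - (\<Sum>i\<in>X. SW (vbasis E i t) (b [y i])) \<in> FW ?M"
      by (rule U.W.vbasis_approx[OF z(2,1) E X]) (use off W.f_zero[of "[]" "[]"] y(3) in auto)
    then show "(z - plift b [fy]) t \<in> FW ?M" by (simp add: plift_def bfy)
  qed
  ultimately show "\<exists>y\<in>vanish E \<inter> pG SW GW FW (-1) \<inter> pF FW (2 ^ q). z - plift b [y] \<in> pF FW ?M" by blast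
qed

text \<open>
  A flow in a direction that vanishes at \<open>s\<close> is constant at \<open>s\<close>.
\<close>

lemma p_ideal_pair: "P.ideal_pair (vanish E) (vanish E)"
  unfolding P.ideal_pair_def
proof (intro conjI allI ballI impI)
  show "P.U.V.subspace (vanish E)" "P.U.W.subspace (vanish E)"
    unfolding P.U.V.subspace_def P.U.W.subspace_def by (auto simp: vanish_def)
  show "v \<in> vanish E" if v: "\<forall>p. \<exists>j\<in>vanish E. v - j \<in> pF FV p" for v
    unfolding vanish_def
  proof (intro CollectI ballI U.V.hausdorff)
    fix s p assume s: "s \<in> E"
    obtain j where j: "j \<in> vanish E" "v - j \<in> pF FV p" using v by blast
    have "j s = 0" using j(1) s by (simp add: vanish_def)
    moreover have "v s - j s \<in> FV p" using j(2) by (simp add: pF_iff)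
    ultimately show "v s \<in> FV p" by simp
  qed
  show "v \<in> vanish E" if v: "\<forall>p. \<exists>j\<in>vanish E. v - j \<in> pF FW p" for v
    unfolding vanish_def
  proof (intro CollectI ballI U.W.hausdorff)
    fix s p assume s: "s \<in> E"
    obtain j where j: "j \<in> vanish E" "v - j \<in> pF FW p" using v by blast
    have "j s = 0" using j(1) s by (simp add: vanish_def)
    moreover have "v s - j s \<in> FW p" using j(2) by (simp add: pF_iff)
    ultimately show "v s \<in> FW p" by simp
  qed
  show "(\<lambda>t. d (x t)) \<in> vanish E" if "x \<in> vanish E" for x using that by (simp add: vanish_def)
  show "P.U.I [] a' - P.U.I [] a \<in> vanish E"
    if "a \<in> pG SV GV FV 0 \<inter> pF FV 1" "a' \<in> pG SV GV FV 0 \<inter> pF FV 1" "a' - a \<in> vanish E" for a a'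
    using that U.ins_pointwise[of "[]" "[]"] by (simp add: vanish_def)
  show "A 1 - a \<in> vanish E"
    if a: "a \<in> pG SW GW FW 0" and y: "y \<in> pG SW GW FW (-1) \<inter> vanish E" and A: "P.W.is_flow a y A" for a y A
    unfolding vanish_def
  proof (intro CollectI ballI)
    fix s assume s: "s \<in> E"
    have "W.is_flow (a s) (y s) (\<lambda>\<sigma>. A \<sigma> s)" using W.flow_eval[OF A] y by blast
    moreover have ys: "y s = 0" using y s by (simp add: vanish_def)
    ultimately have "(\<lambda>\<sigma>. A \<sigma> s) = (\<lambda>_. a s)"
      using W.flow_unique[OF W.flow_trivial[OF U.W.pG_value[OF a]] _ U.W.G_zero] by simp
    then show "(A 1 - a) s = 0" by (simp add: fun_eq_iff)
  qed
qed

lemma vanish_empty: "vanish {} = UNIV" by (simp add: vanish_def)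

end

section \<open>Connected components\<close>

context mc_algebra
begin

text \<open>
  The Maurer-Cartan equation of \<open>a(t) + \<beta>(t) dt\<close>, separated into its components.
\<close>

definition path :: "('k \<Rightarrow> 'w) \<Rightarrow> ('k \<Rightarrow> 'w) \<Rightarrow> bool" where
  "path a \<beta> \<longleftrightarrow> a \<in> pG S G F 0 \<and> \<beta> \<in> pG S G F (-1) \<and> IP [] a = 0 \<and> pD S F a = - IP [\<beta>] a"

definition joined :: "'w \<Rightarrow> 'w \<Rightarrow> bool" where
  "joined w w' \<longleftrightarrow> (\<exists>a \<beta>. path a \<beta> \<and> a 0 = w \<and> a 1 = w')"

lemma path_mc: assumes "path a \<beta>" shows "a t \<in> G 0" "I [] (a t) = 0"
  using assms V.pG_value ins_pointwise[of "[]" "[]" a t] unfolding path_def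
  by (auto simp: fun_eq_iff pF_iff)

lemma flow_joined:
  assumes fl: "is_flow a y A" and y: "y \<in> G (-1)" and mc: "I [] a = 0"
  shows "joined a (A 1)"
proof -
  have "path A (\<lambda>_. y)"
    unfolding path_def using flow_pG[OF fl] flow_pD[OF fl] flow_mc[OF fl y mc] V.pG_const[OF y] by simp
  then show ?thesis unfolding joined_def using flow_0[OF fl] by blast
qed

end

locale quasi_iso_pair = abelian_morphism SV GV FV SW GW FW u b r d
  for SV :: "'k::field_char_0 \<Rightarrow> 'v::ab_group_add \<Rightarrow> 'v" and GV FV
    and SW :: "'k \<Rightarrow> 'w::ab_group_add \<Rightarrow> 'w" and GW FW u b and r :: int and d +
  assumes page_base: "page_condition UNIV UNIV" and H1_base: "H1_condition UNIV"
begin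

lemma ideal_base: "ideal_pair UNIV UNIV"
  unfolding ideal_pair_def by simp

interpretation B: goldman_millson SV GV FV SW GW FW u b r d UNIV UNIV
  by unfold_locales (rule page_base H1_base ideal_base)+

interpretation P: abelian_morphism "pS SV" "pG SV GV FV" "pF FV :: int \<Rightarrow> ('k \<Rightarrow> 'v) set" "pS SW" "pG SW GW FW"
  "pF FW" "plift u" "plift b" r "\<lambda>f t. d (f t)"
  by (rule p_abelian_morphism)

interpretation P0: goldman_millson "pS SV" "pG SV GV FV" "pF FV :: int \<Rightarrow> ('k \<Rightarrow> 'v) set" "pS SW" "pG SW GW FW"
  "pF FW" "plift u" "plift b" r "\<lambda>f t. d (f t)" UNIV UNIV
  using p_page_condition[OF page_base, of "{}"] p_H1_condition[OF H1_base, of "{}"] p_ideal_pair[of "{}"]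
  by unfold_locales (simp_all add: vanish_empty)

interpretation P1: goldman_millson "pS SV" "pG SV GV FV" "pF FV :: int \<Rightarrow> ('k \<Rightarrow> 'v) set" "pS SW" "pG SW GW FW"
  "pF FW" "plift u" "plift b" r "\<lambda>f t. d (f t)" "vanish {0, 1}" "vanish {0, 1}"
  using p_page_condition[OF page_base, of "{0, 1}"] p_H1_condition[OF H1_base, of "{0, 1}"] p_ideal_pair[of "{0, 1}"]
  by unfold_locales simp_all

lemma path_flow:
  assumes p: "W.path a \<beta>" and fl: "P.W.is_flow a y A" and y: "y \<in> pG SW GW FW (-1)"
  shows "\<exists>\<beta>'. W.path (A 1) \<beta>'"
proof -
  have a: "a \<in> pG SW GW FW 0" and \<beta>: "\<beta> \<in> pG SW GW FW (-1)" and mc: "P.W.I [] a = 0"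
    and d: "pD SW FW a = - P.W.I [\<beta>] a" using p unfolding W.path_def by auto
  have "\<exists>\<beta>'\<in>pG SW GW FW (-1). pD SW FW (A 1) = - P.W.I [\<beta>'] (A 1)"
  proof (rule P.W.flow_transport[where \<delta> = "pD SW FW", OF _ _ _ _ _ fl y mc \<beta> d])
    show "pD SW FW x \<in> pG SW GW FW k" if "x \<in> pG SW GW FW k" for k x by (rule U.W.pD_in_pG[OF that])
    show "pD SW FW (x - y) = pD SW FW x - pD SW FW y" if "x \<in> pG SW GW FW k" "y \<in> pG SW GW FW k" for k x y
      by (rule U.W.pD_diff[OF that])
    show "pD SW FW (pS SW c x) = pS SW c (pD SW FW x)" if "x \<in> pG SW GW FW k" for k x c
      by (rule U.W.pD_scale[OF that])
    show "pD SW FW x \<in> pF FW p" if "x \<in> pG SW GW FW k" "x \<in> pF FW p" for k x p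
      by (rule U.W.pD_F[OF that])
    show "pD SW FW (P.W.I [x] a) = P.W.I [pD SW FW x] a + P.W.I [x, pD SW FW a] a"
      if "x \<in> pG SW GW FW (-1)" "a \<in> pG SW GW FW 0" for x a
      by (rule W.pD_ins1[OF that]) (simp add: pF_iff)
  qed
  then show ?thesis using P.W.flow_G[OF fl] P.W.flow_mc_end[OF fl y mc] unfolding W.path_def by blast
qed

lemma path_moves:
  assumes "(P.moves J)\<^sup>*\<^sup>* a a'" "W.path a \<beta>" shows "\<exists>\<beta>'. W.path a' \<beta>'"
  using assms
proof (induction rule: rtranclp_induct)
  case (step a' a'')
  then obtain \<beta>' y A where "W.path a' \<beta>'" "y \<in> pG SW GW FW (-1)" "P.W.is_flow a' y A" "A 1 = a''"
    unfolding P.moves_def by blast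
  then show ?case using path_flow by blast
qed blast

text \<open>
  The path is flowed as a family in the direction \<open>(1 - t) y\<close> or \<open>t y\<close>, which is \<open>y\<close> at the end \<open>e\<close> and \<open>0\<close> at the
  other end.
\<close>

lemma path_move_end:
  assumes p: "W.path a \<beta>" and ee: "(e, e') \<in> {(0, 1), (1, 0)}"
    and fl: "W.is_flow (a e) y A" and y: "y \<in> GW (-1)"
  shows "\<exists>a' \<beta>'. W.path a' \<beta>' \<and> a' e = A 1 \<and> a' e' = a e'"
proof -
  \<comment> \<open>a direction that is \<open>y\<close> at \<open>e\<close> and \<open>0\<close> at \<open>e'\<close>\<close>
  let ?Y = "\<lambda>t. SW (if e = 0 then 1 - t else t) y"
  have "(\<lambda>_. y) - (\<lambda>t. SW (t ^ 1) y) \<in> pG SW GW FW (-1)"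
    by (intro U.W.pG_diff U.W.pG_const U.W.pG_monom y)
  then have "(\<lambda>t. SW (1 - t) y) \<in> pG SW GW FW (-1)"
    by (simp add: fun_diff_def U.W.scale_left_diff_distrib)
  then have Y: "?Y \<in> pG SW GW FW (-1)" using U.W.pG_monom[OF y, of 1] by (cases "e = 0") simp_all
  have Ye: "?Y e = y" "?Y e' = 0" using ee by auto
  have a: "a \<in> pG SW GW FW 0" using p unfolding W.path_def by simp
  obtain B where B: "P.W.is_flow a ?Y B" using P.W.flow_exists[OF a Y] by blast
  obtain \<beta>' where "W.path (B 1) \<beta>'" using path_flow[OF p B Y] by blast
  moreover have "(\<lambda>s. B s e) = A"
    by (rule W.flow_unique[OF fl W.flow_eval[OF B Y, of e, unfolded Ye] y])
  then have "B 1 e = A 1" by (rule fun_cong)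
  moreover have "(\<lambda>s. B s e') = (\<lambda>_. a e')"
    by (rule W.flow_unique[OF W.flow_trivial[OF U.W.pG_value[OF a]] W.flow_eval[OF B Y, of e', unfolded Ye] U.W.G_zero])
  then have "B 1 e' = a e'" by (rule fun_cong)
  ultimately show ?thesis by blast
qed

lemma path_move_end_star:
  assumes "(moves UNIV)\<^sup>*\<^sup>* w w'" "W.path a \<beta>" "a e = w" and ee: "(e, e') \<in> {(0, 1), (1, 0)}"
  shows "\<exists>a' \<beta>'. W.path a' \<beta>' \<and> a' e = w' \<and> a' e' = a e'"
  using assms(1-3)
proof (induction arbitrary: a \<beta> rule: converse_rtranclp_induct)
  case (step w w1)
  obtain y A where yA: "y \<in> GW (-1)" "W.is_flow w y A" "A 1 = w1"
    using step(1) unfolding moves_def by blast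
  obtain a1 \<beta>1 where 1: "W.path a1 \<beta>1" "a1 e = w1" "a1 e' = a e'"
    using path_move_end[OF step.prems(1) ee _ yA(1), of A] yA step.prems(2) by blast
  then show ?case using step.IH[OF 1(1,2)] by auto
qed blast

text \<open>
  The linear interpolation of \<open>\<gamma>\<^sub>0\<close> and \<open>\<gamma>\<^sub>1\<close> is a first approximation of the family \<open>\<alpha>(t)\<close>: the images
  agree with the path at both ends. Surjectivity relative to the families vanishing at \<open>0\<close> and \<open>1\<close> turns it
  into a family of closed vectors with the same ends, and \<open>twisted_injectivity\<close>, for families without
  conditions at the ends, shows that its derivative is exact.
\<close>

lemma path_between_images:
  assumes p: "W.path a \<beta>" and ends: "a 0 = U.I [] \<gamma>0" "a 1 = U.I [] \<gamma>1"
    and \<gamma>0: "\<gamma>0 \<in> GV 0" "\<gamma>0 \<in> FV 1" "d \<gamma>0 = 0" and \<gamma>1: "\<gamma>1 \<in> GV 0" "\<gamma>1 \<in> FV 1" "d \<gamma>1 = 0"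
  shows "\<exists>x\<in>GV (-1). \<gamma>1 - \<gamma>0 = d x"
proof -
  have a: "a \<in> pG SW GW FW 0" and mc: "P.W.I [] a = 0" using p unfolding W.path_def by auto
  \<comment> \<open>the linear interpolation\<close>
  let ?\<alpha>0 = "(\<lambda>_. \<gamma>0) + (\<lambda>t. SV (t ^ 1) (\<gamma>1 - \<gamma>0))"
  have \<alpha>0: "?\<alpha>0 \<in> pG SV GV FV 0" by (intro U.V.pG_add U.V.pG_const U.V.pG_monom U.V.G_diff \<gamma>0 \<gamma>1)
  have \<alpha>0F: "?\<alpha>0 \<in> pF FV 1" unfolding pF_iff by (auto intro!: U.V.F_add U.V.F_scale U.V.F_diff \<gamma>0 \<gamma>1)
  have d\<alpha>0: "(\<lambda>t. d (?\<alpha>0 t)) = 0" using \<gamma>0 \<gamma>1 by (auto simp: d_add d_scale d_diff)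
  have "a - P.U.I [] ?\<alpha>0 \<in> vanish {0, 1}"
    using U.ins_pointwise[of "[]" "[]" ?\<alpha>0] \<alpha>0 \<alpha>0F ends by (simp add: vanish_def)
  from P1.surjectivity[OF a mc \<alpha>0 \<alpha>0F d\<alpha>0 this]
  obtain \<alpha> where \<alpha>: "\<alpha> \<in> pG SV GV FV 0" "\<alpha> \<in> pF FV 1" "(\<lambda>t. d (\<alpha> t)) = 0" "\<alpha> - ?\<alpha>0 \<in> vanish {0, 1}"
    and m: "(P.moves (vanish {0, 1}))\<^sup>*\<^sup>* a (P.U.I [] \<alpha>)" by blast
  obtain \<beta>' where p': "W.path (P.U.I [] \<alpha>) \<beta>'" using path_moves[OF m p] by blast
  then have \<beta>': "\<beta>' \<in> pG SW GW FW (-1)" "pD SW FW (P.U.I [] \<alpha>) = - P.W.I [\<beta>'] (P.U.I [] \<alpha>)"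
    unfolding W.path_def by auto
  have d\<alpha>: "pD SV FV \<alpha> \<in> pG SV GV FV 0" by (rule U.V.pD_in_pG[OF \<alpha>(1)])
  have "(\<lambda>t. d (pD SV FV \<alpha> t)) = pD SV FV (\<lambda>t. d (\<alpha> t))" using d_pD[OF \<alpha>(1)] by simp
  also have "\<dots> = 0" unfolding \<alpha>(3) using U.V.pD_const[OF U.V.G_zero] by (simp add: zero_fun_def)
  finally have closed: "(\<lambda>t. d (pD SV FV \<alpha> t)) = 0" .
  have "P.U.I [pD SV FV \<alpha>] \<alpha> = P.W.I [- \<beta>'] (P.U.I [] \<alpha>)"
    using U.pD_ins0[OF \<alpha>(1,2)] \<beta>'(2) P.W.ins_neg[of "[]" "[]" \<beta>' "-1" "[]" "[]" "P.U.I [] \<alpha>"] \<beta>'(1)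
      P.image_in_F(2)[OF \<alpha>(1,2)] by simp
  from P0.twisted_injectivity[OF refl refl \<alpha>(1,2,3) d\<alpha> closed P.U.W.G_neg[OF \<beta>'(1)] this]
  obtain X where X: "X \<in> pG SV GV FV (-1)" "(\<lambda>t. d (X t)) = pD SV FV \<alpha>" by blast
  let ?x = "pI SV FV X"
  have x: "?x \<in> pG SV GV FV (-1)" by (rule U.V.pI_in_pG[OF X(1)])
  let ?g = "\<alpha> - (\<lambda>t. d (?x t))"
  have dx: "(\<lambda>t. d (?x t)) \<in> pG SV GV FV 0" using d_map[OF x] by simp
  have "pD SV FV ?g = 0"
    using U.V.pD_diff[OF \<alpha>(1) dx] d_pD[OF x] U.V.pD_pI[OF X(1)] X(2) by simp
  then have "?g 1 = ?g 0" by (intro U.V.pD_zero_const[OF U.V.pG_diff[OF \<alpha>(1) dx]]) simp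
  then have "\<alpha> 1 - \<alpha> 0 = d (?x 1)" using U.V.pI_0[OF X(1)] by (simp add: algebra_simps)
  moreover have "\<alpha> 0 = \<gamma>0" "\<alpha> 1 = \<gamma>1" using \<alpha>(4) by (auto simp: vanish_def)
  ultimately show ?thesis using U.V.pG_value[OF x, of 1] by metis
qed

lemma reaches_image:
  assumes "w \<in> GW 0" "W.I [] w = 0"
  shows "\<exists>\<gamma>\<in>GV 0 \<inter> FV 1. d \<gamma> = 0 \<and> (moves UNIV)\<^sup>*\<^sup>* w (U.I [] \<gamma>)"
  using B.surjectivity[OF assms, of 0] by auto

lemma joined_images:
  assumes "W.joined w w'" "(moves UNIV)\<^sup>*\<^sup>* w (U.I [] \<gamma>0)" "(moves UNIV)\<^sup>*\<^sup>* w' (U.I [] \<gamma>1)"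
    and \<gamma>0: "\<gamma>0 \<in> GV 0" "\<gamma>0 \<in> FV 1" "d \<gamma>0 = 0" and \<gamma>1: "\<gamma>1 \<in> GV 0" "\<gamma>1 \<in> FV 1" "d \<gamma>1 = 0"
  shows "\<exists>x\<in>GV (-1). \<gamma>1 - \<gamma>0 = d x"
proof -
  obtain a \<beta> where a: "W.path a \<beta>" "a 0 = w" "a 1 = w'" using assms(1) unfolding W.joined_def by blast
  obtain a1 \<beta>1 where a1: "W.path a1 \<beta>1" "a1 0 = U.I [] \<gamma>0" "a1 1 = w'"
    using path_move_end_star[OF assms(2) a(1,2), of 1] a(3) by auto
  obtain a2 \<beta>2 where a2: "W.path a2 \<beta>2" "a2 1 = U.I [] \<gamma>1" "a2 0 = U.I [] \<gamma>0"
    using path_move_end_star[OF assms(3) a1(1,3), of 0] a1(2) by auto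
  show ?thesis by (rule path_between_images[OF a2(1,3,2) \<gamma>0 \<gamma>1])
qed

abbreviation "linked \<equiv> (\<lambda>x y. W.joined x y \<or> W.joined y x)\<^sup>*\<^sup>*"

lemma moves_linked:
  assumes "(moves UNIV)\<^sup>*\<^sup>* w w'" "w \<in> GW 0" "W.I [] w = 0"
  shows "linked w w'"
  using assms(1)
proof (induction rule: rtranclp_induct)
  case (step w1 w2)
  have "W.I [] w1 = 0" using B.moves_star[OF step(1) assms(2,3), of 0] by simp
  then have "W.joined w1 w2" using step(2) W.flow_joined unfolding moves_def by blast
  then show ?case using step(3) by (simp add: rtranclp.rtrancl_into_rtrancl)
qed simp

theorem components_surjective:
  assumes "w \<in> GW 0" "W.I [] w = 0"
  shows "\<exists>\<gamma>\<in>GV 0 \<inter> FV 1. d \<gamma> = 0 \<and> linked w (U.I [] \<gamma>)"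
  using reaches_image[OF assms] moves_linked[OF _ assms] by blast

text \<open>
  Along a chain of paths every vertex flows to some \<open>U\<^sub>\<star>(\<gamma>)\<close>, by surjectivity; \<open>\<gamma>\<close> changes by a
  boundary in each step. For a vertex, all choices of \<open>\<gamma>\<close> are considered, as its two neighbouring
  paths need not give the same one.
\<close>

theorem components_injective:
  assumes conn: "linked (U.I [] \<gamma>0) (U.I [] \<gamma>1)"
    and \<gamma>0: "\<gamma>0 \<in> GV 0" "\<gamma>0 \<in> FV 1" "d \<gamma>0 = 0" and \<gamma>1: "\<gamma>1 \<in> GV 0" "\<gamma>1 \<in> FV 1" "d \<gamma>1 = 0"
  shows "\<exists>x\<in>GV (-1). \<gamma>1 - \<gamma>0 = d x"
proof -
  have mc0: "U.I [] \<gamma>0 \<in> GW 0" "W.I [] (U.I [] \<gamma>0) = 0"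
    using image_in_F[OF \<gamma>0(1,2)] curvature_image[OF \<gamma>0(1,2)] \<gamma>0(3) U.ins_zero[of "[]" "[]"] by auto
  have joined_refl: "W.joined w w" if "w \<in> GW 0" "W.I [] w = 0" for w
    using W.flow_joined[OF W.flow_trivial[OF that(1)] U.W.G_zero that(2)] .
  \<comment> \<open>the induction along the chain, for all \<open>\<gamma>\<close> at once\<close>
  have "w \<in> GW 0 \<and> W.I [] w = 0 \<and> (\<forall>\<gamma>. \<gamma> \<in> GV 0 \<inter> FV 1 \<and> d \<gamma> = 0 \<and> (moves UNIV)\<^sup>*\<^sup>* w (U.I [] \<gamma>) \<longrightarrow>
          (\<exists>x\<in>GV (-1). \<gamma> - \<gamma>0 = d x))" if "linked (U.I [] \<gamma>0) w" for w
    using that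
  proof (induction rule: rtranclp_induct)
    case base
    show ?case using mc0 joined_images[OF joined_refl[OF mc0] _ _ \<gamma>0] by auto
  next
    case (step w w')
    then have w: "w \<in> GW 0" "W.I [] w = 0" by auto
    have j: "W.joined w w' \<or> W.joined w' w" using step(2) by auto
    then have w': "w' \<in> GW 0" "W.I [] w' = 0" unfolding W.joined_def using W.path_mc by blast+
    obtain \<gamma> where \<gamma>: "\<gamma> \<in> GV 0" "\<gamma> \<in> FV 1" "d \<gamma> = 0" "(moves UNIV)\<^sup>*\<^sup>* w (U.I [] \<gamma>)"
      using reaches_image[OF w] by blast
    obtain x where x: "x \<in> GV (-1)" "\<gamma> - \<gamma>0 = d x" using step.IH \<gamma> by blast
    have "\<exists>z\<in>GV (-1). \<gamma>' - \<gamma>0 = d z"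
      if \<gamma>': "\<gamma>' \<in> GV 0" "\<gamma>' \<in> FV 1" "d \<gamma>' = 0" "(moves UNIV)\<^sup>*\<^sup>* w' (U.I [] \<gamma>')" for \<gamma>'
      using j
    proof
      assume "W.joined w w'"
      from joined_images[OF this \<gamma>(4) \<gamma>'(4) \<gamma>(1-3) \<gamma>'(1-3)] obtain y where y: "y \<in> GV (-1)" "\<gamma>' - \<gamma> = d y" by blast
      have "\<gamma>' - \<gamma>0 = d (x + y)" using x(2) y(2) by (simp add: d_add algebra_simps)
      then show ?thesis using U.V.G_add[OF x(1) y(1)] by blast
    next
      assume "W.joined w' w"
      from joined_images[OF this \<gamma>'(4) \<gamma>(4) \<gamma>'(1-3) \<gamma>(1-3)] obtain y where y: "y \<in> GV (-1)" "\<gamma> - \<gamma>' = d y" by blast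
      have "\<gamma>' - \<gamma>0 = d (x - y)" unfolding d_diff x(2)[symmetric] y(2)[symmetric] by simp
      then show ?thesis using U.V.G_diff[OF x(1) y(1)] by blast
    qed
    then show ?case using w' by blast
  qed
  then show ?thesis using conn \<gamma>1 by blast
qed

end

section \<open>Reading off the structure equations\<close>

abbreviation (input) unshuffle :: "nat \<Rightarrow> nat set \<Rightarrow> nat list" where
  "unshuffle n I \<equiv> sorted_list_of_set I @ sorted_list_of_set ({..<n} - I)"

definition lin :: "('k::field \<Rightarrow> 'w \<Rightarrow> 'w) \<Rightarrow> ('a \<Rightarrow> 'w::ab_group_add) \<Rightarrow> ('a \<Rightarrow>\<^sub>0 'k) \<Rightarrow> 'w" where
  "lin S \<phi> x = (\<Sum>w\<in>Poly_Mapping.keys x. S (Poly_Mapping.lookup x w) (\<phi> w))"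

lemma lookup_smul [simp]: "Poly_Mapping.lookup (smul c x) w = c * Poly_Mapping.lookup x w"
  by (simp add: smul_def Poly_Mapping.map.rep_eq when_def)

lemma module_smul: "module (smul :: 'k::field \<Rightarrow> ('a \<Rightarrow>\<^sub>0 'k) \<Rightarrow> _)"
  by unfold_locales (auto intro!: poly_mapping_eqI simp: lookup_add algebra_simps)

lemma keys_smul: "Poly_Mapping.keys (smul c x) \<subseteq> Poly_Mapping.keys x"
  by (auto simp: in_keys_iff)

context
  fixes S :: "'k::field \<Rightarrow> 'w::ab_group_add \<Rightarrow> 'w"
  assumes S: "vector_space S"
begin

interpretation vector_space S by (rule S)

lemma lin_superset:
  "finite A \<Longrightarrow> Poly_Mapping.keys x \<subseteq> A \<Longrightarrow> lin S \<phi> x = (\<Sum>w\<in>A. S (Poly_Mapping.lookup x w) (\<phi> w))"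
  unfolding lin_def by (rule sum.mono_neutral_left) (auto simp: in_keys_iff)

lemma lin_add: "lin S \<phi> (x + y) = lin S \<phi> x + lin S \<phi> y"
proof -
  let ?A = "Poly_Mapping.keys x \<union> Poly_Mapping.keys y"
  have "lin S \<phi> (x + y) = (\<Sum>w\<in>?A. S (Poly_Mapping.lookup (x + y) w) (\<phi> w))"
    by (rule lin_superset) (use Poly_Mapping.keys_add[of x y] in auto)
  also have "\<dots> = lin S \<phi> x + lin S \<phi> y"
    using lin_superset[of ?A x \<phi>] lin_superset[of ?A y \<phi>]
    by (simp add: lookup_add scale_left_distrib sum.distrib)
  finally show ?thesis .
qed

lemma lin_smul: "lin S \<phi> (smul c x) = S c (lin S \<phi> x)"
proof -
  have "lin S \<phi> (smul c x) = (\<Sum>w\<in>Poly_Mapping.keys x. S (Poly_Mapping.lookup (smul c x) w) (\<phi> w))"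
    by (rule lin_superset) (simp_all add: keys_smul)
  then show ?thesis by (simp add: lin_def[of S \<phi> x] scale_sum_right)
qed

lemma lin_diff: "lin S \<phi> (x - y) = lin S \<phi> x - lin S \<phi> y"
  using lin_add[of \<phi> "x - y" y] by simp

lemma lin_word: "lin S \<phi> (word w) = \<phi> w"
  unfolding lin_def word_def by simp

lemma lin_zero: "lin S \<phi> 0 = 0"
  by (simp add: lin_def)

lemma lin_sum: "lin S \<phi> (\<Sum>i\<in>A. g i) = (\<Sum>i\<in>A. lin S \<phi> (g i))"
  by (induction A rule: infinite_finite_induct) (auto simp: lin_add lin_zero)

lemma lin_linear_extension: "lin S \<phi> (linear_extension g x) = lin S (\<lambda>w. lin S \<phi> (g w)) x"
  unfolding linear_extension_def lin_sum lin_smul by (simp add: lin_def[of S _ x])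

lemma lin_sym_relations:
  fixes V :: "('k, 'v::ab_group_add) bracket_space"
  assumes x: "x \<in> sym_relations V"
    and add: "\<And>xs a b ys. \<phi> (xs @ (a + b) # ys) = \<phi> (xs @ a # ys) + \<phi> (xs @ b # ys)"
    and scale: "\<And>xs c a ys. \<phi> (xs @ scl V c a # ys) = S c (\<phi> (xs @ a # ys))"
    and sym: "\<And>xs ys i j a b. a \<in> grd V i \<Longrightarrow> b \<in> grd V j \<Longrightarrow>
                \<phi> (xs @ a # b # ys) = S (parity_sign (i * j)) (\<phi> (xs @ b # a # ys))"
  shows "lin S \<phi> x = 0"
proof -
  have sub: "module.subspace smul {x. lin S \<phi> x = 0}"
    unfolding module.subspace_def[OF module_smul] by (auto simp: lin_add lin_smul lin_zero)
  have "sym_relations V \<subseteq> {x. lin S \<phi> x = 0}"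
    unfolding sym_relations_def
  proof (rule module.span_minimal[OF module_smul _ sub], intro Un_least)
    show "{word (xs @ a # b # ys) - smul (parity_sign (i * j)) (word (xs @ b # a # ys))
        | xs a b ys i j. a \<in> grd V i \<and> b \<in> grd V j} \<subseteq> {x. lin S \<phi> x = 0}"
    proof
      fix x :: "'v list \<Rightarrow>\<^sub>0 'k" assume "x \<in> {word (xs @ a # b # ys) - smul (parity_sign (i * j)) (word (xs @ b # a # ys))
        | xs a b ys i j. a \<in> grd V i \<and> b \<in> grd V j}"
      then obtain xs a b ys i j where x: "x = word (xs @ a # b # ys) - smul (parity_sign (i * j)) (word (xs @ b # a # ys))"
        and "a \<in> grd V i" "b \<in> grd V j" by blast
      from sym[OF this(2,3), of xs ys] show "x \<in> {x. lin S \<phi> x = 0}"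
        unfolding x mem_Collect_eq lin_diff lin_smul lin_word by simp
    qed
  qed (auto simp: lin_diff lin_smul lin_word add scale)
  then show ?thesis using x by blast
qed

end

text \<open>
  The projection of \<open>S\<^sup>+(V)\<close> onto \<open>V\<close>. As a map on words it respects the symmetry relations, so that it
  converts identities modulo \<^const>\<open>sym_relations\<close> into identities in \<open>V\<close>.
\<close>

definition letter :: "'v list \<Rightarrow> 'v::zero" where
  "letter w = (if length w = 1 then hd w else 0)"

lemma lin_letter_sym_relations:
  fixes V :: "('k::field, 'v::ab_group_add) bracket_space"
  assumes V: "vector_space (scl V)" and x: "x \<in> sym_relations V"
  shows "lin (scl V) letter x = 0"
proof (rule lin_sym_relations[OF V x])
  interpret vector_space "scl V" by (rule V)
  show "letter (xs @ (a + b) # ys) = letter (xs @ a # ys) + letter (xs @ b # ys)" for xs ys :: "'v list" and a b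
    by (cases xs) (auto simp: letter_def)
  show "letter (xs @ scl V c a # ys) = scl V c (letter (xs @ a # ys))" for xs c a ys
    by (cases xs) (auto simp: letter_def)
  show "letter (xs @ a # b # ys) = scl V (parity_sign (i * j)) (letter (xs @ b # a # ys))" for xs ys :: "'v list" and a b i j
    by (simp add: letter_def)
qed

text \<open>
  Brackets and morphisms are families \<open>f\<close> indexed by nonempty words; this normalises them on the empty one.
\<close>

definition nilz :: "('v list \<Rightarrow> 'w) \<Rightarrow> 'v list \<Rightarrow> 'w::zero" where
  "nilz f w = (if w = [] then 0 else f w)"

lemma koszul_one:
  assumes "\<And>A B. A < B \<Longrightarrow> B < length js \<Longrightarrow> js ! B < js ! A \<Longrightarrow>
     even (hdeg V (vs ! (js ! A)) * hdeg V (vs ! (js ! B)))"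
  shows "koszul V vs js = (1 :: 'k::field)"
  unfolding koszul_def by (rule prod.neutral) (use assms in \<open>auto simp: parity_sign_def\<close>)

lemma koszul_single:
  assumes "A0 < B0" "B0 < length js" "js ! B0 < js ! A0"
    and "\<And>A B. A < B \<Longrightarrow> B < length js \<Longrightarrow> js ! B < js ! A \<Longrightarrow> (A, B) \<noteq> (A0, B0) \<Longrightarrow>
     even (hdeg V (vs ! (js ! A)) * hdeg V (vs ! (js ! B)))"
  shows "koszul V vs js = (parity_sign (hdeg V (vs ! (js ! A0)) * hdeg V (vs ! (js ! B0))) :: 'k::field)"
proof -
  let ?X = "{(A, B). A < B \<and> B < length js \<and> js ! B < js ! A}"
  let ?g = "\<lambda>(A, B). parity_sign (hdeg V (vs ! (js ! A)) * hdeg V (vs ! (js ! B))) :: 'k"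
  have "finite ?X" by (rule finite_subset[of _ "{..<length js} \<times> {..<length js}"]) auto
  then have "prod ?g ?X = ?g (A0, B0) * prod ?g (?X - {(A0, B0)})"
    by (rule prod.remove) (use assms in auto)
  moreover have "prod ?g (?X - {(A0, B0)}) = 1"
  proof (rule prod.neutral, rule ballI)
    fix p assume p: "p \<in> ?X - {(A0, B0)}"
    obtain A B where AB: "p = (A, B)" by (cases p)
    have "even (hdeg V (vs ! (js ! A)) * hdeg V (vs ! (js ! B)))"
      by (rule assms(4)) (use p AB in auto)
    then show "?g p = 1" by (auto simp: AB parity_sign_def)
  qed
  ultimately show ?thesis unfolding koszul_def by simp
qed

text \<open>
  A summand of the coderivation has one letter only if all positions are contracted.
\<close>

lemma lin_letter_coderivation:
  assumes V: "vector_space (scl V)"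
  shows "lin (scl V) letter (coderivation V w) = nilz (brk V) w"
proof -
  interpret vector_space "scl V" by (rule V)
  let ?n = "length w"
  let ?js = "\<lambda>I. unshuffle ?n I"
  let ?t = "\<lambda>I. scl V (koszul V w (?js I)) (letter (brk V (nths w I) # nths w ({..<?n} - I)))"
  have "lin (scl V) letter (coderivation V w) = (\<Sum>I | I \<subseteq> {..<?n} \<and> I \<noteq> {}. ?t I)"
    unfolding coderivation_def by (simp add: lin_sum[OF V] lin_smul[OF V] lin_word[OF V])
  also have "\<dots> = (\<Sum>I\<in>{I. I \<subseteq> {..<?n} \<and> I \<noteq> {} \<and> I = {..<?n}}. ?t I)"
  proof (rule sum.mono_neutral_right)
    show "\<forall>I\<in>{I. I \<subseteq> {..<?n} \<and> I \<noteq> {}} - {I. I \<subseteq> {..<?n} \<and> I \<noteq> {} \<and> I = {..<?n}}. ?t I = 0"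
    proof
      fix I assume "I \<in> {I. I \<subseteq> {..<?n} \<and> I \<noteq> {}} - {I. I \<subseteq> {..<?n} \<and> I \<noteq> {} \<and> I = {..<?n}}"
      then obtain i where i: "i < ?n" "i \<notin> I" by auto
      then have "w ! i \<in> set (nths w ({..<?n} - I))" by (auto simp: set_nths)
      then have "nths w ({..<?n} - I) \<noteq> []" by auto
      then show "?t I = 0" by (simp add: letter_def)
    qed
  qed auto
  also have "\<dots> = nilz (brk V) w"
  proof (cases "w = []")
    case False
    have "koszul V w (?js {..<?n}) = 1"
    proof (rule koszul_one)
      fix A B assume "A < B" "B < length (?js {..<?n})" "?js {..<?n} ! B < ?js {..<?n} ! A"
      then show "even (hdeg V (w ! (?js {..<?n} ! A)) * hdeg V (w ! (?js {..<?n} ! B)))"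
        by (simp add: lessThan_atLeast0 )
    qed
    moreover have "{I. I \<subseteq> {..<?n} \<and> I \<noteq> {} \<and> I = {..<?n}} = {{..<?n}}" using False by auto
    moreover have "nths w {..<?n} = w" by (simp add: nths_all)
    ultimately show ?thesis using False by (simp add: letter_def nilz_def)
  qed (auto simp: nilz_def intro!: sum.neutral)
  finally show ?thesis .
qed

text \<open>
  The empty set may be included among the subsets \<open>I\<close>, because of \<^const>\<open>nilz\<close>; sums over all subsets are
  easier to split.
\<close>

lemma coderivation_square:
  assumes "shifted_Linf_algebra V" "homogeneous_word V vs"
  shows "(\<Sum>I\<in>Pow {..<length vs}.
     scl V (koszul V vs (unshuffle (length vs) I))
       (nilz (brk V) (nilz (brk V) (nths vs I) # nths vs ({..<length vs} - I)))) = 0"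
proof -
  have V: "vector_space (scl V)" using assms(1) unfolding shifted_Linf_algebra_def graded_space_def by blast
  interpret vector_space "scl V" by (rule V)
  let ?n = "length vs"
  let ?k = "\<lambda>I. koszul V vs (unshuffle ?n I)"
  have zero: "brk V (0 # ys) = 0" for ys
  proof -
    have "multilinear_on_lists (scl V) (scl V) (brk V)" using assms(1) unfolding shifted_Linf_algebra_def by blast
    then have "brk V ([] @ scl V 0 0 # ys) = scl V 0 (brk V ([] @ 0 # ys))" unfolding multilinear_on_lists_def by blast
    then show ?thesis by simp
  qed
  have "0 = lin (scl V) letter (linear_extension (coderivation V) (coderivation V vs))"
    using lin_letter_sym_relations[OF V] assms unfolding shifted_Linf_algebra_def by metis
  also have "\<dots> = lin (scl V) (nilz (brk V)) (coderivation V vs)"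
    unfolding lin_linear_extension[OF V] lin_letter_coderivation[OF V] ..
  also have "\<dots> = (\<Sum>I | I \<subseteq> {..<?n} \<and> I \<noteq> {}. scl V (?k I) (nilz (brk V) (brk V (nths vs I) # nths vs ({..<?n} - I))))"
    unfolding coderivation_def by (simp add: lin_sum[OF V] lin_smul[OF V] lin_word[OF V])
  also have "\<dots> = (\<Sum>I\<in>Pow {..<?n}. scl V (?k I) (nilz (brk V) (nilz (brk V) (nths vs I) # nths vs ({..<?n} - I))))"
  proof (rule sum.mono_neutral_cong_left)
    show "\<forall>I\<in>Pow {..<?n} - {I. I \<subseteq> {..<?n} \<and> I \<noteq> {}}.
       scl V (?k I) (nilz (brk V) (nilz (brk V) (nths vs I) # nths vs ({..<?n} - I))) = 0"
      using zero by (auto simp: nilz_def)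
    fix I assume "I \<in> {I. I \<subseteq> {..<?n} \<and> I \<noteq> {}}"
    then obtain i where "i \<in> I" "i < ?n" by auto
    then have "vs ! i \<in> set (nths vs I)" by (auto simp: set_nths)
    then have "nths vs I \<noteq> []" by auto
    then show "scl V (?k I) (nilz (brk V) (brk V (nths vs I) # nths vs ({..<?n} - I)))
      = scl V (?k I) (nilz (brk V) (nilz (brk V) (nths vs I) # nths vs ({..<?n} - I)))" by (simp add: nilz_def)
  qed auto
  finally show ?thesis by simp
qed

definition ordered_partitions :: "'a set \<Rightarrow> 'a set list set" where
  "ordered_partitions A = {Is. distinct Is \<and> partition_on A (set Is)}"

lemma finite_ordered_partitions: "finite A \<Longrightarrow> finite (ordered_partitions A)"
  by (rule finite_subset[OF _ finite_subset_distinct[of "Pow A"]])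
     (auto simp: ordered_partitions_def partition_on_def)

lemma ordered_partitions_Nil: "[] \<in> ordered_partitions A \<longleftrightarrow> A = {}"
  by (auto simp: ordered_partitions_def partition_on_def)

lemma ordered_partitions_Cons:
  "I # Is \<in> ordered_partitions A \<longleftrightarrow> I \<noteq> {} \<and> I \<subseteq> A \<and> Is \<in> ordered_partitions (A - I)"
proof
  assume l: "I # Is \<in> ordered_partitions A"
  then have "I \<inter> J = {}" if "J \<in> set Is" for J
    using that unfolding ordered_partitions_def partition_on_def disjoint_def by auto
  then have "\<Union>(set Is) = A - I" using l unfolding ordered_partitions_def partition_on_def by auto
  then show "I \<noteq> {} \<and> I \<subseteq> A \<and> Is \<in> ordered_partitions (A - I)"
    using l unfolding ordered_partitions_def partition_on_def disjoint_def by auto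
next
  assume r: "I \<noteq> {} \<and> I \<subseteq> A \<and> Is \<in> ordered_partitions (A - I)"
  then have u: "\<Union>(set Is) = A - I" unfolding ordered_partitions_def partition_on_def by auto
  then have d: "I \<inter> J = {}" if "J \<in> set Is" for J using that by blast
  then have "I \<notin> set Is" using r by blast
  then show "I # Is \<in> ordered_partitions A"
    using r u d unfolding ordered_partitions_def partition_on_def disjoint_def by auto
qed

text \<open>
  A summand has one letter only if the partition has one block.
\<close>

lemma lin_letter_coalgebra_morphism:
  assumes W: "vector_space (scl W)"
  shows "lin (scl W) letter (coalgebra_morphism V U w) = nilz U w"
proof -
  interpret vector_space "scl W" by (rule W)
  let ?n = "length w"
  let ?t = "\<lambda>Is. scl W (koszul V w (concat (map sorted_list_of_set Is)) / fact (length Is)) (letter (map (\<lambda>I. U (nths w I)) Is))"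
  have "lin (scl W) letter (coalgebra_morphism V U w) = (\<Sum>Is\<in>ordered_partitions {..<?n}. ?t Is)"
    unfolding coalgebra_morphism_def ordered_partitions_def by (simp add: lin_sum[OF W] lin_smul[OF W] lin_word[OF W])
  also have "\<dots> = (\<Sum>Is\<in>{Is\<in>ordered_partitions {..<?n}. length Is = 1}. ?t Is)"
    by (rule sum.mono_neutral_right) (auto simp: letter_def finite_ordered_partitions)
  also have "{Is\<in>ordered_partitions {..<?n}. length Is = 1} = (if w = [] then {} else {[{..<?n}]})"
    by (auto simp: length_Suc_conv ordered_partitions_Cons ordered_partitions_Nil lessThan_empty_iff)
  also have "(\<Sum>Is\<in>\<dots>. ?t Is) = nilz U w"
  proof (cases "w = []")
    case False
    have "koszul V w (concat (map sorted_list_of_set [{..<?n}])) = 1"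
    proof (rule koszul_one)
      fix A B assume "A < B" "B < length (concat (map sorted_list_of_set [{..<?n}]))"
        "concat (map sorted_list_of_set [{..<?n}]) ! B < concat (map sorted_list_of_set [{..<?n}]) ! A"
      then show "even (hdeg V (w ! (concat (map sorted_list_of_set [{..<?n}]) ! A)) * hdeg V (w ! (concat (map sorted_list_of_set [{..<?n}]) ! B)))"
        by (simp add: lessThan_atLeast0)
    qed
    then show ?thesis using False by (simp add: letter_def nilz_def nths_all)
  qed (simp add: nilz_def)
  finally show ?thesis .
qed

lemma morphism_equation:
  assumes V: "vector_space (scl V)" and W: "vector_space (scl W)"
    and U: "infinity_morphism V W U" and vs: "homogeneous_word V vs"
  shows "(\<Sum>I | I \<subseteq> {..<length vs} \<and> I \<noteq> {}.
     scl W (koszul V vs (unshuffle (length vs) I))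
       (nilz U (brk V (nths vs I) # nths vs ({..<length vs} - I))))
   = (\<Sum>Is\<in>ordered_partitions {..<length vs}.
     scl W (koszul V vs (concat (map sorted_list_of_set Is)) / fact (length Is))
       (nilz (brk W) (map (\<lambda>I. U (nths vs I)) Is)))"
proof -
  interpret vector_space "scl W" by (rule W)
  have "lin (scl W) letter (linear_extension (coalgebra_morphism V U) (coderivation V vs)
        - linear_extension (coderivation W) (coalgebra_morphism V U vs)) = 0"
    using lin_letter_sym_relations[OF W] U vs unfolding infinity_morphism_def by blast
  then have "lin (scl W) (nilz U) (coderivation V vs) = lin (scl W) (nilz (brk W)) (coalgebra_morphism V U vs)"
    unfolding lin_diff[OF W] lin_linear_extension[OF W] lin_letter_coderivation[OF W]
      lin_letter_coalgebra_morphism[OF W] by simp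
  then show ?thesis
    unfolding coderivation_def coalgebra_morphism_def ordered_partitions_def
    by (simp add: lin_sum[OF W] lin_smul[OF W] lin_word[OF W])
qed

section \<open>Sums over subsets and ordered partitions\<close>

lemma (in vector_space) sum_Pow_card:
  assumes "finite A"
  shows "(\<Sum>I\<in>Pow A. g (card I)) = (\<Sum>i\<le>card A. scale (of_nat (card A choose i)) (g i))"
proof -
  have "(\<Sum>I\<in>Pow A. g (card I)) = (\<Sum>i\<le>card A. \<Sum>I | I \<in> Pow A \<and> card I = i. g (card I))"
    by (rule sum.group[symmetric]) (use assms in \<open>auto intro: card_mono\<close>)
  also have "\<dots> = (\<Sum>i\<le>card A. scale (of_nat (card A choose i)) (g i))"
  proof (rule sum.cong[OF refl])
    fix i
    have "(\<Sum>I | I \<in> Pow A \<and> card I = i. g (card I)) = (\<Sum>I | I \<in> Pow A \<and> card I = i. g i)" by (rule sum.cong) auto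
    also have "\<dots> = scale (of_nat (card {I. I \<in> Pow A \<and> card I = i})) (g i)" by (simp add: sum_constant_scale)
    also have "card {I. I \<in> Pow A \<and> card I = i} = card A choose i" using n_subsets[OF assms, of i] by simp
    finally show "(\<Sum>I | I \<in> Pow A \<and> card I = i. g (card I)) = scale (of_nat (card A choose i)) (g i)" .
  qed
  finally show ?thesis .
qed

lemma sum_Pow_Suc:
  fixes g :: "nat set \<Rightarrow> 'w::comm_monoid_add"
  shows "(\<Sum>I\<in>Pow {..<Suc n}. g I) = (\<Sum>I\<in>Pow {..<n}. g (Suc ` I) + g (insert 0 (Suc ` I)))"
proof -
  have inj: "inj_on (image Suc) (Pow {..<n})" by (simp add: inj_on_def inj_image_eq_iff)
  have P: "Pow (Suc ` {..<n}) = image Suc ` Pow {..<n}"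
    by (rule image_Pow_surj[OF refl, symmetric])
  have "Pow {..<Suc n} = Pow (Suc ` {..<n}) \<union> insert 0 ` Pow (Suc ` {..<n})"
    unfolding lessThan_Suc_eq_insert_0 by (rule Pow_insert)
  also have "(\<Sum>I\<in>\<dots>. g I) = (\<Sum>I\<in>Pow (Suc ` {..<n}). g I) + (\<Sum>I\<in>insert 0 ` Pow (Suc ` {..<n}). g I)"
    by (rule sum.union_disjoint) auto
  also have "(\<Sum>I\<in>insert 0 ` Pow (Suc ` {..<n}). g I) = (\<Sum>I\<in>Pow (Suc ` {..<n}). g (insert 0 I))"
  proof (rule sum.reindex_cong[OF _ refl])
    show "inj_on (insert 0) (Pow (Suc ` {..<n}))"
    proof (rule inj_onI)
      fix I J assume IJ: "I \<in> Pow (Suc ` {..<n})" "J \<in> Pow (Suc ` {..<n})" "insert 0 I = insert 0 J"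
      then have "0 \<notin> I" "0 \<notin> J" by auto
      then show "I = J" using IJ(3) by (metis insert_ident)
    qed
  qed simp
  finally show ?thesis unfolding P sum.reindex[OF inj] by (simp add: sum.distrib)
qed

text \<open>
  The possible lists of block sizes of an ordered partition of \<open>n\<close> positions.
\<close>

definition compositions :: "nat \<Rightarrow> nat list set" where
  "compositions n = {ns. sum_list ns = n \<and> 0 \<notin> set ns}"

lemma length_compositions: "0 \<notin> set ns \<Longrightarrow> length ns \<le> sum_list ns"
  by (induction ns) auto

lemma finite_compositions: "finite (compositions n)"
proof (rule finite_subset)
  show "compositions n \<subseteq> {ns. set ns \<subseteq> {..n} \<and> length ns \<le> n}"
    using length_compositions member_le_sum_list by (fastforce simp: compositions_def)
  show "finite {ns. set ns \<subseteq> {..n} \<and> length ns \<le> n}" by (rule finite_lists_length_le) simp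
qed

lemma compositions_0: "compositions 0 = {[]}"
proof -
  have "ns = []" if "ns \<in> compositions 0" for ns
  proof -
    have ns: "sum_list ns = 0 \<and> 0 \<notin> set ns" using that unfolding compositions_def mem_Collect_eq .
    have "length ns \<le> 0" using length_compositions[OF conjunct2[OF ns]] unfolding conjunct1[OF ns] .
    then show ?thesis by simp
  qed
  then show ?thesis by (auto simp: compositions_def)
qed

lemma sum_compositions:
  fixes g :: "nat list \<Rightarrow> 'w::comm_monoid_add"
  assumes "n > 0"
  shows "(\<Sum>ns\<in>compositions n. g ns) = (\<Sum>i\<in>{1..n}. \<Sum>ns\<in>compositions (n - i). g (i # ns))"
proof -
  have "(\<Sum>i\<in>{1..n}. \<Sum>ns\<in>compositions (n - i). g (i # ns)) = (\<Sum>(i, ns)\<in>Sigma {1..n} (\<lambda>i. compositions (n - i)). g (i # ns))"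
    by (rule sum.Sigma) (auto simp: finite_compositions)
  also have "\<dots> = (\<Sum>ns\<in>compositions n. g ns)"
  proof (rule sum.reindex_bij_witness[where i = "\<lambda>ns. (hd ns, tl ns)" and j = "\<lambda>(i, ns). i # ns"])
    fix ns assume ns: "ns \<in> compositions n"
    then obtain m ms where "ns = m # ms" using assms by (cases ns) (auto simp: compositions_def)
    then show "(case (hd ns, tl ns) of (i, ns) \<Rightarrow> i # ns) = ns"
      "(hd ns, tl ns) \<in> Sigma {1..n} (\<lambda>i. compositions (n - i))" using ns by (auto simp: compositions_def)
  qed (auto simp: compositions_def)
  finally show ?thesis by simp
qed

lemma sum_ordered_partitions_Cons:
  fixes g :: "'a set list \<Rightarrow> 'w::comm_monoid_add"
  assumes "finite A" "A \<noteq> {}"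
  shows "(\<Sum>Is\<in>ordered_partitions A. g Is) = (\<Sum>I\<in>Pow A - {{}}. \<Sum>Is\<in>ordered_partitions (A - I). g (I # Is))"
proof -
  have "(\<Sum>I\<in>Pow A - {{}}. \<Sum>Is\<in>ordered_partitions (A - I). g (I # Is))
      = (\<Sum>(I, Is)\<in>Sigma (Pow A - {{}}) (\<lambda>I. ordered_partitions (A - I)). g (I # Is))"
    by (rule sum.Sigma) (use assms finite_ordered_partitions in auto)
  also have "\<dots> = (\<Sum>Is\<in>ordered_partitions A. g Is)"
  proof (rule sum.reindex_bij_witness[where i = "\<lambda>ns. (hd ns, tl ns)" and j = "\<lambda>(i, ns). i # ns"])
    fix Is assume Is: "Is \<in> ordered_partitions A"
    then obtain J Js where "Is = J # Js" using assms by (cases Is) (auto simp: ordered_partitions_Nil)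
    then show "(case (hd Is, tl Is) of (i, ns) \<Rightarrow> i # ns) = Is"
      "(hd Is, tl Is) \<in> Sigma (Pow A - {{}}) (\<lambda>I. ordered_partitions (A - I))"
      using Is by (auto simp: ordered_partitions_Cons)
  qed (auto simp: ordered_partitions_Cons)
  finally show ?thesis by simp
qed

abbreviation prod_fact :: "nat list \<Rightarrow> 'k::field_char_0" where
  "prod_fact ns \<equiv> prod_list (map fact ns)"

text \<open>
  There are \<open>n! / (n\<^sub>1! \<cdots> n\<^sub>k!)\<close> ordered partitions with blocks of sizes \<open>n\<^sub>1, \<dots>, n\<^sub>k\<close>.
\<close>

lemma sum_ordered_partitions:
  fixes S :: "'k::field_char_0 \<Rightarrow> 'w::ab_group_add \<Rightarrow> 'w" and \<Phi> :: "nat list \<Rightarrow> 'w"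
  assumes "vector_space S" "finite A"
  shows "(\<Sum>Is\<in>ordered_partitions A. \<Phi> (map card Is))
    = (\<Sum>ns\<in>compositions (card A). S (fact (card A) / prod_fact ns) (\<Phi> ns))"
  using assms(2)
proof (induction "card A" arbitrary: A \<Phi> rule: less_induct)
  case less
  interpret vector_space S by (rule assms(1))
  let ?n = "card A"
  show ?case
  proof (cases "A = {}")
    case True
    have "Is = []" if "Is \<in> ordered_partitions {}" for Is :: "'a set list"
      using that by (cases Is) (auto simp: ordered_partitions_Cons)
    then have "ordered_partitions {} = {[] :: 'a set list}" by (auto simp: ordered_partitions_Nil)
    then show ?thesis using True by (simp add: compositions_0)
  next
    case False
    then have n: "?n > 0" using less.prems by (simp add: card_gt_0_iff)
    define G where "G i = (\<Sum>ns\<in>compositions (?n - i). S (fact (?n - i) / prod_fact ns) (\<Phi> (i # ns)))" for i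
    have "(\<Sum>Is\<in>ordered_partitions A. \<Phi> (map card Is)) = (\<Sum>I\<in>Pow A - {{}}. \<Sum>Is\<in>ordered_partitions (A - I). \<Phi> (map card (I # Is)))"
      by (rule sum_ordered_partitions_Cons[OF less.prems False])
    also have "\<dots> = (\<Sum>I\<in>Pow A - {{}}. G (card I))"
    proof (rule sum.cong[OF refl])
      fix I assume I: "I \<in> Pow A - {{}}"
      then have fI: "finite I" using less.prems finite_subset by blast
      have c: "card (A - I) = ?n - card I" using I fI card_Diff_subset by blast
      have "card I > 0" using I fI by (simp add: card_gt_0_iff)
      then have "card (A - I) < ?n" using c n by simp
      from less.hyps[OF this _, of "\<lambda>ns. \<Phi> (card I # ns)"]
      show "(\<Sum>Is\<in>ordered_partitions (A - I). \<Phi> (map card (I # Is))) = G (card I)"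
        using less.prems by (simp add: G_def c)
    qed
    also have "\<dots> = (\<Sum>I\<in>Pow A. if card I = 0 then 0 else G (card I))"
    proof (rule sum.mono_neutral_cong_left)
      show "\<forall>i\<in>Pow A - (Pow A - {{}}). (if card i = 0 then 0 else G (card i)) = 0" by auto
      fix I assume "I \<in> Pow A - {{}}"
      then have "card I \<noteq> 0" using less.prems finite_subset by (metis DiffE Pow_iff card_0_eq singletonI)
      then show "G (card I) = (if card I = 0 then 0 else G (card I))" by simp
    qed (use less.prems in auto)
    also have "\<dots> = (\<Sum>i\<le>?n. S (of_nat (?n choose i)) (if i = 0 then 0 else G i))"
      by (rule sum_Pow_card[OF less.prems])
    also have "\<dots> = (\<Sum>i\<in>{1..?n}. S (of_nat (?n choose i)) (G i))"
      by (rule sum.mono_neutral_cong_right) auto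
    also have "\<dots> = (\<Sum>i\<in>{1..?n}. \<Sum>ns\<in>compositions (?n - i). S (fact ?n / prod_fact (i # ns)) (\<Phi> (i # ns)))"
    proof (rule sum.cong[OF refl])
      fix i assume "i \<in> {1..?n}"
      then have "(of_nat (?n choose i) :: 'k) = fact ?n / (fact i * fact (?n - i))" by (simp add: binomial_fact)
      then show "S (of_nat (?n choose i)) (G i) = (\<Sum>ns\<in>compositions (?n - i). S (fact ?n / prod_fact (i # ns)) (\<Phi> (i # ns)))"
        unfolding G_def scale_sum_right scale_scale by (intro sum.cong refl) simp
    qed
    also have "\<dots> = (\<Sum>ns\<in>compositions ?n. S (fact ?n / prod_fact ns) (\<Phi> ns))"
      by (rule sum_compositions[OF n, symmetric])
    finally show ?thesis .
  qed
qed

lemma ordered_partitions_rotate: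
  "take j Js @ I # drop j Js \<in> ordered_partitions A \<longleftrightarrow> I # Js \<in> ordered_partitions A"
proof -
  let ?A = "take j Js" and ?B = "drop j Js"
  have J: "?A @ ?B = Js" by simp
  have aux: "distinct (As @ I # Bs) \<longleftrightarrow> I \<notin> set (As @ Bs) \<and> distinct (As @ Bs)"
    "set (As @ I # Bs) = insert I (set (As @ Bs))" for As Bs by auto
  have "distinct (?A @ I # ?B) \<longleftrightarrow> distinct (I # Js)" using aux(1)[of ?A ?B] unfolding J by simp
  moreover have "set (?A @ I # ?B) = set (I # Js)" using aux(2)[of ?A ?B] unfolding J by simp
  ultimately show ?thesis unfolding ordered_partitions_def by (simp only: mem_Collect_eq)
qed

text \<open>
  The block of a marked element \<open>z\<close> is singled out; \<open>j\<close> is its place among the other blocks.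
\<close>

lemma sum_ordered_partitions_marked:
  fixes g :: "'a set list \<Rightarrow> 'w::comm_monoid_add"
  assumes A: "finite A" "z \<in> A"
  shows "(\<Sum>Is\<in>ordered_partitions A. g Is) =
    (\<Sum>I | I \<subseteq> A \<and> z \<in> I. \<Sum>Js\<in>ordered_partitions (A - I). \<Sum>j\<le>length Js. g (take j Js @ I # drop j Js))"
proof -
  let ?B = "{I. I \<subseteq> A \<and> z \<in> I}"
  have fin: "finite ?B" using A(1) by (auto intro: finite_subset[of _ "Pow A"])
  have "(\<Sum>I\<in>?B. \<Sum>Js\<in>ordered_partitions (A - I). \<Sum>j\<le>length Js. g (take j Js @ I # drop j Js))
     = (\<Sum>I\<in>?B. \<Sum>(Js, j)\<in>Sigma (ordered_partitions (A - I)) (\<lambda>Js. {..length Js}). g (take j Js @ I # drop j Js))"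
    by (intro sum.cong refl sum.Sigma) (use A finite_ordered_partitions in auto)
  also have "\<dots> = (\<Sum>(I, Js, j)\<in>Sigma ?B (\<lambda>I. Sigma (ordered_partitions (A - I)) (\<lambda>Js. {..length Js})). g (take j Js @ I # drop j Js))"
    by (subst sum.Sigma) (use A fin finite_ordered_partitions in \<open>auto simp: case_prod_unfold\<close>)
  also have "\<dots> = (\<Sum>Is\<in>ordered_partitions A. g Is)"
  proof (rule sum.reindex_bij_witness[where j = "\<lambda>(I, Js, j). take j Js @ I # drop j Js"
        and i = "\<lambda>Is. let j = length (takeWhile (\<lambda>I. z \<notin> I) Is) in (Is ! j, take j Is @ drop (Suc j) Is, j)"])
    fix t assume t: "t \<in> Sigma ?B (\<lambda>I. Sigma (ordered_partitions (A - I)) (\<lambda>Js. {..length Js}))"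
    obtain I Js j where tt: "t = (I, Js, j)" by (cases t)
    have I: "I \<subseteq> A" "z \<in> I" "Js \<in> ordered_partitions (A - I)" "j \<le> length Js" using t tt by auto
    let ?Is = "take j Js @ I # drop j Js"
    have "z \<notin> J" if "J \<in> set (take j Js)" for J
      using that I(2,3) by (auto simp: ordered_partitions_def partition_on_def dest: in_set_takeD)
    then have "takeWhile (\<lambda>I. z \<notin> I) ?Is = take j Js" using I(2)
      by (subst takeWhile_append2) auto
    then have l: "length (takeWhile (\<lambda>I. z \<notin> I) ?Is) = j" using I(4) by simp
    show "(let j = length (takeWhile (\<lambda>I. z \<notin> I) (case t of (I, Js, j) \<Rightarrow> take j Js @ I # drop j Js))
        in ((case t of (I, Js, j) \<Rightarrow> take j Js @ I # drop j Js) ! j,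
         take j (case t of (I, Js, j) \<Rightarrow> take j Js @ I # drop j Js) @
         drop (Suc j) (case t of (I, Js, j) \<Rightarrow> take j Js @ I # drop j Js), j)) = t"
      unfolding tt prod.case l Let_def using I(4) by (simp add: nth_append min_absorb2)
    have "I # Js \<in> ordered_partitions A" using I by (auto simp: ordered_partitions_Cons)
    then show "(case t of (I, Js, j) \<Rightarrow> take j Js @ I # drop j Js) \<in> ordered_partitions A"
      unfolding tt prod.case ordered_partitions_rotate .
    show "g (case t of (I, Js, j) \<Rightarrow> take j Js @ I # drop j Js) = (case t of (I, Js, j) \<Rightarrow> g (take j Js @ I # drop j Js))"
      unfolding tt by simp
  next
    fix Is assume Is: "Is \<in> ordered_partitions A"
    define j where "j = length (takeWhile (\<lambda>I. z \<notin> I) Is)"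
    have "\<Union>(set Is) = A" using Is by (auto simp: ordered_partitions_def partition_on_def)
    then obtain J where "J \<in> set Is" "z \<in> J" using A(2) by blast
    then have "dropWhile (\<lambda>I. z \<notin> I) Is \<noteq> []" by (auto simp: dropWhile_eq_Nil_conv)
    moreover have "length Is = j + length (dropWhile (\<lambda>I. z \<notin> I) Is)"
      unfolding j_def length_append[symmetric] takeWhile_dropWhile_id ..
    ultimately have j: "j < length Is" by simp
    then have zj: "z \<in> Is ! j" unfolding j_def using nth_length_takeWhile by blast
    have eq: "take j (take j Is @ drop (Suc j) Is) @ Is ! j # drop j (take j Is @ drop (Suc j) Is) = Is"
      using j by (simp add: id_take_nth_drop[symmetric])
    from Is have "Is ! j # (take j Is @ drop (Suc j) Is) \<in> ordered_partitions A"
      using ordered_partitions_rotate[of j "take j Is @ drop (Suc j) Is" "Is ! j" A] unfolding eq by blast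
    then show "(let j = length (takeWhile (\<lambda>I. z \<notin> I) Is) in (Is ! j, take j Is @ drop (Suc j) Is, j))
       \<in> Sigma ?B (\<lambda>I. Sigma (ordered_partitions (A - I)) (\<lambda>Js. {..length Js}))"
      unfolding j_def[symmetric] Let_def using j zj by (auto simp: ordered_partitions_Cons)
    show "(case (let j = length (takeWhile (\<lambda>I. z \<notin> I) Is) in (Is ! j, take j Is @ drop (Suc j) Is, j)) of
          (I, Js, j) \<Rightarrow> take j Js @ I # drop j Js) = Is"
      unfolding j_def[symmetric] Let_def prod.case by (rule eq)
  qed
  finally show ?thesis by simp
qed

section \<open>The structure equations on words with few odd letters\<close>

lemma hdeg_eq:
  assumes V: "graded_space V" and v: "v \<in> grd V i" "v \<noteq> 0" shows "hdeg V v = i"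
proof -
  have V': "vector_space (scl V)" "\<And>j. module.subspace (scl V) (grd V j)" "\<exists>!c. is_decomposition V v c"
    using V unfolding graded_space_def by auto
  interpret vector_space "scl V" by (rule V'(1))
  have dec: "is_decomposition V v (\<lambda>k. if k = j then v else 0)" if "v \<in> grd V j" for j
  proof -
    have "{k. (if k = j then v else 0) \<noteq> 0} = {j}" using v(2) by auto
    then show ?thesis unfolding is_decomposition_def using that subspace_0[OF V'(2)] by auto
  qed
  have "j = i" if "v \<in> grd V j" for j
  proof -
    have "(\<lambda>k. if k = j then v else 0) = (\<lambda>k. if k = i then v else 0)"
      using V'(3) dec[OF that] dec[OF v(1)] by blast
    from fun_cong[OF this, of j] show ?thesis using v(2) by (auto split: if_splits)
  qed
  then show ?thesis unfolding hdeg_def using v(1) by (metis someI)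
qed

lemma nths_replicate: "I \<subseteq> {..<n} \<Longrightarrow> nths (replicate n a) I = replicate (card I) a"
proof -
  assume I: "I \<subseteq> {..<n}"
  then have "{i. i < n \<and> i \<in> I} = I" by auto
  then have "length (nths (replicate n a) I) = card I" by (simp add: length_nths)
  moreover have "\<forall>y\<in>set (nths (replicate n a) I). y = a" using set_nths_subset by fastforce
  ultimately show ?thesis by (metis replicate_length_same)
qed

lemma nths_Suc: "nths (x # l) (Suc ` I) = nths l I" "nths (x # l) (insert 0 (Suc ` I)) = x # nths l I"
proof -
  have "{j. Suc j \<in> Suc ` I} = I" by auto
  then show "nths (x # l) (Suc ` I) = nths l I" "nths (x # l) (insert 0 (Suc ` I)) = x # nths l I"
    by (auto simp: nths_Cons)
qed

lemma complement_Suc: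
  "{..<Suc n} - Suc ` I = insert 0 (Suc ` ({..<n} - I))" "{..<Suc n} - insert 0 (Suc ` I) = Suc ` ({..<n} - I)"
  by (auto simp: lessThan_Suc_eq_insert_0)

lemma card_complement: "I \<subseteq> {..<n} \<Longrightarrow> card ({..<n} - I) = n - card I"
  by (simp add: card_Diff_subset finite_subset)

text \<open>
  Both parts of an unshuffle are increasing.
\<close>

lemma unshuffle_inversion:
  assumes "finite I" "finite J" and js: "js = sorted_list_of_set I @ sorted_list_of_set J"
    and AB: "A < B" "B < length js" "js ! B < js ! (A::nat)"
  shows "A < card I \<and> card I \<le> B \<and> js ! A \<in> I \<and> js ! B \<in> (J :: nat set)"
proof -
  let ?i = "sorted_list_of_set I" and ?j = "sorted_list_of_set J"
  have s: "sorted ?i" "sorted ?j" and l: "length ?i = card I" "length ?j = card J" by auto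
  have "\<not> B < card I" 
  proof
    assume "B < card I"
    then have "js ! A \<le> js ! B" unfolding js using s(1) l AB(1) by (simp add: nth_append sorted_nth_mono)
    then show False using AB by simp
  qed
  moreover have "\<not> card I \<le> A"
  proof
    assume a: "card I \<le> A"
    have "js ! A = ?j ! (A - card I)" "js ! B = ?j ! (B - card I)" unfolding js using a AB(1) l by (simp_all add: nth_append)
    moreover have "?j ! (A - card I) \<le> ?j ! (B - card I)"
      using s(2) AB(1,2) a l unfolding js by (intro sorted_nth_mono) auto
    ultimately show False using AB by simp
  qed
  ultimately have AB': "A < card I" "card I \<le> B" by auto
  have "js ! A \<in> set ?i" unfolding js using AB'(1) l by (simp add: nth_append)
  moreover have "js ! B \<in> set ?j" unfolding js using AB'(2) l AB(2) js by (simp add: nth_append)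
  ultimately show ?thesis using AB' assms(1,2) by simp
qed

text \<open>
  A sign needs two odd letters.
\<close>

lemma koszul_even_tail:
  assumes "\<And>i. 0 < i \<Longrightarrow> i < length vs \<Longrightarrow> even (hdeg V (vs ! i))" "set js \<subseteq> {..<length vs}"
  shows "koszul V vs js = (1 :: 'k::field)"
proof (rule koszul_one)
  fix A B assume AB: "A < B" "B < length js" "js ! B < js ! A"
  then have "js ! A < length vs" using assms(2) by (metis lessThan_iff nth_mem order.strict_trans subsetD)
  then have "even (hdeg V (vs ! (js ! A)))" using assms(1) AB(3) by simp
  then show "even (hdeg V (vs ! (js ! A)) * hdeg V (vs ! (js ! B)))" by simp
qed

context
  fixes V :: "('k::field_char_0, 'v::ab_group_add) bracket_space"
  assumes V: "shifted_Linf_algebra V"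
begin

private lemma graded: "graded_space V" and vs: "vector_space (scl V)"
  and ml: "multilinear_on_lists (scl V) (scl V) (brk V)"
  using V unfolding shifted_Linf_algebra_def graded_space_def by auto

interpretation vector_space "scl V" by (rule vs)

abbreviation (input) "bb \<equiv> nilz (brk V)"

private lemma bb_zero: "bb (xs @ 0 # ys) = 0"
proof -
  have "brk V (xs @ scl V 0 0 # ys) = scl V 0 (brk V (xs @ 0 # ys))"
    using ml unfolding multilinear_on_lists_def by blast
  then show ?thesis by (simp add: nilz_def)
qed

private lemma bb_zero_simps:
  "bb (0 # ys) = 0" "bb (x # 0 # ys) = 0" "bb (x # y # 0 # ys) = 0"
  using bb_zero[of "[]" ys] bb_zero[of "[x]" ys] bb_zero[of "[x, y]" ys] by auto

private lemma bb_zero_replicate: "n > 0 \<Longrightarrow> bb (xs @ replicate n 0) = 0"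
  by (cases n) (auto simp: bb_zero)

private lemma tail_even:
  assumes "a \<in> grd V 0" "a \<noteq> 0 \<or> n = 0" "0 < i" "i < length (x # replicate n a)"
  shows "even (hdeg V ((x # replicate n a) ! i))"
  using assms hdeg_eq[OF graded assms(1)] by (cases i) auto

lemma twisted_square_coefficients:
  assumes x: "x \<in> grd V k" and a: "a \<in> grd V 0"
  shows "(\<Sum>i\<le>n. scl V (of_nat (n choose i))
     (square_terms bb x a i (n - i))) = 0"
proof (cases "a \<noteq> 0 \<or> n = 0")
  case False
  have "square_terms bb x a i (n - i) = 0"
    if "i \<le> n" for i
  proof (cases "i = n")
    case True
    then show ?thesis using False bb_zero_replicate[of i "[x]"] bb_zero_replicate[of i "[]"] bb_zero_simps by simp
  next
    case ne: False
    then show ?thesis using False that bb_zero_replicate[of "n - i" "[_]"] bb_zero_replicate[of "n - i" "[_, _]"] by simp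
  qed
  then show ?thesis by simp
next
  case True
  let ?vs = "x # replicate n a"
  have hom: "homogeneous_word V ?vs" unfolding homogeneous_word_def using x a by auto
  let ?js = "\<lambda>I. unshuffle (Suc n) I"
  let ?t = "\<lambda>I. bb (bb (nths ?vs I) # nths ?vs ({..<Suc n} - I))"
  have "koszul V ?vs (?js I) = 1" if "I \<in> Pow {..<Suc n}" for I
  proof (rule koszul_even_tail)
    have "finite I" using that finite_subset by auto
    then show "set (?js I) \<subseteq> {..<length ?vs}" using that by auto
  qed (rule tail_even[OF a True])
  then have "(\<Sum>I\<in>Pow {..<Suc n}. ?t I) = (\<Sum>I\<in>Pow {..<Suc n}. scl V (koszul V ?vs (?js I)) (?t I))"
    by (intro sum.cong refl) simp
  also have "\<dots> = 0" using coderivation_square[OF V hom] by simp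
  finally have "(\<Sum>I\<in>Pow {..<Suc n}. ?t I) = 0" .
  then have "(\<Sum>I\<in>Pow {..<n}. ?t (Suc ` I) + ?t (insert 0 (Suc ` I))) = 0" unfolding sum_Pow_Suc .
  moreover have "(\<Sum>I\<in>Pow {..<n}. ?t (Suc ` I) + ?t (insert 0 (Suc ` I))) =
     (\<Sum>I\<in>Pow {..<n}. (\<lambda>i. square_terms bb x a i (n - i)) (card I))"
    by (intro sum.cong refl)
       (auto simp: complement_Suc nths_Suc nths_replicate card_complement add.commute)
  ultimately show ?thesis
    using sum_Pow_card[OF finite_lessThan, of "\<lambda>i. square_terms bb x a i (n - i)" n] by simp
qed

text \<open>
  With two odd letters \<open>x\<close>, \<open>y\<close> in front, an unshuffle has a sign exactly when it selects \<open>y\<close> but not \<open>x\<close>. The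
  four groups of subsets, according to which of \<open>x\<close> and \<open>y\<close> they contain, give the four terms.
\<close>

lemma twisted_leibniz_coefficients:
  assumes x: "x \<in> grd V (-1)" and y: "y \<in> grd V (-1)" and a: "a \<in> grd V 0"
  shows "(\<Sum>i\<le>n. scl V (of_nat (n choose i))
     (leibniz_terms bb x y a i (n - i))) = 0"
proof (cases "x \<noteq> 0 \<and> y \<noteq> 0 \<and> (a \<noteq> 0 \<or> n = 0)")
  case False
  have "leibniz_terms bb x y a i (n - i) = 0"
    if "i \<le> n" for i
  proof (cases "x = 0 \<or> y = 0")
    case True
    then show ?thesis by (auto simp: bb_zero_simps)
  next
    case ne: False
    then have an: "a = 0" "n \<noteq> 0" using False by auto
    show ?thesis
    proof (cases "i = n")
      case True
      then show ?thesis using an bb_zero_replicate[of i "[_]"] bb_zero_replicate[of i "[_, _]"] bb_zero_replicate[of i "[]"] bb_zero_simps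
        by simp
    next
      case ne: False
      then show ?thesis using an that bb_zero_replicate[of "n - i" "[_]"] bb_zero_replicate[of "n - i" "[_, _]"]
          bb_zero_replicate[of "n - i" "[_, _, _]"] by simp
    qed
  qed
  then show ?thesis by simp
next
  case True
  let ?vs = "x # y # replicate n a"
  have hom: "homogeneous_word V ?vs" unfolding homogeneous_word_def using x y a by auto
  let ?N = "Suc (Suc n)"
  let ?js = "\<lambda>I. unshuffle ?N I"
  let ?t = "\<lambda>I. bb (bb (nths ?vs I) # nths ?vs ({..<?N} - I))"
  have fin: "finite I" if "I \<in> Pow {..<?N}" for I using that finite_subset by auto
  have ev: "even (hdeg V (?vs ! i))" if "2 \<le> i" "i < ?N" for i
    using True that hdeg_eq[OF graded a] by (auto simp: nth_Cons' )
  have inv: "A < card I \<and> card I \<le> B \<and> ?js I ! A = 1 \<and> ?js I ! B = 0 \<and> 1 \<in> I \<and> 0 \<notin> I"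
    if I: "I \<in> Pow {..<?N}" and AB: "A < B" "B < length (?js I)" "?js I ! B < ?js I ! A"
      and odd: "odd (hdeg V (?vs ! (?js I ! A)) * hdeg V (?vs ! (?js I ! B)))" for I A B
  proof -
    have u: "A < card I \<and> card I \<le> B \<and> ?js I ! A \<in> I \<and> ?js I ! B \<in> {..<?N} - I"
      by (rule unshuffle_inversion[OF fin[OF I] _ refl AB]) simp
    then have "?js I ! A < ?N" using I by auto
    then have "?js I ! A < 2" using ev odd by (metis even_mult_iff not_le)
    then have "?js I ! A = 1" "?js I ! B = 0" using AB(3) by auto
    then show ?thesis using u by (metis DiffE)
  qed
  have k1: "koszul V ?vs (?js I) = 1" if I: "I \<in> Pow {..<?N}" "\<not> (1 \<in> I \<and> 0 \<notin> I)" for I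
    by (rule koszul_one) (use inv[OF I(1)] I(2) in blast)
  \<comment> \<open>the only odd inversion is that of \<open>y\<close>, first in \<open>I\<close>, and \<open>x\<close>, first in its complement\<close>
  have k2: "koszul V ?vs (?js I) = -1" if I: "I \<in> Pow {..<?N}" "1 \<in> I" "0 \<notin> I" for I
  proof -
    let ?J = "{..<?N} - I"
    have "Min I = 1" using I fin[OF I(1)] by (intro Min_eqI) (auto simp: Suc_le_eq intro: gr0I)
    then have i: "sorted_list_of_set I = 1 # sorted_list_of_set (I - {1})"
      using sorted_list_of_set_nonempty[OF fin[OF I(1)]] I(2) by fastforce
    have "Min ?J = 0" using I by (intro Min_eqI) auto
    then have j: "sorted_list_of_set ?J = 0 # sorted_list_of_set (?J - {0})"
      using sorted_list_of_set_nonempty[of ?J] I(3) by fastforce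
    have l: "length (sorted_list_of_set I) = card I" by simp
    have pos: "card I > 0" using I fin[OF I(1)] by (auto simp: card_gt_0_iff)
    have A0: "?js I ! 0 = 1" using i by simp
    have B0: "?js I ! card I = 0" using j l by (metis nth_append_length nth_append_length_plus add_0_right nth_Cons_0)
    have len: "card I < length (?js I)" using j by simp
    have dist: "distinct (?js I)" using fin[OF I(1)] by auto
    have "koszul V ?vs (?js I) = parity_sign (hdeg V (?vs ! (?js I ! 0)) * hdeg V (?vs ! (?js I ! card I)))"
    proof (rule koszul_single[OF pos len])
      show "?js I ! card I < ?js I ! 0" unfolding A0 B0 by simp
      fix A B assume AB: "A < B" "B < length (?js I)" "?js I ! B < ?js I ! A" "(A, B) \<noteq> (0, card I)"
      show "even (hdeg V (?vs ! (?js I ! A)) * hdeg V (?vs ! (?js I ! B)))"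
      proof (rule ccontr)
        assume "odd (hdeg V (?vs ! (?js I ! A)) * hdeg V (?vs ! (?js I ! B)))"
        from inv[OF I(1) AB(1-3) this] have "?js I ! A = ?js I ! 0" "?js I ! B = ?js I ! card I"
          using A0 B0 by auto
        then have "A = 0" "B = card I"
          using nth_eq_iff_index_eq[OF dist, of A 0] nth_eq_iff_index_eq[OF dist, of B "card I"] AB(1,2) len
          by linarith+
        then show False using AB(4) by simp
      qed
    qed
    also have "hdeg V (?vs ! (?js I ! 0)) = -1" unfolding A0 using hdeg_eq[OF graded y] True by simp
    also have "hdeg V (?vs ! (?js I ! card I)) = -1" unfolding B0 using hdeg_eq[OF graded x] True by simp
    finally show ?thesis by (simp add: parity_sign_def)
  qed
  let ?s = "\<lambda>I. scl V (koszul V ?vs (?js I)) (?t I)"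
  have "(\<Sum>I\<in>Pow {..<?N}. ?s I) = 0" using coderivation_square[OF V hom] by simp
  then have z: "(\<Sum>I\<in>Pow {..<n}. (?s (Suc ` Suc ` I) + ?s (insert 0 (Suc ` Suc ` I)))
        + (?s (Suc ` insert 0 (Suc ` I)) + ?s (insert 0 (Suc ` insert 0 (Suc ` I))))) = 0"
    unfolding sum_Pow_Suc by simp
  have "(?s (Suc ` Suc ` I) + ?s (insert 0 (Suc ` Suc ` I)))
        + (?s (Suc ` insert 0 (Suc ` I)) + ?s (insert 0 (Suc ` insert 0 (Suc ` I))))
    = (\<lambda>i. leibniz_terms bb x y a i (n - i)) (card I)"
    if I: "I \<in> Pow {..<n}" for I
  proof -
    have m: "Suc ` Suc ` I \<in> Pow {..<?N}" "insert 0 (Suc ` Suc ` I) \<in> Pow {..<?N}"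
      "Suc ` insert 0 (Suc ` I) \<in> Pow {..<?N}" "insert 0 (Suc ` insert 0 (Suc ` I)) \<in> Pow {..<?N}"
      using I by auto
    have c: "{..<n} - I \<subseteq> {..<n}" by auto
    have "?s (Suc ` Suc ` I) = bb (bb (replicate (card I) a) # x # y # replicate (n - card I) a)"
      using I c by (subst k1[OF m(1)]) (auto simp: complement_Suc nths_Suc nths_replicate card_complement simp del: image_insert)
    moreover have "?s (insert 0 (Suc ` Suc ` I)) = bb (bb (x # replicate (card I) a) # y # replicate (n - card I) a)"
      using I c by (subst k1[OF m(2)]) (auto simp: complement_Suc nths_Suc nths_replicate card_complement simp del: image_insert)
    moreover have "?s (Suc ` insert 0 (Suc ` I)) = - bb (bb (y # replicate (card I) a) # x # replicate (n - card I) a)"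
      using I c by (subst k2[OF m(3)]) (auto simp: complement_Suc nths_Suc nths_replicate card_complement simp del: image_insert)
    moreover have "?s (insert 0 (Suc ` insert 0 (Suc ` I))) = bb (bb (x # y # replicate (card I) a) # replicate (n - card I) a)"
      using I c by (subst k1[OF m(4)]) (auto simp: complement_Suc nths_Suc nths_replicate card_complement simp del: image_insert)
    ultimately show ?thesis by (simp add: algebra_simps)
  qed
  note e = this
  have "(\<Sum>I\<in>Pow {..<n}. (\<lambda>i. leibniz_terms bb x y a i (n - i)) (card I)) = 0"
    by (rule trans[OF sum.cong[OF refl e, symmetric] z])
  then show ?thesis
    using sum_Pow_card[OF finite_lessThan, of "\<lambda>i. leibniz_terms bb x y a i (n - i)" n] by simp
qed

end

section \<open>The morphism equations in closed form\<close>

context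
  fixes V :: "('k::field_char_0, 'v::ab_group_add) bracket_space"
    and W :: "('k, 'w::ab_group_add) bracket_space" and U :: "'v list \<Rightarrow> 'w"
  assumes V: "shifted_Linf_algebra V" and W: "shifted_Linf_algebra W"
    and ab: "abelian V" and U: "infinity_morphism V W U"
begin

private lemma gV: "graded_space V" and vV: "vector_space (scl V)" and mV: "multilinear_on_lists (scl V) (scl V) (brk V)"
  using V unfolding shifted_Linf_algebra_def graded_space_def by auto

private lemma vW: "vector_space (scl W)" and mW: "multilinear_on_lists (scl W) (scl W) (brk W)"
  and sW: "graded_symmetric W (scl W) (brk W)"
  using W unfolding shifted_Linf_algebra_def graded_space_def by auto

private lemma mU: "multilinear_on_lists (scl V) (scl W) U" and dU: "has_degree V W U 0"
  using U unfolding infinity_morphism_def by auto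

interpretation V: vector_space "scl V" by (rule vV)
interpretation W: vector_space "scl W" by (rule vW)

abbreviation (input) "uu \<equiv> nilz U"
abbreviation (input) "bw \<equiv> nilz (brk W)"

private lemma uu_zero: "uu (xs @ 0 # ys) = 0"
proof -
  have "U (xs @ scl V 0 0 # ys) = scl W 0 (U (xs @ 0 # ys))" using mU unfolding multilinear_on_lists_def by blast
  then show ?thesis by (simp add: nilz_def)
qed

private lemma bw_zero: "bw (xs @ 0 # ys) = 0"
proof -
  have "brk W (xs @ scl W 0 0 # ys) = scl W 0 (brk W (xs @ 0 # ys))" using mW unfolding multilinear_on_lists_def by blast
  then show ?thesis by (simp add: nilz_def)
qed

private lemma bw_zero_mem: "0 \<in> set ws \<Longrightarrow> bw ws = 0"
  using bw_zero by (metis split_list)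

private lemma uu_zero_replicate: "n > 0 \<Longrightarrow> uu (xs @ replicate n 0) = 0"
  by (cases n) (auto simp: uu_zero)

private lemma diffl_zero: "diffl V 0 = 0"
proof -
  have "brk V ([] @ scl V 0 0 # []) = scl V 0 (brk V ([] @ 0 # []))" using mV unfolding multilinear_on_lists_def by blast
  then show ?thesis by (simp add: diffl_def)
qed

private lemma brk_long: "length vs \<ge> 2 \<Longrightarrow> brk V vs = 0"
  using ab unfolding abelian_def by blast

text \<open>
  Letters of degree \<open>0\<close> produce no signs. On the left, ordered partitions are counted by their block sizes; on the
  right, only singletons contribute since \<open>V\<close> is Abelian.
\<close>

lemma morphism_on_powers:
  assumes a: "a \<in> grd V 0"
  shows "(\<Sum>ns\<in>compositions n. scl W (fact n / (prod_fact ns * fact (length ns))) (bw (map (\<lambda>i. uu (replicate i a)) ns)))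
     = scl W (of_nat n) (uu (diffl V a # replicate (n - 1) a))"
proof (cases "n = 0")
  case True
  then show ?thesis by (simp add: compositions_0 nilz_def)
next
  case n: False
  show ?thesis
  proof (cases "a = 0")
    case True
    have "bw (map (\<lambda>i. uu (replicate i a)) ns) = 0" if ns: "ns \<in> compositions n" for ns
    proof (rule bw_zero_mem)
      have "ns \<noteq> []" "0 \<notin> set ns" using ns n by (auto simp: compositions_def)
      then have "uu (replicate (hd ns) a) = 0" using True uu_zero_replicate[of "hd ns" "[]"] by (cases ns) auto
      then show "0 \<in> set (map (\<lambda>i. uu (replicate i a)) ns)" using \<open>ns \<noteq> []\<close> by (cases ns) auto
    qed
    then show ?thesis using True uu_zero[of "[]"] by (simp add: diffl_zero)
  next
    case False
    let ?vs = "replicate n a"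
    have hom: "homogeneous_word V ?vs" unfolding homogeneous_word_def using a n by auto
    have ev: "even (hdeg V (?vs ! i))" if "i < length ?vs" for i
      using that hdeg_eq[OF gV a False] by simp
    define z where "z = uu (diffl V a # replicate (n - 1) a)"
    let ?L = "(\<Sum>I | I \<subseteq> {..<length ?vs} \<and> I \<noteq> {}.
        scl W (koszul V ?vs (unshuffle (length ?vs) I))
          (nilz U (brk V (nths ?vs I) # nths ?vs ({..<length ?vs} - I))))"
    have "?L
      = (\<Sum>I\<in>Pow {..<n}. if card I = 1 then z else 0)"
    proof (rule sum.mono_neutral_cong_left)
      show "\<forall>I\<in>Pow {..<n} - {I. I \<subseteq> {..<length ?vs} \<and> I \<noteq> {}}. (if card I = 1 then z else 0) = 0" by auto
      fix I assume "I \<in> {I. I \<subseteq> {..<length ?vs} \<and> I \<noteq> {}}"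
      then have I: "I \<subseteq> {..<n}" "I \<noteq> {}" "finite I" using finite_subset by auto
      have k: "koszul V ?vs (unshuffle (length ?vs) I) = (1::'k)"
        by (rule koszul_even_tail[OF ev]) (use I in auto)
      have J: "nths ?vs ({..<length ?vs} - I) = replicate (n - card I) a"
        using nths_replicate[of "{..<n} - I" n a] card_complement[OF I(1)] by simp
      have "card I > 0" using I by (simp add: card_gt_0_iff)
      then consider "card I = 1" | "card I \<ge> 2" by linarith
      then have "nilz U (brk V (replicate (card I) a) # replicate (n - card I) a) = (if card I = 1 then z else 0)"
      proof cases
        case 2
        then show ?thesis using brk_long[of "replicate (card I) a"] uu_zero[of "[]"] by simp
      qed (simp add: z_def diffl_def)
      then show "scl W (koszul V ?vs (unshuffle (length ?vs) I))
          (nilz U (brk V (nths ?vs I) # nths ?vs ({..<length ?vs} - I))) = (if card I = 1 then z else 0)"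
        unfolding k J nths_replicate[OF I(1)] by simp
    qed auto
    also have "\<dots> = (\<Sum>i\<le>n. scl W (of_nat (n choose i)) (if i = 1 then z else 0))"
      using W.sum_Pow_card[OF finite_lessThan, of "\<lambda>i. if i = 1 then z else 0" n] by simp
    also have "\<dots> = (\<Sum>i\<in>{1}. scl W (of_nat (n choose i)) (if i = 1 then z else 0))"
      by (rule sum.mono_neutral_right) (use n in auto)
    finally have L: "?L = scl W (of_nat n) z" by simp
    define \<Phi> where "\<Phi> ns = scl W (1 / fact (length ns)) (bw (map (\<lambda>i. uu (replicate i a)) ns))" for ns
    have "(\<Sum>Is\<in>ordered_partitions {..<length ?vs}.
        scl W (koszul V ?vs (concat (map sorted_list_of_set Is)) / fact (length Is)) (nilz (brk W) (map (\<lambda>I. U (nths ?vs I)) Is)))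
      = (\<Sum>Is\<in>ordered_partitions {..<n}. \<Phi> (map card Is))"
    proof (rule sum.cong)
      fix Is assume Is: "Is \<in> ordered_partitions {..<n}"
      then have u: "\<Union>(set Is) = {..<n}" "{} \<notin> set Is" by (auto simp: ordered_partitions_def partition_on_def)
      have fin: "finite I" if "I \<in> set Is" for I using that u finite_subset[of I "{..<n}"] by blast
      have k: "koszul V ?vs (concat (map sorted_list_of_set Is)) = (1::'k)"
        by (rule koszul_even_tail[OF ev]) (use u fin in auto)
      have e: "map (\<lambda>I. U (nths ?vs I)) Is = map (\<lambda>i. uu (replicate i a)) (map card Is)"
      proof (simp, intro ballI)
        fix I assume I: "I \<in> set Is"
        then have "I \<subseteq> {..<n}" "I \<noteq> {}" using u by auto
        moreover have "card I \<noteq> 0" using fin[OF I] \<open>I \<noteq> {}\<close> by simp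
        ultimately show "U (nths ?vs I) = uu (replicate (card I) a)" by (simp add: nths_replicate nilz_def)
      qed
      show "scl W (koszul V ?vs (concat (map sorted_list_of_set Is)) / fact (length Is)) (nilz (brk W) (map (\<lambda>I. U (nths ?vs I)) Is))
        = \<Phi> (map card Is)" unfolding k \<Phi>_def e by simp
    qed simp
    also have "\<dots> = (\<Sum>ns\<in>compositions n. scl W (fact n / prod_fact ns) (\<Phi> ns))"
      using sum_ordered_partitions[OF vW, of "{..<n}" \<Phi>] by simp
    finally show ?thesis using morphism_equation[OF vV vW U hom] unfolding L \<Phi>_def z_def by simp
  qed
qed

private lemma bw_front:
  assumes "v \<in> grd W k" "\<And>w. w \<in> set ws \<Longrightarrow> w \<in> grd W 0"
  shows "bw (ws @ v # ys) = bw (v # ws @ ys)"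
  using assms(2)
proof (induction ws arbitrary: ys rule: rev_induct)
  case (snoc w ws)
  have "brk W (ws @ w # v # ys) = scl W (parity_sign (0 * k)) (brk W (ws @ v # w # ys))"
    by (rule sW[unfolded graded_symmetric_def, rule_format, OF snoc.prems assms(1)]) simp
  then have "bw ((ws @ [w]) @ v # ys) = bw (ws @ v # (w # ys))" by (simp add: nilz_def parity_sign_def)
  also have "\<dots> = bw (v # ws @ w # ys)" using snoc by auto
  finally show ?case by simp
qed simp

private lemma deg_power: "a \<in> grd V 0 \<Longrightarrow> uu (replicate i a) \<in> grd W 0"
proof (cases i)
  case 0
  have "module.subspace (scl W) (grd W 0)" using W unfolding shifted_Linf_algebra_def graded_space_def by blast
  then show ?thesis using 0 W.subspace_0 by (simp add: nilz_def)
next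
  case (Suc j)
  assume "a \<in> grd V 0"
  then have "lies_in (grd V) (replicate i a) (replicate i 0)" by (rule list_all2_replicate2)
  then have "U (replicate i a) \<in> grd W (sum_list (replicate i 0) + 0)"
    using dU[unfolded has_degree_def, rule_format, of "replicate i a" "replicate i 0"] Suc by simp
  then show ?thesis using Suc by (simp add: nilz_def sum_list_replicate)
qed

private lemma deg_power_x: "a \<in> grd V 0 \<Longrightarrow> x \<in> grd V k \<Longrightarrow> uu (x # replicate i a) \<in> grd W k"
proof -
  assume "a \<in> grd V 0" "x \<in> grd V k"
  then have "lies_in (grd V) (x # replicate i a) (k # replicate i 0)" by (simp add: list_all2_replicate2)
  then have "U (x # replicate i a) \<in> grd W (sum_list (k # replicate i 0) + 0)"
    using dU[unfolded has_degree_def, rule_format, of "x # replicate i a" "k # replicate i 0"] by simp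
  then show ?thesis by (simp add: nilz_def sum_list_replicate)
qed

text \<open>
  As before, with one further letter \<open>x\<close>. Its block is moved to the front of the bracket, past blocks of degree \<open>0\<close>;
  the number of its possible places accounts for the change from \<open>1 / (k + 1)!\<close> to \<open>1 / k!\<close>.
\<close>

lemma morphism_on_marked_powers:
  assumes a: "a \<in> grd V 0" "diffl V a = 0" and x: "x \<in> grd V k"
  shows "(\<Sum>m\<le>n. \<Sum>ns\<in>compositions (n - m). scl W (fact n / (fact m * prod_fact ns * fact (length ns)))
       (bw (uu (x # replicate m a) # map (\<lambda>i. uu (replicate i a)) ns)))
     = uu (diffl V x # replicate n a)"
proof (cases "a \<noteq> 0 \<or> n = 0")
  case False
  have "bw (uu (x # replicate m a) # map (\<lambda>i. uu (replicate i a)) ns) = 0" if "m \<le> n" "ns \<in> compositions (n - m)" for m ns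
  proof (cases "m = 0")
    case True
    then have "ns \<noteq> []" "0 \<notin> set ns" using that False by (auto simp: compositions_def)
    then have "uu (replicate (hd ns) a) = 0" using False uu_zero_replicate[of "hd ns" "[]"] by (cases ns) auto
    then have "0 \<in> set (map (\<lambda>i. uu (replicate i a)) ns)" using \<open>ns \<noteq> []\<close> by (cases ns) auto
    then show ?thesis using bw_zero_mem by auto
  next
    case m: False
    then show ?thesis using False uu_zero_replicate[of m "[x]"] bw_zero[of "[]"] by simp
  qed
  then show ?thesis using False uu_zero_replicate[of n "[diffl V x]"] by simp
next
  case True
  let ?vs = "x # replicate n a" and ?A = "{..<Suc n}"
  have hom: "homogeneous_word V ?vs" unfolding homogeneous_word_def using x a by auto
  have ev: "even (hdeg V (?vs ! i))" if "0 < i" "i < length ?vs" for i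
    using that True hdeg_eq[OF gV a(1)] by (cases i) auto
  define z where "z = uu (diffl V x # replicate n a)"
  let ?t = "\<lambda>I. uu (nilz (brk V) (nths ?vs I) # nths ?vs (?A - I))"
  let ?L = "(\<Sum>I | I \<subseteq> {..<length ?vs} \<and> I \<noteq> {}.
      scl W (koszul V ?vs (unshuffle (length ?vs) I))
        (nilz U (brk V (nths ?vs I) # nths ?vs ({..<length ?vs} - I))))"
  have "?L
    = (\<Sum>I\<in>Pow ?A. ?t I)"
  proof (rule sum.mono_neutral_cong_left)
    show "\<forall>I\<in>Pow ?A - {I. I \<subseteq> {..<length ?vs} \<and> I \<noteq> {}}. ?t I = 0" using uu_zero[of "[]"] by (auto simp: nilz_def)
    fix I assume "I \<in> {I. I \<subseteq> {..<length ?vs} \<and> I \<noteq> {}}"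
    then have I: "I \<subseteq> ?A" "I \<noteq> {}" "finite I" using finite_subset by auto
    have k: "koszul V ?vs (unshuffle (length ?vs) I) = (1::'k)"
      by (rule koszul_even_tail[OF ev]) (use I in auto)
    obtain i where "i \<in> I" "i < length ?vs" using I by auto
    then have "?vs ! i \<in> set (nths ?vs I)" unfolding set_nths by blast
    then have "nths ?vs I \<noteq> []" by auto
    then show "scl W (koszul V ?vs (unshuffle (length ?vs) I))
        (nilz U (brk V (nths ?vs I) # nths ?vs ({..<length ?vs} - I))) = ?t I" unfolding k by (simp add: nilz_def)
  qed auto
  also have "\<dots> = (\<Sum>I\<in>Pow {..<n}. ?t (Suc ` I) + ?t (insert 0 (Suc ` I)))" by (rule sum_Pow_Suc)
  also have "\<dots> = (\<Sum>I\<in>Pow {..<n}. if card I = 0 then z else 0)"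
  proof (rule sum.cong[OF refl])
    fix I assume "I \<in> Pow {..<n}"
    then have I: "I \<subseteq> {..<n}" by simp
    have t1: "?t (Suc ` I) = uu (nilz (brk V) (replicate (card I) a) # x # replicate (n - card I) a)"
      and t2: "?t (insert 0 (Suc ` I)) = uu (brk V (x # replicate (card I) a) # replicate (n - card I) a)"
      using I by (auto simp: complement_Suc nths_Suc nths_replicate card_complement nilz_def)
    consider "card I = 0" | "card I = 1" | "card I \<ge> 2" by linarith
    then show "?t (Suc ` I) + ?t (insert 0 (Suc ` I)) = (if card I = 0 then z else 0)"
    proof cases
      case 1
      then show ?thesis unfolding t1 t2 z_def diffl_def using uu_zero[of "[]"] by (simp add: nilz_def)
    next
      case 2
      have "brk V [a] = 0" using a(2) by (simp add: diffl_def)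
      then show ?thesis unfolding t1 t2 using 2 uu_zero[of "[]"] brk_long[of "[x, a]"] by (simp add: nilz_def)
    next
      case 3
      then show ?thesis unfolding t1 t2
        using uu_zero[of "[]"] brk_long[of "replicate (card I) a"] brk_long[of "x # replicate (card I) a"]
        by (simp add: nilz_def)
    qed
  qed
  also have "\<dots> = (\<Sum>i\<le>n. scl W (of_nat (n choose i)) (if i = 0 then z else 0))"
    using W.sum_Pow_card[OF finite_lessThan, of "\<lambda>i. if i = 0 then z else 0" n] by simp
  also have "\<dots> = (\<Sum>i\<in>{0}. scl W (of_nat (n choose i)) (if i = 0 then z else 0))"
    by (rule sum.mono_neutral_right) auto
  finally have L: "?L = z" by simp
  define g where "g Is = scl W (1 / fact (length Is)) (bw (map (\<lambda>I. U (nths ?vs I)) Is))" for Is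
  define \<Phi> where "\<Phi> m ns = scl W (1 / fact (length ns)) (bw (uu (x # replicate m a) # map (\<lambda>i. uu (replicate i a)) ns))" for m ns
  have "(\<Sum>Is\<in>ordered_partitions {..<length ?vs}.
      scl W (koszul V ?vs (concat (map sorted_list_of_set Is)) / fact (length Is)) (nilz (brk W) (map (\<lambda>I. U (nths ?vs I)) Is)))
    = (\<Sum>Is\<in>ordered_partitions ?A. g Is)"
  proof (rule sum.cong)
    fix Is assume Is: "Is \<in> ordered_partitions ?A"
    then have u: "\<Union>(set Is) = ?A" by (auto simp: ordered_partitions_def partition_on_def)
    have fin: "finite I" if "I \<in> set Is" for I using that u finite_subset[of I ?A] by blast
    have "koszul V ?vs (concat (map sorted_list_of_set Is)) = (1::'k)"
      by (rule koszul_even_tail[OF ev]) (use u fin in auto)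
    then show "scl W (koszul V ?vs (concat (map sorted_list_of_set Is)) / fact (length Is)) (nilz (brk W) (map (\<lambda>I. U (nths ?vs I)) Is)) = g Is"
      unfolding g_def by simp
  qed simp
  also have "\<dots> = (\<Sum>I | I \<subseteq> ?A \<and> 0 \<in> I. \<Sum>Js\<in>ordered_partitions (?A - I). \<Sum>j\<le>length Js. g (take j Js @ I # drop j Js))"
    by (rule sum_ordered_partitions_marked) auto
  also have "\<dots> = (\<Sum>I\<in>Pow {..<n}. \<Sum>Js\<in>ordered_partitions (Suc ` ({..<n} - I)). \<Sum>j\<le>length Js. g (take j Js @ insert 0 (Suc ` I) # drop j Js))"
  proof (rule sum.reindex_cong[where l = "\<lambda>I. insert 0 (Suc ` I)"])
    show "inj_on (\<lambda>I. insert 0 (Suc ` I)) (Pow {..<n})"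
    proof (rule inj_onI)
      fix I J :: "nat set" assume "insert 0 (Suc ` I) = insert 0 (Suc ` J)"
      moreover have "0 \<notin> Suc ` I" "0 \<notin> Suc ` J" by auto
      ultimately have "Suc ` I = Suc ` J" by (metis insert_ident)
      then show "I = J" by (simp add: inj_image_eq_iff)
    qed
    show "{I. I \<subseteq> ?A \<and> 0 \<in> I} = (\<lambda>I. insert 0 (Suc ` I)) ` Pow {..<n}"
    proof (intro equalityI subsetI)
      fix I assume "I \<in> {I. I \<subseteq> ?A \<and> 0 \<in> I}"
      then have I: "I \<subseteq> ?A" "0 \<in> I" by auto
      have "I = insert 0 (Suc ` {j. Suc j \<in> I})"
        using I(2) by (auto simp: image_iff) (metis not0_implies_Suc)
      moreover have "{j. Suc j \<in> I} \<in> Pow {..<n}" using I(1) by auto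
      ultimately show "I \<in> (\<lambda>I. insert 0 (Suc ` I)) ` Pow {..<n}" by blast
    qed auto
  qed (simp add: complement_Suc)
  also have "\<dots> = (\<Sum>I\<in>Pow {..<n}. (\<lambda>m. \<Sum>ns\<in>compositions (n - m). scl W (fact (n - m) / prod_fact ns) (\<Phi> m ns)) (card I))"
  proof (rule sum.cong[OF refl])
    fix I assume "I \<in> Pow {..<n}"
    then have I: "I \<subseteq> {..<n}" by simp
    let ?C = "Suc ` ({..<n} - I)" and ?I = "insert 0 (Suc ` I)"
    have cC: "card ?C = n - card I" using card_complement[OF I] by (simp add: card_image)
    have vI: "U (nths ?vs ?I) = uu (x # replicate (card I) a)" using I by (simp add: nths_Suc nths_replicate nilz_def)
    have "(\<Sum>Js\<in>ordered_partitions ?C. \<Sum>j\<le>length Js. g (take j Js @ ?I # drop j Js)) = (\<Sum>Js\<in>ordered_partitions ?C. \<Phi> (card I) (map card Js))"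
    proof (rule sum.cong[OF refl])
      fix Js assume Js: "Js \<in> ordered_partitions ?C"
      then have u: "\<Union>(set Js) = ?C" "{} \<notin> set Js" by (auto simp: ordered_partitions_def partition_on_def)
      have vJ: "U (nths ?vs J) = uu (replicate (card J) a)" if J: "J \<in> set Js" for J
      proof -
        have "J \<subseteq> ?C" "J \<noteq> {}" using J u by auto
        then obtain J' where J': "J = Suc ` J'" "J' \<subseteq> {..<n} - I" by (meson subset_imageE)
        have "finite J'" using J'(2) finite_subset by blast
        then have "card J' \<noteq> 0" using J'(1) \<open>J \<noteq> {}\<close> by auto
        moreover have "card J = card J'" using J'(1) by (simp add: card_image)
        moreover have "nths ?vs J = replicate (card J') a" using J' nths_replicate[of J' n a] by (auto simp: nths_Suc)
        ultimately show ?thesis by (simp add: nilz_def)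
      qed
      then have mJ: "map (\<lambda>I. U (nths ?vs I)) Js = map (\<lambda>i. uu (replicate i a)) (map card Js)" by simp
      have "g (take j Js @ ?I # drop j Js) = scl W (1 / fact (Suc (length Js))) (bw (U (nths ?vs ?I) # map (\<lambda>I. U (nths ?vs I)) Js))"
        if j: "j \<le> length Js" for j
      proof -
        have "bw (map (\<lambda>I. U (nths ?vs I)) (take j Js) @ U (nths ?vs ?I) # map (\<lambda>I. U (nths ?vs I)) (drop j Js))
          = bw (U (nths ?vs ?I) # map (\<lambda>I. U (nths ?vs I)) (take j Js) @ map (\<lambda>I. U (nths ?vs I)) (drop j Js))"
        proof (rule bw_front)
          show "U (nths ?vs ?I) \<in> grd W k" unfolding vI by (rule deg_power_x[OF a(1) x])
          fix w assume "w \<in> set (map (\<lambda>I. U (nths ?vs I)) (take j Js))"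
          then obtain J where "J \<in> set Js" "w = U (nths ?vs J)" by (auto dest: in_set_takeD)
          then show "w \<in> grd W 0" using vJ deg_power[OF a(1)] by simp
        qed
        moreover have "map (\<lambda>I. U (nths ?vs I)) (take j Js) @ map (\<lambda>I. U (nths ?vs I)) (drop j Js) = map (\<lambda>I. U (nths ?vs I)) Js"
          by (simp flip: map_append)
        moreover have "length (take j Js @ ?I # drop j Js) = Suc (length Js)" using j by simp
        ultimately show ?thesis unfolding g_def map_append list.map by (simp only:)
      qed
      then have "(\<Sum>j\<le>length Js. g (take j Js @ ?I # drop j Js))
        = (\<Sum>j\<le>length Js. scl W (1 / fact (Suc (length Js))) (bw (U (nths ?vs ?I) # map (\<lambda>I. U (nths ?vs I)) Js)))"
        by (intro sum.cong) auto
      also have "\<dots> = scl W (of_nat (Suc (length Js)) * (1 / fact (Suc (length Js)))) (bw (U (nths ?vs ?I) # map (\<lambda>I. U (nths ?vs I)) Js))"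
        by (simp add: W.sum_constant_scale)
      also have "of_nat (Suc (length Js)) * (1 / fact (Suc (length Js))) = (1 / fact (length Js) :: 'k)"
        unfolding fact_Suc using of_nat_neq_0[of "length Js", where 'a = 'k] by (simp del: of_nat_Suc)
      finally show "(\<Sum>j\<le>length Js. g (take j Js @ ?I # drop j Js)) = \<Phi> (card I) (map card Js)"
        unfolding \<Phi>_def vI mJ by simp
    qed
    also have "\<dots> = (\<Sum>ns\<in>compositions (n - card I). scl W (fact (n - card I) / prod_fact ns) (\<Phi> (card I) ns))"
      using sum_ordered_partitions[OF vW, of ?C "\<Phi> (card I)"] cC by simp
    finally show "(\<Sum>Js\<in>ordered_partitions ?C. \<Sum>j\<le>length Js. g (take j Js @ ?I # drop j Js))
      = (\<lambda>m. \<Sum>ns\<in>compositions (n - m). scl W (fact (n - m) / prod_fact ns) (\<Phi> m ns)) (card I)" .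
  qed
  also have "\<dots> = (\<Sum>m\<le>n. scl W (of_nat (n choose m)) (\<Sum>ns\<in>compositions (n - m). scl W (fact (n - m) / prod_fact ns) (\<Phi> m ns)))"
    using W.sum_Pow_card[OF finite_lessThan, of "\<lambda>m. \<Sum>ns\<in>compositions (n - m). scl W (fact (n - m) / prod_fact ns) (\<Phi> m ns)" n] by simp
  also have "\<dots> = (\<Sum>m\<le>n. \<Sum>ns\<in>compositions (n - m). scl W (fact n / (fact m * prod_fact ns * fact (length ns)))
       (bw (uu (x # replicate m a) # map (\<lambda>i. uu (replicate i a)) ns)))"
  proof (rule sum.cong[OF refl])
    fix m assume "m \<in> {..n}"
    then have "(of_nat (n choose m) :: 'k) = fact n / (fact m * fact (n - m))" by (simp add: binomial_fact)
    then show "scl W (of_nat (n choose m)) (\<Sum>ns\<in>compositions (n - m). scl W (fact (n - m) / prod_fact ns) (\<Phi> m ns))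
      = (\<Sum>ns\<in>compositions (n - m). scl W (fact n / (fact m * prod_fact ns * fact (length ns)))
       (bw (uu (x # replicate m a) # map (\<lambda>i. uu (replicate i a)) ns)))"
      unfolding \<Phi>_def W.scale_sum_right W.scale_scale by (intro sum.cong refl) simp
  qed
  finally show ?thesis using morphism_equation[OF vV vW U hom] unfolding L z_def by simp
qed

end

section \<open>The series of a morphism\<close>

context mc_algebra
begin

text \<open>
  Substitution of convergent series into an exponential series. The terms are null jointly, since every
  bracket with \<open>p\<close> further arguments lies in \<open>F p\<close> and the series for a fixed \<open>p\<close> converges.
\<close>

lemma ins_expand:
  assumes hs: "list_all2 (\<lambda>h s. has_nsum F h UNIV s) hs ss" and ss: "lies_in G ss ds"
    and h: "has_nsum F h UNIV s" and s: "s \<in> G 0"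
  shows "has_nsum F (\<lambda>is. S (1 / fact (length is - length hs))
            (b (map2 (\<lambda>h i. h i) (hs @ replicate (length is - length hs) h) is)))
           {is. length hs \<le> length is} (I ss s)"
proof -
  let ?B = "\<lambda>p. {is. length is = length hs + p}"
  let ?H = "\<lambda>(p, is). S (1 / fact p) (b (map2 (\<lambda>h i. h i) (hs @ replicate p h) is))"
  have inner: "has_nsum F (\<lambda>is. ?H (p, is)) (?B p) (S (1 / fact p) (b (ss @ replicate p s)))" for p
  proof -
    have "list_all2 (\<lambda>h s. has_nsum F h UNIV s) (hs @ replicate p h) (ss @ replicate p s)"
      using hs h by (intro list_all2_appendI list_all2_replicate2)
    from V.has_nsum_scale[OF f_expand[OF this, of "[]"], of "1 / fact p"] show ?thesis by simp
  qed
  have "has_nsum F ?H (Sigma UNIV ?B) (I ss s)"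
  proof (rule V.has_nsum_Sigma[OF _ inner ins_sum[OF ss s in_F_one]])
    show "nullf F ?H (Sigma UNIV ?B)" unfolding nullf_def
    proof
      fix q
      have "{x \<in> Sigma UNIV ?B. ?H x \<notin> F q} \<subseteq> Sigma {..<nat q} (\<lambda>p. {is\<in>?B p. ?H (p, is) \<notin> F q})"
      proof
        fix x assume x: "x \<in> {x \<in> Sigma UNIV ?B. ?H x \<notin> F q}"
        obtain p "is" where xp: "x = (p, is)" by (cases x)
        have l: "length is = length hs + p" and nF: "?H (p, is) \<notin> F q" using x xp by auto
        have "p < nat q"
        proof (rule ccontr)
          assume np: "\<not> p < nat q"
          let ?vs = "map2 (\<lambda>h i. h i) (hs @ replicate p h) is"
          have "b ?vs \<in> F q"
          proof (cases "?vs = []")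
            case False
            have "lies_in F ?vs (replicate (length ?vs) 1)"
              by (simp add: list_all2_conv_all_nth)
            from f_fil[OF False this] have "b ?vs \<in> F (int (length hs + p))" using l by (simp add: sum_list_replicate)
            then show ?thesis by (rule V.F_antiD) (use np in linarith)
          qed (simp only: f_nil V.F_zero)
          then have "?H (p, is) \<in> F q" using V.F_scale by simp
          then show False using nF by blast
        qed
        then show "x \<in> Sigma {..<nat q} (\<lambda>p. {is\<in>?B p. ?H (p, is) \<notin> F q})" using x xp by auto
      qed
      moreover have "finite (Sigma {..<nat q} (\<lambda>p. {is\<in>?B p. ?H (p, is) \<notin> F q}))"
        by (intro finite_SigmaI V.has_nsum_null[OF inner]) simp
      ultimately show "finite {x \<in> Sigma UNIV ?B. ?H x \<notin> F q}" by (rule finite_subset)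
    qed
  qed
  then have "has_nsum F (\<lambda>x. S (1 / fact (length (snd x) - length hs))
      (b (map2 (\<lambda>h i. h i) (hs @ replicate (length (snd x) - length hs) h) (snd x)))) (Sigma UNIV ?B) (I ss s)"
    by (rule V.has_nsum_congD) auto
  moreover have "bij_betw snd (Sigma UNIV ?B) {is. length hs \<le> length is}"
    by (rule bij_betwI[where g = "\<lambda>is. (length is - length hs, is)"]) auto
  ultimately show ?thesis
    using V.has_nsum_reindex[of snd "Sigma UNIV ?B" "{is. length hs \<le> length is}"
        "\<lambda>is. S (1 / fact (length is - length hs)) (b (map2 (\<lambda>h i. h i) (hs @ replicate (length is - length hs) h) is))"]
    by blast
qed

end

lemma map2_replicate: "map2 (\<lambda>h i. h i) (replicate (length is) h) is = map h is"
  by (induction "is") auto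

lemma prod_inverse_fact: "prod_list (map (\<lambda>i. 1 / fact i) is) = (1 / prod_fact is :: 'k::field_char_0)"
  by (induction "is") auto

text \<open>
  The setting for the two composition formulas below, before \<open>U\<^sub>\<star>\<close> is known to satisfy any equation.
\<close>

locale morphism_series = U: multimap SV GV FV SW GW FW u 0 "r - 1" + W: mc_algebra SW GW FW b
  for SV :: "'k::field_char_0 \<Rightarrow> 'v::ab_group_add \<Rightarrow> 'v" and GV FV
    and SW :: "'k \<Rightarrow> 'w::ab_group_add \<Rightarrow> 'w" and GW FW u b and r :: int
begin

lemma scaled_powers:
  "b (xs @ map (\<lambda>i. SW (1 / fact i) (w i)) is) = SW (1 / prod_fact is) (b (xs @ map w is))"
proof -
  have "map (\<lambda>i. SW (1 / fact i) (w i)) is = map2 SW (map (\<lambda>i. 1 / fact i) is) (map w is)"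
    by (induction "is") auto
  then show ?thesis
    using W.f_scale_list[of "map (\<lambda>i. 1 / fact i) is" "map w is" xs] by (simp add: prod_inverse_fact)
qed

lemma power_sum:
  assumes "a \<in> GV 0" "nullf FW (\<lambda>k. u (replicate k a)) UNIV"
  shows "has_nsum FW (\<lambda>i. SW (1 / fact i) (u (replicate i a))) UNIV (U.I [] a)" "U.I [] a \<in> GW 0"
proof -
  show s: "has_nsum FW (\<lambda>i. SW (1 / fact i) (u (replicate i a))) UNIV (U.I [] a)"
    using U.ins_sum_null[of "[]" "[]" a] assms by simp
  have "u (replicate i a) \<in> GW 0" for i using U.deg_replicate[of "[]" "[]" a i] assms by simp
  then show "U.I [] a \<in> GW 0" using U.W.has_nsum_G[OF s] U.W.G_scale by blast
qed

text \<open>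
  The curvature of \<open>U\<^sub>\<star>(a)\<close> is expanded as a sum over lists of exponents and regrouped by their total. The
  hypothesis is a finite identity for each total, so that the result also holds for \<open>a\<close> outside
  \<open>F 1\<close>, provided that the powers tend to zero.
\<close>

lemma curvature_series:
  assumes a: "a \<in> GV 0" "nullf FW (\<lambda>k. u (replicate k a)) UNIV"
    and fin: "\<And>n. (\<Sum>ns\<in>compositions n. SW (fact n / (prod_fact ns * fact (length ns)))
                 (b (map (\<lambda>i. u (replicate i a)) ns))) = SW (of_nat n) (z n)"
  shows "has_nsum FW (\<lambda>n. SW (1 / fact n) (SW (of_nat n) (z n))) UNIV (W.I [] (U.I [] a))"
proof -
  let ?w = "\<lambda>i. u (replicate i a)"
  let ?h = "\<lambda>is. SW (1 / fact (length is)) (SW (1 / prod_fact is) (b (map ?w is)))"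
  note s = power_sum[OF a]
  have "has_nsum FW (\<lambda>is. SW (1 / fact (length is)) (b (map2 (\<lambda>h i. h i) (replicate (length is) (\<lambda>i. SW (1 / fact i) (?w i))) is)))
      UNIV (W.I [] (U.I [] a))"
    using W.ins_expand[OF _ _ s, of "[]" "[]" "[]"] by simp
  then have all: "has_nsum FW ?h UNIV (W.I [] (U.I [] a))"
    unfolding map2_replicate scaled_powers[of "[]", simplified] .
  show ?thesis
  proof (rule U.W.has_nsum_group[OF all, where q = sum_list])
    fix n
    have "has_nsum FW ?h {is \<in> UNIV. sum_list is = n} (sum ?h (compositions n))"
    proof (rule U.W.has_nsum_support_on[OF finite_compositions])
      fix "is" assume "is \<in> {is \<in> UNIV. sum_list is = n} - compositions n"
      then have "0 \<in> set is" by (auto simp: compositions_def)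
      then have "0 \<in> set (map ?w is)" by force
      then obtain xs ys where "map ?w is = xs @ 0 # ys" by (meson split_list)
      then have "b (map ?w is) = 0" using W.f_zero[of xs ys] by (simp only:)
      then show "?h is = 0" by simp
    qed (auto simp: compositions_def)
    moreover have "sum ?h (compositions n) = SW (1 / fact n) (\<Sum>ns\<in>compositions n. SW (fact n / (prod_fact ns * fact (length ns))) (b (map ?w ns)))"
      unfolding U.W.scale_sum_right by (intro sum.cong refl) (simp add: mult.commute)
    ultimately show "has_nsum FW ?h {is \<in> UNIV. sum_list is = n} (SW (1 / fact n) (SW (of_nat n) (z n)))"
      unfolding fin by simp
  qed simp
qed

lemma marked_series:
  assumes a: "a \<in> GV 0" "nullf FW (\<lambda>k. u (replicate k a)) UNIV"
    and x: "x \<in> GV k" "nullf FW (\<lambda>k. u (x # replicate k a)) UNIV"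
    and fin: "\<And>n. (\<Sum>m\<le>n. \<Sum>ns\<in>compositions (n - m). SW (fact n / (fact m * prod_fact ns * fact (length ns)))
                 (b (u (x # replicate m a) # map (\<lambda>i. u (replicate i a)) ns))) = z n"
  shows "has_nsum FW (\<lambda>n. SW (1 / fact n) (z n)) UNIV (W.I [U.I [x] a] (U.I [] a))"
proof -
  let ?w = "\<lambda>i. u (replicate i a)" and ?v = "\<lambda>m. SW (1 / fact m) (u (x # replicate m a))"
  let ?h = "\<lambda>is. SW (1 / fact (length is - 1)) (b (?v (hd is) # map (\<lambda>i. SW (1 / fact i) (?w i)) (tl is)))"
  note s = power_sum[OF a]
  have v: "has_nsum FW ?v UNIV (U.I [x] a)"
    using U.ins_sum_null[of "[x]" "[k]" a] a x by simp
  have "u (x # replicate i a) \<in> GW k" for i using U.deg_replicate[of "[x]" "[k]" a i] a x by simp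
  then have vG: "U.I [x] a \<in> GW k" using U.W.has_nsum_G[OF v] U.W.G_scale by blast
  have "has_nsum FW (\<lambda>is. SW (1 / fact (length is - length [?v])) (b (map2 (\<lambda>h i. h i) ([?v] @ replicate (length is - length [?v]) (\<lambda>i. SW (1 / fact i) (?w i))) is)))
      {is. length [?v] \<le> length is} (W.I [U.I [x] a] (U.I [] a))"
    by (rule W.ins_expand[OF _ _ s, where ds = "[k]"]) (use v vG in auto)
  then have all: "has_nsum FW ?h {is. 1 \<le> length is} (W.I [U.I [x] a] (U.I [] a))"
    unfolding list.size One_nat_def[symmetric] add_0
  proof (rule U.W.has_nsum_congD)
    fix "is" :: "nat list" assume "is \<in> {is. 1 \<le> length is}"
    then obtain m ns where "is = m # ns" by (cases "is") auto
    then show "SW (1 / fact (length is - 1)) (b (map2 (\<lambda>h i. h i) ([?v] @ replicate (length is - 1) (\<lambda>i. SW (1 / fact i) (?w i))) is)) = ?h is"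
      by (simp add: map2_replicate)
  qed
  have hc: "?h (m # ns) = SW (1 / (fact m * prod_fact ns * fact (length ns))) (b (u (x # replicate m a) # map ?w ns))" for m ns
    using scaled_powers[of "[?v m]" ?w ns] W.f_scale[of "[]" "1 / fact m" "u (x # replicate m a)" "map ?w ns"]
    by (simp add: mult.commute mult.left_commute)
  show ?thesis
  proof (rule U.W.has_nsum_group[OF all, where q = sum_list])
    fix n :: nat
    let ?X = "{is. 1 \<le> length is \<and> sum_list is = n \<and> 0 \<notin> set (tl is)}"
    let ?S = "Sigma {..n} (\<lambda>m. compositions (n - m))"
    have X: "?X = (\<lambda>(m, ns). m # ns) ` ?S"
    proof (intro equalityI subsetI)
      fix "is" assume "is \<in> ?X"
      then obtain m ns where "is = m # ns" "m + sum_list ns = n" "0 \<notin> set ns" by (cases "is") auto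
      then show "is \<in> (\<lambda>(m, ns). m # ns) ` ?S" by (intro image_eqI[of _ _ "(m, ns)"]) (auto simp: compositions_def)
    qed (auto simp: compositions_def)
    have inj: "inj_on (\<lambda>(m, ns). m # ns) ?S" by (auto simp: inj_on_def)
    have fS: "finite ?S" by (auto intro: finite_compositions)
    have "has_nsum FW ?h {is \<in> {is. 1 \<le> length is}. sum_list is = n} (sum ?h ?X)"
    proof (rule U.W.has_nsum_support_on)
      show "finite ?X" unfolding X by (rule finite_imageI[OF fS])
      fix "is" assume "is \<in> {is \<in> {is. 1 \<le> length is}. sum_list is = n} - ?X"
      then have "0 \<in> set (tl is)" by auto
      then have "0 \<in> set (?v (hd is) # map (\<lambda>i. SW (1 / fact i) (?w i)) (tl is))" by force
      then obtain xs ys where "?v (hd is) # map (\<lambda>i. SW (1 / fact i) (?w i)) (tl is) = xs @ 0 # ys" by (meson split_list)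
      then have "b (?v (hd is) # map (\<lambda>i. SW (1 / fact i) (?w i)) (tl is)) = 0" using W.f_zero[of xs ys] by (simp only:)
      then show "?h is = 0" by simp
    qed auto
    moreover have "sum ?h ?X = SW (1 / fact n) (z n)"
    proof -
      have "sum ?h ?X = (\<Sum>(m, ns)\<in>?S. ?h (m # ns))"
        unfolding X sum.reindex[OF inj] by (rule sum.cong) auto
      also have "\<dots> = (\<Sum>m\<le>n. \<Sum>ns\<in>compositions (n - m). ?h (m # ns))"
        by (rule sum.Sigma[symmetric]) (auto simp: finite_compositions)
      also have "\<dots> = SW (1 / fact n) (z n)"
        unfolding fin[symmetric] U.W.scale_sum_right hc by (intro sum.cong refl) simp
      finally show ?thesis .
    qed
    ultimately show "has_nsum FW ?h {is \<in> {is. 1 \<le> length is}. sum_list is = n} (SW (1 / fact n) (z n))" by simp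
  qed simp
qed

end

section \<open>Filtered L-infinity algebras and their shifts\<close>

text \<open>
  Only the grading changes under the shift.
\<close>

lemma shift1_simps [simp]:
  "scl (shift1 L) = scl L" "grd (shift1 L) i = grd L (i + 1)" "fil (shift1 L) = fil L" "brk (shift1 L) = brk L"
  by (simp_all add: shift1_def)

lemma decomposition_shift1:
  "is_decomposition L v c \<longleftrightarrow> is_decomposition (shift1 L) v (\<lambda>i. c (i + 1))"
proof -
  have s: "{i. c i \<noteq> 0} = (\<lambda>i. i + 1) ` {i. c (i + 1) \<noteq> 0}"
    by (auto simp: image_iff) (metis diff_add_cancel)
  have inj: "inj_on (\<lambda>i. i + 1) {i::int. c (i + 1) \<noteq> 0}" by (simp add: inj_on_def)
  have "(\<forall>i. c i \<in> grd L i) \<longleftrightarrow> (\<forall>i. c (i + 1) \<in> grd L (i + 1))" by (metis diff_add_cancel)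
  moreover have "finite {i. c i \<noteq> 0} \<longleftrightarrow> finite {i. c (i + 1) \<noteq> 0}" unfolding s using finite_image_iff[OF inj] .
  moreover have "(\<Sum>i | c i \<noteq> 0. c i) = (\<Sum>i | c (i + 1) \<noteq> 0. c (i + 1))" unfolding s sum.reindex[OF inj] by simp
  ultimately show ?thesis unfolding is_decomposition_def shift1_simps by simp
qed

lemma decomposition_ex1:
  assumes "graded_space (shift1 L)" shows "\<exists>!c. is_decomposition L v c"
proof -
  obtain c where c: "is_decomposition (shift1 L) v c" and u: "\<And>c'. is_decomposition (shift1 L) v c' \<Longrightarrow> c' = c"
    using assms unfolding graded_space_def by blast
  show ?thesis
  proof (rule ex1I[of _ "\<lambda>i. c (i - 1)"])
    show "is_decomposition L v (\<lambda>i. c (i - 1))" using c unfolding decomposition_shift1[of L] by simp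
    fix c' assume "is_decomposition L v c'"
    then have "(\<lambda>i. c' (i + 1)) = c" using u unfolding decomposition_shift1[of L] by blast
    then show "c' = (\<lambda>i. c (i - 1))" by (metis diff_add_cancel)
  qed
qed

lemma component_decomposition:
  assumes "graded_space (shift1 L)" shows "is_decomposition L v (component L v)"
  unfolding component_def by (rule theI'[OF decomposition_ex1[OF assms]])

lemma component_eq:
  assumes "graded_space (shift1 L)" "is_decomposition L v c" shows "component L v = c"
  using decomposition_ex1[OF assms(1)] component_decomposition[OF assms(1)] assms(2) by blast

text \<open>
  Homogeneous maps commute with taking components. This reduces the page condition to homogeneous pairs.
\<close>

lemma component_map:
  assumes L: "graded_space (shift1 L)" and M: "graded_space (shift1 M)"
    and T: "\<And>x y. T (x + y) = T x + T y" and deg: "\<And>i x. x \<in> grd L i \<Longrightarrow> T x \<in> grd M (i + e)"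
  shows "component M (T v) (i + e) = T (component L v i)"
proof -
  let ?c = "component L v"
  have d: "is_decomposition L v ?c" by (rule component_decomposition[OF L])
  have T0: "T 0 = 0" using T[of 0 0] by simp
  have Tsum: "T (sum f A) = (\<Sum>j\<in>A. T (f j))" for f :: "int \<Rightarrow> 'b" and A
    by (induction A rule: infinite_finite_induct) (auto simp: T0 T)
  let ?c' = "\<lambda>j. T (?c (j - e))"
  have fin: "finite {i. ?c i \<noteq> 0}" using d unfolding is_decomposition_def by blast
  have "is_decomposition M (T v) ?c'" unfolding is_decomposition_def
  proof (intro conjI allI)
    show "?c' j \<in> grd M j" for j using deg[of "?c (j - e)" "j - e"] d unfolding is_decomposition_def by simp
    have "{j. ?c' j \<noteq> 0} \<subseteq> (\<lambda>i. i + e) ` {i. ?c i \<noteq> 0}"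
    proof
      fix j assume "j \<in> {j. ?c' j \<noteq> 0}"
      then have "?c (j - e) \<noteq> 0" using T0 by auto
      then show "j \<in> (\<lambda>i. i + e) ` {i. ?c i \<noteq> 0}" by (intro image_eqI[of _ _ "j - e"]) auto
    qed
    note sub = this
    then show "finite {j. ?c' j \<noteq> 0}" using fin finite_subset by blast
    have inj: "inj_on (\<lambda>i. i + e) {i. ?c i \<noteq> 0}" by (simp add: inj_on_def)
    have "T v = (\<Sum>i | ?c i \<noteq> 0. T (?c i))" using d Tsum unfolding is_decomposition_def by metis
    also have "\<dots> = (\<Sum>j\<in>(\<lambda>i. i + e) ` {i. ?c i \<noteq> 0}. ?c' j)" unfolding sum.reindex[OF inj] by simp
    also have "\<dots> = (\<Sum>j | ?c' j \<noteq> 0. ?c' j)"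
      by (rule sum.mono_neutral_right[OF _ sub]) (use fin in auto)
    finally show "T v = (\<Sum>j | ?c' j \<noteq> 0. ?c' j)" .
  qed
  from component_eq[OF M this] show ?thesis by simp
qed

lemma grd_subspace:
  assumes "graded_space (shift1 L)" shows "module (scl L)" "module.subspace (scl L) (grd L j)"
proof -
  have v: "vector_space (scl L)" and g: "\<And>i. module.subspace (scl L) (grd L (i + 1))"
    using assms unfolding graded_space_def by simp_all
  show "module (scl L)" using v by (simp add: module_iff_vector_space)
  show "module.subspace (scl L) (grd L j)" using g[of "j - 1"] by simp
qed

lemma component_homogeneous:
  assumes L: "graded_space (shift1 L)" and v: "v \<in> grd L i" shows "component L v i = v"
proof -
  have "0 \<in> grd L j" for j by (rule module.subspace_0[OF grd_subspace[OF L]])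
  moreover have "{k. (if k = i then v else 0) \<noteq> 0} = (if v = 0 then {} else {i})" by auto
  ultimately have "is_decomposition L v (\<lambda>k. if k = i then v else 0)"
    unfolding is_decomposition_def using v by auto
  from component_eq[OF L this] show ?thesis by simp
qed

lemma component_diff:
  assumes L: "graded_space (shift1 L)"
  shows "component L (x - y) i = component L x i - component L y i"
proof -
  have "component L (x + y) i = component L x i + component L y i" for x y
  proof -
    let ?c = "component L x" and ?d = "component L y"
    note dx = component_decomposition[OF L, of x, unfolded is_decomposition_def]
    note dy = component_decomposition[OF L, of y, unfolded is_decomposition_def]
    let ?S = "{i. ?c i \<noteq> 0} \<union> {i. ?d i \<noteq> 0}"
    have S: "finite ?S" using dx dy by blast
    have sub: "{i. ?c i + ?d i \<noteq> 0} \<subseteq> ?S" by auto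
    have "is_decomposition L (x + y) (\<lambda>i. ?c i + ?d i)" unfolding is_decomposition_def
    proof (intro conjI allI)
      show "?c j + ?d j \<in> grd L j" for j
        by (rule module.subspace_add[OF grd_subspace[OF L]]) (use dx dy in auto)
      show "finite {i. ?c i + ?d i \<noteq> 0}" using sub S by (rule finite_subset)
      have "(\<Sum>i | ?c i + ?d i \<noteq> 0. ?c i + ?d i) = (\<Sum>i\<in>?S. ?c i + ?d i)"
        by (rule sum.mono_neutral_left[OF S sub]) auto
      also have "\<dots> = (\<Sum>i\<in>?S. ?c i) + (\<Sum>i\<in>?S. ?d i)" by (rule sum.distrib)
      also have "(\<Sum>i\<in>?S. ?c i) = x" using dx by (subst sum.mono_neutral_right[OF S, of "{i. ?c i \<noteq> 0}"]) auto
      also have "(\<Sum>i\<in>?S. ?d i) = y" using dy by (subst sum.mono_neutral_right[OF S, of "{i. ?d i \<noteq> 0}"]) auto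
      finally show "x + y = (\<Sum>i | ?c i + ?d i \<noteq> 0. ?c i + ?d i)" by simp
    qed
    from component_eq[OF L this] show ?thesis by simp
  qed
  from this[of "x - y" y] show ?thesis by (simp add: algebra_simps)
qed

text \<open>
  A vector in all \<open>F p\<close> has its components there, and these vanish by uniqueness of limits in each degree.
\<close>

lemma filtered_space_shift1:
  assumes L: "graded_space (shift1 L)" and c: "complete_filtration st L" "0 \<le> st"
  shows "filtered_space (scl L) (grd (shift1 L)) (fil L)"
proof -
  have vs: "vector_space (scl L)" and gs: "module.subspace (scl L) (grd (shift1 L) i)" for i
    using L unfolding graded_space_def by auto
  interpret vector_space "scl L" by (rule vs)
  have c': "\<And>p. subspace (fil L p)" "\<And>p v i. v \<in> fil L p \<Longrightarrow> component L v i \<in> fil L p"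
    "\<And>p. fil L (p + 1) \<subseteq> fil L p" "\<And>p. p \<le> st \<Longrightarrow> fil L p = UNIV"
    and cc: "\<And>k x. (\<forall>p::int. x p \<in> grd L k \<and> x (p + 1) - x p \<in> fil L p) \<Longrightarrow>
        (\<exists>!v. v \<in> grd L k \<and> (\<forall>p. v - x p \<in> fil L p))"
    using c(1) unfolding complete_filtration_def by blast+
  show ?thesis
  proof
    show "subspace (grd (shift1 L) k)" for k by (rule gs)
    show "subspace (fil L p)" for p by (rule c'(1))
    show "fil L (p + 1) \<subseteq> fil L p" for p by (rule c'(3))
    show "fil L p = UNIV" if "p \<le> 0" for p using c'(4)[of p] that c(2) by simp
    show "v = 0" if v: "\<And>p. v \<in> fil L p" for v
    proof -
      note d = component_decomposition[OF L, of v]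
      have "component L v i = 0" for i
      proof -
        have "0 \<in> grd L i" using subspace_0[OF gs[of "i - 1"]] by simp
        moreover have "0 \<in> fil L p" for p using subspace_0[OF c'(1)] .
        ultimately have "\<exists>!w. w \<in> grd L i \<and> (\<forall>p. w - 0 \<in> fil L p)" by (intro cc) simp
        moreover have "component L v i \<in> grd L i" using d unfolding is_decomposition_def by blast
        ultimately show ?thesis
          using c'(2)[OF v] \<open>0 \<in> grd L i\<close> \<open>\<And>p. 0 \<in> fil L p\<close> by (metis diff_zero)
      qed
      then show ?thesis using d unfolding is_decomposition_def by simp
    qed
    fix x :: "int \<Rightarrow> 'b" and k
    assume x: "\<And>p. x p \<in> grd (shift1 L) k" "\<And>p. x (p + 1) - x p \<in> fil L p"
    have "\<exists>!v. v \<in> grd L (k + 1) \<and> (\<forall>p. v - x p \<in> fil L p)" by (rule cc) (use x in simp)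
    then show "\<exists>v\<in>grd (shift1 L) k. \<forall>p. v - x p \<in> fil L p" by auto
  qed
qed

lemma nilz_Cons [simp]: "nilz f (x # xs) = f (x # xs)" "nilz f (xs @ y # ys) = f (xs @ y # ys)" "nilz f [] = 0"
  by (simp_all add: nilz_def)

lemma multimap_shift1:
  assumes "filtered_space (scl L) (grd (shift1 L)) (fil L)" "filtered_space (scl M) (grd (shift1 M)) (fil M)"
    and "multilinear_on_lists (scl L) (scl M) f" "graded_symmetric (shift1 L) (scl M) f"
    and "has_degree (shift1 L) (shift1 M) f e" "raises_filtration L M f \<sigma>" "0 \<le> \<sigma>"
  shows "multimap (scl L) (grd (shift1 L)) (fil L) (scl M) (grd (shift1 M)) (fil M) (nilz f) e \<sigma>"
proof -
  interpret V: filtered_space "scl L" "grd (shift1 L)" "fil L" by (rule assms)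
  interpret W: filtered_space "scl M" "grd (shift1 M)" "fil M" by (rule assms)
  note ml = assms(3)[unfolded multilinear_on_lists_def]
  show ?thesis
  proof
    show "nilz f (xs @ (a + b) # ys) = nilz f (xs @ a # ys) + nilz f (xs @ b # ys)" for xs a b ys
      using ml by simp
    show "nilz f (xs @ scl L c a # ys) = scl M c (nilz f (xs @ a # ys))" for xs c a ys using ml by simp
    show "nilz f (xs @ a # b # ys) = scl M (parity_sign (i * j)) (nilz f (xs @ b # a # ys))"
      if "a \<in> grd (shift1 L) i" "b \<in> grd (shift1 L) j" for a i b j xs ys
      unfolding nilz_Cons by (rule assms(4)[unfolded graded_symmetric_def, rule_format, OF that])
    show "nilz f vs \<in> grd (shift1 M) (sum_list is + e)"
      if "vs \<noteq> []" "lies_in (grd (shift1 L)) vs is" for vs "is"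
      using assms(5)[unfolded has_degree_def, rule_format, OF that] that(1) by (simp add: nilz_def)
    show "nilz f vs \<in> fil M (sum_list is + \<sigma>)"
      if "vs \<noteq> []" "lies_in (fil L) vs is" for vs "is"
      using assms(6)[unfolded raises_filtration_def, rule_format, OF that] that(1) by (simp add: nilz_def)
  qed (simp_all add: assms(7))
qed

text \<open>
  From here on, degrees of a shift are not rewritten: the facts about filtered spaces refer to
  \<open>grd (shift1 L)\<close> as a whole.
\<close>

declare shift1_simps(2) [simp del]

lemma mc_algebra_shift1:
  assumes M: "shifted_Linf_algebra (shift1 M)" and c: "complete_filtration 1 M" and f: "filtration_compatible M M (brk M)"
  shows "mc_algebra (scl M) (grd (shift1 M)) (fil M) (nilz (brk M))"
proof -
  note M' = M[unfolded shifted_Linf_algebra_def shift1_simps(1,3,4)]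
  have fs: "filtered_space (scl M) (grd (shift1 M)) (fil M)"
    by (rule filtered_space_shift1[OF _ c]) (use M' in auto)
  interpret multimap "scl M" "grd (shift1 M)" "fil M" "scl M" "grd (shift1 M)" "fil M" "nilz (brk M)" 1 0
    by (rule multimap_shift1[OF fs fs]) (use M' f in auto)
  show ?thesis
  proof
    show "fil M 1 = UNIV" using c unfolding complete_filtration_def by simp
  qed (use twisted_square_coefficients[OF M] twisted_leibniz_coefficients[OF M] in \<open>simp_all only: shift1_simps(1,3,4)\<close>)
qed

text \<open>
  The setting of the theorem. The interpretations below supply, in turn, the space \<open>V\<close>, the algebra \<open>W\<close>, the
  operations of \<open>U\<close>, and the structures on them.
\<close>

locale abelian_to_Linf =
  fixes L :: "('k::field_char_0, 'v::ab_group_add) bracket_space"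
    and M :: "('k, 'w::ab_group_add) bracket_space" and U :: "'v list \<Rightarrow> 'w" and r :: int
  assumes L: "Linf_algebra L" and M: "Linf_algebra M"
    and cL: "complete_filtration 0 L" and cM: "complete_filtration 1 M"
    and fL: "filtration_compatible L L (brk L)" and fM: "filtration_compatible M M (brk M)"
    and ab: "abelian L" and U: "infinity_morphism (shift1 L) (shift1 M) U" and r: "r \<ge> 1"
    and page: "page_vanishes (cone_diffl L M (linear_part U)) (cone_fil L M) r"
    and raises: "raises_filtration L M U (r - 1)"
    and finite_sum: "\<And>a. \<exists>N. \<forall>n\<ge>N. U (replicate n a) = 0"
    and H1: "\<And>q::nat. 2 ^ q < r \<Longrightarrow> quotient_cohomology_vanishes M (2 ^ q) (min (2 ^ (q + 1)) r) 1"
begin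

abbreviation "GV \<equiv> grd (shift1 L)"
abbreviation "GW \<equiv> grd (shift1 M)"

lemma abV: "abelian (shift1 L)" using ab unfolding abelian_def by simp

lemmas LV = L[unfolded Linf_algebra_def] and MW = M[unfolded Linf_algebra_def]
lemmas LV' = LV[unfolded shifted_Linf_algebra_def shift1_simps(1,3,4)]
lemmas MW' = MW[unfolded shifted_Linf_algebra_def shift1_simps(1,3,4)]
lemmas U' = U[unfolded infinity_morphism_def shift1_simps(1,3,4)]

lemma gL: "graded_space (shift1 L)" using LV' by blast
lemma gM: "graded_space (shift1 M)" using MW' by blast

sublocale D: multimap "scl L" "GV" "fil L" "scl L" "GV" "fil L" "nilz (brk L)" 1 0
  by (rule multimap_shift1[OF filtered_space_shift1[OF gL cL] filtered_space_shift1[OF gL cL]])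
    (use LV' fL in auto)

sublocale W: mc_algebra "scl M" "GW" "fil M" "nilz (brk M)"
  by (rule mc_algebra_shift1[OF MW cM fM])

sublocale U: multimap "scl L" "GV" "fil L" "scl M" "GW" "fil M" "nilz U" 0 "r - 1"
  by (rule multimap_shift1[OF D.V.filtered_space_axioms W.V.filtered_space_axioms])
    (use U' raises r in auto)

sublocale P: morphism_series "scl L" "GV" "fil L" "scl M" "GW" "fil M" "nilz U" "nilz (brk M)" r ..

lemma d_diff: "diffl L (x - y) = diffl L x - diffl L y"
  using D.f_diff[of "[]" x y "[]"] by (simp add: diffl_def)

lemma d_add: "diffl L (x + y) = diffl L x + diffl L y"
  using D.f_add[of "[]" x y "[]"] by (simp add: diffl_def)

lemma d_scale: "diffl L (scl L c x) = scl L c (diffl L x)"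
  using D.f_scale[of "[]" c x "[]"] by (simp add: diffl_def)

lemma d_G: "x \<in> GV k \<Longrightarrow> diffl L x \<in> GV (k + 1)"
  using D.f_deg[of "[x]" "[k]"] by (simp add: diffl_def)

lemma d_F: "x \<in> fil L p \<Longrightarrow> diffl L x \<in> fil L p"
  using D.f_fil[of "[x]" "[p]"] by (simp add: diffl_def)

lemma d_d: assumes "x \<in> GV k" shows "diffl L (diffl L x) = 0"
  using twisted_square_coefficients[OF LV assms, of 0 0] D.V.G_zero D.f_zero[of "[]" "[x]"] by (simp add: diffl_def)

lemma star_curvature:
  assumes a: "a \<in> GV 0" "nullf (fil M) (\<lambda>k. nilz U (replicate k a)) UNIV"
  shows "has_nsum (fil M) (\<lambda>n. scl M (1 / fact n) (scl M (of_nat n) (nilz U (diffl L a # replicate (n - 1) a)))) UNIV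
           (W.I [] (U.I [] a))"
  by (rule P.curvature_series[OF a]) (use morphism_on_powers[OF LV MW abV U a(1)] in \<open>simp add: diffl_def\<close>)

lemma star_tangent:
  assumes a: "a \<in> GV 0" "nullf (fil M) (\<lambda>k. nilz U (replicate k a)) UNIV" "diffl L a = 0"
    and x: "x \<in> GV k" "nullf (fil M) (\<lambda>k. nilz U (x # replicate k a)) UNIV"
  shows "has_nsum (fil M) (\<lambda>n. scl M (1 / fact n) (nilz U (diffl L x # replicate n a))) UNIV
           (W.I [U.I [x] a] (U.I [] a))"
  by (rule P.marked_series[OF a(1,2) x])
    (use morphism_on_marked_powers[OF LV MW abV U a(1) _ x(1)] a(3) in \<open>simp add: diffl_def\<close>)

sublocale P: abelian_morphism "scl L" "GV" "fil L" "scl M" "GW" "fil M" "nilz U" "nilz (brk M)" r "diffl L"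
proof
  show "W.I [] (U.I [] a) = U.I [diffl L a] a" if a: "a \<in> GV 0" "a \<in> fil L 1" for a
  proof (rule W.V.has_nsum_unique[OF star_curvature[OF a(1)]])
    show "nullf (fil M) (\<lambda>k. nilz U (replicate k a)) UNIV" using U.ins_null[OF a(2), of "[]"] by simp
    show "has_nsum (fil M) (\<lambda>n. scl M (1 / fact n) (scl M (of_nat n) (nilz U (diffl L a # replicate (n - 1) a)))) UNIV
        (U.I [diffl L a] a)"
      using U.ins_shift_sum[of "[]" "diffl L a" "[1]" a] a d_G[OF a(1)] by simp
  qed
  show "W.I [U.I [x] a] (U.I [] a) = U.I [diffl L x] a"
    if a: "a \<in> GV 0" "a \<in> fil L 1" "diffl L a = 0" and x: "x \<in> GV k" for a x k
  proof (rule W.V.has_nsum_unique[OF star_tangent[OF a(1) _ a(3) x]])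
    show "nullf (fil M) (\<lambda>k. nilz U (replicate k a)) UNIV" using U.ins_null[OF a(2), of "[]"] by simp
    show "nullf (fil M) (\<lambda>k. nilz U (x # replicate k a)) UNIV" using U.ins_null[OF a(2), of "[x]"] by simp
    show "has_nsum (fil M) (\<lambda>n. scl M (1 / fact n) (nilz U (diffl L x # replicate n a))) UNIV (U.I [diffl L x] a)"
      using U.ins_sum[of "[diffl L x]" "[k + 1]" a] a d_G[OF x] by simp
  qed
qed (rule d_diff d_scale d_G d_F d_d; assumption?)+

text \<open>
  A cycle of the cone with homogeneous entries \<open>a\<close>, \<open>c\<close> is written as \<open>y + d z\<close> by the vanishing of the page. The
  entries of \<open>z\<close> need not be homogeneous, but their components in the right degrees have the same
  properties.
\<close>

lemma page_base: "P.page_condition UNIV UNIV"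
  unfolding P.page_condition_def
proof (intro allI impI)
  fix k p a c
  assume a: "a \<in> UNIV \<inter> GV (k + 1) \<inter> fil L p" and c: "c \<in> UNIV \<inter> GW k \<inter> fil M p"
    and da: "diffl L a \<in> fil L (p + r)" and dc: "nilz U [a] - nilz (brk M) [c] \<in> fil M (p + r)"
  have "(a, c) \<in> page_cycles (cone_diffl L M (linear_part U)) (cone_fil L M) r p"
    using a c da dc unfolding page_cycles_def cone_diffl_def cone_fil_def linear_part_def diffl_def by simp
  then obtain y z where yz: "(a, c) = y + cone_diffl L M (linear_part U) z"
    and y: "y \<in> page_cycles (cone_diffl L M (linear_part U)) (cone_fil L M) (r - 1) (p + 1)"
    and z: "z \<in> page_cycles (cone_diffl L M (linear_part U)) (cone_fil L M) (r - 1) (p - r + 1)"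
    using page unfolding page_vanishes_def by blast
  obtain x0 y0 where z0: "z = (x0, y0)" by (cases z)
  obtain y1 y2 where y0: "y = (y1, y2)" by (cases y)
  let ?T = "\<lambda>w. nilz (brk M) [w]" and ?P = "\<lambda>v. nilz U [v]"
  have z1: "x0 \<in> fil L (p - r + 1)" "y0 \<in> fil M (p - r + 1)" "diffl L x0 \<in> fil L p" "?P x0 - ?T y0 \<in> fil M p"
    using z unfolding z0 page_cycles_def cone_diffl_def cone_fil_def linear_part_def diffl_def by simp_all
  have y1: "a - diffl L x0 \<in> fil L (p + 1)" "c - (?P x0 - ?T y0) \<in> fil M (p + 1)"
    using y yz unfolding z0 y0 page_cycles_def cone_diffl_def cone_fil_def linear_part_def diffl_def
    by (auto simp: diff_diff_eq2)
  have cF: "component L v i \<in> fil L q" if "v \<in> fil L q" for v i q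
    using cL that unfolding complete_filtration_def by blast
  have cF': "component M v i \<in> fil M q" if "v \<in> fil M q" for v i q
    using cM that unfolding complete_filtration_def by blast
  have cG: "component L v i \<in> grd L i" for v i
    using component_decomposition[OF gL, of v] unfolding is_decomposition_def by blast
  have cG': "component M v i \<in> grd M i" for v i
    using component_decomposition[OF gM, of v] unfolding is_decomposition_def by blast
  have m1: "component L (diffl L v) (i + 1) = diffl L (component L v i)" for v i
    using component_map[OF gL gL, of "diffl L" 1] d_add d_G[of _ "j - 1" for j] by (simp add: shift1_simps(2))
  have m2: "component M (?T v) (i + 1) = ?T (component M v i)" for v i
  proof (rule component_map[OF gM gM])
    show "?T (x + y) = ?T x + ?T y" for x y using W.f_add[of "[]" x y "[]"] by simp
    show "?T x \<in> grd M (j + 1)" if "x \<in> grd M j" for j x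
      using W.f_deg[of "[x]" "[j - 1]"] that by (simp add: shift1_simps(2))
  qed
  have m3: "component M (?P v) (i + 0) = ?P (component L v i)" for v i
  proof (rule component_map[OF gL gM])
    show "?P (x + y) = ?P x + ?P y" for x y using U.f_add[of "[]" x y "[]"] by simp
    show "?P x \<in> grd M (j + 0)" if "x \<in> grd L j" for j x
      using U.f_deg[of "[x]" "[j - 1]"] that by (simp add: shift1_simps(2))
  qed
  have ca: "component L a (k + 2) = a" by (rule component_homogeneous[OF gL]) (use a in \<open>simp add: shift1_simps(2) add.assoc\<close>)
  have cc: "component M c (k + 1) = c" by (rule component_homogeneous[OF gM]) (use c in \<open>simp add: shift1_simps(2)\<close>)
  \<comment> \<open>degree \<open>k\<close> in \<open>V\<close> and degree \<open>k - 1\<close> in \<open>W\<close> are one higher in \<open>L\<close> and \<open>M\<close>\<close>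
  define x where "x = component L x0 (k + 1)"
  define y where "y = component M y0 k"
  have dx: "diffl L x = component L (diffl L x0) (k + 2)" using m1[of x0 "k + 1"] unfolding x_def by (simp add: add.assoc)
  have uxy: "?P x - ?T y = component M (?P x0 - ?T y0) (k + 1)"
    unfolding component_diff[OF gM] using m3[of x0 "k + 1"] m2[of y0 k] unfolding x_def y_def by simp
  have "x \<in> UNIV \<inter> GV k \<inter> fil L (p - r + 1)" unfolding x_def using cF z1(1) cG by (simp add: shift1_simps(2))
  moreover have "y \<in> UNIV \<inter> GW (k - 1) \<inter> fil M (p - r + 1)" unfolding y_def using cF' z1(2) cG' by (simp add: shift1_simps(2))
  moreover have "diffl L x \<in> fil L p" unfolding dx by (rule cF[OF z1(3)])
  moreover have "?P x - ?T y \<in> fil M p" unfolding uxy by (rule cF'[OF z1(4)])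
  moreover have "a - diffl L x \<in> fil L (p + 1)"
    using cF[OF y1(1), of "k + 2"] unfolding component_diff[OF gL] dx ca .
  moreover have "c - ?P x + ?T y \<in> fil M (p + 1)"
  proof -
    have "c - ?P x + ?T y = c - (?P x - ?T y)" by simp
    also have "\<dots> = component M (c - (?P x0 - ?T y0)) (k + 1)"
      unfolding uxy component_diff[OF gM, of c] cc ..
    finally show ?thesis using cF'[OF y1(2)] by simp
  qed
  ultimately show "\<exists>x\<in>UNIV \<inter> GV k \<inter> fil L (p - r + 1). \<exists>y\<in>UNIV \<inter> GW (k - 1) \<inter> fil M (p - r + 1).
      diffl L x \<in> fil L p \<and> ?P x - ?T y \<in> fil M p \<and> a - diffl L x \<in> fil L (p + 1) \<and> c - ?P x + ?T y \<in> fil M (p + 1)"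
    by blast
qed

lemma H1_base: "P.H1_condition UNIV"
  unfolding P.H1_condition_def
proof (intro allI impI ballI)
  fix q :: nat and z
  assume q: "2 ^ q < r" and z: "z \<in> UNIV \<inter> GW 0 \<inter> fil M (2 ^ q)" "nilz (brk M) [z] \<in> fil M (min (2 ^ (q + 1)) r)"
  have "\<exists>y\<in>fil M (2 ^ q) \<inter> grd M (1 - 1). z - diffl M y \<in> fil M (min (2 ^ (q + 1)) r)"
    using H1[OF q] z unfolding quotient_cohomology_vanishes_def diffl_def by (simp add: shift1_simps(2))
  then show "\<exists>y\<in>UNIV \<inter> GW (-1) \<inter> fil M (2 ^ q). z - nilz (brk M) [y] \<in> fil M (min (2 ^ (q + 1)) r)"
    by (auto simp: shift1_simps(2) diffl_def)
qed

sublocale Q: quasi_iso_pair "scl L" "GV" "fil L" "scl M" "GW" "fil M" "nilz U" "nilz (brk M)" r "diffl L"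
  by unfold_locales (rule page_base H1_base)+

end

section \<open>Maurer-Cartan simplices as paths\<close>

text \<open>
  The reason why no signs appear in the Maurer-Cartan equation of a 1-simplex: the only coefficients moved past \<open>dt\<close>
  have degree \<open>0\<close>.
\<close>

lemma grading_involution_even:
  assumes g: "graded_space V" and v: "v \<in> grd V 0" shows "grading_involution V v = v"
proof -
  have m: "module (scl V)" and s: "\<And>i. module.subspace (scl V) (grd V i)"
    using g unfolding graded_space_def by (auto simp: module_iff_vector_space)
  have z: "0 \<in> grd V i" for i by (rule module.subspace_0[OF m s])
  have supp: "{k::int. (if k = 0 then v else 0) \<noteq> 0} = (if v = 0 then {} else {0})" by auto
  have "is_decomposition V v (\<lambda>k. if k = 0 then v else 0)"
    unfolding is_decomposition_def supp using v z by auto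
  moreover have "\<exists>!c. is_decomposition V v c" using g unfolding graded_space_def by blast
  ultimately have c: "component V v = (\<lambda>k. if k = 0 then v else 0)"
    unfolding component_def by (rule the1_equality[rotated])
  show ?thesis unfolding grading_involution_def c supp by (simp add: parity_sign_def module.scale_one[OF m])
qed

lemma form_bracket_even:
  assumes g: "graded_space V" and h: "\<And>i. h (i, False) \<in> grd V 0"
  shows "form_bracket V (replicate n h) (m, dt) = (\<Sum>bs | length bs = n \<and> sum_list (map fst bs) = m
             \<and> length (filter snd bs) = (if dt then 1 else 0). brk V (map h bs))"
  unfolding form_bracket_def case_prod_conv length_replicate
proof (rule sum.cong[OF refl])
  fix bs :: "(nat \<times> bool) list"
  assume "bs \<in> {bs. length bs = n \<and> sum_list (map fst bs) = m \<and> length (filter snd bs) = (if dt then 1 else 0)}"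
  then have l: "length bs = n" and f: "length (filter snd bs) \<le> 1" by auto
  have inv: "(grading_involution V ^^ c) v = v" if "v \<in> grd V 0" for c v
    by (induction c) (auto simp: grading_involution_even[OF g that])
  have "(grading_involution V ^^ length (filter snd (take j bs))) (h (bs ! j)) = h (bs ! j)" if j: "j < n" for j
  proof (cases "length (filter snd (take j bs)) = 0")
    case False
    have "bs = take j bs @ bs ! j # drop (Suc j) bs" using id_take_nth_drop[of j bs] j l by simp
    then have "length (filter snd bs) = length (filter snd (take j bs)) + length (filter snd (bs ! j # drop (Suc j) bs))"
      by (metis filter_append length_append)
    then have "\<not> snd (bs ! j)" using False f by (auto split: if_splits)
    then have "h (bs ! j) \<in> grd V 0" using h by (cases "bs ! j") simp
    then show ?thesis by (rule inv)
  qed simp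
  then show "brk V (map (\<lambda>j. (grading_involution V ^^ length (filter snd (take j bs))) ((replicate n h ! j) (bs ! j))) [0..<n])
      = brk V (map h bs)"
    by (intro arg_cong[where f = "brk V"] nth_equalityI) (auto simp: l)
qed

lemma flags_none: "{ds. length ds = n \<and> length (filter id ds) = 0} = {replicate n False}"
proof (intro equalityI subsetI)
  fix ds assume "ds \<in> {ds. length ds = n \<and> length (filter id ds) = 0}"
  then have n: "length ds = n" and "\<forall>d\<in>set ds. \<not> id d" by (auto simp: filter_empty_conv)
  then have "ds = replicate n False" by (intro replicate_eqI) auto
  then show "ds \<in> {replicate n False}" by simp
qed simp

lemma flags_one: "{ds. length ds = n \<and> length (filter id ds) = 1} = (\<lambda>l. replicate l False @ True # replicate (n - 1 - l) False) ` {..<n}"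
proof (intro equalityI subsetI)
  fix ds assume "ds \<in> {ds. length ds = n \<and> length (filter id ds) = 1}"
  then have n: "length ds = n" and "length (filter id ds) = 1" by auto
  then obtain x where "filter id ds = x # []" by (auto simp: length_Suc_conv)
  then obtain us vs where ds: "ds = us @ x # vs" "\<forall>u\<in>set us. \<not> id u" "id x" "[] = filter id vs"
    unfolding filter_eq_Cons_iff by blast
  have "\<forall>v\<in>set vs. \<not> id v" using ds(4) by (metis filter_empty_conv)
  then have "us = replicate (length us) False" "vs = replicate (length vs) False"
    using ds(2) by (auto intro!: replicate_eqI)
  moreover have "length vs = n - 1 - length us" "length us < n" using n ds(1) by auto
  ultimately show "ds \<in> (\<lambda>l. replicate l False @ True # replicate (n - 1 - l) False) ` {..<n}"
    using ds(1,3) by (intro image_eqI[of _ _ "length us"]) auto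
qed auto

lemma finite_lists_sum: "finite {is. length is = n \<and> sum_list is = (m::nat)}"
proof (rule finite_subset[OF _ finite_lists_length_eq[OF finite_atMost[of m], of n]])
  show "{is. length is = n \<and> sum_list is = m} \<subseteq> {xs. set xs \<subseteq> {..m} \<and> length xs = n}"
    using member_le_sum_list by fastforce
qed

text \<open>
  A list of basis forms is a list of exponents together with a list of flags.
\<close>

lemma sum_over_flags:
  assumes "finite D" "\<And>ds. ds \<in> D \<Longrightarrow> length ds = n"
  shows "(\<Sum>bs | length bs = n \<and> sum_list (map fst bs) = m \<and> map snd bs \<in> D. f bs)
     = (\<Sum>ds\<in>D. \<Sum>is | length is = n \<and> sum_list is = (m::nat). f (zip is ds))"
proof -
  note fin = finite_lists_sum[of n m]
  have "(\<Sum>ds\<in>D. \<Sum>is | length is = n \<and> sum_list is = m. f (zip is ds))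
    = (\<Sum>(ds, is)\<in>Sigma D (\<lambda>_. {is. length is = n \<and> sum_list is = m}). f (zip is ds))"
    by (rule sum.Sigma) (use assms fin in auto)
  also have "\<dots> = (\<Sum>bs | length bs = n \<and> sum_list (map fst bs) = m \<and> map snd bs \<in> D. f bs)"
    by (rule sum.reindex_bij_witness[where i = "\<lambda>bs. (map snd bs, map fst bs)" and j = "\<lambda>(ds, is). zip is ds"])
      (use assms(2) in \<open>auto simp: zip_map_fst_snd\<close>)
  finally show ?thesis by simp
qed

context
  fixes N :: "('k::field_char_0, 'v::ab_group_add) bracket_space"
  assumes gN: "graded_space N" and mc: "mc_algebra (scl N) (grd N) (fil N) (nilz (brk N))"
begin

interpretation W: mc_algebra "scl N" "grd N" "fil N" "nilz (brk N)" by (rule mc)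
interpretation PW: mc_algebra "pS (scl N)" "pG (scl N) (grd N) (fil N)" "pF (fil N) :: int \<Rightarrow> ('k \<Rightarrow> 'v) set" "plift (nilz (brk N))"
  by (rule W.p_mc_algebra)

abbreviation "expandsN \<equiv> expands (scl N) (fil N)"
abbreviation "coefN \<equiv> coef (scl N) (fil N)"
abbreviation "pGN \<equiv> pG (scl N) (grd N) (fil N)"
abbreviation "pDN \<equiv> pD (scl N) (fil N)"
abbreviation "lift \<equiv> plift (nilz (brk N))"

text \<open>
  The series of the definition starts with \<open>k = 1\<close>, the insertion with the vanishing term for \<open>k = 0\<close>.
\<close>

lemma MC_iff: "\<alpha> \<in> MC N \<longleftrightarrow> \<alpha> \<in> grd N 0 \<and> W.I [] \<alpha> = 0"
proof -
  have "filt_sums (fil N) (\<lambda>k. scl N (1 / fact (k + 1)) (brk N (replicate (k + 1) \<alpha>))) (W.I [] \<alpha>)" if "\<alpha> \<in> grd N 0"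
  proof -
    have "has_nsum (fil N) (\<lambda>k. scl N (1 / fact (Suc k)) (nilz (brk N) ([] @ replicate (Suc k) \<alpha>))) UNIV (W.I [] \<alpha>)"
      using W.ins_sum[of "[]" "[]" \<alpha>] that
        W.V.has_nsum_Suc[of "\<lambda>k. scl N (1 / fact k) (nilz (brk N) ([] @ replicate k \<alpha>))"] by simp
    from W.V.has_nsum_imp_filt_sums[OF this] show ?thesis by (simp del: fact_Suc)
  qed
  then show ?thesis unfolding MC_def using W.V.filt_sums_unique by fastforce
qed

text \<open>
  The function of \<open>t\<close> whose coefficients are those of \<open>h\<close> at \<open>t\<^sup>i\<close>, or at \<open>t\<^sup>i dt\<close> if \<open>dt\<close> holds.
\<close>

definition face :: "(nat \<times> bool \<Rightarrow> 'v) \<Rightarrow> bool \<Rightarrow> 'k \<Rightarrow> 'v" where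
  "face h dt t = nsum (fil N) (\<lambda>i. scl N (t ^ i) (h (i, dt))) UNIV"

lemma plift_flags:
  assumes \<gamma>: "\<And>dt. \<gamma> dt \<in> pGN (if dt then -1 else 0)" and ne: "ds \<noteq> []"
    and c: "\<And>dt i. coefN (\<gamma> dt) i = h (i, dt)"
  shows "expandsN (lift (map \<gamma> ds))
      (\<lambda>m. \<Sum>is | length is = length ds \<and> sum_list is = m. brk N (map h (zip is ds)))"
proof -
  let ?fs = "map \<gamma> ds" and ?A = "{is. length is = length ds}"
  have G: "lies_in (pGN) ?fs (map (\<lambda>dt. if dt then -1 else 0) ds)"
    using \<gamma> by (simp add: list_all2_conv_all_nth)
  have coef_bracket: "W.coef_bracket ?fs is = brk N (map h (zip is ds))" if "length is = length ds" for "is"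
  proof -
    have "map2 (coefN) ?fs is = map h (zip is ds)"
      using that by (intro nth_equalityI) (auto simp: c)
    moreover have "map h (zip is ds) \<noteq> []" using that ne by (cases ds; cases "is") auto
    ultimately show ?thesis by (simp add: nilz_def)
  qed
  have pg: "\<exists>k. g \<in> pGN k" if "g \<in> set ?fs" for g using W.list_all2_pG[OF G that] .
  have "expandsN (lift ?fs) (\<lambda>m. nsum (fil N) (W.coef_bracket ?fs) {is \<in> ?A. sum_list is = m})"
  proof (rule W.V.expands_group[THEN conjunct1])
    show "nullf (fil N) (W.coef_bracket ?fs) ?A" using W.plift_null[of ?fs, OF pg] by simp
    show "W.coef_bracket ?fs is \<in> grd N (sum_list (map (\<lambda>dt. if dt then -1 else 0) ds) + 1)" if "is \<in> ?A" for "is"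
      by (rule W.fV_degree[OF G]) (use that in simp)
    show "has_nsum (fil N) (\<lambda>is. scl N (t ^ sum_list is) (W.coef_bracket ?fs is)) ?A (lift ?fs t)" for t
      using W.plift_expand[of ?fs, OF pg, of t] by simp
  qed
  moreover have "nsum (fil N) (W.coef_bracket ?fs) {is \<in> ?A. sum_list is = m}
      = (\<Sum>is | length is = length ds \<and> sum_list is = m. brk N (map h (zip is ds)))" for m
  proof -
    have fin: "finite {is \<in> ?A. sum_list is = m}" using finite_lists_sum[of "length ds" m] by simp
    show ?thesis unfolding W.V.nsum_eq[OF W.V.has_nsum_finite[OF fin]] by (intro sum.cong) (auto simp: coef_bracket)
  qed
  ultimately show ?thesis by simp
qed

context
  fixes h :: "nat \<times> bool \<Rightarrow> 'v"
  assumes null: "null_family (fil N) h" and deg: "\<And>i. h (i, False) \<in> grd N 0" "\<And>i. h (i, True) \<in> grd N (-1)"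
begin

lemma face_expands: "expandsN (face h dt) (\<lambda>i. h (i, dt))"
  unfolding expands_def
proof (intro conjI allI)
  have "finite {i. h (i, dt) \<notin> fil N p}" for p
    using null finite_vimageI[of "{b. h b \<notin> fil N p}" "\<lambda>i. (i, dt)"] unfolding null_family_def
    by (simp add: vimage_def inj_on_def)
  then show n: "nullf (fil N) (\<lambda>i. h (i, dt)) UNIV" unfolding nullf_def by simp
  show "has_nsum (fil N) (\<lambda>i. scl N (t ^ i) (h (i, dt))) UNIV (face h dt t)" for t
    unfolding face_def
    by (rule W.V.has_nsum_nsum[OF W.V.nullf_scale[OF n] W.V.G_scale, where k = "if dt then -1 else 0"])
      (use deg in \<open>cases dt; simp\<close>)
qed

lemma face_pG: "face h dt \<in> pGN (if dt then -1 else 0)"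
  by (rule W.V.pG_I[OF face_expands]) (use deg in \<open>cases dt; simp\<close>)

lemma face_coef: "coefN (face h dt) = (\<lambda>i. h (i, dt))"
  by (rule W.V.coef_eq[OF face_expands])

text \<open>
  The two components of the \<open>(n + 1)\<close>-fold bracket of \<open>h\<close> with itself, as functions of \<open>t\<close>: with
  \<open>h = a + \<beta> dt\<close> these are \<open>{a\<^bsup>n+1\<^esup>}\<close> and \<open>(n + 1) {\<beta>, a\<^sup>n}\<close>, and the de Rham differential contributes \<open>a'\<close> for
  \<open>n = 0\<close>.
\<close>

definition slice :: "nat \<Rightarrow> bool \<Rightarrow> 'k \<Rightarrow> 'v" where
  "slice n dt = (if dt then pS (scl N) (of_nat (n + 1)) (lift (face h True # replicate n (face h False)))
       + (if n = 0 then pDN (face h False) else 0)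
     else lift (replicate (n + 1) (face h False)))"

abbreviation slices_sum :: "bool \<Rightarrow> ('k \<Rightarrow> 'v) \<Rightarrow> bool" where
  "slices_sum dt \<equiv> filt_sums (pF (fil N)) (\<lambda>k. pS (scl N) (1 / fact (k + 1)) (slice k dt))"

lemma form_bracket_flags:
  "form_bracket N (replicate n h) (m, dt) = (\<Sum>ds | length ds = n \<and> length (filter id ds) = (if dt then 1 else 0).
     \<Sum>is | length is = n \<and> sum_list is = m. brk N (map h (zip is ds)))"
proof -
  let ?D = "{ds. length ds = n \<and> length (filter id ds) = (if dt then 1 else 0)}"
  have fin: "finite ?D"
    by (rule finite_subset[OF _ finite_lists_length_eq[OF finite, of UNIV n]]) auto
  have "length (filter id (map snd bs)) = length (filter snd bs)" for bs :: "(nat \<times> bool) list"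
    by (simp add: filter_map comp_def)
  then have eq: "{bs. length bs = n \<and> sum_list (map fst bs) = m \<and> length (filter snd bs) = (if dt then 1 else 0)}
      = {bs. length bs = n \<and> sum_list (map fst bs) = m \<and> map snd bs \<in> ?D}" by auto
  show ?thesis
    unfolding form_bracket_even[where h = h, OF gN deg(1)] eq by (rule sum_over_flags[OF fin]) blast
qed

text \<open>
  In the component at \<open>dt\<close>, the flag \<open>dt\<close> can be at any of the \<open>n + 1\<close> places; all places give the same
  function because \<open>a\<close> has degree \<open>0\<close>.
\<close>

lemma bracket_slice: "expandsN (slice n dt) (\<lambda>m. brk (tensor_forms N) (replicate (n + 1) h) (m, dt))"
proof (cases dt)
  case False
  have "{ds. length ds = n + 1 \<and> length (filter id ds) = 0} = {replicate (n + 1) False}"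
    by (rule flags_none)
  then have b: "form_bracket N (replicate (n + 1) h) (m, False)
      = (\<Sum>is | length is = n + 1 \<and> sum_list is = m. brk N (map h (zip is (replicate (n + 1) False))))" for m
    unfolding form_bracket_flags if_False by (simp only:) simp
  have "brk (tensor_forms N) (replicate (n + 1) h) (m, False) = form_bracket N (replicate (n + 1) h) (m, False)" for m
    by (simp add: tensor_forms_def form_diffl_def)
  then have e: "brk (tensor_forms N) (replicate (n + 1) h) (m, dt)
      = (\<Sum>is | length is = n + 1 \<and> sum_list is = m. brk N (map h (zip is (replicate (n + 1) False))))" for m
    using b False by simp
  have "expandsN (lift (map (face h) (replicate (n + 1) False)))
      (\<lambda>m. \<Sum>is | length is = length (replicate (n + 1) False) \<and> sum_list is = m. brk N (map h (zip is (replicate (n + 1) False))))"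
    by (rule plift_flags[OF face_pG]) (simp_all add: face_coef)
  then show ?thesis unfolding e length_replicate map_replicate slice_def using False by (simp only: if_False)
next
  case dt: True
  \<comment> \<open>the flag lists with \<open>dt\<close> at place \<open>l\<close>\<close>
  let ?D = "\<lambda>l. replicate l False @ True # replicate (n - l) False"
  let ?c = "\<lambda>l m. \<Sum>is | length is = n + 1 \<and> sum_list is = m. brk N (map h (zip is (?D l)))"
  let ?f = "lift (face h True # replicate n (face h False))"
  have inj: "inj_on ?D {..<n + 1}"
  proof (rule inj_onI)
    fix l l' assume l: "l \<in> {..<n + 1}" "l' \<in> {..<n + 1}" "?D l = ?D l'"
    have nth: "?D k ! j \<longleftrightarrow> j = k" if "j \<in> {..<n + 1}" for j k using that by (auto simp: nth_append nth_Cons')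
    have "?D l ! l" using nth[OF l(1)] by blast
    then have "?D l' ! l" unfolding l(3) .
    then show "l = l'" using nth[OF l(1)] by blast
  qed
  have b: "form_bracket N (replicate (n + 1) h) (m, True) = (\<Sum>l<n + 1. ?c l m)" for m
    unfolding form_bracket_flags if_True flags_one add_diff_cancel_right' sum.reindex[OF inj] comp_def ..
  have c: "?c l m = coefN ?f m" if l: "l < n + 1" for l m
  proof -
    have "lift (map (face h) (?D l)) = ?f"
      using PW.f_even_replicate[OF face_pG[of False, simplified] face_pG[of True], of "[]" l "replicate (n - l) (face h False)"] l
      by (simp add: replicate_add[symmetric])
    moreover have "expandsN (lift (map (face h) (?D l)))
        (\<lambda>m. \<Sum>is | length is = length (?D l) \<and> sum_list is = m. brk N (map h (zip is (?D l))))"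
      by (rule plift_flags[OF face_pG]) (simp_all add: face_coef)
    moreover have "length (?D l) = n + 1" using l by simp
    ultimately have "expandsN ?f (?c l)" by (simp only:)
    from W.V.coef_eq[OF this] show ?thesis by (simp only:)
  qed
  have "lies_in (pGN) (face h True # replicate n (face h False)) (-1 # replicate n 0)"
    using face_pG[of True] face_pG[of False] by (simp add: list_all2_replicate2)
  from W.V.pG_expands[OF W.plift_degree[OF this]]
  have f: "expandsN ?f (coefN ?f)" .
  have s: "expandsN (pS (scl N) (of_nat (n + 1)) ?f) (\<lambda>m. form_bracket N (replicate (n + 1) h) (m, True))"
  proof -
    have "form_bracket N (replicate (n + 1) h) (m, True) = scl N (of_nat (n + 1)) (coefN ?f m)" for m
    proof -
      have "(\<Sum>l<n + 1. ?c l m) = (\<Sum>l<n + 1. coefN ?f m)" by (rule sum.cong) (use c in auto)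
      then show ?thesis unfolding b W.V.sum_constant_scale by simp
    qed
    then show ?thesis using W.V.expands_scale[OF f, of "of_nat (n + 1)"] by simp
  qed
  show ?thesis
  proof (cases "n = 0")
    case n: True
    have e: "brk (tensor_forms N) (replicate (n + 1) h) (m, True) = form_bracket N (replicate (n + 1) h) (m, True)
        + scl N (of_nat (m + 1)) (coefN (face h False) (m + 1))" for m
      unfolding face_coef by (simp add: tensor_forms_def form_diffl_def n grading_involution_even[OF gN deg(1)])
    have "slice n dt = pS (scl N) (of_nat (n + 1)) ?f + pDN (face h False)"
      using dt n unfolding slice_def by (simp only: if_True refl)
    moreover have "(\<lambda>m. brk (tensor_forms N) (replicate (n + 1) h) (m, dt)) = (\<lambda>m. form_bracket N (replicate (n + 1) h) (m, True)
        + scl N (of_nat (m + 1)) (coefN (face h False) (m + 1)))" using e dt by simp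
    ultimately show ?thesis using W.V.expands_add[OF s W.V.expands_pD[OF face_pG[of False]]] by (simp only:)
  next
    case n: False
    have e: "brk (tensor_forms N) (replicate (n + 1) h) (m, True) = form_bracket N (replicate (n + 1) h) (m, True)" for m
      using n by (simp add: tensor_forms_def)
    have "slice n dt = pS (scl N) (of_nat (n + 1)) ?f"
      using dt n unfolding slice_def by (simp only: if_True if_False add_0_right)
    moreover have "(\<lambda>m. brk (tensor_forms N) (replicate (n + 1) h) (m, dt)) = (\<lambda>m. form_bracket N (replicate (n + 1) h) (m, True))"
      using e dt by simp
    ultimately show ?thesis using s by (simp only:)
  qed
qed

text \<open>
  By \<open>expands_F\<close>, coefficients in \<open>F p\<close> are the same as functions with values in \<open>F p\<close>.
\<close>

lemma slices_filt_sums: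
  "filt_sums (fil (tensor_forms N)) (\<lambda>k. scl (tensor_forms N) (1 / fact (k + 1)) (brk (tensor_forms N) (replicate (k + 1) h))) 0
    \<longleftrightarrow> (\<forall>dt. slices_sum dt 0)"
proof -
  let ?X = "\<lambda>n. \<Sum>k<n. scl (tensor_forms N) (1 / fact (k + 1)) (brk (tensor_forms N) (replicate (k + 1) h))"
  let ?\<Phi> = "\<lambda>n dt. \<Sum>k<n. pS (scl N) (1 / fact (k + 1)) (slice k dt)"
  have X: "?X n b = (\<Sum>k<n. scl N (1 / fact (k + 1)) (brk (tensor_forms N) (replicate (k + 1) h) b))" for n b
    unfolding fun_sum_apply by (simp add: tensor_forms_def)
  have e: "expandsN (?\<Phi> n dt) (\<lambda>m. ?X n (m, dt))" for n dt
    unfolding X by (rule W.V.expands_sum_list[OF _ W.V.expands_scale[OF bracket_slice]]) simp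
  have nl: "null_family (fil N) (?X n)" for n unfolding null_family_def
  proof
    fix p
    have "{b. ?X n b \<notin> fil N p} \<subseteq> (\<Union>dt. (\<lambda>m. (m, dt)) ` {m \<in> UNIV. ?X n (m, dt) \<notin> fil N p})" by auto
    moreover have "finite \<dots>" using e[of _ n] unfolding expands_def nullf_def by (intro finite_UN_I finite_imageI) auto
    ultimately show "finite {b. ?X n b \<notin> fil N p}" by (rule finite_subset)
  qed
  have "?X n \<in> fil (tensor_forms N) p \<longleftrightarrow> (\<forall>dt. ?\<Phi> n dt \<in> pF (fil N) p)" for n p
  proof -
    have "?X n \<in> fil (tensor_forms N) p \<longleftrightarrow> (\<forall>b. ?X n b \<in> fil N p)"
      using nl[of n] by (simp add: tensor_forms_def)
    also have "\<dots> \<longleftrightarrow> (\<forall>dt m. ?X n (m, dt) \<in> fil N p)" by (simp only: split_paired_All) blast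
    also have "\<dots> \<longleftrightarrow> (\<forall>dt. ?\<Phi> n dt \<in> pF (fil N) p)" unfolding W.V.expands_F[OF e] ..
    finally show ?thesis .
  qed
  then have "?thesis \<longleftrightarrow> (\<forall>p. \<exists>N'. \<forall>n\<ge>N'. \<forall>dt. ?\<Phi> n dt \<in> pF (fil N) p) = (\<forall>dt p. \<exists>N'. \<forall>n\<ge>N'. ?\<Phi> n dt \<in> pF (fil N) p)"
    unfolding filt_sums_def diff_0_right by (simp only:)
  moreover have "(\<exists>N'. \<forall>n\<ge>N'. \<forall>dt. ?\<Phi> n dt \<in> pF (fil N) p) \<longleftrightarrow> (\<forall>dt. \<exists>N'. \<forall>n\<ge>N'. ?\<Phi> n dt \<in> pF (fil N) p)" for p
  proof
    assume "\<forall>dt. \<exists>N'. \<forall>n\<ge>N'. ?\<Phi> n dt \<in> pF (fil N) p"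
    then obtain N1 N2 where N: "\<forall>n\<ge>N1. ?\<Phi> n True \<in> pF (fil N) p" "\<forall>n\<ge>N2. ?\<Phi> n False \<in> pF (fil N) p" by blast
    have "?\<Phi> n dt \<in> pF (fil N) p" if "n \<ge> max N1 N2" for n dt
    proof (cases dt)
      case True
      then show ?thesis using N(1)[rule_format, of n] that by (simp only: max.bounded_iff)
    next
      case False
      then show ?thesis using N(2)[rule_format, of n] that by (simp only: max.bounded_iff)
    qed
    then show "\<exists>N'. \<forall>n\<ge>N'. \<forall>dt. ?\<Phi> n dt \<in> pF (fil N) p" by blast
  qed blast
  ultimately show ?thesis by blast
qed

lemma MC1_iff_path: "h \<in> MC1 N \<longleftrightarrow> W.path (face h False) (face h True)"
proof -
  let ?a = "face h False" and ?b = "face h True"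
  have a: "?a \<in> pGN 0" and b: "?b \<in> pGN (-1)"
    using face_pG[of False] face_pG[of True] by auto
  have one: "?a \<in> pF (fil N) 1" by (simp add: pF_iff)
  have "has_nsum (pF (fil N)) (\<lambda>k. pS (scl N) (1 / fact (Suc k)) (lift ([] @ replicate (Suc k) ?a))) UNIV (W.IP [] ?a)"
    using PW.ins_sum[of "[]" "[]" ?a] a one
      PW.V.has_nsum_Suc[of "\<lambda>k. pS (scl N) (1 / fact k) (lift ([] @ replicate k ?a))"] by simp
  then have F: "slices_sum False (W.IP [] ?a)"
    by (intro PW.V.has_nsum_imp_filt_sums) (simp add: slice_def del: fact_Suc replicate_Suc)
  have s1: "has_nsum (pF (fil N)) (\<lambda>k. pS (scl N) (1 / fact k) (lift ([?b] @ replicate k ?a))) UNIV (W.IP [?b] ?a)"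
    using PW.ins_sum[of "[?b]" "[-1]" ?a] a b one by simp
  have s2: "has_nsum (pF (fil N)) (\<lambda>k::nat. if k = 0 then pDN ?a else 0) UNIV (pDN ?a)"
    using PW.V.has_nsum_support_on[of "{0}" UNIV "\<lambda>k::nat. if k = 0 then pDN ?a else 0"] by simp
  have "has_nsum (pF (fil N)) (\<lambda>k. pS (scl N) (1 / fact (k + 1)) (slice k True)) UNIV (W.IP [?b] ?a + pDN ?a)"
  proof (rule PW.V.has_nsum_congD[OF PW.V.has_nsum_add[OF s1 s2]])
    fix k :: nat
    have "of_nat (Suc k) \<noteq> (0::'k)" by (rule of_nat_neq_0)
    then have f: "1 / fact (k + 1) * of_nat (k + 1) = (1 / fact k :: 'k)"
      unfolding Suc_eq_plus1[symmetric] fact_Suc by (simp del: of_nat_Suc)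
    show "pS (scl N) (1 / fact k) (lift ([?b] @ replicate k ?a)) + (if k = 0 then pDN ?a else 0)
        = pS (scl N) (1 / fact (k + 1)) (slice k True)"
      unfolding slice_def if_True PW.V.scale_right_distrib PW.V.scale_scale f by simp
  qed
  then have T: "slices_sum True (W.IP [?b] ?a + pDN ?a)"
    by (rule PW.V.has_nsum_imp_filt_sums)
  have "h \<in> MC1 N \<longleftrightarrow> (\<forall>dt. slices_sum dt 0)"
  proof -
    have "h \<in> grd (tensor_forms N) 0" using null deg by (simp add: tensor_forms_def)
    then show ?thesis unfolding MC1_def MC_def mem_Collect_eq slices_filt_sums by blast
  qed
  also have "\<dots> \<longleftrightarrow> W.IP [] ?a = 0 \<and> W.IP [?b] ?a + pDN ?a = 0"
  proof -
    have "slices_sum False 0 \<longleftrightarrow> W.IP [] ?a = 0"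
    proof
      assume "slices_sum False 0"
      from PW.V.filt_sums_unique[OF F this] show "W.IP [] ?a = 0" .
    next
      assume "W.IP [] ?a = 0"
      from F[unfolded this] show "slices_sum False 0" .
    qed
    moreover have "slices_sum True 0
        \<longleftrightarrow> W.IP [?b] ?a + pDN ?a = 0"
    proof
      assume "slices_sum True 0"
      from PW.V.filt_sums_unique[OF T this] show "W.IP [?b] ?a + pDN ?a = 0" .
    next
      assume "W.IP [?b] ?a + pDN ?a = 0"
      from T[unfolded this] show "slices_sum True 0" .
    qed
    ultimately show ?thesis unfolding all_bool_eq by (simp only: conj_commute)
  qed
  also have "\<dots> \<longleftrightarrow> W.path ?a ?b"
    unfolding W.path_def eq_neg_iff_add_eq_0 add.commute[of "pDN ?a"] using a b by (simp only: simp_thms)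
  finally show ?thesis .
qed

end

lemma MC_endpoints_eq: "MC_endpoints N = {(x, y). W.joined x y}"
proof (intro equalityI subsetI)
  fix xy assume "xy \<in> MC_endpoints N"
  then obtain h y where xy: "xy = (h (0, False), y)" and h: "h \<in> MC1 N" and y: "filt_sums (fil N) (\<lambda>i. h (i, False)) y"
    unfolding MC_endpoints_def by blast
  have n: "null_family (fil N) h" "\<And>i. h (i, False) \<in> grd N 0" "\<And>i. h (i, True) \<in> grd N (-1)"
    using h unfolding MC1_def MC_def by (simp_all add: tensor_forms_def)
  note e = face_expands[OF n, of False]
  have "face h False 0 = h (0, False)" by (rule W.V.coef_0[OF e])
  moreover have "face h False 1 = y"
    by (rule W.V.filt_sums_unique[OF _ y]) (use W.V.has_nsum_imp_filt_sums[OF W.V.expands_sum[OF e, of 1]] in simp)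
  ultimately show "xy \<in> {(x, y). W.joined x y}"
    using MC1_iff_path[OF n] h unfolding xy W.joined_def by blast
next
  fix xy assume "xy \<in> {(x, y). W.joined x y}"
  then obtain a b where p: "W.path a b" and xy: "xy = (a 0, a 1)" unfolding W.joined_def by (cases xy) auto
  have a: "a \<in> pGN 0" and b: "b \<in> pGN (-1)"
    using p unfolding W.path_def by auto
  define h where "h = (\<lambda>(i, dt). coefN (if dt then b else a) i)"
  have n: "null_family (fil N) h" unfolding null_family_def
  proof
    fix q
    have "{x. h x \<notin> fil N q} \<subseteq> (\<Union>dt. (\<lambda>m. (m, dt)) ` {m \<in> UNIV. h (m, dt) \<notin> fil N q})" by auto
    moreover have "finite {m \<in> UNIV. h (m, dt) \<notin> fil N q}" for dt
      using W.V.pG_null[OF a] W.V.pG_null[OF b] unfolding nullf_def h_def by (cases dt) auto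
    then have "finite (\<Union>dt. (\<lambda>m. (m, dt)) ` {m \<in> UNIV. h (m, dt) \<notin> fil N q})" by (intro finite_UN_I finite_imageI) auto
    ultimately show "finite {x. h x \<notin> fil N q}" by (rule finite_subset)
  qed
  have d: "h (i, False) \<in> grd N 0" "h (i, True) \<in> grd N (-1)" for i
    unfolding h_def using W.V.pG_coef[OF a] W.V.pG_coef[OF b] by auto
  have fa: "face h False = a" "face h True = b"
    using W.V.nsum_eq[OF W.V.expands_sum[OF W.V.pG_expands[OF a]]] W.V.nsum_eq[OF W.V.expands_sum[OF W.V.pG_expands[OF b]]]
    unfolding face_def h_def by (auto simp: fun_eq_iff)
  have "h \<in> MC1 N" using MC1_iff_path[OF n d] fa p by simp
  moreover have "h (0, False) = a 0" using W.V.coef_0[OF W.V.pG_expands[OF a]] by (simp add: h_def)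
  moreover have "filt_sums (fil N) (\<lambda>i. h (i, False)) (a 1)"
    using W.V.has_nsum_imp_filt_sums[OF W.V.expands_sum[OF W.V.pG_expands[OF a], of 1]] by (simp add: h_def)
  ultimately show "xy \<in> MC_endpoints N" unfolding xy MC_endpoints_def mem_Collect_eq
    by (intro exI[of _ h] exI[of _ "a 1"]) simp
qed

end

section \<open>Exact deformations of the argument\<close>

context multimap
begin

lemma binomial_expansion:
  assumes x: "x \<in> GV 0" and y: "y \<in> GV j"
  shows "f (xs @ replicate n (x + y)) = (\<Sum>i\<le>n. SW (of_nat (n choose i)) (f (xs @ replicate i x @ replicate (n - i) y)))"
proof (induction n arbitrary: xs)
  case (Suc n)
  let ?g = "\<lambda>i. f (xs @ replicate i x @ replicate (Suc n - i) y)"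
  have "f (xs @ replicate (Suc n) (x + y)) = f ((xs @ [x]) @ replicate n (x + y)) + f ((xs @ [y]) @ replicate n (x + y))"
    using f_add[of xs x y "replicate n (x + y)"] by simp
  also have "f ((xs @ [x]) @ replicate n (x + y)) = (\<Sum>i\<le>n. SW (of_nat (n choose i)) (?g (Suc i)))"
    unfolding Suc.IH by simp
  also have "f ((xs @ [y]) @ replicate n (x + y)) = (\<Sum>i\<le>n. SW (of_nat (n choose i)) (?g i))"
    unfolding Suc.IH
  proof (rule sum.cong[OF refl])
    fix i assume "i \<in> {..n}"
    then have "Suc n - i = Suc (n - i)" by simp
    then show "SW (of_nat (n choose i)) (f ((xs @ [y]) @ replicate i x @ replicate (n - i) y)) = SW (of_nat (n choose i)) (?g i)"
      using f_even_replicate[OF x y, of xs i "replicate (n - i) y"] by simp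
  qed
  also have "(\<Sum>i\<le>n. SW (of_nat (n choose i)) (?g i)) = (\<Sum>i\<le>Suc n. SW (of_nat (n choose i)) (?g i))" by simp
  also have "\<dots> = SW (of_nat (n choose 0)) (?g 0) + (\<Sum>i\<le>n. SW (of_nat (n choose Suc i)) (?g (Suc i)))"
    by (rule sum.atMost_Suc_shift)
  also have "(\<Sum>i\<le>n. SW (of_nat (n choose i)) (?g (Suc i)))
      + (SW (of_nat (n choose 0)) (?g 0) + (\<Sum>i\<le>n. SW (of_nat (n choose Suc i)) (?g (Suc i))))
    = SW (of_nat (Suc n choose 0)) (?g 0) + (\<Sum>i\<le>n. SW (of_nat (Suc n choose Suc i)) (?g (Suc i)))"
    by (simp add: W.scale_left_distrib sum.distrib add.assoc add.left_commute)
  also have "\<dots> = (\<Sum>i\<le>Suc n. SW (of_nat (Suc n choose i)) (?g i))"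
    by (rule sum.atMost_Suc_shift[symmetric])
  finally show ?case .
qed simp

lemma odd_repeat: assumes "z \<in> GV (-1)" shows "f (xs @ z # z # ys) = 0"
proof -
  have "f (xs @ z # z # ys) = - f (xs @ z # z # ys)" using f_sym[OF assms assms, of xs ys] by (simp add: parity_sign_def)
  then have "SW (1 + 1) (f (xs @ z # z # ys)) = 0"
    unfolding W.scale_left_distrib W.scale_one by (metis add.right_inverse)
  then show ?thesis by (simp only: W.scale_eq_0_iff) simp
qed

text \<open>
  The binomial expansion of \<open>(b + z)\<^bsup>n+1\<^esup>\<close> stops after the linear term, because an odd argument cannot be repeated.
\<close>

lemma odd_increment:
  assumes b: "b \<in> GV 0" and z: "z \<in> GV (-1)"
  shows "f (replicate (Suc n) (b + z)) = f (replicate (Suc n) b) + SW (of_nat (Suc n)) (f (z # replicate n b))"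
proof -
  let ?g = "\<lambda>i. SW (of_nat (Suc n choose i)) (f (replicate i b @ replicate (Suc n - i) z))"
  have "f (replicate (Suc n) (b + z)) = sum ?g {..Suc n}"
    using binomial_expansion[OF b z, of "[]" "Suc n"] by (simp only: append_Nil)
  also have "\<dots> = sum ?g {n, Suc n}"
  proof (rule sum.mono_neutral_right)
    show "\<forall>i\<in>{..Suc n} - {n, Suc n}. ?g i = 0"
    proof
      fix i assume "i \<in> {..Suc n} - {n, Suc n}"
      then have "i < n" by auto
      then have "Suc n - i = Suc (Suc (n - 1 - i))" by linarith
      then show "?g i = 0" using odd_repeat[OF z, of "replicate i b" "replicate (n - 1 - i) z"] by simp
    qed
  qed auto
  also have "\<dots> = f (replicate (Suc n) b) + SW (of_nat (Suc n)) (f (z # replicate n b))"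
  proof -
    have "f (replicate n b @ [z]) = f (z # replicate n b)"
      using f_even_replicate[OF b z, of "[]" n "[]"] by simp
    then have "?g n = SW (of_nat (Suc n)) (f (z # replicate n b))" "?g (Suc n) = f (replicate (Suc n) b)"
      by simp_all
    then show ?thesis by (simp add: add.commute)
  qed
  finally show ?thesis .
qed

lemma scale_powers:
  "f (xs @ replicate k (SV s a) @ replicate m (SV t y)) = SW (s ^ k * t ^ m) (f (xs @ replicate k a @ replicate m y))"
proof -
  have map2: "map2 SV (replicate n c) (replicate n v) = replicate n (SV c v)" for n :: nat and c v by (induction n) auto
  have "prod_list (replicate k s @ replicate m t) = s ^ k * t ^ m" by (simp add: prod_list_replicate)
  then show ?thesis
    using f_scale_list[of "replicate k s @ replicate m t" "replicate k a @ replicate m y" xs]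
    by (simp add: map2)
qed

text \<open>
  Modulo \<open>F p\<close> with \<open>p \<le> P\<close>, the terms with \<open>i \<ge> P\<close> vanish. If \<open>i + j = n\<close> is large, the remaining
  ones are the coefficients of the polynomial \<open>s \<mapsto> f(xs, (s a + y)\<^sup>n)\<close> of degree less than \<open>P\<close> modulo \<open>F p\<close>,
  which has the value \<open>0\<close> at the \<open>P\<close> points \<open>2\<^sup>0, \<dots>, 2\<^bsup>P-1\<^esup>\<close> by hypothesis. Only finitely many instances of the
  hypothesis are needed, so that the bound for \<open>n\<close> is uniform.
\<close>

lemma finite_powers_null:
  assumes a: "a \<in> GV 0" "a \<in> FV 1" and y: "y \<in> GV 0"
    and fin: "\<And>t. \<exists>N. \<forall>n\<ge>N. f (xs @ replicate n (SV t a + y)) = 0"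
  shows "nullf FW (\<lambda>(i, j). f (xs @ replicate i a @ replicate j y)) UNIV"
  unfolding nullf_def
proof
  fix p
  let ?w = "\<lambda>i j. f (xs @ replicate i a @ replicate j y)"
  obtain P where P: "p \<le> int P" by (metis nat_le_iff order_refl)
  have high: "?w i j \<in> FW p" if "P \<le> i" for i j
  proof (cases "xs @ replicate i a @ replicate j y = []")
    case False
    have "lies_in FV (xs @ replicate i a @ replicate j y)
        (replicate (length xs) 0 @ replicate i 1 @ replicate j 0)"
      using a(2) V.F_top by (intro list_all2_appendI list_all2_replicate2) (auto simp: list_all2_conv_all_nth)
    from f_fil[OF False this] have "?w i j \<in> FW (int i + \<sigma>)" by (simp add: sum_list_replicate)
    then show ?thesis by (rule W.F_antiD) (use that P shift_nonneg in linarith)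
  qed (simp only: f_nil W.F_zero)
  from fin obtain N where N: "\<And>t n. N t \<le> n \<Longrightarrow> f (xs @ replicate n (SV t a + y)) = 0" by metis
  \<comment> \<open>a common bound for the \<open>P\<close> points used by \<open>vandermonde\<close>\<close>
  define N' where "N' = Max (insert P ((\<lambda>s. N (2 ^ s)) ` {..<P}))"
  have N': "P \<le> N'" "\<And>s. s < P \<Longrightarrow> N (2 ^ s) \<le> N'" unfolding N'_def by auto
  have low: "?w i j \<in> FW p" if ij: "N' \<le> i + j" "i < P" for i j
  proof -
    let ?n = "i + j"
    let ?c = "\<lambda>k. SW (of_nat (?n choose k)) (?w k (?n - k))"
    have "(\<Sum>k<P. SW ((2 ^ s) ^ k) (?c k)) \<in> FW p" if s: "s < P" for s
    proof -
      have zero: "(\<Sum>k\<le>?n. SW ((2 ^ s) ^ k) (?c k)) = 0"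
      proof -
        have "0 = f (xs @ replicate ?n (SV (2 ^ s) a + y))" using N[of "2 ^ s" ?n] N'(2)[OF s] ij(1) by simp
        also have "\<dots> = (\<Sum>k\<le>?n. SW (of_nat (?n choose k)) (f (xs @ replicate k (SV (2 ^ s) a) @ replicate (?n - k) y)))"
          by (rule binomial_expansion[OF V.G_scale[OF a(1)] y])
        also have "\<dots> = (\<Sum>k\<le>?n. SW ((2 ^ s) ^ k) (?c k))"
        proof (rule sum.cong[OF refl])
          fix k
          have "f (xs @ replicate k (SV (2 ^ s) a) @ replicate (?n - k) y) = SW ((2 ^ s) ^ k) (?w k (?n - k))"
            using scale_powers[of xs k "2 ^ s" a "?n - k" 1 y] by simp
          then show "SW (of_nat (?n choose k)) (f (xs @ replicate k (SV (2 ^ s) a) @ replicate (?n - k) y)) = SW ((2 ^ s) ^ k) (?c k)"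
            by (simp add: mult.commute)
        qed
        finally show ?thesis by simp
      qed
      have split: "(\<Sum>k\<le>?n. SW ((2 ^ s) ^ k) (?c k)) = (\<Sum>k<P. SW ((2 ^ s) ^ k) (?c k)) + (\<Sum>k=P..?n. SW ((2 ^ s) ^ k) (?c k))"
      proof -
        have "{..?n} = {..<P} \<union> {P..?n}" using N'(1) ij(1) by auto
        then show ?thesis by (simp only: sum.union_disjoint[OF finite_lessThan finite_atLeastAtMost] ivl_disj_int)
      qed
      have tail: "(\<Sum>k=P..?n. SW ((2 ^ s) ^ k) (?c k)) \<in> FW p"
        by (rule W.subspace_sum[OF W.F_sub]) (use high W.F_scale in auto)
      have "(\<Sum>k<P. SW ((2 ^ s) ^ k) (?c k)) = - (\<Sum>k=P..?n. SW ((2 ^ s) ^ k) (?c k))"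
        using zero unfolding split eq_neg_iff_add_eq_0 .
      then show ?thesis using W.F_neg[OF tail] by (simp only:)
    qed
    from W.vandermonde[of P ?c p i, OF this ij(2)] have c: "?c i \<in> FW p" by simp
    have "of_nat (?n choose i) \<noteq> (0 :: 'k)" by simp
    from W.F_scale_iff[OF this] c have "?w i (?n - i) \<in> FW p" by (rule iffD1)
    then show ?thesis by simp
  qed
  have "{x \<in> UNIV. (case x of (i, j) \<Rightarrow> ?w i j) \<notin> FW p} \<subseteq> {..<N'} \<times> {..<N'}"
  proof
    fix x assume x: "x \<in> {x \<in> UNIV. (case x of (i, j) \<Rightarrow> ?w i j) \<notin> FW p}"
    obtain i j where ij: "x = (i, j)" by (cases x)
    have nF: "?w i j \<notin> FW p" using x ij by simp
    have "i < P"
    proof (rule ccontr)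
      assume "\<not> i < P"
      then show False using high[of i j] nF by simp
    qed
    moreover have "i + j < N'"
    proof (rule ccontr)
      assume "\<not> i + j < N'"
      then show False using low[of i j] nF \<open>i < P\<close> by simp
    qed
    ultimately show "x \<in> {..<N'} \<times> {..<N'}" unfolding ij by simp
  qed
  then show "finite {x \<in> UNIV. (case x of (i, j) \<Rightarrow> ?w i j) \<notin> FW p}"
    by (rule finite_subset) simp
qed

lemma two_variable_series:
  assumes a: "a \<in> GV 0" and y: "y \<in> GV 0" and xs: "lies_in GV xs ds"
    and null: "nullf FW (\<lambda>(i, j). f (xs @ replicate i a @ replicate j y)) UNIV"
  shows "f (xs @ replicate (fst x) a @ replicate (snd x) y) \<in> GW (sum_list ds + e)"
    and "has_nsum FW (\<lambda>x. SW (t ^ snd x) (SW (1 / (fact (fst x) * fact (snd x))) (f (xs @ replicate (fst x) a @ replicate (snd x) y))))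
           UNIV (I xs (a + SV t y))"
proof -
  let ?w = "\<lambda>x. f (xs @ replicate (fst x) a @ replicate (snd x) y)"
  let ?h = "\<lambda>x. SW (t ^ snd x) (SW (1 / (fact (fst x) * fact (snd x))) (?w x))"
  have n: "nullf FW ?w UNIV" using null by (simp add: case_prod_unfold)
  have deg: "?w x \<in> GW (sum_list ds + e)" for x
    using deg_replicate[of "xs @ replicate (fst x) a" "ds @ replicate (fst x) 0" y "snd x"] a y xs
    by (simp add: list_all2_appendI list_all2_replicate2 sum_list_replicate)
  then show "?w x \<in> GW (sum_list ds + e)" .
  have s: "has_nsum FW ?h UNIV (nsum FW ?h UNIV)"
    by (rule W.has_nsum_nsum[OF W.nullf_scale[OF W.nullf_scale[OF n]] W.G_scale[OF W.G_scale[OF deg]]])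
  have "has_nsum FW (\<lambda>k. SW (1 / fact k) (f (xs @ replicate k (a + SV t y)))) UNIV (nsum FW ?h UNIV)"
  proof (rule W.has_nsum_group[OF s, where q = "\<lambda>x. fst x + snd x"])
    fix k :: nat
    have fib: "{x \<in> UNIV. fst x + snd x = k} = (\<lambda>i. (i, k - i)) ` {..k}" by force
    have inj: "inj_on (\<lambda>i. (i, k - i)) {..k}" by (simp add: inj_on_def)
    have "sum ?h {x \<in> UNIV. fst x + snd x = k} = (\<Sum>i\<le>k. ?h (i, k - i))"
      unfolding fib sum.reindex[OF inj] comp_def ..
    also have "\<dots> = SW (1 / fact k) (f (xs @ replicate k (a + SV t y)))"
      unfolding binomial_expansion[OF a V.G_scale[OF y]] W.scale_sum_right
    proof (rule sum.cong[OF refl])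
      fix i assume i: "i \<in> {..k}"
      have "f (xs @ replicate i a @ replicate (k - i) (SV t y)) = SW (t ^ (k - i)) (?w (i, k - i))"
        using scale_powers[of xs i 1 a "k - i" t y] by simp
      moreover have "t ^ (k - i) * (1 / (fact i * fact (k - i))) = 1 / fact k * (of_nat (k choose i) * t ^ (k - i))"
        using i by (simp add: binomial_fact)
      ultimately show "?h (i, k - i) = SW (1 / fact k) (SW (of_nat (k choose i)) (f (xs @ replicate i a @ replicate (k - i) (SV t y))))"
        by (simp only: W.scale_scale fst_conv snd_conv)
    qed
    finally show "has_nsum FW ?h {x \<in> UNIV. fst x + snd x = k} (SW (1 / fact k) (f (xs @ replicate k (a + SV t y))))"
      using W.has_nsum_finite[of "{x \<in> UNIV. fst x + snd x = k}" ?h] unfolding fib by (simp only: finite_imageI finite_atMost)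
  qed simp
  then have "I xs (a + SV t y) = nsum FW ?h UNIV" unfolding ins_def by (rule W.nsum_eq)
  then show "has_nsum FW ?h UNIV (I xs (a + SV t y))" using s by (simp only:)
qed

end

section \<open>The map on components\<close>

context abelian_to_Linf
begin

lemma MC_L_iff: "\<alpha> \<in> MC (shift1 L) \<longleftrightarrow> \<alpha> \<in> GV 0 \<and> diffl L \<alpha> = 0"
proof -
  let ?s = "\<lambda>k. scl L (1 / fact (k + 1)) (brk L (replicate (k + 1) \<alpha>))"
  have "?s = (\<lambda>k. if k = 0 then diffl L \<alpha> else 0)"
    using ab unfolding abelian_def diffl_def by (auto simp: fun_eq_iff D.V.scale_zero_right)
  moreover have "has_nsum (fil L) (\<lambda>k::nat. if k = 0 then diffl L \<alpha> else 0) UNIV (diffl L \<alpha>)"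
    using D.V.has_nsum_support_on[of "{0}" UNIV "\<lambda>k::nat. if k = 0 then diffl L \<alpha> else 0"] by simp
  ultimately have s: "filt_sums (fil L) ?s (diffl L \<alpha>)"
    using D.V.has_nsum_imp_filt_sums by simp
  have "filt_sums (fil L) ?s 0 \<longleftrightarrow> diffl L \<alpha> = 0"
  proof
    assume "filt_sums (fil L) ?s 0"
    from D.V.filt_sums_unique[OF s this] show "diffl L \<alpha> = 0" .
  next
    assume "diffl L \<alpha> = 0"
    from s[unfolded this] show "filt_sums (fil L) ?s 0" .
  qed
  then show ?thesis unfolding MC_def mem_Collect_eq shift1_simps(1,3,4) by blast
qed

lemma bracket_single:
  assumes h: "\<And>i. h (i, False) \<in> GV 0"
  shows "brk (tensor_forms (shift1 L)) [h] (m, False) = diffl L (h (m, False))"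
    and "brk (tensor_forms (shift1 L)) [h] (m, True) = diffl L (h (m, True)) + scl L (of_nat (m + 1)) (h (m + 1, False))"
proof -
  have "{bs. length bs = 1 \<and> sum_list (map fst bs) = m \<and> length (filter snd bs) = (if dt then 1 else 0)} = {[(m, dt)]}" for dt
    by (cases dt) (auto simp: length_Suc_conv split: if_splits)
  then have "form_bracket (shift1 L) (replicate 1 h) (m, dt) = diffl L (h (m, dt))" for dt
    unfolding form_bracket_even[where h = h, OF gL h] by (simp add: diffl_def)
  then have f: "form_bracket (shift1 L) [h] (m, dt) = diffl L (h (m, dt))" for dt by simp
  show "brk (tensor_forms (shift1 L)) [h] (m, False) = diffl L (h (m, False))"
    using f by (simp add: tensor_forms_def form_diffl_def)
  show "brk (tensor_forms (shift1 L)) [h] (m, True) = diffl L (h (m, True)) + scl L (of_nat (m + 1)) (h (m + 1, False))"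
    using f by (simp add: tensor_forms_def form_diffl_def grading_involution_even[OF gL h])
qed

text \<open>
  As all brackets with two or more arguments vanish, the series in the definition are constant from
  the first term on.
\<close>

lemma MC1_L_iff: "h \<in> MC1 (shift1 L) \<longleftrightarrow> null_family (fil L) h \<and>
    (\<forall>m. h (m, False) \<in> GV 0 \<and> h (m, True) \<in> GV (-1) \<and> diffl L (h (m, False)) = 0 \<and>
       diffl L (h (m, True)) + scl L (of_nat (m + 1)) (h (m + 1, False)) = 0)"
proof -
  let ?T = "tensor_forms (shift1 L)"
  have G: "h \<in> grd ?T 0 \<longleftrightarrow> null_family (fil L) h \<and> (\<forall>m. h (m, False) \<in> GV 0 \<and> h (m, True) \<in> GV (-1))"
    by (simp add: tensor_forms_def)
  have "filt_sums (fil ?T) (\<lambda>k. scl ?T (1 / fact (k + 1)) (brk ?T (replicate (k + 1) h))) 0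
     \<longleftrightarrow> (\<forall>m. diffl L (h (m, False)) = 0 \<and> diffl L (h (m, True)) + scl L (of_nat (m + 1)) (h (m + 1, False)) = 0)"
    (is "?l \<longleftrightarrow> ?r") if h: "h \<in> grd ?T 0"
  proof -
    have h0: "h (i, False) \<in> GV 0" for i using h G by blast
    have summand: "scl ?T (1 / fact (k + 1)) (brk ?T (replicate (k + 1) h)) = (if k = 0 then brk ?T [h] else 0)" for k
    proof (cases "k = 0")
      case False
      have "brk L (map f [0..<length (replicate (k + 1) h)]) = 0" for f
        using ab False unfolding abelian_def by simp
      then have "form_bracket (shift1 L) (replicate (k + 1) h) = 0"
        unfolding form_bracket_def shift1_simps(4) by (simp only: sum.neutral_const) (simp add: fun_eq_iff)
      then have "brk ?T (replicate (k + 1) h) = 0" using False by (simp add: tensor_forms_def)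
      then show ?thesis using False by (simp add: tensor_forms_def fun_eq_iff)
    qed (simp add: tensor_forms_def)
    have r: "?r \<longleftrightarrow> (\<forall>b. brk ?T [h] b = 0)"
      unfolding split_paired_All all_bool_eq bracket_single[where h = h, OF h0] by blast
    have partial: "(\<Sum>k<n. scl ?T (1 / fact (k + 1)) (brk ?T (replicate (k + 1) h))) = (if n = 0 then 0 else brk ?T [h])" for n
      unfolding summand by (simp add: sum.delta)
    show ?thesis
    proof
      assume l: ?l
      have "brk ?T [h] b \<in> fil L p" for b p
      proof -
        obtain N :: nat where N: "\<forall>n\<ge>N. (if n = 0 then 0 else brk ?T [h]) - 0 \<in> fil ?T p"
          using l unfolding filt_sums_def partial by blast
        then have "brk ?T [h] \<in> fil ?T p" using N[rule_format, of "Suc N"] by simp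
        then show ?thesis by (cases b) (simp add: tensor_forms_def)
      qed
      then show ?r unfolding r using D.V.hausdorff by blast
    next
      assume ?r
      then have "brk ?T [h] = 0" unfolding r by (simp add: fun_eq_iff)
      moreover have "0 \<in> fil ?T p" for p by (simp add: tensor_forms_def null_family_def)
      ultimately show ?l unfolding filt_sums_def partial by simp
    qed
  qed
  then show ?thesis using G unfolding MC1_def MC_def mem_Collect_eq by blast
qed

text \<open>
  The equation at \<open>dt\<close> shows that each coefficient of positive degree is exact. The primitives tend to zero and
  can be summed.
\<close>

lemma endpoints_L_exact:
  assumes "(\<alpha>, \<alpha>') \<in> MC_endpoints (shift1 L)" shows "\<exists>z\<in>GV (-1). \<alpha>' - \<alpha> = diffl L z"
proof -
  obtain h where h: "h \<in> MC1 (shift1 L)" and \<alpha>: "\<alpha> = h (0, False)" and s: "filt_sums (fil L) (\<lambda>i. h (i, False)) \<alpha>'"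
    using assms unfolding MC_endpoints_def by auto
  have n: "null_family (fil L) h" and hG: "\<And>m. h (m, True) \<in> GV (-1)"
    and eq: "\<And>m. diffl L (h (m, True)) + scl L (of_nat (m + 1)) (h (m + 1, False)) = 0"
    using h unfolding MC1_L_iff by blast+
  \<comment> \<open>primitives of the coefficients at \<open>t\<^bsup>m+1\<^esup>\<close>\<close>
  let ?w = "\<lambda>m. scl L (- 1 / of_nat (m + 1)) (h (m, True))"
  have "finite {i. h (i, True) \<notin> fil L p}" for p
    using n finite_vimageI[of "{b. h b \<notin> fil L p}" "\<lambda>i. (i, True)"] unfolding null_family_def
    by (simp add: vimage_def inj_on_def)
  then have null: "nullf (fil L) (\<lambda>m. h (m, True)) UNIV" unfolding nullf_def by simp
  have "nullf (fil L) ?w UNIV" by (rule D.V.nullf_scale[OF null])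
  from D.V.has_nsum_exists[OF this D.V.G_scale[OF hG]]
  obtain z where z: "z \<in> GV (-1)" "has_nsum (fil L) ?w UNIV z" by (rule bexE)
  have "diffl L (?w m) = h (Suc m, False)" for m
  proof -
    have "diffl L (h (m, True)) = - scl L (of_nat (m + 1)) (h (m + 1, False))"
      using eq[of m] unfolding eq_neg_iff_add_eq_0 .
    moreover have "of_nat (m + 1) \<noteq> (0::'k)" by (simp del: of_nat_Suc)
    ultimately show ?thesis unfolding d_scale by (simp del: of_nat_Suc of_nat_add)
  qed
  then have "has_nsum (fil L) (\<lambda>m. h (Suc m, False)) UNIV (diffl L z)"
    using D.f_nsum[OF z(2), of "[]" "[]"] by (simp add: diffl_def)
  then have "has_nsum (fil L) (\<lambda>m. if m = 0 then 0 else h (m, False)) UNIV (diffl L z)"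
    using D.V.has_nsum_Suc[of "\<lambda>m. if m = 0 then 0 else h (m, False)" "diffl L z"] by simp
  moreover have "has_nsum (fil L) (\<lambda>m::nat. if m = 0 then \<alpha> else 0) UNIV \<alpha>"
    using D.V.has_nsum_support_on[of "{0}" UNIV "\<lambda>m::nat. if m = 0 then \<alpha> else 0"] by simp
  ultimately have "has_nsum (fil L) (\<lambda>m. (if m = 0 then 0 else h (m, False)) + (if m = 0 then \<alpha> else 0)) UNIV (diffl L z + \<alpha>)"
    by (rule D.V.has_nsum_add)
  moreover have "(\<lambda>m. (if m = 0 then 0 else h (m, False)) + (if m = 0 then \<alpha> else 0)) = (\<lambda>m. h (m, False))"
    by (auto simp: \<alpha> fun_eq_iff)
  ultimately have "filt_sums (fil L) (\<lambda>m. h (m, False)) (diffl L z + \<alpha>)" using D.V.has_nsum_imp_filt_sums by simp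
  from D.V.filt_sums_unique[OF s this] have "\<alpha>' - \<alpha> = diffl L z" by simp
  then show ?thesis using z(1) by blast
qed

text \<open>
  The 1-simplex \<open>\<alpha> + t d z - z dt\<close>.
\<close>

lemma exact_endpoints_L:
  assumes \<alpha>: "\<alpha> \<in> MC (shift1 L)" and z: "z \<in> GV (-1)" shows "(\<alpha>, \<alpha> + diffl L z) \<in> MC_endpoints (shift1 L)"
proof -
  note \<alpha>' = \<alpha>[unfolded MC_L_iff]
  let ?h = "\<lambda>(i::nat, dt). if dt then (if i = 0 then - z else 0) else if i = 0 then \<alpha> else if i = 1 then diffl L z else 0"
  have "{b. ?h b \<notin> fil L p} \<subseteq> {(0, False), (1, False), (0, True)}" for p by (auto split: if_splits)
  then have n: "null_family (fil L) ?h" unfolding null_family_def using finite_subset by blast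
  have dz: "diffl L z \<in> GV 0" using d_G[OF z] by simp
  have d0: "diffl L 0 = 0" and dn: "diffl L (- z) = - diffl L z" using d_diff[of 0 0] d_diff[of 0 z] by simp_all
  have "?h \<in> MC1 (shift1 L)" unfolding MC1_L_iff
    using n \<alpha>' dz z D.V.G_neg[OF z] D.V.G_zero d_d[OF z] by (auto simp: d0 dn)
  moreover have "filt_sums (fil L) (\<lambda>i. ?h (i, False)) (\<alpha> + diffl L z)"
    using D.V.has_nsum_imp_filt_sums[OF D.V.has_nsum_support_on[of "{0, 1}" UNIV "\<lambda>i. ?h (i, False)"]] by simp
  ultimately show ?thesis unfolding MC_endpoints_def mem_Collect_eq
    by (intro exI[of _ ?h] exI[of _ "\<alpha> + diffl L z"]) simp
qed

lemma MC_M_iff: "\<beta> \<in> MC (shift1 M) \<longleftrightarrow> \<beta> \<in> GW 0 \<and> W.I [] \<beta> = 0"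
  using MC_iff[of "shift1 M" \<beta>] gM W.mc_algebra_axioms by simp

lemma MC_endpoints_M: "MC_endpoints (shift1 M) = {(x, y). W.joined x y}"
  using MC_endpoints_eq[of "shift1 M"] gM W.mc_algebra_axioms by simp

lemma powers_null: "nullf (fil M) (\<lambda>k. nilz U (replicate k a)) UNIV"
proof -
  obtain N where N: "\<forall>n\<ge>N. U (replicate n a) = 0" using finite_sum by blast
  have "{k \<in> UNIV. nilz U (replicate k a) \<notin> fil M p} \<subseteq> {..<N}" for p
  proof
    fix k assume k: "k \<in> {k \<in> UNIV. nilz U (replicate k a) \<notin> fil M p}"
    show "k \<in> {..<N}"
    proof (rule ccontr)
      assume "k \<notin> {..<N}"
      then have "nilz U (replicate k a) = 0" using N by (simp add: nilz_def)
      then show False using k by simp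
    qed
  qed
  then show ?thesis unfolding nullf_def using finite_subset by blast
qed

lemma U_star_eq: assumes "\<alpha> \<in> GV 0" shows "U_star (shift1 M) U \<alpha> = U.I [] \<alpha>"
proof -
  have "has_nsum (fil M) (\<lambda>k. scl M (1 / fact (Suc k)) (nilz U (replicate (Suc k) \<alpha>))) UNIV (U.I [] \<alpha>)"
    using P.power_sum(1)[OF assms powers_null] W.V.has_nsum_Suc[of "\<lambda>k. scl M (1 / fact k) (nilz U (replicate k \<alpha>))"] by simp
  from W.V.has_nsum_imp_filt_sums[OF this]
  have s: "filt_sums (fil M) (\<lambda>k. scl M (1 / fact (k + 1)) (U (replicate (k + 1) \<alpha>))) (U.I [] \<alpha>)" by (simp del: fact_Suc)
  show ?thesis unfolding U_star_def shift1_simps(1,3)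
  proof (rule the_equality)
    show "filt_sums (fil M) (\<lambda>k. scl M (1 / fact (k + 1)) (U (replicate (k + 1) \<alpha>))) (U.I [] \<alpha>)" by (rule s)
  qed (rule W.V.filt_sums_unique[OF _ s])
qed

lemma star_MC:
  assumes "\<alpha> \<in> GV 0" "diffl L \<alpha> = 0" shows "U.I [] \<alpha> \<in> GW 0" "W.I [] (U.I [] \<alpha>) = 0"
proof -
  show "U.I [] \<alpha> \<in> GW 0" by (rule P.power_sum(2)[OF assms(1) powers_null])
  have z: "nilz U (0 # replicate n \<alpha>) = 0" for n using U.f_zero[of "[]" "replicate n \<alpha>"] by simp
  have "has_nsum (fil M) (\<lambda>n::nat. 0) UNIV (W.I [] (U.I [] \<alpha>))"
    using star_curvature[OF assms(1) powers_null] unfolding assms(2) z by simp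
  then show "W.I [] (U.I [] \<alpha>) = 0" using W.V.has_nsum_unique[OF _ W.V.has_nsum_0] by blast
qed

text \<open>
  The hypothesis that \<open>U\<^sub>\<star>\<close> is a finite sum concerns all vectors. Applied to the inhomogeneous vector \<open>b + z\<close> it
  also controls the terms that are linear in the odd vector \<open>z\<close>.
\<close>

lemma marked_powers_vanish:
  assumes b: "b \<in> GV 0" and z: "z \<in> GV (-1)"
  shows "\<exists>N. \<forall>n\<ge>N. nilz U (z # replicate n b) = 0"
proof -
  obtain N1 N2 where N: "\<forall>n\<ge>N1. U (replicate n b) = 0" "\<forall>n\<ge>N2. U (replicate n (b + z)) = 0" using finite_sum by meson
  have "nilz U (z # replicate n b) = 0" if "max N1 N2 \<le> n" for n
  proof -
    have "nilz U (replicate (Suc n) b) = 0" "nilz U (replicate (Suc n) (b + z)) = 0"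
      using N(1)[rule_format, of "Suc n"] N(2)[rule_format, of "Suc n"] that by simp_all
    then have "scl M (of_nat (Suc n)) (nilz U (z # replicate n b)) = 0"
      using U.odd_increment[OF b z, of n] by (simp only: add_0_left)
    moreover have "of_nat (Suc n) \<noteq> (0::'k)" by (rule of_nat_neq_0)
    ultimately show ?thesis using W.V.scale_eq_0_iff by blast
  qed
  then show ?thesis by blast
qed

text \<open>
  With \<open>b(t) = \<alpha> + t e\<close> and \<open>e = d z\<close>, the path is \<open>A(t) = U\<^sub>\<star>(b(t))\<close> together with \<open>B(t) = - \<psi>\<^bsub>b(t)\<^esub>(z)\<close>, where
  \<open>\<psi>\<^sub>b\<close> is the derivative of \<open>U\<^sub>\<star>\<close> at \<open>b\<close>: then \<open>A' = \<psi>\<^sub>b(e) = \<psi>\<^sub>b(d z) = D\<^sub>A \<psi>\<^sub>b(z)\<close>.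
\<close>

lemma exact_deformation_joined:
  assumes \<alpha>: "\<alpha> \<in> GV 0" "\<alpha> \<in> fil L 1" "diffl L \<alpha> = 0" and z: "z \<in> GV (-1)"
  shows "W.joined (U.I [] \<alpha>) (U.I [] (\<alpha> + diffl L z))"
proof -
  define e where "e = diffl L z"
  let ?G = "GV" and ?F = "fil M" and ?u = "nilz U"
  have e: "e \<in> ?G 0" "diffl L e = 0" using d_G[OF z] d_d[OF z] unfolding e_def by simp_all
  define b where "b t = \<alpha> + scl L t e" for t
  have b: "b t \<in> ?G 0" "diffl L (b t) = 0" for t
    unfolding b_def using D.V.G_add[OF \<alpha>(1) D.V.G_scale[OF e(1)]] by (simp_all add: d_add d_scale \<alpha>(3) e(2))
  have n0: "nullf ?F (\<lambda>(i, j). ?u ([] @ replicate i \<alpha> @ replicate j e)) UNIV"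
  proof (rule U.finite_powers_null[OF \<alpha>(1,2) e(1)])
    fix t
    obtain N where "\<forall>n\<ge>N. U (replicate n (scl L t \<alpha> + e)) = 0" using finite_sum by blast
    then show "\<exists>N. \<forall>n\<ge>N. ?u ([] @ replicate n (scl L t \<alpha> + e)) = 0" by (auto simp: nilz_def)
  qed
  have nz: "nullf ?F (\<lambda>(i, j). ?u ([z] @ replicate i \<alpha> @ replicate j e)) UNIV"
    by (rule U.finite_powers_null[OF \<alpha>(1,2) e(1)])
      (use marked_powers_vanish[OF D.V.G_add[OF D.V.G_scale[OF \<alpha>(1)] e(1)] z] in simp)
  let ?w = "\<lambda>x. ?u ([] @ replicate (fst x) \<alpha> @ replicate (snd x) e)"
    and ?v = "\<lambda>x. ?u ([z] @ replicate (fst x) \<alpha> @ replicate (snd x) e)"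
    and ?c = "\<lambda>x. 1 / (fact (fst x) * fact (snd x)) :: 'k"
  have l0: "lies_in ?G [] []" and lz: "lies_in ?G [z] [-1]" using z by simp_all
  note s0 = U.two_variable_series[OF \<alpha>(1) e(1) l0 n0, folded b_def]
  note sz = U.two_variable_series[OF \<alpha>(1) e(1) lz nz, folded b_def]
  define A where "A t = U.I [] (b t)" for t
  define B where "B t = - U.I [z] (b t)" for t
  have w0: "nullf ?F (\<lambda>x. scl M (?c x) (?w x)) UNIV" and wz: "nullf ?F (\<lambda>x. scl M (?c x) (?v x)) UNIV"
    using W.V.nullf_scale[OF n0[unfolded case_prod_unfold]] W.V.nullf_scale[OF nz[unfolded case_prod_unfold]] by simp_all
  have w0G: "scl M (?c x) (?w x) \<in> GW 0" and wzG: "scl M (?c x) (?v x) \<in> GW (-1)" for x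
    using W.V.G_scale[OF s0(1)] W.V.G_scale[OF sz(1)] by simp_all
  have A_sum: "has_nsum ?F (\<lambda>x. scl M (t ^ snd x) (scl M (?c x) (?w x))) UNIV (A t)" for t
    unfolding A_def by (rule s0(2))
  have ApG: "A \<in> pG (scl M) GW ?F 0"
    by (rule W.V.pG_group[where n = snd, OF w0 w0G A_sum])
  have "(\<lambda>t. U.I [z] (b t)) \<in> pG (scl M) GW ?F (-1)"
    by (rule W.V.pG_group[where n = snd, OF wz wzG sz(2)])
  moreover have "B = - (\<lambda>t. U.I [z] (b t))" by (simp add: B_def fun_eq_iff)
  ultimately have BpG: "B \<in> pG (scl M) GW ?F (-1)"
    using filtered_space.G_neg[OF W.V.p_filtered_space] by simp
  have one: "A \<in> pF ?F 1" by (simp add: pF_iff)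
  have mc: "W.IP [] A = 0"
  proof
    fix t
    have "W.IP [] A t = W.I [] (A t)" using W.ins_pointwise[of "[]" "[]" A t] ApG one by simp
    then show "W.IP [] A t = 0 t" unfolding A_def using star_MC(2)[OF b] by simp
  qed
  have flow: "pD (scl M) ?F A = - W.IP [B] A"
  proof
    fix t
    have "has_nsum ?F (\<lambda>x. scl M (of_nat (snd x) * t ^ (snd x - 1)) (scl M (?c x) (?w x))) UNIV (pD (scl M) ?F A t)"
      by (rule W.V.pD_group[where n = snd, OF w0 w0G A_sum])
    note d = this
    have shift: "?w (i, Suc j) = ?u ([e] @ replicate i \<alpha> @ replicate j e)" for i j
      using U.f_even_replicate[OF \<alpha>(1) e(1), of "[]" i "replicate j e"] by simp
    have le: "lies_in ?G [e] [0]" using e by simp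
    have ne: "nullf ?F (\<lambda>(i, j). ?u ([e] @ replicate i \<alpha> @ replicate j e)) UNIV"
      unfolding nullf_def
    proof
      fix p
      have "finite ((\<lambda>x. (fst x, Suc (snd x))) -` {x \<in> UNIV. ?w x \<notin> ?F p})"
        by (rule finite_vimageI) (use n0 in \<open>auto simp: nullf_def case_prod_unfold inj_def prod_eq_iff\<close>)
      moreover have "{x \<in> UNIV. (case x of (i, j) \<Rightarrow> ?u ([e] @ replicate i \<alpha> @ replicate j e)) \<notin> ?F p}
          = (\<lambda>x. (fst x, Suc (snd x))) -` {x \<in> UNIV. ?w x \<notin> ?F p}"
      proof -
        have "(case x of (i, j) \<Rightarrow> ?u ([e] @ replicate i \<alpha> @ replicate j e)) = ?w (fst x, Suc (snd x))" for x
          unfolding shift by (simp only: case_prod_unfold)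
        then show ?thesis by (simp only: vimage_def mem_Collect_eq UNIV_I simp_thms)
      qed
      ultimately show "finite {x \<in> UNIV. (case x of (i, j) \<Rightarrow> ?u ([e] @ replicate i \<alpha> @ replicate j e)) \<notin> ?F p}"
        by (simp only:)
    qed
    note se = U.two_variable_series(2)[OF \<alpha>(1) e(1) le ne, folded b_def, of t]
    have pDt: "pD (scl M) ?F A t = U.I [e] (b t)"
    proof -
      let ?h = "\<lambda>x. scl M (of_nat (snd x) * t ^ (snd x - 1)) (scl M (?c x) (?w x))"
      \<comment> \<open>the derivative in \<open>t\<close> removes one argument \<open>e\<close> from the powers, which \<open>U.I [e]\<close> adds\<close>
      let ?g = "\<lambda>x :: nat \<times> nat. (fst x, Suc (snd x))"
      have "has_nsum ?F (\<lambda>x. ?h (?g x)) UNIV (U.I [e] (b t))"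
      proof (rule W.V.has_nsum_congD[OF se])
        fix x :: "nat \<times> nat"
        have "of_nat (Suc (snd x)) \<noteq> (0::'k)" by (rule of_nat_neq_0)
        then have "of_nat (Suc (snd x)) * t ^ snd x * (1 / (fact (fst x) * fact (Suc (snd x))))
            = t ^ snd x * (1 / (fact (fst x) * fact (snd x)))" unfolding fact_Suc by (simp del: of_nat_Suc)
        then show "scl M (t ^ snd x) (scl M (?c x) (?u ([e] @ replicate (fst x) \<alpha> @ replicate (snd x) e))) = ?h (?g x)"
          unfolding fst_conv snd_conv shift[unfolded fst_conv snd_conv] W.V.scale_scale diff_Suc_1 by (simp only:)
      qed
      moreover have "bij_betw ?g UNIV {x. snd x \<noteq> 0}"
        by (rule bij_betwI[where g = "\<lambda>x. (fst x, snd x - 1)"]) auto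
      ultimately have "has_nsum ?F ?h {x. snd x \<noteq> 0} (U.I [e] (b t))"
        using W.V.has_nsum_reindex[of ?g UNIV "{x. snd x \<noteq> 0}" ?h] by blast
      then have "has_nsum ?F ?h UNIV (U.I [e] (b t))" by (rule W.V.has_nsum_extend) auto
      from W.V.has_nsum_unique[OF d this] show ?thesis .
    qed
    have "nullf ?F (\<lambda>k. ?u (z # replicate k (b t))) UNIV"
    proof -
      obtain N where N: "\<forall>n\<ge>N. ?u (z # replicate n (b t)) = 0" using marked_powers_vanish[OF b(1) z] by blast
      have "{k \<in> UNIV. ?u (z # replicate k (b t)) \<notin> ?F p} \<subseteq> {..<N}" for p
      proof
        fix k assume k: "k \<in> {k \<in> UNIV. ?u (z # replicate k (b t)) \<notin> ?F p}"
        show "k \<in> {..<N}"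
        proof (rule ccontr)
          assume "k \<notin> {..<N}"
          then have eq: "?u (z # replicate k (b t)) = 0" using N by (simp del: nilz_Cons)
          have "?u (z # replicate k (b t)) \<notin> ?F p" using k by blast
          then show False unfolding eq using W.V.F_zero by blast
        qed
      qed
      then show ?thesis unfolding nullf_def using finite_subset by blast
    qed
    from W.V.nsum_eq[OF star_tangent[OF b(1) powers_null b(2) z this]]
    have "nsum ?F (\<lambda>n. scl M (1 / fact n) (?u (e # replicate n (b t)))) UNIV = W.I [U.I [z] (b t)] (A t)"
      unfolding e_def A_def .
    moreover have "U.I [e] (b t) = nsum ?F (\<lambda>n. scl M (1 / fact n) (?u (e # replicate n (b t)))) UNIV"
      by (simp only: ins_def append_Cons append_Nil)
    ultimately have tangent: "U.I [e] (b t) = W.I [U.I [z] (b t)] (A t)" by (simp only:)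
    have "W.IP [B] A t = W.I [B t] (A t)"
      using W.ins_pointwise[of "[B]" "[-1]" A t] ApG BpG one by simp
    moreover have "W.I [B t] (A t) = - W.I [U.I [z] (b t)] (A t)"
    proof -
      have "U.I [z] (b t) \<in> GW (-1)"
        using W.V.G_neg[OF W.V.pG_value[OF BpG, of t]] by (simp add: B_def)
      then show ?thesis
        using W.ins_neg[of "[]" "[]" "U.I [z] (b t)" "-1" "[]" "[]" "A t"] W.V.pG_value[OF ApG, of t] by (simp add: B_def)
    qed
    ultimately show "pD (scl M) ?F A t = (- W.IP [B] A) t" using pDt tangent by simp
  qed
  have "W.path A B" unfolding W.path_def using ApG BpG mc flow by blast
  moreover have "A 0 = U.I [] \<alpha>" "A 1 = U.I [] (\<alpha> + diffl L z)" by (simp_all add: A_def b_def e_def)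
  ultimately show ?thesis unfolding W.joined_def by blast
qed

text \<open>
  As \<open>U\<close> raises the filtration, \<open>\<psi>(\<alpha>)\<close> is a cycle in \<open>F (r - 1)\<close>. For \<open>r > 1\<close>, the cohomological hypothesis for
  the largest \<open>2\<^sup>q < r\<close> makes it exact modulo \<open>F r\<close>; for \<open>r = 1\<close> it lies in \<open>F 1\<close> anyway. So \<open>\<alpha>\<close> is the first entry of a cycle of the cone at filtration
  \<open>0\<close>, and the page condition shows that \<open>\<alpha>\<close> is exact modulo \<open>F 1\<close>.
\<close>

lemma closed_decomposition:
  assumes \<alpha>: "\<alpha> \<in> GV 0" "diffl L \<alpha> = 0"
  shows "\<exists>\<alpha>1\<in>GV 0 \<inter> fil L 1. \<exists>z\<in>GV (-1). diffl L \<alpha>1 = 0 \<and> \<alpha> = \<alpha>1 + diffl L z"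
proof -
  let ?u = "nilz U" and ?b = "nilz (brk M)"
  have uG: "?u [\<alpha>] \<in> GW 0" using U.f_deg[of "[\<alpha>]" "[0]"] \<alpha> by simp
  have top: "v \<in> fil L 0" for v using D.V.F_top[of 0] by simp
  have uF: "?u [\<alpha>] \<in> fil M (r - 1)" using U.f_fil[of "[\<alpha>]" "[0]"] top by simp
  have bu: "?b [?u [\<alpha>]] = 0"
    using morphism_on_marked_powers[OF LV MW abV U D.V.G_zero _ \<alpha>(1), of 0] \<alpha>(2) d_diff[of 0 0] U.f_zero[of "[]" "[]"]
    by (simp add: compositions_0 diffl_def)
  have "\<exists>c\<in>GW (-1). ?u [\<alpha>] - ?b [c] \<in> fil M r"
  proof (cases "r = 1")
    case True
    have "?u [\<alpha>] - ?b [0] \<in> fil M r" unfolding True by simp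
    then show ?thesis using W.V.G_zero by (rule_tac bexI[of _ 0]) auto
  next
    case False
    \<comment> \<open>\<open>q = n - 1\<close> is the largest exponent with \<open>2\<^sup>q < r\<close>\<close>
    define n where "n = (LEAST n. r \<le> 2 ^ n)"
    have "r \<le> 2 ^ nat r" using r of_nat_less_two_power[of "nat r", where ?'a = int] by simp
    then have n: "r \<le> 2 ^ n" unfolding n_def by (rule LeastI)
    then have "n \<noteq> 0" using r False by (cases n) auto
    then obtain q where q: "n = q + 1" by (metis Suc_eq_plus1 not0_implies_Suc)
    have "\<not> r \<le> 2 ^ q" using not_less_Least[of q "\<lambda>n. r \<le> 2 ^ n"] unfolding n_def[symmetric] q by simp
    then have q2: "2 ^ q < r" by simp
    have m: "min (2 ^ (q + 1)) r = r" using n unfolding q by simp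
    have "?u [\<alpha>] \<in> UNIV \<inter> GW 0 \<inter> fil M (2 ^ q)"
      using uG W.V.F_antiD[OF uF, of "2 ^ q"] q2 by simp
    moreover have "?b [?u [\<alpha>]] \<in> fil M (min (2 ^ (q + 1)) r)" unfolding bu by simp
    ultimately have "\<exists>y\<in>UNIV \<inter> GW (-1) \<inter> fil M (2 ^ q). ?u [\<alpha>] - ?b [y] \<in> fil M (min (2 ^ (q + 1)) r)"
      using H1_base q2 unfolding P.H1_condition_def by blast
    then show ?thesis unfolding m by blast
  qed
  then obtain c where c: "c \<in> GW (-1)" "?u [\<alpha>] - ?b [c] \<in> fil M r" by blast
  have "\<exists>x\<in>UNIV \<inter> GV (-1) \<inter> fil L (0 - r + 1). \<exists>y\<in>UNIV \<inter> GW (-1 - 1) \<inter> fil M (0 - r + 1).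
      diffl L x \<in> fil L 0 \<and> ?u [x] - ?b [y] \<in> fil M 0 \<and> \<alpha> - diffl L x \<in> fil L (0 + 1) \<and> c - ?u [x] + ?b [y] \<in> fil M (0 + 1)"
    using page_base[unfolded P.page_condition_def, rule_format, of \<alpha> "-1" 0 c] \<alpha> c top W.V.F_top[of 0] by simp
  then obtain x where x: "x \<in> GV (-1)" "\<alpha> - diffl L x \<in> fil L 1" by auto
  have "\<alpha> - diffl L x \<in> GV 0" using D.V.G_diff[OF \<alpha>(1)] d_G[OF x(1)] by simp
  moreover have "diffl L (\<alpha> - diffl L x) = 0" unfolding d_diff using \<alpha>(2) d_d[OF x(1)] by simp
  ultimately show ?thesis using x by (intro bexI[of _ "\<alpha> - diffl L x"] bexI[of _ x]) auto
qed

text \<open>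
  Both vectors are exact deformations of the same element of \<open>F 1\<close>.
\<close>

lemma exact_linked:
  assumes \<alpha>: "\<alpha> \<in> GV 0" "diffl L \<alpha> = 0" and z: "z \<in> GV (-1)"
  shows "Q.linked (U.I [] \<alpha>) (U.I [] (\<alpha> + diffl L z))"
proof -
  obtain \<alpha>1 x where a1: "\<alpha>1 \<in> GV 0" "\<alpha>1 \<in> fil L 1" "diffl L \<alpha>1 = 0"
    and x: "x \<in> GV (-1)" and eq: "\<alpha> = \<alpha>1 + diffl L x"
    using closed_decomposition[OF \<alpha>] by blast
  have "W.joined (U.I [] \<alpha>1) (U.I [] \<alpha>)" unfolding eq by (rule exact_deformation_joined[OF a1 x])
  then have "Q.linked (U.I [] \<alpha>) (U.I [] \<alpha>1)" by (intro r_into_rtranclp disjI2)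
  moreover have "\<alpha> + diffl L z = \<alpha>1 + diffl L (x + z)" unfolding eq d_add by (rule add.assoc)
  then have "W.joined (U.I [] \<alpha>1) (U.I [] (\<alpha> + diffl L z))"
    using exact_deformation_joined[OF a1 D.V.G_add[OF x z]] by (simp only:)
  then have "Q.linked (U.I [] \<alpha>1) (U.I [] (\<alpha> + diffl L z))" by (intro r_into_rtranclp disjI1)
  ultimately show ?thesis by (rule rtranclp_trans)
qed

lemma linked_sym: "Q.linked x y \<Longrightarrow> Q.linked y x"
  by (rule sympD[OF symp_rtranclp]) (auto simp: symp_def)

text \<open>
  Both vectors are replaced by cohomologous ones in \<open>F 1\<close>, where \<open>components_injective\<close> applies.
\<close>

lemma linked_exact:
  assumes \<alpha>: "\<alpha> \<in> GV 0" "diffl L \<alpha> = 0" and \<alpha>': "\<alpha>' \<in> GV 0" "diffl L \<alpha>' = 0"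
    and conn: "Q.linked (U.I [] \<alpha>) (U.I [] \<alpha>')"
  shows "\<exists>z\<in>GV (-1). \<alpha>' - \<alpha> = diffl L z"
proof -
  obtain \<alpha>1 x where a1: "\<alpha>1 \<in> GV 0" "\<alpha>1 \<in> fil L 1" "diffl L \<alpha>1 = 0"
    and x: "x \<in> GV (-1)" and eq: "\<alpha> = \<alpha>1 + diffl L x"
    using closed_decomposition[OF \<alpha>] by blast
  obtain \<alpha>1' x' where a1': "\<alpha>1' \<in> GV 0" "\<alpha>1' \<in> fil L 1" "diffl L \<alpha>1' = 0"
    and x': "x' \<in> GV (-1)" and eq': "\<alpha>' = \<alpha>1' + diffl L x'"
    using closed_decomposition[OF \<alpha>'] by blast
  have "Q.linked (U.I [] \<alpha>1) (U.I [] \<alpha>)" unfolding eq by (rule exact_linked[OF a1(1,3) x])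
  moreover have "Q.linked (U.I [] \<alpha>') (U.I [] \<alpha>1')" unfolding eq' by (rule linked_sym[OF exact_linked[OF a1'(1,3) x']])
  ultimately have "Q.linked (U.I [] \<alpha>1) (U.I [] \<alpha>1')" using conn by (meson rtranclp_trans)
  then obtain y where y: "y \<in> GV (-1)" "\<alpha>1' - \<alpha>1 = diffl L y"
    using Q.components_injective[OF _ a1 a1'] by blast
  have "\<alpha>' - \<alpha> = (\<alpha>1' - \<alpha>1) + diffl L x' - diffl L x" unfolding eq eq' by (simp add: algebra_simps)
  also have "\<dots> = diffl L (y + x' - x)" unfolding y(2) d_diff d_add ..
  finally show ?thesis using D.V.G_diff[OF D.V.G_add[OF y(1) x'] x] by blast
qed

text \<open>
  A single 1-simplex suffices to connect cohomologous elements.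
\<close>

lemma MC_connected_L:
  "(\<alpha>, \<alpha>') \<in> MC_connected (shift1 L) \<longleftrightarrow> \<alpha> \<in> MC (shift1 L) \<and> \<alpha>' \<in> MC (shift1 L) \<and> (\<exists>z\<in>GV (-1). \<alpha>' - \<alpha> = diffl L z)"
proof -
  let ?E = "MC_endpoints (shift1 L)" and ?G = "GV (-1)"
  have "\<exists>z\<in>?G. \<alpha>' - \<alpha> = diffl L z" if "(\<alpha>, \<alpha>') \<in> (?E \<union> ?E\<inverse>)\<^sup>*"
    using that
  proof (induction rule: rtrancl_induct)
    case base
    show ?case using D.V.G_zero d_diff[of 0 0] by (intro bexI[of _ 0]) auto
  next
    case (step y w)
    obtain z where z: "z \<in> ?G" "y - \<alpha> = diffl L z" using step.IH by blast
    have "\<exists>z'\<in>?G. w - y = diffl L z'"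
    proof (cases "(y, w) \<in> ?E")
      case True then show ?thesis by (rule endpoints_L_exact)
    next
      case False
      then have "(w, y) \<in> ?E" using step.hyps(2) by blast
      then obtain z' where z': "z' \<in> ?G" "y - w = diffl L z'" using endpoints_L_exact by blast
      have "diffl L (- z') = - diffl L z'" using d_diff[of 0 z'] d_diff[of 0 0] by simp
      also have "\<dots> = w - y" unfolding z'(2)[symmetric] by simp
      finally have "w - y = diffl L (- z')" by (rule sym)
      then show ?thesis using D.V.G_neg[OF z'(1)] by blast
    qed
    then obtain z' where z': "z' \<in> ?G" "w - y = diffl L z'" by blast
    have "w - \<alpha> = diffl L (z' + z)" unfolding d_add z'(2)[symmetric] z(2)[symmetric] by simp
    then show ?case using D.V.G_add[OF z'(1) z(1)] by blast
  qed
  moreover have "(\<alpha>, \<alpha>') \<in> (?E \<union> ?E\<inverse>)\<^sup>*" if "\<alpha> \<in> MC (shift1 L)" "z \<in> ?G" "\<alpha>' - \<alpha> = diffl L z" for z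
  proof -
    have "\<alpha>' = \<alpha> + diffl L z" unfolding that(3)[symmetric] by simp
    then have "(\<alpha>, \<alpha>') \<in> ?E" using exact_endpoints_L[OF that(1,2)] by (simp only:)
    then show ?thesis by blast
  qed
  ultimately show ?thesis unfolding MC_connected_def by blast
qed

lemma MC_connected_M:
  "(\<beta>, \<beta>') \<in> MC_connected (shift1 M) \<longleftrightarrow> \<beta> \<in> MC (shift1 M) \<and> \<beta>' \<in> MC (shift1 M) \<and> Q.linked \<beta> \<beta>'"
proof -
  have "{(x, y). W.joined x y \<or> W.joined y x} = MC_endpoints (shift1 M) \<union> (MC_endpoints (shift1 M))\<inverse>"
    unfolding MC_endpoints_M by auto
  then have "(\<beta>, \<beta>') \<in> (MC_endpoints (shift1 M) \<union> (MC_endpoints (shift1 M))\<inverse>)\<^sup>* \<longleftrightarrow> Q.linked \<beta> \<beta>'"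
    using rtranclp_rtrancl_eq[of "\<lambda>x y. W.joined x y \<or> W.joined y x" \<beta> \<beta>'] by (simp only:)
  then show ?thesis unfolding MC_connected_def by blast
qed

end

lemma MC_connected_equiv: "equiv (MC V) (MC_connected V)"
proof (rule equivI)
  show "MC_connected V \<subseteq> MC V \<times> MC V" unfolding MC_connected_def by blast
  show "refl_on (MC V) (MC_connected V)" unfolding MC_connected_def refl_on_def by blast
  have "sym ((MC_endpoints V \<union> (MC_endpoints V)\<inverse>)\<^sup>*)" by (rule sym_rtrancl) (auto simp: sym_def)
  then show "sym (MC_connected V)" unfolding MC_connected_def sym_def by blast
  show "trans (MC_connected V)" unfolding MC_connected_def trans_def by (blast intro: rtrancl_trans)
qed

lemma quotient_bijection:
  assumes R: "equiv A R" and S: "equiv B S" and f: "\<And>a. a \<in> A \<Longrightarrow> f a \<in> B"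
    and iff: "\<And>a a'. a \<in> A \<Longrightarrow> a' \<in> A \<Longrightarrow> (a, a') \<in> R \<longleftrightarrow> (f a, f a') \<in> S"
    and surj: "\<And>b. b \<in> B \<Longrightarrow> \<exists>a\<in>A. (b, f a) \<in> S"
  shows "\<exists>\<phi>. (\<forall>a\<in>A. \<phi> (R `` {a}) = S `` {f a}) \<and> bij_betw \<phi> (A // R) (B // S)"
proof -
  define \<phi> where "\<phi> X = (\<Union>x\<in>X. S `` {f x})" for X
  have \<phi>: "\<phi> (R `` {a}) = S `` {f a}" if a: "a \<in> A" for a
  proof -
    have "S `` {f x} = S `` {f a}" if "x \<in> R `` {a}" for x
    proof -
      have ax: "(a, x) \<in> R" using that by simp
      then have "x \<in> A" using equiv_type[OF R] by blast
      then have "(f a, f x) \<in> S" using iff a ax by blast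
      then show ?thesis by (rule equiv_class_eq[OF S, symmetric])
    qed
    moreover have "a \<in> R `` {a}" by (rule equiv_class_self[OF R a])
    ultimately show ?thesis unfolding \<phi>_def by blast
  qed
  have "inj_on \<phi> (A // R)"
  proof (rule inj_onI)
    fix X Y assume "X \<in> A // R" "Y \<in> A // R" and eq: "\<phi> X = \<phi> Y"
    then obtain a a' where a: "a \<in> A" "X = R `` {a}" "a' \<in> A" "Y = R `` {a'}" by (meson quotientE)
    have "S `` {f a} = S `` {f a'}" using eq unfolding a(2,4) \<phi>[OF a(1)] \<phi>[OF a(3)] .
    then have "(f a, f a') \<in> S" using eq_equiv_class[OF _ S f[OF a(3)]] by blast
    then have "(a, a') \<in> R" using iff a by blast
    then show "X = Y" unfolding a(2,4) by (rule equiv_class_eq[OF R])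
  qed
  moreover have "\<phi> ` (A // R) = B // S"
  proof (intro equalityI subsetI)
    fix Y assume "Y \<in> \<phi> ` (A // R)"
    then obtain X where X: "X \<in> A // R" "Y = \<phi> X" by blast
    then obtain a where a: "a \<in> A" "X = R `` {a}" by (meson quotientE)
    show "Y \<in> B // S" unfolding X(2) a(2) \<phi>[OF a(1)] by (rule quotientI[OF f[OF a(1)]])
  next
    fix Y assume "Y \<in> B // S"
    then obtain b where b: "b \<in> B" "Y = S `` {b}" by (meson quotientE)
    obtain a where a: "a \<in> A" "(b, f a) \<in> S" using surj[OF b(1)] by blast
    have "Y = \<phi> (R `` {a})" unfolding \<phi>[OF a(1)] b(2) by (rule equiv_class_eq[OF S a(2)])
    then show "Y \<in> \<phi> ` (A // R)" using quotientI[OF a(1)] by blast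
  qed
  ultimately show ?thesis using \<phi> unfolding bij_betw_def by blast
qed

theorem theorem1p4:
  fixes L :: "('k::field_char_0, 'v::ab_group_add) bracket_space"
    and M :: "('k, 'w::ab_group_add) bracket_space"
    and U :: "'v list \<Rightarrow> 'w"
    and r :: int
  assumes "Linf_algebra L"
    and "Linf_algebra M"
    and "complete_filtration 0 L"
    and "complete_filtration 1 M"
    and "filtration_compatible L L (brk L)"
    and "filtration_compatible M M (brk M)"
    and "abelian L"
    and "infinity_morphism (shift1 L) (shift1 M) U"
    and "filtration_compatible L M U"
    and "r \<ge> 1"
    and "page_vanishes (cone_diffl L M (linear_part U)) (cone_fil L M) r"
    and "raises_filtration L M U (r - 1)"
    and "\<forall>a. \<exists>N. \<forall>n\<ge>N. U (replicate n a) = 0"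
    and "\<forall>q::nat. 2 ^ q < r \<longrightarrow> quotient_cohomology_vanishes M (2 ^ q) (min (2 ^ (q + 1)) r) 1"
  shows "\<exists>\<phi>. (\<forall>\<alpha>\<in>MC (shift1 L).
                \<phi> (MC_connected (shift1 L) `` {\<alpha>}) = MC_connected (shift1 M) `` {U_star (shift1 M) U \<alpha>}) \<and>
             bij_betw \<phi> (pi0_MC (shift1 L)) (pi0_MC (shift1 M))"
proof -
  interpret abelian_to_Linf L M U r
    by unfold_locales (use assms in auto)
  have star: "U_star (shift1 M) U \<alpha> = U.I [] \<alpha>" and closed: "\<alpha> \<in> grd (shift1 L) 0" "diffl L \<alpha> = 0"
    and image: "U.I [] \<alpha> \<in> MC (shift1 M)" if "\<alpha> \<in> MC (shift1 L)" for \<alpha>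
    using that U_star_eq star_MC unfolding MC_L_iff MC_M_iff by auto
  show ?thesis unfolding pi0_MC_def
  proof (rule quotient_bijection[OF MC_connected_equiv MC_connected_equiv])
    show "U_star (shift1 M) U \<alpha> \<in> MC (shift1 M)" if "\<alpha> \<in> MC (shift1 L)" for \<alpha>
      using image[OF that] unfolding star[OF that] .
    show "(\<alpha>, \<alpha>') \<in> MC_connected (shift1 L) \<longleftrightarrow> (U_star (shift1 M) U \<alpha>, U_star (shift1 M) U \<alpha>') \<in> MC_connected (shift1 M)"
      if \<alpha>: "\<alpha> \<in> MC (shift1 L)" and \<alpha>': "\<alpha>' \<in> MC (shift1 L)" for \<alpha> \<alpha>'
    proof -
      have "Q.linked (U.I [] \<alpha>) (U.I [] \<alpha>')" if "z \<in> grd (shift1 L) (-1)" "\<alpha>' - \<alpha> = diffl L z" for z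
        using exact_linked[OF closed[OF \<alpha>] that(1)] unfolding that(2)[symmetric] by simp
      then show ?thesis
        unfolding MC_connected_L MC_connected_M star[OF \<alpha>] star[OF \<alpha>']
        using \<alpha> \<alpha>' image[OF \<alpha>] image[OF \<alpha>'] linked_exact[OF closed[OF \<alpha>] closed[OF \<alpha>']] by blast
    qed
    show "\<exists>\<alpha>\<in>MC (shift1 L). (\<beta>, U_star (shift1 M) U \<alpha>) \<in> MC_connected (shift1 M)" if \<beta>: "\<beta> \<in> MC (shift1 M)" for \<beta>
    proof -
      obtain \<gamma> where \<gamma>: "\<gamma> \<in> grd (shift1 L) 0" "diffl L \<gamma> = 0" "Q.linked \<beta> (U.I [] \<gamma>)"
        using Q.components_surjective \<beta> unfolding MC_M_iff by blast
      then have m: "\<gamma> \<in> MC (shift1 L)" unfolding MC_L_iff by blast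
      then have "(\<beta>, U_star (shift1 M) U \<gamma>) \<in> MC_connected (shift1 M)"
        unfolding MC_connected_M star[OF m] using \<beta> image[OF m] \<gamma>(3) by blast
      then show ?thesis using m by blast
    qed
  qed
qed

end
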